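(* Let $n\ge1$, $\alpha\in\mathbb{R}$, $\gamma>\alpha^2/4$, $\frac12<b<1$ and $0<T<1$. Assume that $$-\frac12<\omega<2,\qquad s>0\qquad\text{if } n=1,$$ and $$1-\frac n2<\omega<2,\qquad s>\frac n2-1\qquad\text{if } n\ge2.$$ Then for all $u_1,u_2\in X^{s,b}_\omega(0,T)$, $$\big\||D|^2\langle D\rangle^{-2}(u_1u_2)\big\|_{X^{s,b-1}_\omega(0,T)}\le C\,T^{1-b}\,\|u_1\|_{X^{s,b}_\omega(0,T)}\,\|u_2\|_{X^{s,b}_\omega(0,T)},$$ where the constant $C>0$ depends only on $n,\alpha,\gamma,s,\omega,b$ (not on $T$, $u_1$, $u_2$).
   Context: Notation: $\langle\xi\rangle=(1+|\xi|^2)^{1/2}$; $|D|$ and $\langle D\rangle$ are the spatial Fourier multipliers on $\mathbb{R}^n$ with symbols $|\xi|$ and $\langle\xi\rangle$; $\widetilde u(\xi,\tau)$ is the space-time Fourier transform. The phase function is $\varphi(\xi)=\sqrt{|\xi|^4+\alpha|\xi|^2+\gamma}$. For $s,\omega,b\in\mathbb{R}$, $$\|u\|_{X^{s,b}_\omega}=\big\|\langle\xi\rangle^{s+\omega}|\xi|^{-\omega}\langle|\tau|-\varphi(\xi)\rangle^b\,\widetilde u(\xi,\tau)\big\|_{L^2_{\xi,\tau}},$$ and $X^{s,b}_\omega(0,T)$ is the restriction space in time, with norm $\|u\|_{X^{s,b}_\omega(0,T)}=\inf\{\|v\|_{X^{s,b}_\omega}: v=u\text{ on }\mathbb{R}^n\times(0,T)\}$.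 *)

theory Defs
  imports "HOL-Analysis.Analysis"
begin

section \<open>Schwartz functions, test functions and the Fourier transform\<close>

primrec partials :: "'a::euclidean_space list \<Rightarrow> ('a \<Rightarrow> complex) \<Rightarrow> 'a \<Rightarrow> complex" where
  "partials [] f = f"
| "partials (v # vs) f = (\<lambda>x. frechet_derivative (partials vs f) (at x) v)"

definition smooth :: "('a::euclidean_space \<Rightarrow> complex) \<Rightarrow> bool" where
  "smooth f \<longleftrightarrow> (\<forall>vs. set vs \<subseteq> Basis \<longrightarrow> (\<forall>x. partials vs f differentiable at x))"

definition schwartz :: "('a::euclidean_space \<Rightarrow> complex) set" where
  "schwartz = {f. smooth f \<and>
     (\<forall>k vs. set vs \<subseteq> Basis \<longrightarrow> bounded (range (\<lambda>x. norm x ^ k *\<^sub>R partials vs f x)))}"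

definition schwartz_seminorm :: "nat \<Rightarrow> ('a::euclidean_space \<Rightarrow> complex) \<Rightarrow> real" where
  "schwartz_seminorm N f =
     (\<Sum>vs\<in>{vs. set vs \<subseteq> Basis \<and> length vs \<le> N}. SUP x. (1 + norm x) ^ N * cmod (partials vs f x))"

definition test_functions :: "'a::euclidean_space set \<Rightarrow> ('a \<Rightarrow> complex) set" where
  "test_functions \<Omega> =
     {\<psi>. smooth \<psi> \<and> compact (closure {x. \<psi> x \<noteq> 0}) \<and> closure {x. \<psi> x \<noteq> 0} \<subseteq> \<Omega>}"

definition fourier :: "('a::euclidean_space \<Rightarrow> complex) \<Rightarrow> 'a \<Rightarrow> complex" where
  "fourier f \<xi> = (LINT x|lborel. exp (- \<i> * complex_of_real (x \<bullet> \<xi>)) * f x)"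

definition inverse_fourier :: "('a::euclidean_space \<Rightarrow> complex) \<Rightarrow> 'a \<Rightarrow> complex" where
  "inverse_fourier g x =
     complex_of_real (1 / (2 * pi) ^ DIM('a)) * (LINT \<xi>|lborel. exp (\<i> * complex_of_real (x \<bullet> \<xi>)) * g \<xi>)"


section \<open>Distributions\<close>

text \<open>A distribution is encoded as a functional on all functions; only its values on Schwartz
  functions (for tempered distributions), respectively on test functions supported in an open
  set (for distributions on that set), are meaningful. The pairing is bilinear.\<close>

type_synonym 'a distribution = "('a \<Rightarrow> complex) \<Rightarrow> complex"

definition tempered_distribution :: "'a::euclidean_space distribution \<Rightarrow> bool" where
  "tempered_distribution u \<longleftrightarrow>
     (\<forall>f\<in>schwartz. \<forall>g\<in>schwartz. \<forall>c. u (\<lambda>x. c * f x + g x) = c * u f + u g) \<and>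
     (\<exists>N C. \<forall>f\<in>schwartz. cmod (u f) \<le> C * schwartz_seminorm N f)"

definition equal_on :: "'a::euclidean_space set \<Rightarrow> 'a distribution \<Rightarrow> 'a distribution \<Rightarrow> bool" where
  "equal_on \<Omega> u v \<longleftrightarrow> (\<forall>\<psi>\<in>test_functions \<Omega>. u \<psi> = v \<psi>)"

definition represents_on :: "'a::euclidean_space set \<Rightarrow> ('a \<Rightarrow> complex) \<Rightarrow> 'a distribution \<Rightarrow> bool" where
  "represents_on \<Omega> f u \<longleftrightarrow> set_borel_measurable lborel \<Omega> f \<and>
     (\<forall>\<psi>\<in>test_functions \<Omega>. set_integrable lborel \<Omega> (\<lambda>x. f x * \<psi> x) \<and>
        u \<psi> = (LINT x:\<Omega>|lborel. f x * \<psi> x))"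

text \<open>The product of two distributions on \<open>\<Omega>\<close> that are given by functions there: \<open>w\<close> is the tempered
  distribution given by their pointwise product, extended by zero outside \<open>\<Omega>\<close>. Since the
  functions are unique almost everywhere on \<open>\<Omega>\<close>, \<open>w\<close> is uniquely determined on Schwartz functions.\<close>

definition is_product_on ::
  "'a::euclidean_space set \<Rightarrow> 'a distribution \<Rightarrow> 'a distribution \<Rightarrow> 'a distribution \<Rightarrow> bool" where
  "is_product_on \<Omega> u\<^sub>1 u\<^sub>2 w \<longleftrightarrow> tempered_distribution w \<and>
     (\<exists>f\<^sub>1 f\<^sub>2. represents_on \<Omega> f\<^sub>1 u\<^sub>1 \<and> represents_on \<Omega> f\<^sub>2 u\<^sub>2 \<and>
        (\<forall>\<psi>\<in>schwartz. set_integrable lborel \<Omega> (\<lambda>x. f\<^sub>1 x * f\<^sub>2 x * \<psi> x) \<and>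
           w \<psi> = (LINT x:\<Omega>|lborel. f\<^sub>1 x * f\<^sub>2 x * \<psi> x)))"

text \<open>The Fourier transform of the tempered distribution \<open>u\<close> is the function \<open>g\<close>.\<close>

definition has_fourier_transform :: "'a::euclidean_space distribution \<Rightarrow> ('a \<Rightarrow> complex) \<Rightarrow> bool" where
  "has_fourier_transform u g \<longleftrightarrow> g \<in> borel_measurable lborel \<and>
     (\<forall>\<psi>\<in>schwartz. integrable lborel (\<lambda>p. g p * \<psi> p) \<and>
        u (fourier \<psi>) = (LINT p|lborel. g p * \<psi> p))"

text \<open>The multiplier with symbol \<open>m\<close> (smooth, of polynomial growth) acts by transposition:
  if \<open>Fu\<close> denotes the Fourier transform, \<open>\<langle>m(D)u, \<psi>\<rangle> = \<langle>m Fu, F\<^sup>-\<^sup>1\<psi>\<rangle> = \<langle>u, F(m F\<^sup>-\<^sup>1\<psi>)\<rangle>\<close>.\<close>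

definition multiplier :: "('a::euclidean_space \<Rightarrow> complex) \<Rightarrow> 'a distribution \<Rightarrow> 'a distribution" where
  "multiplier m u = (\<lambda>\<psi>. u (fourier (\<lambda>\<xi>. m \<xi> * inverse_fourier \<psi> \<xi>)))"


section \<open>Space-time and the spaces \<open>X\<^sup>s\<^sup>,\<^sup>b\<^sub>\<omega>\<close>\<close>

type_synonym 'n spacetime = "(real ^ 'n) \<times> real"

definition japanese :: "'a::real_normed_vector \<Rightarrow> real" where
  "japanese x = sqrt (1 + (norm x)\<^sup>2)"

text \<open>A Fourier multiplier in the space variable only is the space-time multiplier whose symbol
  does not depend on the time frequency.\<close>

definition spatial_multiplier ::
  "(real ^ 'n \<Rightarrow> real) \<Rightarrow> ('n::finite) spacetime distribution \<Rightarrow> 'n spacetime distribution" where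
  "spatial_multiplier m = multiplier (\<lambda>(\<xi>, \<tau>). complex_of_real (m \<xi>))"

definition phase :: "real \<Rightarrow> real \<Rightarrow> real ^ 'n::finite \<Rightarrow> real" where
  "phase \<alpha> \<gamma> \<xi> = sqrt (norm \<xi> ^ 4 + \<alpha> * (norm \<xi>)\<^sup>2 + \<gamma>)"

definition X_weight ::
  "real \<Rightarrow> real \<Rightarrow> real \<Rightarrow> real \<Rightarrow> real \<Rightarrow> ('n::finite) spacetime \<Rightarrow> real" where
  "X_weight \<alpha> \<gamma> s \<omega> b = (\<lambda>(\<xi>, \<tau>).
     japanese \<xi> powr (s + \<omega>) * norm \<xi> powr (- \<omega>) * japanese (\<bar>\<tau>\<bar> - phase \<alpha> \<gamma> \<xi>) powr b)"

definition X_space ::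
  "real \<Rightarrow> real \<Rightarrow> real \<Rightarrow> real \<Rightarrow> real \<Rightarrow> ('n::finite) spacetime distribution set" where
  "X_space \<alpha> \<gamma> s \<omega> b = {u. tempered_distribution u \<and>
     (\<exists>g. has_fourier_transform u g \<and>
        integrable lborel (\<lambda>p. (X_weight \<alpha> \<gamma> s \<omega> b p * cmod (g p))\<^sup>2))}"

text \<open>The Fourier transform is unique almost everywhere, so the choice of \<open>g\<close> is immaterial.\<close>

definition X_norm ::
  "real \<Rightarrow> real \<Rightarrow> real \<Rightarrow> real \<Rightarrow> real \<Rightarrow> ('n::finite) spacetime distribution \<Rightarrow> real" where
  "X_norm \<alpha> \<gamma> s \<omega> b u =
     (let g = SOME g. has_fourier_transform u g
      in sqrt (LINT p|lborel. (X_weight \<alpha> \<gamma> s \<omega> b p * cmod (g p))\<^sup>2))"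

definition slab :: "real \<Rightarrow> ('n::finite) spacetime set" where
  "slab T = UNIV \<times> {0<..<T}"

definition X_space_slab ::
  "real \<Rightarrow> real \<Rightarrow> real \<Rightarrow> real \<Rightarrow> real \<Rightarrow> real \<Rightarrow> ('n::finite) spacetime distribution set" where
  "X_space_slab \<alpha> \<gamma> s \<omega> b T = {u. \<exists>v\<in>X_space \<alpha> \<gamma> s \<omega> b. equal_on (slab T) v u}"

definition X_norm_slab ::
  "real \<Rightarrow> real \<Rightarrow> real \<Rightarrow> real \<Rightarrow> real \<Rightarrow> real \<Rightarrow> ('n::finite) spacetime distribution \<Rightarrow> real" where
  "X_norm_slab \<alpha> \<gamma> s \<omega> b T u =
     (INF v\<in>{v\<in>X_space \<alpha> \<gamma> s \<omega> b. equal_on (slab T) v u}. X_norm \<alpha> \<gamma> s \<omega> b v)"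

end

theory Submission
  imports Defs "HOL-Probability.Probability"
begin

text \<open>On the Fourier side the product becomes a convolution, and the cutoff to \<open>(0, T)\<close> a further
  convolution in \<open>\<tau>\<close> with a kernel bounded by \<open>3 T / (1 + T \<bar>\<tau>\<bar>)\<close>, so no smooth extension of the product
  is needed: the product itself, extended by zero, is the competitor in the restriction norm.
  Against the weight \<open>\<langle>\<bar>\<tau>\<bar> - \<phi>\<rangle>\<^sup>b\<^sup>-\<^sup>1\<close> a Schur test for this kernel gains \<open>T\<^sup>1\<^sup>-\<^sup>b\<close>.
  It remains to bound the convolution in \<open>L\<^sup>2\<close>. The multiplier \<open>\<bar>D\<bar>\<^sup>2 \<langle>D\<rangle>\<^sup>-\<^sup>2\<close> makes up for
  the singularity at \<open>\<xi> = 0\<close>, and the spatial weight is monotone and doubling, hence subadditive up to a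
  constant, so that it can be moved to one factor. A reflection argument reduces to frequencies \<open>\<tau> \<ge> 0\<close>,
  where \<open>\<phi>\<close> may be replaced by \<open>\<bar>\<xi>\<bar>\<^sup>2\<close> because the difference is bounded. By Cauchy-Schwarz and
  \<open>\<bar>\<xi> - \<eta>\<bar>\<^sup>2 + \<bar>\<eta>\<bar>\<^sup>2 = 2 \<bar>\<eta> - \<xi>/2\<bar>\<^sup>2 + \<bar>\<xi>\<bar>\<^sup>2/2\<close> the estimate follows from a uniform bound on the
  integral of the inverse square of the spatial weight over thickened spheres.\<close>

section \<open>Calculus of Schwartz functions\<close>

text \<open>The spaces consist of distributions, so before anything can be estimated the product has
  to make sense: every element must be shown to be a function. For \<omega> < 0 the weight vanishes
  at \<xi> = 0, and the transform \<open>g\<close> of an element may be neither integrable nor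
  square integrable. What remains is that the inverse square of the weight is uniformly locally
  integrable. This already makes the inverse transform of \<open>g\<close> locally square
  integrable, with polynomial growth in the mean, and two such functions can be multiplied and
  paired with Schwartz functions. The bound over thickened spheres that drives the bilinear estimate
  also provides this local integrability.

  The condition b > 1/2 acts twice: 2 b > 1 makes the modulation weights integrable, and 2 (1 - b) <
  1 makes the dual weight locally integrable even without its bracket, which the gain in T exploits.
  The lower bounds on \<omega> and s express integrability of the inverse square weight near the
  origin and at infinity, in the dimensions that the sphere leaves over.\<close>

definition dir_deriv :: "'a::euclidean_space \<Rightarrow> ('a \<Rightarrow> complex) \<Rightarrow> 'a \<Rightarrow> complex" where
  "dir_deriv v f = (\<lambda>x. frechet_derivative f (at x) v)"

lemma dir_deriv_eqI:
  assumes "\<And>x. (f has_derivative f' x) (at x)"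
  shows "dir_deriv v f = (\<lambda>x. f' x v)"
  unfolding dir_deriv_def using assms by (metis frechet_derivative_at)

text \<open>\<open>partials\<close> applies the head of the list last, so differentiating first
  means appending at the end.\<close>

lemma partials_dir_deriv: "partials vs (dir_deriv v f) = partials (vs @ [v]) f"
  by (induction vs) (auto simp: dir_deriv_def)

lemma partials_closed:
  fixes A :: "('a::euclidean_space \<Rightarrow> complex) set"
  assumes "\<And>f v. f \<in> A \<Longrightarrow> v \<in> Basis \<Longrightarrow> dir_deriv v f \<in> A"
    and "f \<in> A" and "set vs \<subseteq> Basis"
  shows "partials vs f \<in> A"
  using assms(3) by (induction vs) (use assms(1,2) in \<open>auto simp: dir_deriv_def\<close>)

text \<open>A single function is rarely stable under differentiation, but it often lies in an
  explicit class that is. The induction over iterated derivatives is done here once; each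
  application has to supply differentiability, stability and the decay of undifferentiated
  members.\<close>

lemma schwartzI_closed:
  fixes A :: "('a::euclidean_space \<Rightarrow> complex) set"
  assumes "\<And>f x. f \<in> A \<Longrightarrow> f differentiable at x"
    and "\<And>f v. f \<in> A \<Longrightarrow> v \<in> Basis \<Longrightarrow> dir_deriv v f \<in> A"
    and "\<And>f k. f \<in> A \<Longrightarrow> \<exists>C. \<forall>x. norm x ^ k * cmod (f x) \<le> C"
    and "f \<in> A"
  shows "f \<in> schwartz"
proof -
  have "partials vs f \<in> A" if "set vs \<subseteq> Basis" for vs
    using partials_closed[OF assms(2)] assms(4) that by blast
  then show ?thesis
    unfolding schwartz_def smooth_def bounded_iff
    using assms(1,3) by (fastforce simp: norm_mult norm_power)
qed

lemma schwartz_differentiable: "f \<in> schwartz \<Longrightarrow> f differentiable at x"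
  unfolding schwartz_def smooth_def by (metis (mono_tags, lifting) empty_subsetI list.set(1) mem_Collect_eq partials.simps(1))

lemma schwartz_dir_deriv: "f \<in> schwartz \<Longrightarrow> v \<in> Basis \<Longrightarrow> dir_deriv v f \<in> schwartz"
  unfolding schwartz_def smooth_def by (auto simp: partials_dir_deriv)

lemma schwartz_has_derivative: "f \<in> schwartz \<Longrightarrow> (f has_derivative frechet_derivative f (at x)) (at x)"
  using schwartz_differentiable[of f x] unfolding frechet_derivative_works .

lemma schwartz_continuous: "f \<in> schwartz \<Longrightarrow> continuous_on UNIV f"
  by (simp add: continuous_at_imp_continuous_on differentiable_imp_continuous_within schwartz_differentiable)

lemma schwartz_measurable: "f \<in> schwartz \<Longrightarrow> f \<in> borel_measurable borel"
  by (rule borel_measurable_continuous_onI[OF schwartz_continuous])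

lemma schwartz_partials: "f \<in> schwartz \<Longrightarrow> set vs \<subseteq> Basis \<Longrightarrow> partials vs f \<in> schwartz"
  using partials_closed[of schwartz] schwartz_dir_deriv by blast

section \<open>Decay and seminorms of Schwartz functions\<close>

lemma one_plus_power_le: "(1 + r) ^ N \<le> 2 ^ N * (1 + r ^ N)" if "0 \<le> (r::real)"
proof -
  have "(1 + r) ^ N \<le> (2 * max 1 r) ^ N"
    using that by (intro power_mono) auto
  also have "\<dots> \<le> 2 ^ N * (1 + r ^ N)"
    using that by (auto simp: power_mult_distrib max_def)
  finally show ?thesis .
qed

lemma schwartz_decay_ex:
  assumes "f \<in> schwartz"
  shows "\<exists>C. \<forall>x. (1 + norm x) ^ N * cmod (f x) \<le> C"
proof -
  have b: "\<exists>C. \<forall>x. norm x ^ k * cmod (f x) \<le> C" for k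
  proof -
    have "bounded (range (\<lambda>x. norm x ^ k *\<^sub>R partials [] f x))"
      using assms unfolding schwartz_def by (auto simp del: partials.simps)
    then show ?thesis by (auto simp: bounded_iff norm_mult norm_power)
  qed
  obtain C0 where C0: "\<And>x. cmod (f x) \<le> C0" using b[of 0] by auto
  obtain CN where CN: "\<And>x. norm x ^ N * cmod (f x) \<le> CN" using b[of N] by auto
  have "(1 + norm x) ^ N * cmod (f x) \<le> 2 ^ N * (C0 + CN)" for x
  proof -
    have "(1 + norm x) ^ N * cmod (f x) \<le> 2 ^ N * (1 + norm x ^ N) * cmod (f x)"
      by (intro mult_right_mono one_plus_power_le) auto
    also have "\<dots> = 2 ^ N * (cmod (f x) + norm x ^ N * cmod (f x))"
      by (simp add: algebra_simps)
    also have "\<dots> \<le> 2 ^ N * (C0 + CN)"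
      by (intro mult_left_mono add_mono C0 CN) auto
    finally show ?thesis .
  qed
  then show ?thesis by blast
qed

lemma finite_basis_lists: "finite {vs::'a::euclidean_space list. set vs \<subseteq> Basis \<and> length vs \<le> N}"
  by (rule finite_lists_length_le) simp

lemma schwartz_sup_bdd:
  assumes "f \<in> schwartz" "set vs \<subseteq> Basis"
  shows "bdd_above (range (\<lambda>x. (1 + norm x) ^ N * cmod (partials vs f x)))"
  using schwartz_decay_ex[OF schwartz_partials[OF assms], of N] by (auto simp: bdd_above_def)

lemma schwartz_sup_nonneg:
  assumes "f \<in> schwartz" "set vs \<subseteq> Basis"
  shows "0 \<le> (SUP x. (1 + norm x) ^ N * cmod (partials vs f x))"
  by (rule order_trans[OF _ cSUP_upper[OF _ schwartz_sup_bdd[OF assms], of 0]]) auto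

lemma schwartz_seminorm_nonneg: "f \<in> schwartz \<Longrightarrow> 0 \<le> schwartz_seminorm N f"
  unfolding schwartz_seminorm_def by (intro sum_nonneg schwartz_sup_nonneg) auto

lemma schwartz_seminorm_bound:
  assumes "f \<in> schwartz"
  shows "(1 + norm x) ^ N * cmod (f x) \<le> schwartz_seminorm N f"
proof -
  have "(1 + norm x) ^ N * cmod (f x) \<le> (SUP x. (1 + norm x) ^ N * cmod (partials [] f x))"
    using schwartz_sup_bdd[OF assms, of "[]" N] by (intro cSUP_upper2[of _ _ x]) auto
  also have "\<dots> \<le> schwartz_seminorm N f"
    unfolding schwartz_seminorm_def
    by (rule member_le_sum[of "[]"]) (auto intro!: schwartz_sup_nonneg assms finite_basis_lists)
  finally show ?thesis .
qed

text \<open>The lists of derivatives of \<open>dir_deriv v f\<close> are those of \<open>f\<close>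
  with \<open>v\<close> appended. They form part of the lists of length at most
  \<open>Suc N\<close>, and all suprema are nonnegative.\<close>

lemma schwartz_seminorm_dir_deriv:
  assumes "f \<in> schwartz" "v \<in> Basis"
  shows "schwartz_seminorm N (dir_deriv v f) \<le> schwartz_seminorm (Suc N) f"
proof -
  let ?L = "{vs. set vs \<subseteq> Basis \<and> length vs \<le> N}"
  let ?S = "\<lambda>M vs. SUP x. (1 + norm x) ^ M * cmod (partials vs f x)"
  have "schwartz_seminorm N (dir_deriv v f) = (\<Sum>vs\<in>?L. ?S N (vs @ [v]))"
    unfolding schwartz_seminorm_def by (simp add: partials_dir_deriv)
  also have "\<dots> \<le> (\<Sum>vs\<in>?L. ?S (Suc N) (vs @ [v]))"
  proof (intro sum_mono cSUP_mono)
    fix vs :: "'a list" assume "vs \<in> ?L"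
    then have *: "set (vs @ [v]) \<subseteq> Basis" using assms by auto
    show "bdd_above (range (\<lambda>x. (1 + norm x) ^ Suc N * cmod (partials (vs @ [v]) f x)))"
      by (rule schwartz_sup_bdd[OF assms(1) *])
    fix x
    show "\<exists>m\<in>UNIV. (1 + norm x) ^ N * cmod (partials (vs @ [v]) f x)
       \<le> (1 + norm m) ^ Suc N * cmod (partials (vs @ [v]) f m)"
      by (intro bexI[of _ x] mult_right_mono power_increasing) auto
  qed auto
  also have "\<dots> = (\<Sum>vs\<in>(\<lambda>vs. vs @ [v]) ` ?L. ?S (Suc N) vs)"
    by (subst sum.reindex) (auto intro!: inj_onI)
  also have "\<dots> \<le> schwartz_seminorm (Suc N) f"
    unfolding schwartz_seminorm_def
    using assms by (intro sum_mono2 schwartz_sup_nonneg finite_basis_lists) auto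
  finally show ?thesis .
qed

lemma schwartz_lincomb:
  assumes "f \<in> schwartz" "g \<in> schwartz"
  shows "(\<lambda>x. c * f x + d * g x) \<in> schwartz"
proof -
  let ?A = "{\<lambda>x. c * f x + d * g x | f g. f \<in> schwartz \<and> g \<in> schwartz}"
  show ?thesis
  proof (rule schwartzI_closed[of ?A])
    fix h x assume "h \<in> ?A"
    then obtain f g where h: "h = (\<lambda>x. c * f x + d * g x)" "f \<in> schwartz" "g \<in> schwartz" by auto
    show "h differentiable at x"
      unfolding h(1) by (intro derivative_intros schwartz_differentiable h)
  next
    fix h :: "'a \<Rightarrow> complex" and v :: 'a assume "h \<in> ?A" "v \<in> Basis"
    then obtain f g where h: "h = (\<lambda>x. c * f x + d * g x)" "f \<in> schwartz" "g \<in> schwartz" by auto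
    have "dir_deriv v h = (\<lambda>x. c * dir_deriv v f x + d * dir_deriv v g x)"
      unfolding h(1) dir_deriv_def[of v f] dir_deriv_def[of v g]
      by (rule dir_deriv_eqI) (auto intro!: derivative_eq_intros schwartz_has_derivative h)
    then show "dir_deriv v h \<in> ?A"
      using schwartz_dir_deriv \<open>v \<in> Basis\<close> h by blast
  next
    fix h :: "'a \<Rightarrow> complex" and k assume "h \<in> ?A"
    then obtain f g where h: "h = (\<lambda>x. c * f x + d * g x)" "f \<in> schwartz" "g \<in> schwartz" by auto
    obtain C D where C: "\<And>x. (1 + norm x) ^ k * cmod (f x) \<le> C" and D: "\<And>x. (1 + norm x) ^ k * cmod (g x) \<le> D"
      using schwartz_decay_ex[OF h(2), of k] schwartz_decay_ex[OF h(3), of k] by auto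
    have "norm x ^ k * cmod (h x) \<le> cmod c * C + cmod d * D" for x
    proof -
      have "norm x ^ k * cmod (h x) \<le> (1 + norm x) ^ k * (cmod c * cmod (f x) + cmod d * cmod (g x))"
        unfolding h(1) by (intro mult_mono power_mono) (auto intro!: norm_triangle_le simp: norm_mult)
      also have "\<dots> = cmod c * ((1 + norm x) ^ k * cmod (f x)) + cmod d * ((1 + norm x) ^ k * cmod (g x))"
        by (simp add: algebra_simps)
      also have "\<dots> \<le> cmod c * C + cmod d * D"
        by (intro add_mono mult_left_mono C D) auto
      finally show ?thesis .
    qed
    then show "\<exists>C. \<forall>x. norm x ^ k * cmod (h x) \<le> C" by blast
  qed (use assms in auto)
qed

lemma schwartz_cmult: "f \<in> schwartz \<Longrightarrow> (\<lambda>x. c * f x) \<in> schwartz"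
  using schwartz_lincomb[of f f c 0] by simp

text \<open>The class is closed under differentiation, and it contains the symbol
  \<open>\<bar>\<xi>\<bar>\<^sup>2 \<langle>\<xi>\<rangle>\<^sup>-\<^sup>2 = 1 - 1 / (1 + \<bar>\<xi>\<bar>\<^sup>2)\<close> if \<open>S\<close> is the basis of the space variables.\<close>

inductive_set mult_class :: "'a set \<Rightarrow> ('a::euclidean_space \<Rightarrow> complex) set" for S where
  const: "(\<lambda>x. c) \<in> mult_class S"
| coord: "b \<in> Basis \<Longrightarrow> (\<lambda>x. complex_of_real (x \<bullet> b)) \<in> mult_class S"
| recip: "(\<lambda>x. complex_of_real (1 / (1 + (\<Sum>b\<in>S. (x \<bullet> b)\<^sup>2)))) \<in> mult_class S"
| add: "p \<in> mult_class S \<Longrightarrow> q \<in> mult_class S \<Longrightarrow> (\<lambda>x. p x + q x) \<in> mult_class S"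
| mult: "p \<in> mult_class S \<Longrightarrow> q \<in> mult_class S \<Longrightarrow> (\<lambda>x. p x * q x) \<in> mult_class S"

lemma mult_class_sum:
  "finite I \<Longrightarrow> (\<And>i. i \<in> I \<Longrightarrow> p i \<in> mult_class S) \<Longrightarrow> (\<lambda>x. \<Sum>i\<in>I. p i x) \<in> mult_class S"
  by (induction I rule: finite_induct) (auto intro: mult_class.intros)

text \<open>Differentiability and stability are proved in one induction, with a full derivative
  rather than with \<open>dir_deriv\<close>, because the sum and product rules for
  \<open>dir_deriv\<close> already presuppose differentiability.\<close>

lemma mult_class_derivative:
  assumes "p \<in> mult_class S" "S \<subseteq> Basis"
  shows "\<exists>p'. (\<forall>x. (p has_derivative p' x) (at x)) \<and> (\<forall>v\<in>Basis. (\<lambda>x. p' x v) \<in> mult_class S)"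
  using assms(1)
proof induction
  case (const c)
  then show ?case by (intro exI[of _ "\<lambda>x v. 0"]) (auto intro: mult_class.const)
next
  case (coord b)
  then show ?case
    by (intro exI[of _ "\<lambda>x v. complex_of_real (v \<bullet> b)"]) 
       (auto intro: mult_class.const intro!: derivative_eq_intros)
next
  case recip
  let ?r = "\<lambda>x. 1 / (1 + (\<Sum>b\<in>S. (x \<bullet> b)\<^sup>2))"
  have pos: "1 + (\<Sum>b\<in>S. (x \<bullet> b)\<^sup>2) \<noteq> 0" for x :: 'a
    using sum_nonneg[of S "\<lambda>b. (x \<bullet> b)\<^sup>2"] by force
  \<comment> \<open>The derivative of 1/q is - dq / q^2 with q = 1 + sum of (x . b)^2, again a
    polynomial times powers of the generator.\<close>
  have "((\<lambda>x. complex_of_real (?r x)) has_derivative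
      (\<lambda>v. complex_of_real ((\<Sum>b\<in>S. - 2 * (v \<bullet> b) * (x \<bullet> b)) * ?r x * ?r x))) (at x)" for x
    by (rule has_derivative_of_real, use pos[of x] in \<open>auto intro!: derivative_eq_intros ext simp: sum_negf sum_distrib_left sum_distrib_right power2_eq_square divide_inverse ac_simps\<close>)
  moreover have "(\<lambda>x. complex_of_real ((\<Sum>b\<in>S. - 2 * (v \<bullet> b) * (x \<bullet> b)) * ?r x * ?r x)) \<in> mult_class S" for v
  proof -
    have "(\<lambda>x. (\<Sum>b\<in>S. complex_of_real (- 2 * (v \<bullet> b)) * complex_of_real (x \<bullet> b)) * complex_of_real (?r x) * complex_of_real (?r x)) \<in> mult_class S"
      using assms(2) finite_subset[OF assms(2)]
      by (intro mult_class.mult mult_class.recip mult_class_sum mult_class.const mult_class.coord) auto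
    then show ?thesis by simp
  qed
  ultimately show ?case
    by (intro exI[of _ "\<lambda>x v. complex_of_real ((\<Sum>b\<in>S. - 2 * (v \<bullet> b) * (x \<bullet> b)) * ?r x * ?r x)"]) blast
next
  case (add p q)
  then obtain p' q' where "\<And>x. (p has_derivative p' x) (at x)" "\<And>v. v \<in> Basis \<Longrightarrow> (\<lambda>x. p' x v) \<in> mult_class S"
     "\<And>x. (q has_derivative q' x) (at x)" "\<And>v. v \<in> Basis \<Longrightarrow> (\<lambda>x. q' x v) \<in> mult_class S" by blast
  then show ?case
    by (intro exI[of _ "\<lambda>x v. p' x v + q' x v"]) (auto intro!: derivative_intros mult_class.add)
next
  case (mult p q)
  then obtain p' q' where "\<And>x. (p has_derivative p' x) (at x)" "\<And>v. v \<in> Basis \<Longrightarrow> (\<lambda>x. p' x v) \<in> mult_class S"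
     "\<And>x. (q has_derivative q' x) (at x)" "\<And>v. v \<in> Basis \<Longrightarrow> (\<lambda>x. q' x v) \<in> mult_class S" by blast
  then show ?case using mult
    by (intro exI[of _ "\<lambda>x v. p x * q' x v + p' x v * q x"]) (auto intro!: derivative_intros mult_class.add mult_class.mult)
qed

lemma mult_class_differentiable:
  "p \<in> mult_class S \<Longrightarrow> S \<subseteq> Basis \<Longrightarrow> p differentiable at x"
  using mult_class_derivative[of p S] unfolding differentiable_def by blast

lemma mult_class_dir_deriv:
  "p \<in> mult_class S \<Longrightarrow> S \<subseteq> Basis \<Longrightarrow> v \<in> Basis \<Longrightarrow> dir_deriv v p \<in> mult_class S"
  using mult_class_derivative[of p S] dir_deriv_eqI[of p _ v] by force

lemma mult_class_bound:
  assumes "p \<in> mult_class S"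
  shows "\<exists>C N. 0 \<le> C \<and> (\<forall>x. cmod (p x) \<le> C * (1 + norm x) ^ N)"
  using assms
proof induction
  case (const c)
  then show ?case by (intro exI[of _ "cmod c"] exI[of _ 0]) auto
next
  case (coord b)
  have "\<bar>x \<bullet> b\<bar> \<le> 1 + norm x" for x
    using Basis_le_norm[OF coord, of x] by simp
  then show ?case by (intro exI[of _ 1] exI[of _ 1]) auto
next
  case recip
  have "0 \<le> (\<Sum>b\<in>S. (x \<bullet> b)\<^sup>2)" for x :: 'a by (intro sum_nonneg) auto
  then have "0 < 1 + (\<Sum>b\<in>S. (x \<bullet> b)\<^sup>2)" "1 \<le> 1 + (\<Sum>b\<in>S. (x \<bullet> b)\<^sup>2)" for x :: 'a
    by (simp_all add: add_pos_nonneg)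
  then have "cmod (complex_of_real (1 / (1 + (\<Sum>b\<in>S. (x \<bullet> b)\<^sup>2)))) \<le> 1" for x :: 'a
    unfolding norm_of_real by (metis abs_of_pos divide_le_eq_1_pos zero_less_divide_1_iff)
  then show ?case by (intro exI[of _ 1] exI[of _ 0]) simp
next
  case (add p q)
  then obtain C N D M where *: "0 \<le> C" "\<And>x. cmod (p x) \<le> C * (1 + norm x) ^ N"
    "0 \<le> D" "\<And>x. cmod (q x) \<le> D * (1 + norm x) ^ M" by blast
  have "cmod (p x + q x) \<le> (C + D) * (1 + norm x) ^ max N M" for x
  proof -
    have "cmod (p x + q x) \<le> C * (1 + norm x) ^ N + D * (1 + norm x) ^ M"
      using *(2,4)[of x] norm_triangle_ineq[of "p x" "q x"] by linarith
    also have "\<dots> \<le> C * (1 + norm x) ^ max N M + D * (1 + norm x) ^ max N M"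
      using *(1,3) by (intro add_mono mult_left_mono power_increasing) auto
    finally show ?thesis by (simp add: algebra_simps)
  qed
  then show ?case using *(1,3) by (intro exI[of _ "C + D"] exI[of _ "max N M"]) auto
next
  case (mult p q)
  then obtain C N D M where *: "0 \<le> C" "\<And>x. cmod (p x) \<le> C * (1 + norm x) ^ N"
    "0 \<le> D" "\<And>x. cmod (q x) \<le> D * (1 + norm x) ^ M" by blast
  have "cmod (p x * q x) \<le> (C * D) * (1 + norm x) ^ (N + M)" for x
  proof -
    have "cmod (p x * q x) \<le> (C * (1 + norm x) ^ N) * (D * (1 + norm x) ^ M)"
      unfolding norm_mult using * by (intro mult_mono) auto
    then show ?thesis by (simp add: algebra_simps power_add)
  qed
  then show ?case using *(1,3) by (intro exI[of _ "C * D"] exI[of _ "N + M"]) auto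
qed

lemma mult_class_times_bound:
  assumes "p \<in> mult_class S" and "\<And>N. \<exists>C. \<forall>x. (1 + norm x) ^ N * cmod (f x) \<le> C"
  shows "\<exists>C. \<forall>x. norm x ^ k * cmod (p x * f x) \<le> C"
proof -
  obtain C N where C: "0 \<le> C" "\<And>x. cmod (p x) \<le> C * (1 + norm x) ^ N"
    using mult_class_bound[OF assms(1)] by blast
  obtain D where D: "\<And>x. (1 + norm x) ^ (k + N) * cmod (f x) \<le> D" using assms(2) by blast
  have "norm x ^ k * cmod (p x * f x) \<le> C * D" for x
  proof -
    have "norm x ^ k * cmod (p x * f x) \<le> (1 + norm x) ^ k * (C * (1 + norm x) ^ N * cmod (f x))"
      unfolding norm_mult using C by (intro mult_mono power_mono) auto
    also have "\<dots> = C * ((1 + norm x) ^ (k + N) * cmod (f x))" by (simp add: power_add)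
    also have "\<dots> \<le> C * D" by (intro mult_left_mono D C)
    finally show ?thesis .
  qed
  then show ?thesis by blast
qed

text \<open>By the Leibniz rule the derivative of a product is a sum of two products; the finite
  sums of products form a class that is visibly stable.\<close>

inductive_set mult_schwartz :: "'a set \<Rightarrow> ('a::euclidean_space \<Rightarrow> complex) set" for S where
  base: "p \<in> mult_class S \<Longrightarrow> f \<in> schwartz \<Longrightarrow> (\<lambda>x. p x * f x) \<in> mult_schwartz S"
| plus: "f \<in> mult_schwartz S \<Longrightarrow> g \<in> mult_schwartz S \<Longrightarrow> (\<lambda>x. f x + g x) \<in> mult_schwartz S"

lemma schwartz_mult_class:
  assumes "p \<in> mult_class S" "f \<in> schwartz" "S \<subseteq> Basis"
  shows "(\<lambda>x. p x * f x) \<in> schwartz"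
proof -
  have d: "(\<forall>x. h differentiable at x) \<and> (\<forall>v\<in>Basis. dir_deriv v h \<in> mult_schwartz S) \<and>
     (\<forall>k. \<exists>C. \<forall>x. norm x ^ k * cmod (h x) \<le> C)" if "h \<in> mult_schwartz S" for h
    using that
  proof induction
    case (base p f)
    note [simp] = mult_class_differentiable[OF base(1) assms(3)] schwartz_differentiable[OF base(2)]
    have "dir_deriv v (\<lambda>x. p x * f x) = (\<lambda>x. p x * dir_deriv v f x + dir_deriv v p x * f x)" for v
      unfolding dir_deriv_def[of v f] dir_deriv_def[of v p]
      by (rule dir_deriv_eqI) (auto intro!: derivative_eq_intros simp: frechet_derivative_works[symmetric])
    then have "\<forall>v\<in>Basis. dir_deriv v (\<lambda>x. p x * f x) \<in> mult_schwartz S"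
      using base by (auto intro!: mult_schwartz.intros schwartz_dir_deriv mult_class_dir_deriv assms(3))
    then show ?case
      using mult_class_times_bound[OF base(1) schwartz_decay_ex[OF base(2)]] by auto
  next
    case (plus f g)
    have "dir_deriv v (\<lambda>x. f x + g x) = (\<lambda>x. dir_deriv v f x + dir_deriv v g x)" for v
      unfolding dir_deriv_def[of v f] dir_deriv_def[of v g]
      by (rule dir_deriv_eqI) (use plus in \<open>auto intro!: derivative_eq_intros simp: frechet_derivative_works[symmetric]\<close>)
    moreover have "\<exists>C. \<forall>x. norm x ^ k * cmod (f x + g x) \<le> C" for k
    proof -
      obtain C D where "\<And>x. norm x ^ k * cmod (f x) \<le> C" "\<And>x. norm x ^ k * cmod (g x) \<le> D"
        using plus by meson
      then have "norm x ^ k * cmod (f x + g x) \<le> C + D" for x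
        using mult_left_mono[OF norm_triangle_ineq[of "f x" "g x"], of "norm x ^ k"]
        by (smt (verit, best) distrib_left norm_ge_zero zero_le_power)
      then show ?thesis by blast
    qed
    ultimately show ?case using plus by (auto intro!: mult_schwartz.plus differentiable_add)
  qed
  show ?thesis
    using d by (intro schwartzI_closed[of "mult_schwartz S"]) (auto intro: mult_schwartz.base assms)
qed

lemma schwartz_coord_mult:
  "f \<in> schwartz \<Longrightarrow> b \<in> Basis \<Longrightarrow> (\<lambda>x. complex_of_real (x \<bullet> b) * f x) \<in> schwartz"
  by (rule schwartz_mult_class[of _ "{}"]) (auto intro: mult_class.coord)

section \<open>Gaussians and test functions as Schwartz functions\<close>

lemma gaussian_decay:
  fixes y :: "'a::euclidean_space"
  assumes "c > 0"
  shows "\<exists>C. \<forall>x. (1 + norm x) ^ N * exp (- c * (norm (x - y))\<^sup>2) \<le> C"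
proof -
  have "((\<lambda>r. (1 + norm y + r) ^ N * exp (- c * r\<^sup>2)) \<longlongrightarrow> 0) at_top"
    using assms by real_asymp
  then have "eventually (\<lambda>r. (1 + norm y + r) ^ N * exp (- c * r\<^sup>2) < 1) at_top"
    by (rule order_tendstoD) simp
  then obtain R where R: "\<And>r. r \<ge> R \<Longrightarrow> (1 + norm y + r) ^ N * exp (- c * r\<^sup>2) < 1"
    by (auto simp: eventually_at_top_linorder)
  have "(1 + norm x) ^ N * exp (- c * (norm (x - y))\<^sup>2) \<le> 1 + (1 + norm y + \<bar>R\<bar>) ^ N" for x
  proof -
    let ?r = "norm (x - y)"
    have 1: "norm x \<le> norm y + ?r" by (metis norm_triangle_sub)
    have "(1 + norm x) ^ N * exp (- c * ?r\<^sup>2) \<le> (1 + norm y + ?r) ^ N * exp (- c * ?r\<^sup>2)"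
      using 1 by (intro mult_right_mono power_mono) auto
    also have "\<dots> \<le> 1 + (1 + norm y + \<bar>R\<bar>) ^ N"
    proof (cases "?r \<ge> R")
      case True
      then show ?thesis using R[OF True] by (smt (verit) norm_ge_zero zero_le_power)
    next
      case False
      then have "(1 + norm y + ?r) ^ N * exp (- c * ?r\<^sup>2) \<le> (1 + norm y + \<bar>R\<bar>) ^ N * 1"
        using assms by (intro mult_mono power_mono) auto
      then show ?thesis by simp
    qed
    finally show ?thesis .
  qed
  then show ?thesis by blast
qed

lemma gaussian_schwartz:
  fixes y :: "'a::euclidean_space"
  assumes "c > 0"
  shows "(\<lambda>x. complex_of_real (exp (- c * (norm (x - y))\<^sup>2))) \<in> schwartz"
proof -
  let ?G = "\<lambda>x. complex_of_real (exp (- c * (norm (x - y))\<^sup>2))"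
  \<comment> \<open>With the empty index set the generator \<open>recip\<close> is the constant 1,
    so \<open>mult_class {}\<close> consists of the polynomials; derivatives of a Gaussian are
    polynomials times the Gaussian.\<close>
  let ?A = "{\<lambda>x. p x * ?G x | p. p \<in> mult_class {}}"
  have dG: "(?G has_derivative (\<lambda>v. complex_of_real (- 2 * c * ((x - y) \<bullet> v)) * ?G x)) (at x)" for x
    unfolding power2_norm_eq_inner
    by (auto intro!: derivative_eq_intros ext simp: inner_commute algebra_simps)
  show ?thesis
  proof (rule schwartzI_closed[of ?A])
    fix h x assume "h \<in> ?A"
    then obtain p where h: "h = (\<lambda>x. p x * ?G x)" "p \<in> mult_class {}" by auto
    have "?G differentiable at x" using dG differentiable_def by blast
    from differentiable_mult[OF mult_class_differentiable[OF h(2)] this]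
    show "h differentiable at x" unfolding h(1) by simp
  next
    fix h and v :: 'a assume "h \<in> ?A" and v: "v \<in> Basis"
    then obtain p where h: "h = (\<lambda>x. p x * ?G x)" "p \<in> mult_class {}" by auto
    let ?q = "\<lambda>x. dir_deriv v p x + p x * (complex_of_real (- 2 * c) * complex_of_real (x \<bullet> v) + complex_of_real (2 * c * (y \<bullet> v)))"
    have "dir_deriv v h = (\<lambda>x. p x * (complex_of_real (- 2 * c * ((x - y) \<bullet> v)) * ?G x) + dir_deriv v p x * ?G x)"
      unfolding h dir_deriv_def[of v p]
      by (rule dir_deriv_eqI)
        (rule has_derivative_mult[OF _ dG], auto simp: frechet_derivative_works[symmetric] mult_class_differentiable[OF h(2)])
    also have "\<dots> = (\<lambda>x. ?q x * ?G x)"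
      by (auto simp: fun_eq_iff inner_diff_left algebra_simps)
    finally have 1: "dir_deriv v h = (\<lambda>x. ?q x * ?G x)" .
    have "?q \<in> mult_class {}"
      using h(2) v by (intro mult_class.add mult_class.mult mult_class_dir_deriv mult_class.const mult_class.coord) auto
    then show "dir_deriv v h \<in> ?A" unfolding 1 mem_Collect_eq by (intro exI[of _ ?q] conjI refl)
  next
    fix h k assume "h \<in> ?A"
    then obtain p where h: "h = (\<lambda>x. p x * ?G x)" "p \<in> mult_class {}" by auto
    show "\<exists>C. \<forall>x. norm x ^ k * cmod (h x) \<le> C"
      unfolding h(1) by (rule mult_class_times_bound[OF h(2)]) (use gaussian_decay[OF assms] in simp)
  next
    show "?G \<in> ?A" by (intro CollectI exI[of _ "\<lambda>x. 1"]) (auto intro: mult_class.const)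
  qed
qed

lemma test_functions_schwartz: "test_functions \<Omega> \<subseteq> schwartz"
proof
  fix \<psi> assume "\<psi> \<in> test_functions \<Omega>"
  then have sm: "smooth \<psi>" and K: "compact (closure {x. \<psi> x \<noteq> 0})" by (auto simp: test_functions_def)
  let ?K = "closure {x. \<psi> x \<noteq> 0}"
  \<comment> \<open>The complement of the support is open, so the function vanishes near each of its
    points and all derivatives vanish there. Boundedness is then a matter of a compact set.\<close>
  have z: "partials vs \<psi> x = 0" if "x \<notin> ?K" for vs x
    using that
  proof (induction vs arbitrary: x)
    case Nil
    then show ?case using closure_subset[of "{x. \<psi> x \<noteq> 0}"] by auto
  next
    case (Cons v vs)
    have "((\<lambda>x. 0) has_derivative (\<lambda>v. 0)) (at x)" by simp
    then have "(partials vs \<psi> has_derivative (\<lambda>v. 0)) (at x)"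
      by (rule has_derivative_transform_within_open[of _ _ _ _ "- ?K"]) (use Cons in auto)
    then show ?case by (simp add: frechet_derivative_at[symmetric])
  qed
  show "\<psi> \<in> schwartz"
    unfolding schwartz_def
  proof (intro CollectI conjI sm allI impI)
    fix k :: nat and vs :: "'a list" assume vs: "set vs \<subseteq> Basis"
    let ?F = "\<lambda>x. norm x ^ k *\<^sub>R partials vs \<psi> x"
    have "continuous_on UNIV (partials vs \<psi>)"
      using sm vs unfolding smooth_def
      by (simp add: continuous_at_imp_continuous_on differentiable_imp_continuous_within)
    then have "continuous_on ?K ?F" by (intro continuous_intros) (auto intro: continuous_on_subset)
    then have "bounded (?F ` ?K)" by (intro compact_imp_bounded compact_continuous_image K)
    then have "bounded (insert 0 (?F ` ?K))" by simp
    moreover have "range ?F \<subseteq> insert 0 (?F ` ?K)"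
    proof
      fix y assume "y \<in> range ?F"
      then obtain x where "y = ?F x" by blast
      then show "y \<in> insert 0 (?F ` ?K)" using z[of x vs] by (cases "x \<in> ?K") auto
    qed
    ultimately show "bounded (range ?F)" by (rule bounded_subset)
  qed
qed

section \<open>The Fourier transform of Schwartz functions\<close>

lemma borel_measurable_cis [measurable (raw)]:
  "f \<in> borel_measurable M \<Longrightarrow> (\<lambda>x. cis (f x)) \<in> borel_measurable M"
  by (rule borel_measurable_continuous_on[where f = cis]) (auto intro!: continuous_intros)

lemma nn_integral_one_plus_square: "(\<integral>\<^sup>+x. ennreal (1 / (1 + x\<^sup>2)) \<partial>lborel) < \<infinity>"
proof -
  have "integrable lborel (\<lambda>x::real. inverse (1 + x\<^sup>2))"
    using integrable_inverse_1_plus_square by (simp add: set_integrable_def)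
  then have "(\<integral>\<^sup>+x. ennreal (norm (inverse (1 + (x::real)\<^sup>2))) \<partial>lborel) < \<infinity>"
    unfolding integrable_iff_bounded by simp
  then show ?thesis by (simp add: inverse_eq_divide)
qed

text \<open>The exponent is chosen so that (1 + |x|)^2 \<ge> 1 + x_b^2, multiplied over all
  coordinates b, bounds this function by a product of the integrable functions 1 / (1 + t^2). It is
  the common majorant of Schwartz functions.\<close>

definition decay :: "'a::euclidean_space \<Rightarrow> real" where
  "decay x = 1 / (1 + norm x) ^ (2 * DIM('a))"

lemma decay_pos [simp]: "0 < decay x" and decay_nonneg [simp]: "0 \<le> decay x"
proof -
  have "0 < 1 + norm x" by (auto intro: add_pos_nonneg)
  then have "0 < (1 + norm x) ^ (2 * DIM('a))" by (rule zero_less_power)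
  then show "0 < decay x" unfolding decay_def by (rule divide_pos_pos[OF zero_less_one])
  then show "0 \<le> decay x" by (rule less_imp_le)
qed

lemma decay_le_1: "decay (x :: 'a::euclidean_space) \<le> 1"
proof -
  have "1 \<le> (1 + norm x) ^ (2 * DIM('a))" by (rule one_le_power) simp
  then show ?thesis unfolding decay_def by (metis divide_le_eq_1_pos less_le_trans zero_less_one)
qed

lemma decay_measurable [measurable]: "decay \<in> borel_measurable borel"
  unfolding decay_def[abs_def] by measurable

lemma nn_integral_decay: "(\<integral>\<^sup>+x. ennreal (decay (x::'a::euclidean_space)) \<partial>lborel) < \<infinity>"
proof -
  have "ennreal (decay x) \<le> (\<Prod>b\<in>Basis. ennreal (1 / (1 + (x \<bullet> b)\<^sup>2)))" for x :: 'a
  proof -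
    have "1 + (x \<bullet> b)\<^sup>2 \<le> (1 + norm x)\<^sup>2" if "b \<in> Basis" for b
    proof -
      have "(x \<bullet> b)\<^sup>2 \<le> (norm x)\<^sup>2" using Basis_le_norm[OF that, of x] by (simp add: abs_le_square_iff[symmetric])
      then show ?thesis by (simp add: power2_sum add_increasing2)
    qed
    then have "(\<Prod>b\<in>(Basis::'a set). 1 + (x \<bullet> b)\<^sup>2) \<le> (\<Prod>b\<in>(Basis::'a set). (1 + norm x)\<^sup>2)"
      by (intro prod_mono) (auto intro: add_nonneg_nonneg)
    then have "decay x \<le> 1 / (\<Prod>b\<in>(Basis::'a set). 1 + (x \<bullet> b)\<^sup>2)"
      unfolding decay_def by (intro divide_left_mono mult_pos_pos prod_pos zero_less_power)
        (auto simp: power_mult add_pos_nonneg)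
    also have "\<dots> = (\<Prod>b\<in>Basis. 1 / (1 + (x \<bullet> b)\<^sup>2))" by (simp add: prod_dividef)
    finally show ?thesis by (simp add: prod_ennreal ennreal_leI)
  qed
  then have "(\<integral>\<^sup>+x. ennreal (decay (x::'a)) \<partial>lborel) \<le> (\<integral>\<^sup>+x. (\<Prod>b\<in>Basis. ennreal (1 / (1 + ((x::'a) \<bullet> b)\<^sup>2))) \<partial>lborel)"
    by (intro nn_integral_mono)
  also have "\<dots> = (\<Prod>b\<in>(Basis::'a set). \<integral>\<^sup>+x. ennreal (1 / (1 + x\<^sup>2)) \<partial>lborel)"
    by (rule nn_integral_lborel_prod) auto
  also have "\<dots> < \<infinity>"
    using nn_integral_one_plus_square by (simp add: power_less_top_ennreal)
  finally show ?thesis .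
qed

lemma integrable_decay: "integrable lborel (decay :: 'a::euclidean_space \<Rightarrow> real)"
  using nn_integral_decay by (intro integrableI_bounded) auto

lemma schwartz_le_decay:
  fixes f :: "'a::euclidean_space \<Rightarrow> complex"
  assumes "f \<in> schwartz"
  shows "(1 + norm x) ^ N * cmod (f x) \<le> schwartz_seminorm (2 * DIM('a) + N) f * decay x"
proof -
  have "0 < (1 + norm x) ^ (2 * DIM('a))" by (intro zero_less_power) (auto intro: add_pos_nonneg)
  then show ?thesis
    using schwartz_seminorm_bound[OF assms, of x "2 * DIM('a) + N"]
    by (simp add: decay_def field_simps power_add)
qed

lemma schwartz_le_decay0:
  fixes f :: "'a::euclidean_space \<Rightarrow> complex"
  assumes "f \<in> schwartz"
  shows "cmod (f x) \<le> schwartz_seminorm (2 * DIM('a)) f * decay x"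
  using schwartz_le_decay[OF assms, of x 0] by simp

lemma schwartz_integrable_power:
  assumes "f \<in> schwartz"
  shows "integrable lborel (\<lambda>x. (1 + norm x) ^ N * cmod (f x))"
proof (rule Bochner_Integration.integrable_bound)
  show "integrable lborel (\<lambda>x::'a. schwartz_seminorm (2 * DIM('a) + N) f * decay x)"
    by (intro integrable_mult_right integrable_decay)
  show "(\<lambda>x. (1 + norm x) ^ N * cmod (f x)) \<in> borel_measurable lborel"
    using schwartz_measurable[OF assms] by measurable
  show "AE x in lborel. norm ((1 + norm x) ^ N * cmod (f x)) \<le> norm (schwartz_seminorm (2 * DIM('a) + N) f * decay x)"
    using schwartz_le_decay[OF assms, of _ N] schwartz_seminorm_nonneg[OF assms]
    by (intro AE_I2) (simp add: abs_mult)
qed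

lemma schwartz_integrable:
  assumes "f \<in> schwartz" shows "integrable lborel f"
proof -
  have "integrable lborel (\<lambda>x. cmod (f x))"
    using schwartz_integrable_power[OF assms, of 0] by simp
  then show ?thesis
    using schwartz_measurable[OF assms] integrable_norm_iff[of f lborel] by simp
qed

text \<open>Both signs \<sigma> = -1 and \<sigma> = 1 occur, since the inverse transform is
  \<open>ft 1\<close> up to a factor; with \<sigma> as a parameter each fact is proved once.\<close>

definition ft :: "real \<Rightarrow> ('a::euclidean_space \<Rightarrow> complex) \<Rightarrow> 'a \<Rightarrow> complex" where
  "ft \<sigma> f p = (LINT x|lborel. cis (\<sigma> * (x \<bullet> p)) * f x)"

lemma fourier_eq_ft: "fourier f = ft (-1) f"
  by (simp add: fun_eq_iff fourier_def ft_def cis_conv_exp)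

lemma inverse_fourier_eq_ft:
  "inverse_fourier (g :: 'a::euclidean_space \<Rightarrow> complex) = (\<lambda>x. complex_of_real (1 / (2 * pi) ^ DIM('a)) * ft 1 g x)"
  by (simp add: fun_eq_iff inverse_fourier_def ft_def cis_conv_exp inner_commute)

lemma integrable_cis_mult:
  fixes f :: "'a \<Rightarrow> complex"
  assumes "integrable M f" "\<phi> \<in> borel_measurable M"
  shows "integrable M (\<lambda>x. cis (\<phi> x) * f x)"
  by (rule Bochner_Integration.integrable_bound[OF assms(1)])
    (use assms borel_measurable_integrable[OF assms(1)] in \<open>auto simp: norm_mult\<close>)

lemma ft_integrable: "integrable lborel f \<Longrightarrow> integrable lborel (\<lambda>x. cis (\<sigma> * (x \<bullet> p)) * f x)"
  by (rule integrable_cis_mult) measurable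

lemma ft_norm_le: "cmod (ft \<sigma> f p) \<le> (LINT x|lborel. cmod (f x))"
proof -
  have "cmod (ft \<sigma> f p) \<le> (LINT x|lborel. cmod (cis (\<sigma> * (x \<bullet> p)) * f x))"
    unfolding ft_def by (rule integral_norm_bound)
  then show ?thesis by (simp add: norm_mult)
qed

lemma ft_measurable [measurable]:
  assumes [measurable]: "f \<in> borel_measurable borel"
  shows "ft \<sigma> f \<in> borel_measurable borel"
proof -
  have "(\<lambda>p. LINT x|lborel. cis (\<sigma> * (x \<bullet> p)) * f x) \<in> borel_measurable borel"
    by (rule lborel.borel_measurable_lebesgue_integral) measurable
  then show ?thesis by (simp add: ft_def[abs_def])
qed

lemma ft_lincomb:
  assumes "integrable lborel f" "integrable lborel g"
  shows "ft \<sigma> (\<lambda>x. c * f x + d * g x) p = c * ft \<sigma> f p + d * ft \<sigma> g p"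
  unfolding ft_def using ft_integrable[OF assms(1)] ft_integrable[OF assms(2)]
  by (simp add: distrib_left mult.left_commute[of _ c] mult.left_commute[of _ d])

lemma ft_cmult: "ft \<sigma> (\<lambda>x. c * f x) p = c * ft \<sigma> f p"
  by (simp add: ft_def mult.left_commute[of _ c])

lemma cis_taylor1: "cmod (cis y - 1 - \<i> * complex_of_real y) \<le> y\<^sup>2 / 2"
  using iexp_approx1[of y 1] by (simp add: cis_conv_exp algebra_simps power2_eq_square numeral_2_eq_2)

lemma bochner_norm_bound:
  fixes f :: "'a \<Rightarrow> 'b::{banach,second_countable_topology}"
  assumes "integrable M f" "integrable M g" "\<And>x. norm (f x) \<le> g x"
  shows "norm (LINT x|M. f x) \<le> (LINT x|M. g x)"
  by (rule order_trans[OF integral_norm_bound Bochner_Integration.integral_mono]) (use assms in auto)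

section \<open>Translation and reflection of integrals\<close>

lemma lborel_integral_translate:
  fixes f :: "'a::euclidean_space \<Rightarrow> 'b::{banach,second_countable_topology}"
  assumes [measurable]: "f \<in> borel_measurable borel"
  shows "(LINT x|lborel. f (c + x)) = (LINT x|lborel. f x)"
proof -
  have "(LINT x|lborel. f x) = (LINT x|distr lborel borel ((+) c). f x)"
    by (simp only: lborel_distr_plus)
  also have "\<dots> = (LINT x|lborel. f (c + x))" by (subst integral_distr) auto
  finally show ?thesis by simp
qed

lemma lborel_integrable_translate:
  fixes f :: "'a::euclidean_space \<Rightarrow> 'b::{banach,second_countable_topology}"
  assumes "integrable lborel f"
  shows "integrable lborel (\<lambda>x. f (c + x))"
proof (rule integrable_distr[of "(+) c" lborel borel])
  show "integrable (distr lborel borel ((+) c)) f"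
    using assms by (simp only: lborel_distr_plus)
qed simp

lemma lborel_nn_integral_translate:
  fixes f :: "'a::euclidean_space \<Rightarrow> ennreal"
  assumes [measurable]: "f \<in> borel_measurable borel"
  shows "(\<integral>\<^sup>+x. f (c + x) \<partial>lborel) = (\<integral>\<^sup>+x. f x \<partial>lborel)"
proof -
  have "(\<integral>\<^sup>+x. f x \<partial>lborel) = (\<integral>\<^sup>+x. f x \<partial>distr lborel borel ((+) c))"
    by (simp only: lborel_distr_plus)
  also have "\<dots> = (\<integral>\<^sup>+x. f (c + x) \<partial>lborel)" by (subst nn_integral_distr) auto
  finally show ?thesis by simp
qed

lemma lborel_distr_uminus_euclidean: "distr lborel borel uminus = (lborel :: 'a::euclidean_space measure)"
proof -
  have "distr lborel borel (\<lambda>x::'a. 0 + (-1) *\<^sub>R x) = distr lborel borel uminus" by (simp add: uminus_add_conv_diff cong: distr_cong)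
  then show ?thesis using lborel_affine[of "-1" "0::'a"] by (simp add: density_1)
qed

lemma lborel_nn_integral_reflect:
  fixes f :: "'a::euclidean_space \<Rightarrow> ennreal"
  assumes [measurable]: "f \<in> borel_measurable borel"
  shows "(\<integral>\<^sup>+x. f (c - x) \<partial>lborel) = (\<integral>\<^sup>+x. f x \<partial>lborel)"
proof -
  have "(\<integral>\<^sup>+x. f (c + x) \<partial>lborel) = (\<integral>\<^sup>+x. f (c + x) \<partial>distr lborel borel (uminus :: 'a \<Rightarrow> 'a))"
    by (simp only: lborel_distr_uminus_euclidean)
  also have "\<dots> = (\<integral>\<^sup>+x. f (c - x) \<partial>lborel)" by (subst nn_integral_distr) auto
  finally show ?thesis by (simp add: lborel_nn_integral_translate)
qed

section \<open>The transform exchanges derivatives with multiplication by coordinates\<close>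

lemma decay_shift:
  fixes x y :: "'a::euclidean_space"
  assumes "norm (x - y) \<le> 1"
  shows "decay y \<le> 2 ^ (2 * DIM('a)) * decay x"
proof -
  have "norm x \<le> norm y + norm (x - y)" by (rule norm_triangle_sub)
  then have "1 + norm x \<le> 2 * (1 + norm y)" using assms by (smt (verit) norm_ge_zero)
  then have "(1 + norm x) ^ (2 * DIM('a)) \<le> (2 * (1 + norm y)) ^ (2 * DIM('a))"
    by (intro power_mono) auto
  moreover have "0 < (1 + norm x) ^ (2 * DIM('a))" "0 < (1 + norm y) ^ (2 * DIM('a))"
    by (auto intro!: zero_less_power add_pos_nonneg)
  ultimately show ?thesis
    unfolding decay_def power_mult_distrib by (simp add: divide_simps)
qed

lemma difference_quotient_tendsto:
  fixes f :: "'a::euclidean_space \<Rightarrow> complex"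
  assumes f: "f \<in> schwartz" and b: "b \<in> Basis"
  shows "(\<lambda>k. (f (x + (1 / real (Suc k)) *\<^sub>R b) - f x) * of_nat (Suc k)) \<longlonglongrightarrow> dir_deriv b f x"
proof -
  let ?y = "\<lambda>k. x + (1 / real (Suc k)) *\<^sub>R b"
  let ?L = "frechet_derivative f (at x)"
  have lin: "bounded_linear ?L" using schwartz_has_derivative[OF f] has_derivative_bounded_linear by blast
  have "b \<noteq> 0" using b by auto
  have "?y \<longlonglongrightarrow> x + 0 *\<^sub>R b"
    using LIMSEQ_inverse_real_of_nat by (intro tendsto_intros) (simp add: inverse_eq_divide)
  then have y: "filterlim ?y (at x) sequentially"
    using \<open>b \<noteq> 0\<close> by (intro filterlim_atI) (auto simp del: of_nat_Suc)
  have "((\<lambda>y. (1 / norm (y - x)) *\<^sub>R (f y - (f x + ?L (y - x)))) \<longlongrightarrow> 0) (at x)"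
    using schwartz_has_derivative[OF f, of x] by (simp add: has_derivative_within)
  from filterlim_compose[OF this y]
  have "(\<lambda>k. real (Suc k) *\<^sub>R (f (?y k) - (f x + (1 / real (Suc k)) *\<^sub>R ?L b))) \<longlonglongrightarrow> 0"
    using b by (simp add: linear_cmul[OF bounded_linear.linear[OF lin]] del: of_nat_Suc)
  moreover have "real (Suc k) *\<^sub>R (f (?y k) - (f x + (1 / real (Suc k)) *\<^sub>R ?L b))
     = (f (?y k) - f x) * of_nat (Suc k) - ?L b" for k
  proof -
    have "real (Suc k) *\<^sub>R (f (?y k) - (f x + (1 / real (Suc k)) *\<^sub>R ?L b))
      = real (Suc k) *\<^sub>R (f (?y k) - f x) - real (Suc k) *\<^sub>R (1 / real (Suc k)) *\<^sub>R ?L b"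
      by (simp add: algebra_simps del: of_nat_Suc)
    also have "real (Suc k) *\<^sub>R (1 / real (Suc k)) *\<^sub>R ?L b = ?L b" by (simp del: of_nat_Suc)
    finally show ?thesis by (simp add: scaleR_conv_of_real mult.commute del: of_nat_Suc)
  qed
  ultimately have "(\<lambda>k. (f (?y k) - f x) * of_nat (Suc k) - ?L b) \<longlonglongrightarrow> 0" by simp
  then show ?thesis unfolding dir_deriv_def by (simp add: LIM_zero_iff del: of_nat_Suc)
qed

text \<open>The mean value inequality reduces the quotient to a derivative at a point within
  distance 1, where \<open>decay_shift\<close> compares the decay with that at \<open>x\<close>. The
  majorant is integrable and independent of \<open>k\<close>, as dominated convergence
  requires.\<close>

lemma difference_quotient_bound:
  fixes f :: "'a::euclidean_space \<Rightarrow> complex"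
  assumes f: "f \<in> schwartz" and b: "b \<in> Basis"
  shows "cmod ((f (x + (1 / real (Suc k)) *\<^sub>R b) - f x) * of_nat (Suc k))
    \<le> schwartz_seminorm (2 * DIM('a)) (dir_deriv b f) * 2 ^ (2 * DIM('a)) * decay x"
proof -
  let ?h = "1 / real (Suc k)"
  let ?g = "\<lambda>t. f (x + t *\<^sub>R b)"
  have h: "0 < ?h" "?h \<le> 1" by auto
  have der: "(?g has_derivative (\<lambda>u. u *\<^sub>R dir_deriv b f (x + t *\<^sub>R b))) (at t)" for t
  proof -
    have lin: "linear (frechet_derivative f (at (x + t *\<^sub>R b)))"
      using schwartz_has_derivative[OF f] has_derivative_linear by blast
    have "(?g has_derivative (\<lambda>u. frechet_derivative f (at (x + t *\<^sub>R b)) (u *\<^sub>R b))) (at t)"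
      by (rule has_derivative_compose[of "\<lambda>t. x + t *\<^sub>R b", OF _ schwartz_has_derivative[OF f]])
        (auto intro!: derivative_eq_intros)
    then show ?thesis by (simp add: linear_cmul[OF lin] dir_deriv_def)
  qed
  have "\<exists>t\<in>{0<..<?h}. cmod (?g ?h - ?g 0) \<le> cmod ((?h - 0) *\<^sub>R dir_deriv b f (x + t *\<^sub>R b))"
  proof (rule mvt_general[OF h(1)])
    show "continuous_on {0..?h} ?g"
      using der by (intro continuous_at_imp_continuous_on) (auto intro: has_derivative_continuous)
  qed (rule der)
  then obtain t where t: "0 < t" "t < ?h" "cmod (?g ?h - ?g 0) \<le> ?h * cmod (dir_deriv b f (x + t *\<^sub>R b))"
    by auto
  have "cmod ((f (x + ?h *\<^sub>R b) - f x) * of_nat (Suc k)) = cmod (?g ?h - ?g 0) * real (Suc k)"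
    by (simp add: norm_mult del: of_nat_Suc)
  also have "\<dots> \<le> (?h * cmod (dir_deriv b f (x + t *\<^sub>R b))) * real (Suc k)"
    by (intro mult_right_mono t) auto
  also have "\<dots> = cmod (dir_deriv b f (x + t *\<^sub>R b))" by (simp del: of_nat_Suc)
  also have "\<dots> \<le> schwartz_seminorm (2 * DIM('a)) (dir_deriv b f) * decay (x + t *\<^sub>R b)"
    by (intro schwartz_le_decay0 schwartz_dir_deriv f b)
  also have "\<dots> \<le> schwartz_seminorm (2 * DIM('a)) (dir_deriv b f) * (2 ^ (2 * DIM('a)) * decay x)"
  proof (intro mult_left_mono decay_shift schwartz_seminorm_nonneg schwartz_dir_deriv f b)
    have "t \<le> 1" using t h by linarith
    then show "norm (x - (x + t *\<^sub>R b)) \<le> 1" using t b by simp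
  qed
  finally show ?thesis by (simp add: mult.assoc)
qed

text \<open>Integration by parts without boundary terms: the translation of \<open>f\<close> is
  moved onto the character, so the transform of each difference quotient is a number
  \<open>r k\<close> times \<open>ft \<sigma> f p\<close>. Both sides are then passed to the
  limit.\<close>

lemma ft_dir_deriv:
  fixes f :: "'a::euclidean_space \<Rightarrow> complex"
  assumes f: "f \<in> schwartz" and b: "b \<in> Basis"
  shows "ft \<sigma> (dir_deriv b f) p = - \<i> * complex_of_real (\<sigma> * (p \<bullet> b)) * ft \<sigma> f p"
proof -
  let ?s = "\<lambda>k x. (f (x + (1 / real (Suc k)) *\<^sub>R b) - f x) * of_nat (Suc k)"
  let ?c = "\<lambda>x. cis (\<sigma> * (x \<bullet> p))"
  note [measurable] = schwartz_measurable[OF f] schwartz_measurable[OF schwartz_dir_deriv[OF f b]]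
  \<comment> \<open>The difference quotient at t = 0 of the function exp(- i \<sigma> t (p . b));
    its limit is the factor in the assertion.\<close>
  define r where "r k = (cis (- (\<sigma> * (p \<bullet> b)) * (1 / real (Suc k))) - 1) * of_nat (Suc k)" for k
  have "(\<lambda>k. LINT x|lborel. ?c x * ?s k x) \<longlonglongrightarrow> (LINT x|lborel. ?c x * dir_deriv b f x)"
  proof (rule integral_dominated_convergence)
    show "integrable lborel (\<lambda>x::'a. schwartz_seminorm (2 * DIM('a)) (dir_deriv b f) * 2 ^ (2 * DIM('a)) * decay x)"
      by (intro integrable_mult_right integrable_decay)
    show "AE x in lborel. (\<lambda>k. ?c x * ?s k x) \<longlonglongrightarrow> ?c x * dir_deriv b f x"
      by (intro AE_I2 tendsto_mult tendsto_const difference_quotient_tendsto f b)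
    show "AE x in lborel. cmod (?c x * ?s k x) \<le> schwartz_seminorm (2 * DIM('a)) (dir_deriv b f) * 2 ^ (2 * DIM('a)) * decay x" for k
      using difference_quotient_bound[OF f b, of _ k] by (auto simp: norm_mult)
  qed measurable
  moreover have "(LINT x|lborel. ?c x * ?s k x) = r k * ft \<sigma> f p" for k
  proof -
    define h where "h = (1 / real (Suc k)) *\<^sub>R b"
    have i: "integrable lborel (\<lambda>x. ?c x * f x)" by (rule ft_integrable[OF schwartz_integrable[OF f]])
    have i2: "integrable lborel (\<lambda>x. cis (- (\<sigma> * (p \<bullet> h))) * (?c x * f x))" using i by simp
    have e: "cis (- (\<sigma> * (p \<bullet> h))) * (?c (h + x) * f (h + x)) = ?c x * f (x + h)" for x
    proof -
      have "- (\<sigma> * (p \<bullet> h)) + \<sigma> * ((h + x) \<bullet> p) = \<sigma> * (x \<bullet> p)"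
        by (simp add: inner_left_distrib inner_commute[of p] distrib_left)
      then show ?thesis by (simp only: mult.assoc[symmetric] cis_mult add.commute[of h x])
    qed
    have i3: "integrable lborel (\<lambda>x. ?c x * f (x + h))"
      by (rule back_subst[of "integrable lborel", OF lborel_integrable_translate[OF i2, of h]]) (rule ext, rule e)
    have "(LINT x|lborel. ?c x * f (x + h)) = (LINT x|lborel. cis (- (\<sigma> * (p \<bullet> h))) * (?c (h + x) * f (h + x)))"
      by (rule Bochner_Integration.integral_cong[OF refl e[symmetric]])
    also have "\<dots> = (LINT x|lborel. cis (- (\<sigma> * (p \<bullet> h))) * (?c x * f x))"
      by (rule lborel_integral_translate) measurable
    also have "\<dots> = cis (- (\<sigma> * (p \<bullet> h))) * ft \<sigma> f p"
      unfolding ft_def by (rule integral_mult_right_zero)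
    finally have t: "(LINT x|lborel. ?c x * f (x + h)) = cis (- (\<sigma> * (p \<bullet> h))) * ft \<sigma> f p" .
    have "(LINT x|lborel. ?c x * ?s k x) = (LINT x|lborel. (?c x * f (x + h) - ?c x * f x) * of_nat (Suc k))"
      unfolding h_def by (intro Bochner_Integration.integral_cong refl) (simp only: right_diff_distrib[symmetric] mult.assoc)
    also have "\<dots> = ((LINT x|lborel. ?c x * f (x + h)) - ft \<sigma> f p) * of_nat (Suc k)"
      using i i3 by (simp add: ft_def del: of_nat_Suc)
    also have "\<dots> = (cis (- (\<sigma> * (p \<bullet> h))) - 1) * of_nat (Suc k) * ft \<sigma> f p"
      unfolding t by (simp add: algebra_simps del: of_nat_Suc)
    also have "\<dots> = r k * ft \<sigma> f p"
      unfolding r_def h_def by (simp del: of_nat_Suc)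
    finally show ?thesis .
  qed
  moreover have "r \<longlonglongrightarrow> - \<i> * complex_of_real (\<sigma> * (p \<bullet> b))"
  proof -
    let ?a = "- (\<sigma> * (p \<bullet> b))"
    have A: "cmod (r k - \<i> * complex_of_real ?a) \<le> ?a\<^sup>2 / 2 * (1 / real (Suc k))" for k
    proof -
      let ?h = "1 / real (Suc k)"
      have "r k - \<i> * complex_of_real ?a = (cis (?a * ?h) - 1 - \<i> * complex_of_real (?a * ?h)) * of_nat (Suc k)"
        unfolding r_def by (simp add: field_simps del: of_nat_Suc)
      then have "cmod (r k - \<i> * complex_of_real ?a) = cmod (cis (?a * ?h) - 1 - \<i> * complex_of_real (?a * ?h)) * real (Suc k)"
        by (simp add: norm_mult del: of_nat_Suc)
      also have "\<dots> \<le> (?a * ?h)\<^sup>2 / 2 * real (Suc k)" by (intro mult_right_mono cis_taylor1) auto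
      also have "\<dots> = ?a\<^sup>2 / 2 * ?h" by (simp add: field_simps power2_eq_square del: of_nat_Suc)
      finally show ?thesis .
    qed
    have B: "(\<lambda>k. ?a\<^sup>2 / 2 * (1 / real (Suc k))) \<longlonglongrightarrow> 0"
      using tendsto_mult[OF tendsto_const LIMSEQ_inverse_real_of_nat, of "?a\<^sup>2 / 2"] by (simp add: inverse_eq_divide)
    have "(\<lambda>k. r k - \<i> * complex_of_real ?a) \<longlonglongrightarrow> 0"
      by (rule Lim_null_comparison[OF always_eventually[OF allI[OF A]] B])
    then have "r \<longlonglongrightarrow> \<i> * complex_of_real ?a" by (rule LIM_zero_cancel)
    then show ?thesis by simp
  qed
  ultimately have "(\<lambda>k. r k * ft \<sigma> f p) \<longlonglongrightarrow> (LINT x|lborel. ?c x * dir_deriv b f x)"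
    and r: "r \<longlonglongrightarrow> - \<i> * complex_of_real (\<sigma> * (p \<bullet> b))"
    by simp_all
  then have "(\<lambda>k. r k * ft \<sigma> f p) \<longlonglongrightarrow> ft \<sigma> (dir_deriv b f) p"
    unfolding ft_def[of \<sigma> "dir_deriv b f"] by simp
  from LIMSEQ_unique[OF this tendsto_mult[OF r tendsto_const]] show ?thesis .
qed

text \<open>Each factor |p| is bounded by the sum of the |p . b|, and each coordinate is traded for
  a derivative of \<open>f\<close> by \<open>ft_dir_deriv\<close>; |\<sigma>| = 1 makes this
  exchange an equality of moduli.\<close>

lemma ft_seminorm_bound:
  fixes \<sigma> :: real
  assumes \<sigma>: "\<bar>\<sigma>\<bar> = 1"
  shows "\<exists>C N. 0 \<le> C \<and> (\<forall>f::'a::euclidean_space \<Rightarrow> complex. f \<in> schwartz \<longrightarrow> (\<forall>p. norm p ^ k * cmod (ft \<sigma> f p) \<le> C * schwartz_seminorm N f))"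
proof (induction k)
  case 0
  let ?I = "LINT x|lborel. decay (x::'a)"
  have "cmod (ft \<sigma> f p) \<le> ?I * schwartz_seminorm (2 * DIM('a)) f" if f: "f \<in> schwartz" for f :: "'a \<Rightarrow> complex" and p
  proof -
    have "cmod (ft \<sigma> f p) \<le> (LINT x|lborel. cmod (f x))" by (rule ft_norm_le)
    also have "\<dots> \<le> (LINT x|lborel. schwartz_seminorm (2 * DIM('a)) f * decay (x::'a))"
    proof (rule Bochner_Integration.integral_mono)
      show "integrable lborel (\<lambda>x. schwartz_seminorm (2 * DIM('a)) f * decay (x::'a))"
        by (intro integrable_mult_right integrable_decay)
    qed (auto intro: integrable_norm schwartz_integrable f schwartz_le_decay0)
    finally show ?thesis by (simp add: mult.commute)
  qed
  moreover have "0 \<le> ?I" by simp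
  ultimately show ?case by (intro exI[of _ ?I] exI[of _ "2 * DIM('a)"]) auto
next
  case (Suc k)
  then obtain C N where C: "0 \<le> C" "\<And>f p. f \<in> schwartz \<Longrightarrow> norm p ^ k * cmod (ft \<sigma> (f::'a\<Rightarrow>complex) p) \<le> C * schwartz_seminorm N f" by blast
  have "norm p ^ Suc k * cmod (ft \<sigma> f p) \<le> (DIM('a) * C) * schwartz_seminorm (Suc N) f"
    if f: "f \<in> schwartz" for f :: "'a \<Rightarrow> complex" and p
  proof -
    have "norm p ^ Suc k * cmod (ft \<sigma> f p) \<le> (\<Sum>b\<in>Basis. \<bar>p \<bullet> b\<bar>) * (norm p ^ k * cmod (ft \<sigma> f p))"
      using norm_le_l1[of p] by (simp add: mult.assoc mult_right_mono)
    also have "\<dots> = (\<Sum>b\<in>Basis. norm p ^ k * cmod (ft \<sigma> (dir_deriv b f) p))"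
      unfolding sum_distrib_right
    proof (rule sum.cong[OF refl])
      fix b :: 'a assume "b \<in> Basis"
      then show "\<bar>p \<bullet> b\<bar> * (norm p ^ k * cmod (ft \<sigma> f p)) = norm p ^ k * cmod (ft \<sigma> (dir_deriv b f) p)"
        using \<sigma> by (simp add: ft_dir_deriv[OF f] norm_mult abs_mult)
    qed
    also have "\<dots> \<le> (\<Sum>b\<in>(Basis::'a set). C * schwartz_seminorm (Suc N) f)"
    proof (rule sum_mono)
      fix b :: 'a assume b: "b \<in> Basis"
      show "norm p ^ k * cmod (ft \<sigma> (dir_deriv b f) p) \<le> C * schwartz_seminorm (Suc N) f"
        by (rule order_trans[OF C(2)[OF schwartz_dir_deriv[OF f b]] mult_left_mono[OF schwartz_seminorm_dir_deriv[OF f b] C(1)]])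
    qed
    finally show ?thesis by simp
  qed
  then show ?case using C(1) by (intro exI[of _ "DIM('a) * C"] exI[of _ "Suc N"]) auto
qed

text \<open>Differentiation under the integral with an explicit remainder: the Taylor bound for the
  exponential leaves (\<sigma> x . h)^2 / 2, and the second moment of |f| is finite.\<close>

lemma ft_has_derivative:
  fixes f :: "'a::euclidean_space \<Rightarrow> complex"
  assumes f: "f \<in> schwartz"
  shows "(ft \<sigma> f has_derivative (\<lambda>h. \<Sum>b\<in>Basis. complex_of_real (h \<bullet> b) * ft \<sigma> (\<lambda>x. \<i> * complex_of_real \<sigma> * (complex_of_real (x \<bullet> b) * f x)) p)) (at p)"
    (is "(_ has_derivative ?L) _")
proof (rule has_derivativeI_sandwich[where e = 1])
  show "bounded_linear ?L"
    by (auto intro!: bounded_linear_sum bounded_linear_mult_left bounded_linear_intros bounded_linear_compose[OF bounded_linear_of_real])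
  define M where "M = (LINT x|lborel. (norm x)\<^sup>2 * cmod (f x))"
  have fi: "integrable lborel f" by (rule schwartz_integrable[OF f])
  have bi: "integrable lborel (\<lambda>x. \<i> * complex_of_real \<sigma> * (complex_of_real (x \<bullet> b) * f x))" if "b \<in> Basis" for b
    using schwartz_integrable[OF schwartz_coord_mult[OF f that]] by simp
  have Mi: "integrable lborel (\<lambda>x. (norm x)\<^sup>2 * cmod (f x))"
  proof (rule Bochner_Integration.integrable_bound[OF schwartz_integrable_power[OF f, of 2]])
    show "(\<lambda>x. (norm x)\<^sup>2 * cmod (f x)) \<in> borel_measurable lborel" using schwartz_measurable[OF f] by measurable
    show "AE x in lborel. norm ((norm x)\<^sup>2 * cmod (f x)) \<le> norm ((1 + norm x)\<^sup>2 * cmod (f x))"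
      by (intro AE_I2) (auto simp: abs_mult intro!: mult_right_mono power_mono)
  qed
  show "norm (ft \<sigma> f y - ft \<sigma> f p - ?L (y - p)) / norm (y - p) \<le> \<sigma>\<^sup>2 / 2 * M * norm (y - p)" if "y \<noteq> p" for y
  proof -
    let ?h = "y - p"
    let ?g = "\<lambda>x. (cis (\<sigma> * (x \<bullet> y)) - cis (\<sigma> * (x \<bullet> p)) - \<i> * complex_of_real (\<sigma> * (x \<bullet> ?h)) * cis (\<sigma> * (x \<bullet> p))) * f x"
    have L: "?L ?h = (LINT x|lborel. \<i> * complex_of_real (\<sigma> * (x \<bullet> ?h)) * cis (\<sigma> * (x \<bullet> p)) * f x)"
    proof -
      have "?L ?h = (LINT x|lborel. (\<Sum>b\<in>Basis. complex_of_real (?h \<bullet> b) * (cis (\<sigma> * (x \<bullet> p)) * (\<i> * complex_of_real \<sigma> * (complex_of_real (x \<bullet> b) * f x)))))"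
        unfolding ft_def using ft_integrable[OF bi] by (subst Bochner_Integration.integral_sum) auto
      also have "\<dots> = (LINT x|lborel. \<i> * complex_of_real (\<sigma> * (x \<bullet> ?h)) * cis (\<sigma> * (x \<bullet> p)) * f x)"
        by (subst euclidean_inner[of _ ?h]) (simp add: sum_distrib_left sum_distrib_right mult_ac)
      finally show ?thesis .
    qed
    have Li: "integrable lborel (\<lambda>x. \<i> * complex_of_real (\<sigma> * (x \<bullet> ?h)) * cis (\<sigma> * (x \<bullet> p)) * f x)"
    proof -
      have "integrable lborel (\<lambda>x. \<Sum>b\<in>Basis. complex_of_real (?h \<bullet> b) * (cis (\<sigma> * (x \<bullet> p)) * (\<i> * complex_of_real \<sigma> * (complex_of_real (x \<bullet> b) * f x))))"
        using ft_integrable[OF bi] by (intro Bochner_Integration.integrable_sum) auto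
      also have "(\<lambda>x. \<Sum>b\<in>Basis. complex_of_real (?h \<bullet> b) * (cis (\<sigma> * (x \<bullet> p)) * (\<i> * complex_of_real \<sigma> * (complex_of_real (x \<bullet> b) * f x)))) =
        (\<lambda>x. \<i> * complex_of_real (\<sigma> * (x \<bullet> ?h)) * cis (\<sigma> * (x \<bullet> p)) * f x)"
        by (subst euclidean_inner[of _ ?h]) (simp add: sum_distrib_left sum_distrib_right mult_ac)
      finally show ?thesis .
    qed
    have "ft \<sigma> f y - ft \<sigma> f p - ?L ?h = (LINT x|lborel. ?g x)"
      unfolding L unfolding ft_def
      using ft_integrable[OF fi] Li by (simp add: left_diff_distrib)
    moreover have "cmod (LINT x|lborel. ?g x) \<le> (LINT x|lborel. \<sigma>\<^sup>2 / 2 * (norm ?h)\<^sup>2 * ((norm x)\<^sup>2 * cmod (f x)))"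
    proof (rule bochner_norm_bound)
      show "integrable lborel ?g" using ft_integrable[OF fi] Li by (simp add: left_diff_distrib)
      show "integrable lborel (\<lambda>x. \<sigma>\<^sup>2 / 2 * (norm ?h)\<^sup>2 * ((norm x)\<^sup>2 * cmod (f x)))" using Mi by simp
      fix x :: 'a
      have "cis (\<sigma> * (x \<bullet> y)) = cis (\<sigma> * (x \<bullet> p)) * cis (\<sigma> * (x \<bullet> ?h))"
        by (simp add: cis_mult algebra_simps inner_diff_right)
      then have "?g x = cis (\<sigma> * (x \<bullet> p)) * (cis (\<sigma> * (x \<bullet> ?h)) - 1 - \<i> * complex_of_real (\<sigma> * (x \<bullet> ?h))) * f x"
        by (simp add: algebra_simps)
      then have "cmod (?g x) = cmod (cis (\<sigma> * (x \<bullet> p))) * cmod (cis (\<sigma> * (x \<bullet> ?h)) - 1 - \<i> * complex_of_real (\<sigma> * (x \<bullet> ?h))) * cmod (f x)"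
        by (simp only: norm_mult)
      then have "cmod (?g x) = cmod (cis (\<sigma> * (x \<bullet> ?h)) - 1 - \<i> * complex_of_real (\<sigma> * (x \<bullet> ?h))) * cmod (f x)"
        by (simp only: norm_cis mult_1_left)
      also have "\<dots> \<le> (\<sigma> * (x \<bullet> ?h))\<^sup>2 / 2 * cmod (f x)" by (intro mult_right_mono cis_taylor1) auto
      also have "\<dots> = \<sigma>\<^sup>2 / 2 * cmod (f x) * (x \<bullet> ?h)\<^sup>2" by (simp add: power_mult_distrib)
      also have "\<dots> \<le> \<sigma>\<^sup>2 / 2 * cmod (f x) * ((norm x)\<^sup>2 * (norm ?h)\<^sup>2)"
        using Cauchy_Schwarz_ineq2[of x ?h]
        by (intro mult_left_mono) (auto simp: power_mult_distrib[symmetric] abs_le_square_iff[symmetric])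
      finally show "cmod (?g x) \<le> \<sigma>\<^sup>2 / 2 * (norm ?h)\<^sup>2 * ((norm x)\<^sup>2 * cmod (f x))" by (simp add: mult_ac)
    qed
    ultimately have "norm (ft \<sigma> f y - ft \<sigma> f p - ?L ?h) \<le> \<sigma>\<^sup>2 / 2 * (norm ?h)\<^sup>2 * M"
      by (simp add: M_def)
    then show ?thesis using that by (simp add: field_simps power2_eq_square)
  qed
  show "((\<lambda>y. \<sigma>\<^sup>2 / 2 * M * norm (y - p)) \<longlongrightarrow> 0) (at p)"
    by (auto intro!: tendsto_eq_intros)
qed auto

text \<open>The set of all transforms of Schwartz functions is stable under coordinate derivatives,
  since these correspond to multiplying by a coordinate before transforming; the decay comes from
  \<open>ft_seminorm_bound\<close>.\<close>

lemma ft_schwartz: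
  fixes f :: "'a::euclidean_space \<Rightarrow> complex"
  assumes "f \<in> schwartz" and \<sigma>: "\<bar>\<sigma>\<bar> = 1"
  shows "ft \<sigma> f \<in> schwartz"
proof (rule schwartzI_closed[of "ft \<sigma> ` schwartz"])
  fix g x assume "g \<in> ft \<sigma> ` (schwartz :: ('a \<Rightarrow> complex) set)"
  then show "g differentiable at x" using ft_has_derivative differentiable_def by blast
next
  fix g :: "'a \<Rightarrow> complex" and v :: 'a assume "g \<in> ft \<sigma> ` schwartz" and v: "v \<in> Basis"
  then obtain f where f: "g = ft \<sigma> f" "f \<in> schwartz" by auto
  have "dir_deriv v g = (\<lambda>p. \<Sum>b\<in>Basis. complex_of_real (v \<bullet> b) * ft \<sigma> (\<lambda>x. \<i> * complex_of_real \<sigma> * (complex_of_real (x \<bullet> b) * f x)) p)"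
    unfolding f(1) by (rule dir_deriv_eqI) (rule ft_has_derivative[OF f(2)])
  also have "\<dots> = (\<lambda>p. \<Sum>b\<in>Basis. if b = v then ft \<sigma> (\<lambda>x. \<i> * complex_of_real \<sigma> * (complex_of_real (x \<bullet> v) * f x)) p else 0)"
    using v by (intro ext sum.cong) (auto simp: inner_Basis)
  also have "\<dots> = ft \<sigma> (\<lambda>x. \<i> * complex_of_real \<sigma> * (complex_of_real (x \<bullet> v) * f x))"
    using v by simp
  finally show "dir_deriv v g \<in> ft \<sigma> ` schwartz"
    using schwartz_cmult[OF schwartz_coord_mult[OF f(2) v]] by blast
next
  fix g k assume "g \<in> ft \<sigma> ` (schwartz :: ('a \<Rightarrow> complex) set)"
  then show "\<exists>C. \<forall>x. norm x ^ k * cmod (g x) \<le> C"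
    using ft_seminorm_bound[OF \<sigma>, of k, where 'a='a] by blast
qed (use assms in auto)

section \<open>Gaussians, Fourier inversion and uniqueness\<close>

text \<open>The parameter is an inverse width, so that the transform of
  \<open>gauss \<epsilon>\<close> is a multiple of \<open>gauss (1 / \<epsilon>)\<close>. The mass
  is not normalised, whence the powers of sqrt (2 pi) below.\<close>

definition gauss :: "real \<Rightarrow> 'a::euclidean_space \<Rightarrow> real" where
  "gauss \<epsilon> x = exp (- ((\<epsilon> * norm x)\<^sup>2) / 2)"

lemma gauss_measurable [measurable]: "gauss \<epsilon> \<in> borel_measurable borel"
  unfolding gauss_def[abs_def] by measurable

lemma gauss_pos: "0 < gauss \<epsilon> x" and gauss_nonneg [simp]: "0 \<le> gauss \<epsilon> x" and gauss_le_1: "gauss \<epsilon> x \<le> 1"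
  by (auto simp: gauss_def)

lemma gauss_minus: "gauss \<epsilon> (x - y) = gauss \<epsilon> (y - x)"
  by (simp add: gauss_def norm_minus_commute)

lemma gauss_schwartz:
  fixes y :: "'a::euclidean_space"
  assumes "\<epsilon> \<noteq> 0" shows "(\<lambda>x. complex_of_real (gauss \<epsilon> (x - y))) \<in> schwartz"
  using gaussian_schwartz[of "\<epsilon>\<^sup>2 / 2" y] assms by (simp add: gauss_def power_mult_distrib field_simps)

lemma integrable_gauss:
  assumes "\<epsilon> \<noteq> 0" shows "integrable lborel (gauss \<epsilon> :: 'a::euclidean_space \<Rightarrow> real)"
proof -
  have "integrable lborel (\<lambda>x. complex_of_real (gauss \<epsilon> (x - (0::'a))))"
    by (rule schwartz_integrable[OF gauss_schwartz[OF assms]])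
  then show ?thesis by (simp add: complex_of_real_integrable_eq)
qed

text \<open>This is the characteristic function of the standard normal distribution, freed from the
  normalising constant of the density.\<close>

lemma cis_gauss_integral_std:
  "(LINT x|lborel. cis (t * x) * complex_of_real (exp (- (x\<^sup>2) / 2))) = complex_of_real (sqrt (2 * pi) * exp (- (t\<^sup>2) / 2))"
proof -
  have "complex_of_real (exp (- (t\<^sup>2) / 2)) = char std_normal_distribution t"
    by (simp add: char_std_normal_distribution)
  also have "\<dots> = (LINT x|lborel. std_normal_density x *\<^sub>R cis (t * x))"
    unfolding char_def by (subst integral_density) (auto simp: cis_conv_exp)
  also have "\<dots> = (LINT x|lborel. complex_of_real (1 / sqrt (2 * pi)) * (cis (t * x) * complex_of_real (exp (- (x\<^sup>2) / 2))))"
    by (simp add: std_normal_density_def scaleR_conv_of_real mult_ac)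
  also have "\<dots> = complex_of_real (1 / sqrt (2 * pi)) * (LINT x|lborel. cis (t * x) * complex_of_real (exp (- (x\<^sup>2) / 2)))"
    by (rule integral_mult_right_zero)
  finally show ?thesis by (simp add: field_simps)
qed

lemma cis_gauss_integral_real:
  assumes "\<epsilon> > 0"
  shows "(LINT x|lborel. cis (t * x) * complex_of_real (exp (- ((\<epsilon> * x)\<^sup>2) / 2)))
    = complex_of_real (sqrt (2 * pi) / \<epsilon> * exp (- ((t / \<epsilon>)\<^sup>2) / 2))"
proof -
  have "complex_of_real (sqrt (2 * pi) * exp (- ((t / \<epsilon>)\<^sup>2) / 2)) = 
    (LINT x|lborel. cis (t / \<epsilon> * x) * complex_of_real (exp (- (x\<^sup>2) / 2)))"
    by (rule cis_gauss_integral_std[symmetric])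
  also have "\<dots> = \<bar>\<epsilon>\<bar> *\<^sub>R (LINT x|lborel. cis (t / \<epsilon> * (0 + \<epsilon> * x)) * complex_of_real (exp (- ((0 + \<epsilon> * x)\<^sup>2) / 2)))"
    using assms by (intro lborel_integral_real_affine) auto
  also have "\<dots> = complex_of_real \<epsilon> * (LINT x|lborel. cis (t * x) * complex_of_real (exp (- ((\<epsilon> * x)\<^sup>2) / 2)))"
    using assms by (simp add: scaleR_conv_of_real)
  finally show ?thesis using assms by (simp add: field_simps)
qed

lemma lborel_integral_prod:
  fixes F :: "'a::euclidean_space \<Rightarrow> real \<Rightarrow> complex"
  assumes "\<And>b. b \<in> Basis \<Longrightarrow> integrable lborel (F b)"
  shows "(LINT x|lborel. (\<Prod>b\<in>Basis. F b (x \<bullet> b))) = (\<Prod>b\<in>Basis. LINT t|lborel. F b t)"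
proof -
  interpret product_sigma_finite "\<lambda>b::'a. lborel :: real measure" ..
  have [measurable]: "F b \<in> borel_measurable borel" if "b \<in> Basis" for b
    using borel_measurable_integrable[OF assms[OF that]] by simp
  have "(LINT x|lborel. (\<Prod>b\<in>Basis. F b (x \<bullet> b))) = (LINT x|distr (\<Pi>\<^sub>M b\<in>Basis. lborel) borel (\<lambda>f. \<Sum>b\<in>Basis. f b *\<^sub>R b). (\<Prod>b\<in>Basis. F b ((x::'a) \<bullet> b)))"
    by (subst lborel_eq) simp
  also have "\<dots> = (LINT f|(\<Pi>\<^sub>M b\<in>(Basis::'a set). lborel). (\<Prod>b\<in>Basis. F b (f b)))"
    by (subst integral_distr) (auto intro!: borel_measurable_prod)
  also have "\<dots> = (\<Prod>b\<in>Basis. LINT t|lborel. F b t)"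
    by (rule product_integral_prod) (use assms in auto)
  finally show ?thesis .
qed

lemma cis_sum: "finite A \<Longrightarrow> cis (\<Sum>i\<in>A. f i) = (\<Prod>i\<in>A. cis (f i))"
  by (induction A rule: finite_induct) (auto simp: cis_mult[symmetric])

lemma norm_sq_Basis: "(norm (x::'a::euclidean_space))\<^sup>2 = (\<Sum>b\<in>Basis. (x \<bullet> b)\<^sup>2)"
  unfolding power2_norm_eq_inner by (subst euclidean_inner) (simp add: power2_eq_square)

lemma gauss_prod: "gauss \<epsilon> (x::'a::euclidean_space) = (\<Prod>b\<in>Basis. exp (- ((\<epsilon> * (x \<bullet> b))\<^sup>2) / 2))"
  by (simp add: gauss_def power_mult_distrib norm_sq_Basis exp_sum[symmetric] sum_distrib_left sum_negf sum_divide_distrib)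

lemma gauss_transform:
  fixes p :: "'a::euclidean_space"
  assumes "\<epsilon> > 0"
  shows "(LINT x|lborel. cis (x \<bullet> p) * complex_of_real (gauss \<epsilon> x)) = complex_of_real ((sqrt (2 * pi) / \<epsilon>) ^ DIM('a) * gauss (1 / \<epsilon>) p)"
proof -
  let ?F = "\<lambda>b t. cis ((p \<bullet> b) * t) * complex_of_real (exp (- ((\<epsilon> * t)\<^sup>2) / 2))"
  have i: "integrable lborel (?F b)" for b
  proof (rule integrable_cis_mult)
    have "integrable lborel (\<lambda>x. gauss \<epsilon> (x::real))" using assms by (intro integrable_gauss) auto
    then have "integrable lborel (\<lambda>t. exp (- ((\<epsilon> * t)\<^sup>2) / 2))" by (simp add: gauss_def power_mult_distrib)
    then show "complex_integrable lborel (\<lambda>t. complex_of_real (exp (- ((\<epsilon> * t)\<^sup>2) / 2)))"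
      by (rule integrable_of_real)
  qed simp
  have "(LINT x|lborel. cis (x \<bullet> p) * complex_of_real (gauss \<epsilon> x)) = (LINT x|lborel. (\<Prod>b\<in>Basis. ?F b (x \<bullet> b)))"
  proof (rule Bochner_Integration.integral_cong[OF refl])
    fix x :: 'a
    have "cis (x \<bullet> p) = (\<Prod>b\<in>Basis. cis ((p \<bullet> b) * (x \<bullet> b)))"
      by (subst euclidean_inner) (simp add: cis_sum mult.commute)
    then show "cis (x \<bullet> p) * complex_of_real (gauss \<epsilon> x) = (\<Prod>b\<in>Basis. ?F b (x \<bullet> b))"
      by (simp add: gauss_prod prod.distrib)
  qed
  also have "\<dots> = (\<Prod>b\<in>Basis. LINT t|lborel. ?F b t)" by (rule lborel_integral_prod) (rule i)
  also have "\<dots> = (\<Prod>b\<in>(Basis::'a set). complex_of_real (sqrt (2 * pi) / \<epsilon>) * complex_of_real (exp (- ((1 / \<epsilon> * (p \<bullet> b))\<^sup>2) / 2)))"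
    unfolding cis_gauss_integral_real[OF assms] by simp
  also have "\<dots> = complex_of_real ((sqrt (2 * pi) / \<epsilon>) ^ DIM('a) * gauss (1 / \<epsilon>) p)"
    unfolding prod.distrib gauss_prod by simp
  finally show ?thesis .
qed

lemma gauss_integral: "(LINT x|lborel. gauss 1 (x::'a::euclidean_space)) = sqrt (2 * pi) ^ DIM('a)"
proof -
  have "complex_of_real (LINT x|lborel. gauss 1 (x::'a)) = complex_of_real (sqrt (2 * pi) ^ DIM('a))"
    using gauss_transform[of 1 "0::'a"] by (simp add: gauss_def[of 1 "0::'a"])
  then show ?thesis by (simp only: of_real_eq_iff)
qed

lemma integrable_prod_mult:
  fixes g :: "'a::euclidean_space \<Rightarrow> complex" and h :: "'b::euclidean_space \<Rightarrow> complex"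
  assumes "integrable lborel g" "integrable lborel h"
  shows "integrable (lborel \<Otimes>\<^sub>M lborel) (\<lambda>(x, y). g x * h y)"
proof -
  note [measurable] = borel_measurable_integrable[OF assms(1)] borel_measurable_integrable[OF assms(2)]
  show ?thesis
    by (rule lborel_pair.Fubini_integrable) (use assms in \<open>auto simp: norm_mult\<close>)
qed

lemma lborel_integral_affine:
  fixes F :: "'a::euclidean_space \<Rightarrow> complex"
  assumes [measurable]: "F \<in> borel_measurable borel" and "\<epsilon> > 0"
  shows "(LINT y|lborel. F y) = complex_of_real (\<epsilon> ^ DIM('a)) * (LINT z|lborel. F (x + \<epsilon> *\<^sub>R z))"
proof -
  have "(LINT y|lborel. F y) = (LINT y|density (distr lborel borel (\<lambda>z. x + \<epsilon> *\<^sub>R z)) (\<lambda>_. ennreal (\<epsilon> ^ DIM('a))). F y)"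
    using lborel_affine[of \<epsilon> x] assms by simp
  also have "\<dots> = (LINT z|lborel. (\<epsilon> ^ DIM('a)) *\<^sub>R F (x + \<epsilon> *\<^sub>R z))"
    using assms by (subst integral_density) (auto simp: integral_distr)
  also have "\<dots> = (\<epsilon> ^ DIM('a)) *\<^sub>R (LINT z|lborel. F (x + \<epsilon> *\<^sub>R z))" by (rule integral_scaleR_right)
  finally show ?thesis by (simp add: scaleR_conv_of_real)
qed

lemma gauss_smoothing_eq:
  fixes F :: "'a::euclidean_space \<Rightarrow> complex"
  assumes [measurable]: "F \<in> borel_measurable borel" and e: "\<epsilon> > 0"
  shows "(LINT y|lborel. F y * complex_of_real (gauss (1 / \<epsilon>) (x - y))) =
     complex_of_real (\<epsilon> ^ DIM('a)) * (LINT z|lborel. F (x + \<epsilon> *\<^sub>R z) * complex_of_real (gauss 1 z))"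
  using lborel_integral_affine[of "\<lambda>y. F y * complex_of_real (gauss (1 / \<epsilon>) (x - y))" \<epsilon> x] e
  by (simp add: gauss_def)

text \<open>An approximate identity after rescaling: the kernel is kept fixed and the evaluation
  points shrink to \<open>x\<close>, so a constant multiple of one Gaussian dominates. The total
  mass of the kernel remains as a factor.\<close>

lemma gauss_smoothing_tendsto:
  fixes F :: "'a::euclidean_space \<Rightarrow> complex"
  assumes F: "continuous_on UNIV F" "\<And>x. cmod (F x) \<le> B"
  shows "(\<lambda>k. LINT z|lborel. F (x + (1 / real (Suc k)) *\<^sub>R z) * complex_of_real (gauss 1 z)) \<longlonglongrightarrow>
    F x * complex_of_real (sqrt (2 * pi) ^ DIM('a))"
proof -
  have [measurable]: "F \<in> borel_measurable borel" by (rule borel_measurable_continuous_onI[OF F(1)])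
  have "(\<lambda>k. LINT z|lborel. F (x + (1 / real (Suc k)) *\<^sub>R z) * complex_of_real (gauss 1 z)) \<longlonglongrightarrow>
    (LINT z|lborel. F x * complex_of_real (gauss 1 (z::'a)))"
  proof (rule integral_dominated_convergence)
    show "integrable lborel (\<lambda>z::'a. B * gauss 1 z)" by (intro integrable_mult_right integrable_gauss) simp
    show "AE z in lborel. (\<lambda>k. F (x + (1 / real (Suc k)) *\<^sub>R z) * complex_of_real (gauss 1 z)) \<longlonglongrightarrow> F x * complex_of_real (gauss 1 z)"
    proof (intro AE_I2 tendsto_mult tendsto_const)
      fix z :: 'a
      have "(\<lambda>k. x + (1 / real (Suc k)) *\<^sub>R z) \<longlonglongrightarrow> x + 0 *\<^sub>R z"
        using LIMSEQ_inverse_real_of_nat by (intro tendsto_intros) (simp add: inverse_eq_divide)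
      then show "(\<lambda>k. F (x + (1 / real (Suc k)) *\<^sub>R z)) \<longlonglongrightarrow> F x"
        using F(1) by (intro isCont_tendsto_compose[of _ F]) (auto simp: continuous_on_eq_continuous_at)
    qed
    show "AE z in lborel. cmod (F (x + (1 / real (Suc k)) *\<^sub>R z) * complex_of_real (gauss 1 z)) \<le> B * gauss 1 z" for k
      using F(2) by (auto simp: norm_mult intro!: mult_right_mono)
  qed measurable
  also have "(LINT z|lborel. F x * complex_of_real (gauss 1 (z::'a))) = F x * complex_of_real (sqrt (2 * pi) ^ DIM('a))"
    by (simp add: gauss_integral)
  finally show ?thesis .
qed

text \<open>The double integral does not converge absolutely, so a Gaussian of growing width is
  inserted. After Fubini the integral over frequencies is a Gaussian around \<open>x\<close>, and
  the result is a smoothing of \<open>f\<close>. As \<open>k\<close> grows, the left side converges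
  by integrability of the transform, the right side by continuity of \<open>f\<close>.\<close>

theorem ft_inversion:
  fixes f :: "'a::euclidean_space \<Rightarrow> complex"
  assumes \<sigma>: "\<bar>\<sigma>\<bar> = 1" and f: "integrable lborel f" "continuous_on UNIV f" "\<And>x. cmod (f x) \<le> B"
    and Ff: "integrable lborel (ft (- \<sigma>) f)"
  shows "ft \<sigma> (ft (- \<sigma>) f) x = complex_of_real ((2 * pi) ^ DIM('a)) * f x"
proof -
  let ?G = "\<lambda>k p. complex_of_real (gauss (1 / real (Suc k)) p)"
  let ?I = "\<lambda>k. LINT p|lborel. ?G k p * (cis (\<sigma> * (p \<bullet> x)) * ft (- \<sigma>) f p)"
  note [measurable] = borel_measurable_integrable[OF f(1)] borel_measurable_integrable[OF Ff]
  have "?I \<longlonglongrightarrow> (LINT p|lborel. cis (\<sigma> * (p \<bullet> x)) * ft (- \<sigma>) f p)"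
  proof (rule integral_dominated_convergence)
    show "integrable lborel (\<lambda>p. cmod (ft (- \<sigma>) f p))" using Ff by simp
    show "AE p in lborel. (\<lambda>k. ?G k p * (cis (\<sigma> * (p \<bullet> x)) * ft (- \<sigma>) f p)) \<longlonglongrightarrow> cis (\<sigma> * (p \<bullet> x)) * ft (- \<sigma>) f p"
    proof (intro AE_I2)
      fix p :: 'a
      have "(\<lambda>k. 1 / real (Suc k)) \<longlonglongrightarrow> 0" using LIMSEQ_inverse_real_of_nat by (simp add: inverse_eq_divide)
      then have "(\<lambda>k. ?G k p) \<longlonglongrightarrow> complex_of_real (exp (- ((0 * norm p)\<^sup>2) / 2))"
        unfolding gauss_def by (intro tendsto_intros) auto
      then have "(\<lambda>k. ?G k p) \<longlonglongrightarrow> 1" by simp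
      from tendsto_mult[OF this tendsto_const] 
      show "(\<lambda>k. ?G k p * (cis (\<sigma> * (p \<bullet> x)) * ft (- \<sigma>) f p)) \<longlonglongrightarrow> cis (\<sigma> * (p \<bullet> x)) * ft (- \<sigma>) f p"
        by simp
    qed
    show "AE p in lborel. cmod (?G k p * (cis (\<sigma> * (p \<bullet> x)) * ft (- \<sigma>) f p)) \<le> cmod (ft (- \<sigma>) f p)" for k
      by (intro AE_I2) (auto simp: norm_mult intro!: mult_left_le_one_le gauss_le_1)
  qed measurable
  moreover have "?I k = complex_of_real (sqrt (2 * pi) ^ DIM('a)) * (LINT z|lborel. f (x + (1 / real (Suc k)) *\<^sub>R z) * complex_of_real (gauss 1 z))" for k
  proof -
    let ?e = "1 / real (Suc k)"
    have e: "?e > 0" by simp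
    let ?\<Phi> = "\<lambda>p y. cis (\<sigma> * (p \<bullet> x) - \<sigma> * (y \<bullet> p)) * (?G k p * f y)"
    have int: "integrable (lborel \<Otimes>\<^sub>M lborel) (\<lambda>(p, y). ?\<Phi> p y)"
    proof -
      have "integrable (lborel \<Otimes>\<^sub>M lborel) (\<lambda>(p, y). ?G k p * f y)"
        using e by (intro integrable_prod_mult f(1) integrable_of_real integrable_gauss) auto
      from integrable_cis_mult[OF this, of "\<lambda>(p, y). \<sigma> * (p \<bullet> x) - \<sigma> * (y \<bullet> p)"]
      show ?thesis by (simp add: case_prod_beta')
    qed
    have "?I k = (LINT p|lborel. LINT y|lborel. ?\<Phi> p y)"
    proof (rule Bochner_Integration.integral_cong[OF refl])
      fix p :: 'a
      have E: "cis (\<sigma> * (p \<bullet> x) - \<sigma> * (y \<bullet> p)) = cis (\<sigma> * (p \<bullet> x)) * cis (- \<sigma> * (y \<bullet> p))" for y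
        by (simp add: cis_mult)
      have "?G k p * (cis (\<sigma> * (p \<bullet> x)) * ft (- \<sigma>) f p) = (LINT y|lborel. ?G k p * cis (\<sigma> * (p \<bullet> x)) * (cis (- \<sigma> * (y \<bullet> p)) * f y))"
        unfolding ft_def by simp
      also have "\<dots> = (LINT y|lborel. ?\<Phi> p y)"
        by (intro Bochner_Integration.integral_cong refl) (simp only: E mult_ac)
      finally show "?G k p * (cis (\<sigma> * (p \<bullet> x)) * ft (- \<sigma>) f p) = (LINT y|lborel. ?\<Phi> p y)" .
    qed
    also have "\<dots> = (LINT y|lborel. LINT p|lborel. ?\<Phi> p y)"
      by (rule lborel_pair.Fubini_integral[symmetric, OF int])
    also have "\<dots> = (LINT y|lborel. complex_of_real ((sqrt (2 * pi) / ?e) ^ DIM('a)) * (f y * complex_of_real (gauss (1 / ?e) (x - y))))"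
    proof (rule Bochner_Integration.integral_cong[OF refl])
      fix y :: 'a
      have "(LINT p|lborel. ?\<Phi> p y) = (LINT p|lborel. f y * (cis (p \<bullet> (\<sigma> *\<^sub>R (x - y))) * ?G k p))"
        by (intro Bochner_Integration.integral_cong refl)
          (simp add: inner_diff_right right_diff_distrib inner_commute mult_ac)
      also have "\<dots> = f y * (LINT p|lborel. cis (p \<bullet> (\<sigma> *\<^sub>R (x - y))) * ?G k p)"
        by (rule integral_mult_right_zero)
      also have "\<dots> = f y * complex_of_real ((sqrt (2 * pi) / ?e) ^ DIM('a) * gauss (1 / ?e) (\<sigma> *\<^sub>R (x - y)))"
        unfolding gauss_transform[OF e] ..
      also have "gauss (1 / ?e) (\<sigma> *\<^sub>R (x - y)) = gauss (1 / ?e) (x - y)"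
        using \<sigma> by (simp add: gauss_def)
      finally show "(LINT p|lborel. ?\<Phi> p y) = complex_of_real ((sqrt (2 * pi) / ?e) ^ DIM('a)) * (f y * complex_of_real (gauss (1 / ?e) (x - y)))"
        by (simp add: mult_ac)
    qed
    also have "\<dots> = complex_of_real ((sqrt (2 * pi) / ?e) ^ DIM('a)) * (LINT y|lborel. f y * complex_of_real (gauss (1 / ?e) (x - y)))"
      by (rule integral_mult_right_zero)
    also have "\<dots> = complex_of_real ((sqrt (2 * pi) / ?e) ^ DIM('a)) * (complex_of_real (?e ^ DIM('a)) * (LINT z|lborel. f (x + ?e *\<^sub>R z) * complex_of_real (gauss 1 z)))"
      by (subst gauss_smoothing_eq[OF _ e]) auto
    \<comment> \<open>The power of the width in the transform of the Gaussian cancels the Jacobian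
      of the rescaling.\<close>
    also have "\<dots> = complex_of_real (sqrt (2 * pi) ^ DIM('a)) * (LINT z|lborel. f (x + ?e *\<^sub>R z) * complex_of_real (gauss 1 z))"
    proof -
      have "(sqrt (2 * pi) / ?e) ^ DIM('a) * ?e ^ DIM('a) = sqrt (2 * pi) ^ DIM('a)"
        by (simp add: power_mult_distrib[symmetric])
      then show ?thesis by (simp only: mult.assoc[symmetric] of_real_mult[symmetric])
    qed
    finally show ?thesis .
  qed
  moreover have "(\<lambda>k. complex_of_real (sqrt (2 * pi) ^ DIM('a)) * (LINT z|lborel. f (x + (1 / real (Suc k)) *\<^sub>R z) * complex_of_real (gauss 1 z)))
     \<longlonglongrightarrow> complex_of_real (sqrt (2 * pi) ^ DIM('a)) * (f x * complex_of_real (sqrt (2 * pi) ^ DIM('a)))"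
    by (intro tendsto_mult tendsto_const gauss_smoothing_tendsto[OF f(2,3)])
  ultimately have "(LINT p|lborel. cis (\<sigma> * (p \<bullet> x)) * ft (- \<sigma>) f p) = complex_of_real (sqrt (2 * pi) ^ DIM('a)) * (f x * complex_of_real (sqrt (2 * pi) ^ DIM('a)))"
    by (simp add: LIMSEQ_unique)
  also have "\<dots> = complex_of_real (sqrt (2 * pi) ^ DIM('a) * sqrt (2 * pi) ^ DIM('a)) * f x"
    by (simp only: of_real_mult mult_ac)
  also have "sqrt (2 * pi) ^ DIM('a) * sqrt (2 * pi) ^ DIM('a) = (2 * pi) ^ DIM('a)"
    unfolding power_mult_distrib[symmetric] by simp
  finally show ?thesis unfolding ft_def[of \<sigma> "ft (- \<sigma>) f"] .
qed

corollary schwartz_ft_inversion: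
  fixes f :: "'a::euclidean_space \<Rightarrow> complex"
  assumes "\<bar>\<sigma>\<bar> = 1" "f \<in> schwartz"
  shows "ft \<sigma> (ft (- \<sigma>) f) = (\<lambda>x. complex_of_real ((2 * pi) ^ DIM('a)) * f x)"
proof
  fix x
  obtain B where "\<And>x. cmod (f x) \<le> B" using schwartz_decay_ex[OF assms(2), of 0] by auto
  then show "ft \<sigma> (ft (- \<sigma>) f) x = complex_of_real ((2 * pi) ^ DIM('a)) * f x"
    using assms by (intro ft_inversion schwartz_integrable schwartz_continuous ft_schwartz) auto
qed

lemma fourier_schwartz: "f \<in> schwartz \<Longrightarrow> fourier f \<in> schwartz"
  unfolding fourier_eq_ft by (rule ft_schwartz) auto

lemma inverse_fourier_schwartz: "f \<in> schwartz \<Longrightarrow> inverse_fourier f \<in> schwartz"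
  unfolding inverse_fourier_eq_ft by (intro schwartz_cmult ft_schwartz) auto

lemma inverse_fourier_fourier: "f \<in> schwartz \<Longrightarrow> inverse_fourier (fourier f) = f"
  unfolding inverse_fourier_eq_ft fourier_eq_ft using schwartz_ft_inversion[of 1 f] by (simp add: fun_eq_iff)

lemma fourier_inverse_fourier:
  fixes f :: "'a::euclidean_space \<Rightarrow> complex"
  assumes "f \<in> schwartz" shows "fourier (inverse_fourier f) = f"
proof
  fix x
  have "fourier (inverse_fourier f) x = complex_of_real (1 / (2 * pi) ^ DIM('a)) * ft (-1) (ft 1 f) x"
    unfolding inverse_fourier_eq_ft fourier_eq_ft by (rule ft_cmult)
  then show "fourier (inverse_fourier f) x = f x"
    using schwartz_ft_inversion[of "-1" f] assms by simp
qed

section \<open>Functions with vanishing integrals against Gaussians or Schwartz functions\<close>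

text \<open>The pairing is tested on the smoothings of \<kappa>: Fubini moves the Gaussian onto
  \<open>D\<close>, where the integral vanishes by assumption, and the smoothings converge boundedly
  to a multiple of \<kappa>.\<close>

lemma gauss_null_bounded_continuous:
  fixes D \<kappa> :: "'a::euclidean_space \<Rightarrow> complex"
  assumes D: "integrable lborel D" and D0: "\<And>m y. 0 < m \<Longrightarrow> (LINT p|lborel. D p * complex_of_real (gauss m (y - p))) = 0"
    and \<kappa>: "continuous_on UNIV \<kappa>" "\<And>x. cmod (\<kappa> x) \<le> B" "integrable lborel \<kappa>"
  shows "(LINT p|lborel. D p * \<kappa> p) = 0"
proof -
  let ?e = "\<lambda>k. 1 / real (Suc k)"
  let ?S = "\<lambda>k p. LINT z|lborel. \<kappa> (p + ?e k *\<^sub>R z) * complex_of_real (gauss 1 (z::'a))"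
  note [measurable] = borel_measurable_integrable[OF D] borel_measurable_integrable[OF \<kappa>(3)]
  have m\<kappa>[measurable]: "\<kappa> \<in> borel_measurable borel" using borel_measurable_integrable[OF \<kappa>(3)] by simp
  have z: "(LINT p|lborel. D p * ?S k p) = 0" for k
  proof -
    have e: "?e k > 0" by simp
    let ?c = "complex_of_real (?e k ^ DIM('a))"
    have int: "integrable (lborel \<Otimes>\<^sub>M lborel) (\<lambda>(p, y). complex_of_real (gauss (1 / ?e k) (y - p)) * (D p * \<kappa> y))"
    proof (rule Bochner_Integration.integrable_bound[OF integrable_prod_mult[OF D \<kappa>(3)]])
      show "AE x in lborel \<Otimes>\<^sub>M lborel. cmod (case x of (p, y) \<Rightarrow> complex_of_real (gauss (1 / ?e k) (y - p)) * (D p * \<kappa> y))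
         \<le> cmod (case x of (p, y) \<Rightarrow> D p * \<kappa> y)"
        by (intro AE_I2) (auto simp: norm_mult intro!: mult_left_le_one_le gauss_le_1)
    qed measurable
    have "?c * (LINT p|lborel. D p * ?S k p) = (LINT p|lborel. D p * (?c * ?S k p))"
      by (subst integral_mult_right_zero[symmetric]) (simp add: mult_ac)
    also have "\<dots> = (LINT p|lborel. D p * (LINT y|lborel. \<kappa> y * complex_of_real (gauss (1 / ?e k) (p - y))))"
      by (simp only: gauss_smoothing_eq[OF m\<kappa> e])
    also have "\<dots> = (LINT p|lborel. LINT y|lborel. complex_of_real (gauss (1 / ?e k) (y - p)) * (D p * \<kappa> y))"
      by (subst integral_mult_right_zero[symmetric]) (simp add: mult_ac gauss_minus)
    also have "\<dots> = (LINT y|lborel. LINT p|lborel. complex_of_real (gauss (1 / ?e k) (y - p)) * (D p * \<kappa> y))"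
      by (rule lborel_pair.Fubini_integral[symmetric, OF int])
    also have "\<dots> = (LINT y|lborel. \<kappa> y * (LINT p|lborel. D p * complex_of_real (gauss (1 / ?e k) (y - p))))"
      by (subst integral_mult_right_zero[symmetric]) (simp add: mult_ac)
    also have "\<dots> = 0" using e by (simp add: D0)
    finally have "?c * (LINT p|lborel. D p * ?S k p) = 0" .
    moreover have "?c \<noteq> 0" by (simp del: of_nat_Suc)
    ultimately show ?thesis by (simp only: mult_eq_0_iff simp_thms)
  qed
  have "(\<lambda>k. LINT p|lborel. D p * ?S k p) \<longlonglongrightarrow> (LINT p|lborel. D p * (\<kappa> p * complex_of_real (sqrt (2 * pi) ^ DIM('a))))"
  proof (rule integral_dominated_convergence)
    show "integrable lborel (\<lambda>p. cmod (D p) * (B * (LINT z|lborel. gauss 1 (z::'a))))" using D by simp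
    show "AE p in lborel. (\<lambda>k. D p * ?S k p) \<longlonglongrightarrow> D p * (\<kappa> p * complex_of_real (sqrt (2 * pi) ^ DIM('a)))"
      by (intro AE_I2 tendsto_mult tendsto_const gauss_smoothing_tendsto[OF \<kappa>(1,2)])
    have "cmod (?S k p) \<le> B * (LINT z|lborel. gauss 1 (z::'a))" for k p
    proof -
      have i: "integrable lborel (\<lambda>z::'a. B * gauss 1 z)" by (intro integrable_mult_right integrable_gauss) simp
      have "cmod (?S k p) \<le> (LINT z|lborel. B * gauss 1 (z::'a))"
      proof (rule bochner_norm_bound[OF _ i])
        fix z :: 'a
        show b: "cmod (\<kappa> (p + ?e k *\<^sub>R z) * complex_of_real (gauss 1 z)) \<le> B * gauss 1 z"
          using \<kappa>(2) by (auto simp: norm_mult intro!: mult_right_mono)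
      next
        show "integrable lborel (\<lambda>z. \<kappa> (p + ?e k *\<^sub>R z) * complex_of_real (gauss 1 z))"
          by (rule Bochner_Integration.integrable_bound[OF i])
            (use \<kappa>(2) in \<open>auto simp: norm_mult abs_mult intro!: AE_I2 mult_right_mono order_trans[OF _ abs_ge_self]\<close>)
      qed
      then show ?thesis by simp
    qed
    then show "AE p in lborel. cmod (D p * ?S k p) \<le> cmod (D p) * (B * (LINT z|lborel. gauss 1 (z::'a)))" for k
      by (intro AE_I2) (auto simp only: norm_mult intro!: mult_left_mono norm_ge_zero)
  qed measurable
  then have "(LINT p|lborel. D p * (\<kappa> p * complex_of_real (sqrt (2 * pi) ^ DIM('a)))) = 0"
    unfolding z using LIMSEQ_unique tendsto_const by blast
  then show ?thesis by (simp add: mult.assoc[symmetric] del: of_real_power)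
qed

text \<open>Indicators of open boxes are limits from below of bounded continuous functions, so
  \<open>D\<close> has integral 0 over every box, and Lebesgue's differentiation theorem
  concludes.\<close>

lemma gauss_null_AE:
  fixes D :: "'a::euclidean_space \<Rightarrow> complex"
  assumes D: "integrable lborel D" and D0: "\<And>m y. 0 < m \<Longrightarrow> (LINT p|lborel. D p * complex_of_real (gauss m (y - p))) = 0"
  shows "AE p in lborel. D p = 0"
proof -
  note [measurable] = borel_measurable_integrable[OF D]
  have bx: "(LINT p|lborel. indicator (box a b) p *\<^sub>R D p) = 0" for a b :: 'a
  proof -
    \<comment> \<open>Continuous functions that vanish off the box and rise to 1 at rate
      \<open>k\<close> with the distance from its complement.\<close>
    let ?\<kappa> = "\<lambda>k y. complex_of_real (min 1 (real k * infdist y (- box a b)))"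
    have ne: "- box a b \<noteq> {}" using bounded_box[of a b] by (metis Compl_empty_eq boolean_algebra_class.boolean_algebra.double_compl not_bounded_UNIV)
    have bd: "cmod (?\<kappa> k y) \<le> indicator (box a b) y" for k y
    proof (cases "y \<in> box a b")
      case False
      then have "infdist y (- box a b) = 0" by simp
      then show ?thesis by simp
    qed (simp add: infdist_nonneg)
    have cont: "continuous_on UNIV (?\<kappa> k)" for k by (intro continuous_intros)
    have ik: "integrable lborel (?\<kappa> k)" for k
    proof (rule Bochner_Integration.integrable_bound)
      show "integrable lborel (indicator (box a b) :: 'a \<Rightarrow> real)" by (rule integrable_real_indicator) (use emeasure_lborel_box_finite[of a b] in auto)
      show "AE y in lborel. norm (?\<kappa> k y) \<le> norm (indicator (box a b) y :: real)" using bd by (intro AE_I2) simp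
      show "?\<kappa> k \<in> borel_measurable lborel" using borel_measurable_continuous_onI[OF cont] by simp
    qed
    have "(\<lambda>k. LINT p|lborel. D p * ?\<kappa> k p) \<longlonglongrightarrow> (LINT p|lborel. D p * complex_of_real (indicator (box a b) p))"
    proof (rule integral_dominated_convergence)
      show "integrable lborel (\<lambda>p. cmod (D p))" using D by simp
      show "AE p in lborel. (\<lambda>k. D p * ?\<kappa> k p) \<longlonglongrightarrow> D p * complex_of_real (indicator (box a b) p)"
      proof (intro AE_I2 tendsto_mult tendsto_const tendsto_of_real)
        fix p
        show "(\<lambda>k. min 1 (real k * infdist p (- box a b))) \<longlonglongrightarrow> indicator (box a b) p"
        proof (cases "p \<in> box a b")
          case True
          have "closed (- box a b)" by (simp add: open_box closed_Compl)
          then have pos: "0 < infdist p (- box a b)"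
            using True ne in_closed_iff_infdist_zero[of "- box a b" p] infdist_nonneg[of p "- box a b"] by force
          obtain N where N: "1 / infdist p (- box a b) < real N" using reals_Archimedean2 by blast
          have "min 1 (real k * infdist p (- box a b)) = 1" if "k \<ge> N" for k
          proof -
            have "1 / infdist p (- box a b) \<le> real k" using N that by linarith
            then show ?thesis using pos by (simp add: divide_le_eq)
          qed
          then have "eventually (\<lambda>k. min 1 (real k * infdist p (- box a b)) = 1) sequentially"
            by (auto simp: eventually_sequentially)
          then show ?thesis using True by (simp add: tendsto_eventually)
        qed simp
      qed
      show "AE p in lborel. cmod (D p * ?\<kappa> k p) \<le> cmod (D p)" for k
        by (intro AE_I2) (auto simp: norm_mult infdist_nonneg intro!: mult_right_le_one_le)
      show "(\<lambda>p. D p * ?\<kappa> k p) \<in> borel_measurable lborel" for k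
        using borel_measurable_continuous_onI[OF cont] by measurable
    qed measurable
    moreover have "(LINT p|lborel. D p * ?\<kappa> k p) = 0" for k
    proof (rule gauss_null_bounded_continuous[OF D D0 cont _ ik])
      show "cmod (?\<kappa> k x) \<le> 1" for x using order_trans[OF bd[of k x], of 1] by (simp add: indicator_def)
    qed auto
    ultimately have "(LINT p|lborel. D p * complex_of_real (indicator (box a b) p)) = 0"
      by (simp add: LIMSEQ_const_iff)
    then show ?thesis by (simp add: scaleR_conv_of_real mult.commute)
  qed
  have on: "D integrable_on cbox a b" for a b
    using integrable_on_lborel[OF D] integrable_on_subcbox by blast
  have z: "integral (cbox a b) D = 0" for a b
  proof -
    have "set_integrable lborel (box a b) D"
      unfolding set_integrable_def using integrable_mult_indicator[OF _ D] by simp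
    then have "integral (box a b) D = (LINT p:box a b|lborel. D p)"
      by (simp add: set_borel_integral_eq_integral(2))
    then show ?thesis using bx[of a b] by (simp add: set_lebesgue_integral_def integral_open_interval)
  qed
  \<comment> \<open>Outside \<open>N\<close>, mean values over shrinking cubes converge to the value
    at the corner; all these mean values are 0.\<close>
  obtain N where N: "negligible N" "\<And>x e. \<lbrakk>x \<notin> N; 0 < e\<rbrakk> \<Longrightarrow>
               \<exists>d>0. \<forall>h. 0 < h \<and> h < d \<longrightarrow> norm (integral (cbox x (x + h *\<^sub>R One)) D /\<^sub>R h ^ DIM('a) - D x) < e"
    using integrable_ccontinuous_explicit[of D, OF on] by blast
  have "D x = 0" if "x \<notin> N" for x
  proof (rule ccontr)
    note xN = that
    assume "D x \<noteq> 0"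
    then obtain d where "d > 0" "\<forall>h. 0 < h \<and> h < d \<longrightarrow> norm (integral (cbox x (x + h *\<^sub>R One)) D /\<^sub>R h ^ DIM('a) - D x) < norm (D x)"
      using N(2)[OF xN, of "norm (D x)"] by auto
    then have "norm (D x) < norm (D x)" unfolding z by (auto dest!: spec[of _ "d / 2"])
    then show False by simp
  qed
  then have "AE x in lebesgue. D x = 0"
    using N(1) unfolding negligible_iff_null_sets by (intro AE_I'[of N]) auto
  then show ?thesis by (simp add: AE_completion_iff)
qed

text \<open>Integrability is available for \<open>D\<close> times a Gaussian. The product of two
  Gaussians is a multiple of a third, so \<open>D\<close> times a Gaussian again annihilates all
  Gaussians and \<open>gauss_null_AE\<close> applies.\<close>

theorem schwartz_annihilator_AE:
  fixes D :: "'a::euclidean_space \<Rightarrow> complex"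
  assumes [measurable]: "D \<in> borel_measurable borel"
    and int: "\<And>\<psi>. \<psi> \<in> schwartz \<Longrightarrow> integrable lborel (\<lambda>p. D p * \<psi> p)"
    and null: "\<And>\<psi>. \<psi> \<in> schwartz \<Longrightarrow> (LINT p|lborel. D p * \<psi> p) = 0"
  shows "AE p in lborel. D p = 0"
proof -
  let ?D = "\<lambda>p. D p * complex_of_real (gauss 1 (p - 0))"
  have "AE p in lborel. ?D p = 0"
  proof (rule gauss_null_AE)
    show "integrable lborel ?D" by (intro int gauss_schwartz) simp
    fix m :: real and y :: 'a assume m: "0 < m"
    \<comment> \<open>Found by completing the square: the product of the Gaussians with centres 0
      and \<open>y\<close> has centre \<open>y'\<close> and inverse width
      \<open>sqrt (1 + m\<^sup>2)\<close>; \<open>c\<close> is the constant left over.\<close>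
    define y' where "y' = (m\<^sup>2 / (1 + m\<^sup>2)) *\<^sub>R y"
    define c where "c = exp (- ((m\<^sup>2 / (1 + m\<^sup>2)) * (norm y)\<^sup>2) / 2)"
    have m1: "1 + m\<^sup>2 > 0" by (simp add: add_pos_nonneg)
    have "gauss 1 (p - 0) * gauss m (y - p) = c * gauss (sqrt (1 + m\<^sup>2)) (p - y')" for p
    proof -
      have ID: "(norm p)\<^sup>2 + m\<^sup>2 * (norm (y - p))\<^sup>2 = (m\<^sup>2 / (1 + m\<^sup>2)) * (norm y)\<^sup>2 + (1 + m\<^sup>2) * (norm (p - y'))\<^sup>2"
      proof -
        \<comment> \<open>The same identity in scalars: t stands for the ratio of m^2 and 1 + m^2, M
          for m^2, and pp, py, yy for the inner products.\<close>
        have *: "t * yy + (1 + M) * (pp - 2 * t * py + t * t * yy) = pp + M * (yy - 2 * py + pp)"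
          if "t * (1 + M) = M" for t M pp py yy :: real
        proof -
          have "t * yy + (1 + M) * (pp - 2 * t * py + t * t * yy)
            = (1 + M) * pp - 2 * (t * (1 + M)) * py + t * yy + (t * (1 + M)) * t * yy"
            by (simp add: algebra_simps)
          also have "\<dots> = (1 + M) * pp - 2 * M * py + t * yy + M * t * yy" by (simp only: that)
          also have "\<dots> = (1 + M) * pp - 2 * M * py + (t * (1 + M)) * yy"
            by (simp add: algebra_simps)
          also have "\<dots> = (1 + M) * pp - 2 * M * py + M * yy" by (simp only: that)
          finally show ?thesis by (simp add: algebra_simps)
        qed
        have n1: "(norm (p - y'))\<^sup>2 = p \<bullet> p - 2 * (m\<^sup>2 / (1 + m\<^sup>2)) * (p \<bullet> y) + (m\<^sup>2 / (1 + m\<^sup>2)) * (m\<^sup>2 / (1 + m\<^sup>2)) * (y \<bullet> y)"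
          unfolding y'_def power2_norm_eq_inner by (simp add: inner_diff_left inner_diff_right inner_commute)
        have n2: "(norm (y - p))\<^sup>2 = y \<bullet> y - 2 * (p \<bullet> y) + p \<bullet> p"
          unfolding power2_norm_eq_inner by (simp add: inner_diff_left inner_diff_right inner_commute)
        have "m\<^sup>2 / (1 + m\<^sup>2) * (1 + m\<^sup>2) = m\<^sup>2" using m1 by simp
        from *[OF this, of "y \<bullet> y" "p \<bullet> p" "p \<bullet> y"] show ?thesis
          unfolding n1 n2 by (simp add: power2_norm_eq_inner)
      qed
      have "gauss 1 (p - 0) * gauss m (y - p) = exp (- ((norm p)\<^sup>2 + m\<^sup>2 * (norm (y - p))\<^sup>2) / 2)"
        by (simp add: gauss_def mult_exp_exp power_mult_distrib add_divide_distrib diff_divide_distrib)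
      also have "\<dots> = exp (- (m\<^sup>2 / (1 + m\<^sup>2) * (norm y)\<^sup>2 + (1 + m\<^sup>2) * (norm (p - y'))\<^sup>2) / 2)"
        unfolding ID ..
      also have "\<dots> = c * exp (- ((1 + m\<^sup>2) * (norm (p - y'))\<^sup>2) / 2)"
        unfolding c_def mult_exp_exp by (rule arg_cong[where f = exp]) (simp add: add_divide_distrib diff_divide_distrib)
      also have "(1 + m\<^sup>2) * (norm (p - y'))\<^sup>2 = (sqrt (1 + m\<^sup>2) * norm (p - y'))\<^sup>2"
        using m1 by (simp add: power_mult_distrib)
      finally show ?thesis by (simp add: gauss_def)
    qed
    then have eq: "?D p * complex_of_real (gauss m (y - p)) = complex_of_real c * (D p * complex_of_real (gauss (sqrt (1 + m\<^sup>2)) (p - y')))" for p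
      by (simp add: mult.assoc of_real_mult[symmetric] del: of_real_mult)
    show "(LINT p|lborel. ?D p * complex_of_real (gauss m (y - p))) = 0"
      unfolding eq using m1 by (simp add: null gauss_schwartz)
  qed
  then show ?thesis
  proof eventually_elim
    case (elim p)
    then show ?case using gauss_pos[of 1 p] by simp
  qed
qed

section \<open>Functions whose Fourier transform lies in a weighted \<open>L\<^sup>2\<close> space\<close>

lemma integrable_prod_mult_lborel:
  fixes g :: "'a::euclidean_space \<Rightarrow> complex" and h :: "'b::euclidean_space \<Rightarrow> complex"
  assumes "integrable lborel g" "integrable lborel h"
  shows "integrable lborel (\<lambda>r. g (fst r) * h (snd r))"
    and "(LINT r|lborel. g (fst r) * h (snd r)) = (LINT x|lborel. g x) * (LINT y|lborel. h y)"
proof -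
  note * = integrable_prod_mult[OF assms]
  show "integrable lborel (\<lambda>r. g (fst r) * h (snd r))"
    using * unfolding lborel_prod by (simp add: case_prod_beta')
  have "(LINT r|lborel. g (fst r) * h (snd r)) = (LINT x|lborel. LINT y|lborel. g x * h y)"
    unfolding lborel_pair.integral_fst[OF *] lborel_prod by (simp add: case_prod_beta')
  then show "(LINT r|lborel. g (fst r) * h (snd r)) = (LINT x|lborel. g x) * (LINT y|lborel. h y)"
    by simp
qed

lemma nn_integral_lborel_fst:
  fixes f :: "'a::euclidean_space \<times> 'b::euclidean_space \<Rightarrow> ennreal"
  assumes "f \<in> borel_measurable (lborel \<Otimes>\<^sub>M lborel)"
  shows "(\<integral>\<^sup>+r. f r \<partial>lborel) = (\<integral>\<^sup>+x. \<integral>\<^sup>+y. f (x, y) \<partial>lborel \<partial>lborel)"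
  using lborel.nn_integral_fst[OF assms] unfolding lborel_prod by simp

text \<open>Writing |ft 1 g|^2 as a double integral over \<open>p\<close> and \<open>q\<close>, the
  integral in \<open>X\<close> is the transform of a Gaussian at \<open>p - q\<close>; the centre
  \<open>Y\<close> only contributes a phase of modulus one, whence the uniformity in
  \<open>Y\<close>. It acts as a local Plancherel inequality in which only nearby frequencies
  interact.\<close>

lemma ft_sq_gauss:
  fixes g :: "'a::euclidean_space \<Rightarrow> complex"
  assumes g: "integrable lborel g"
  shows "(\<integral>\<^sup>+X. ennreal ((cmod (ft 1 g X))\<^sup>2 * gauss 1 (X - Y)) \<partial>lborel)
     \<le> ennreal (sqrt (2 * pi) ^ DIM('a)) * (\<integral>\<^sup>+p. \<integral>\<^sup>+q. ennreal (cmod (g p) * cmod (g q) * gauss 1 (p - q)) \<partial>lborel \<partial>lborel)"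
proof -
  let ?f = "ft 1 g" and ?c = "sqrt (2 * pi) ^ DIM('a)"
  have [measurable]: "g \<in> borel_measurable borel" using borel_measurable_integrable[OF g] by simp
  define h where "h r = g (fst r) * cnj (g (snd r))" for r :: "'a \<times> 'a"
  define G where "G X = complex_of_real (gauss 1 (X - Y))" for X
  have cg: "integrable lborel (\<lambda>x. cnj (g x))" using g by simp
  have h: "integrable lborel h" unfolding h_def by (rule integrable_prod_mult_lborel(1)[OF g cg])
  have G: "integrable lborel G" unfolding G_def by (rule schwartz_integrable[OF gauss_schwartz]) simp
  have [measurable]: "h \<in> borel_measurable borel" "G \<in> borel_measurable borel"
    using borel_measurable_integrable[OF h] borel_measurable_integrable[OF G] by simp_all
  let ?\<Phi> = "\<lambda>X r. cis (X \<bullet> (fst r - snd r)) * (G X * h r)"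
  have int: "integrable (lborel \<Otimes>\<^sub>M lborel) (\<lambda>(X, r). ?\<Phi> X r)"
  proof -
    have "integrable (lborel \<Otimes>\<^sub>M lborel) (\<lambda>x. cis (fst x \<bullet> (fst (snd x) - snd (snd x))) * (case x of (X, r) \<Rightarrow> G X * h r))"
      by (rule integrable_cis_mult[OF integrable_prod_mult[OF G h]])
        (unfold lborel_prod, simp, intro borel_measurable_continuous_onI continuous_intros)
    then show ?thesis by (simp add: case_prod_beta')
  qed
  have 1: "(LINT r|lborel. ?\<Phi> X r) = complex_of_real ((cmod (?f X))\<^sup>2 * gauss 1 (X - Y))" for X
  proof -
    let ?a = "\<lambda>p. cis (1 * (p \<bullet> X)) * g p"
    have a: "integrable lborel ?a" by (rule ft_integrable[OF g])
    have ca: "integrable lborel (\<lambda>q. cnj (?a q))" using a by (rule integrable_cnj)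
    have "(LINT r|lborel. ?\<Phi> X r) = (LINT r|lborel. G X * (?a (fst r) * cnj (?a (snd r))))"
    proof (rule Bochner_Integration.integral_cong[OF refl])
      fix r :: "'a \<times> 'a"
      have "cis (X \<bullet> (fst r - snd r)) = cis (fst r \<bullet> X) * cnj (cis (snd r \<bullet> X))"
        by (simp add: cis_cnj cis_mult inner_diff_right inner_commute)
      then show "?\<Phi> X r = G X * (?a (fst r) * cnj (?a (snd r)))" by (simp add: h_def mult_ac)
    qed
    also have "\<dots> = G X * ((LINT p|lborel. ?a p) * (LINT q|lborel. cnj (?a q)))"
      by (simp only: integral_mult_right_zero integrable_prod_mult_lborel(2)[OF a ca])
    also have "\<dots> = G X * (?f X * cnj (?f X))" 
    proof -
      have "(LINT q|lborel. cnj (?a q)) = cnj (LINT q|lborel. ?a q)" by (rule Bochner_Integration.integral_cnj)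
      then show ?thesis unfolding ft_def by simp
    qed
    finally show ?thesis unfolding G_def complex_norm_square[symmetric] by (simp add: mult.commute)
  qed
  have 2: "(LINT X|lborel. ?\<Phi> X r) = h r * (cis (Y \<bullet> (fst r - snd r)) * complex_of_real (?c * gauss 1 (fst r - snd r)))" for r
  proof -
    let ?q = "fst r - snd r"
    have "(LINT X|lborel. ?\<Phi> X r) = (LINT X|lborel. h r * (cis (X \<bullet> ?q) * G X))" by (simp add: mult_ac)
    also have "\<dots> = h r * (LINT X|lborel. cis (X \<bullet> ?q) * G X)" by (rule integral_mult_right_zero)
    also have "(LINT X|lborel. cis (X \<bullet> ?q) * G X) = (LINT X|lborel. cis ((Y + X) \<bullet> ?q) * G (Y + X))"
      by (rule lborel_integral_translate[symmetric]) measurable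
    also have "\<dots> = (LINT X|lborel. cis (Y \<bullet> ?q) * (cis (X \<bullet> ?q) * complex_of_real (gauss 1 X)))"
    proof (rule Bochner_Integration.integral_cong[OF refl])
      fix X
      have "cis ((Y + X) \<bullet> ?q) = cis (Y \<bullet> ?q) * cis (X \<bullet> ?q)"
        by (simp add: cis_mult inner_left_distrib)
      then show "cis ((Y + X) \<bullet> ?q) * G (Y + X) = cis (Y \<bullet> ?q) * (cis (X \<bullet> ?q) * complex_of_real (gauss 1 X))"
        by (simp only: G_def mult.assoc add_diff_cancel_left')
    qed
    also have "\<dots> = cis (Y \<bullet> ?q) * (LINT X|lborel. cis (X \<bullet> ?q) * complex_of_real (gauss 1 X))"
      by (rule integral_mult_right_zero)
    also have "\<dots> = cis (Y \<bullet> ?q) * complex_of_real (?c * gauss 1 ?q)"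
      using gauss_transform[of 1 ?q] by simp
    finally show ?thesis .
  qed
  have ri: "integrable lborel (\<lambda>X. (cmod (?f X))\<^sup>2 * gauss 1 (X - Y))"
  proof -
    have "integrable lborel (\<lambda>X. LINT r|lborel. ?\<Phi> X r)"
      by (rule lborel_pair.integrable_fst[OF int])
    then show ?thesis unfolding 1 complex_of_real_integrable_eq .
  qed
  have "complex_of_real (LINT X|lborel. (cmod (?f X))\<^sup>2 * gauss 1 (X - Y)) = (LINT X|lborel. LINT r|lborel. ?\<Phi> X r)"
    unfolding 1 by (rule integral_complex_of_real[symmetric])
  also have "\<dots> = (LINT r|lborel. LINT X|lborel. ?\<Phi> X r)"
    by (rule lborel_pair.Fubini_integral[symmetric, OF int])
  finally have e: "complex_of_real (LINT X|lborel. (cmod (?f X))\<^sup>2 * gauss 1 (X - Y)) = (LINT r|lborel. LINT X|lborel. ?\<Phi> X r)" .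
  have "0 \<le> (LINT X|lborel. (cmod (?f X))\<^sup>2 * gauss 1 (X - Y))"
    by (rule Bochner_Integration.integral_nonneg) simp
  then have eq: "(LINT X|lborel. (cmod (?f X))\<^sup>2 * gauss 1 (X - Y)) = cmod (LINT r|lborel. LINT X|lborel. ?\<Phi> X r)"
    unfolding e[symmetric] norm_of_real by simp
  have "(\<integral>\<^sup>+X. ennreal ((cmod (?f X))\<^sup>2 * gauss 1 (X - Y)) \<partial>lborel) = ennreal (cmod (LINT r|lborel. LINT X|lborel. ?\<Phi> X r))"
    unfolding eq[symmetric] by (rule nn_integral_eq_integral[OF ri]) auto
  also have "\<dots> \<le> (\<integral>\<^sup>+r. ennreal (cmod (LINT X|lborel. ?\<Phi> X r)) \<partial>lborel)"
    by (rule integral_norm_bound_ennreal[OF lborel_pair.integrable_snd[OF int]])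
  also have "\<dots> = (\<integral>\<^sup>+r. ennreal ?c * ennreal (cmod (g (fst r)) * cmod (g (snd r)) * gauss 1 (fst r - snd r)) \<partial>lborel)"
    unfolding 2 by (intro nn_integral_cong) (simp add: h_def norm_mult ennreal_mult[symmetric] mult_ac norm_power abs_mult)
  also have "\<dots> = ennreal ?c * (\<integral>\<^sup>+r. ennreal (cmod (g (fst r)) * cmod (g (snd r)) * gauss 1 (fst r - snd r)) \<partial>lborel)"
    by (rule nn_integral_cmult) (unfold lborel_prod[symmetric], measurable)
  also have "(\<integral>\<^sup>+r. ennreal (cmod (g (fst r)) * cmod (g (snd r)) * gauss 1 (fst r - snd r)) \<partial>lborel)
     = (\<integral>\<^sup>+p. \<integral>\<^sup>+q. ennreal (cmod (g p) * cmod (g q) * gauss 1 (p - q)) \<partial>lborel \<partial>lborel)"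
    by (subst nn_integral_lborel_fst) simp_all
  finally show ?thesis .
qed

text \<open>On the unit ball around \<open>X\<close> the function \<open>decay\<close> is comparable
  with its value at \<open>X\<close> and the Gaussian is bounded below. With this, bounds that are
  uniform in the centre of a Gaussian window add up to a bound with polynomial weight.\<close>

lemma decay_le_smoothed:
  "\<exists>C<\<infinity>. \<forall>X::'a::euclidean_space. ennreal (decay X) \<le> C * (\<integral>\<^sup>+Y. ennreal (decay Y * gauss 1 (X - Y)) \<partial>lborel)"
proof -
  let ?v = "emeasure lborel (ball (0::'a) 1)"
  \<comment> \<open>\<open>exp (-1/2)\<close> bounds the Gaussian from below on the unit ball; the
    power of 2 is the loss in \<open>decay_shift\<close>.\<close>
  define c :: real where "c = exp (-1/2) / 2 ^ (2 * DIM('a))"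
  have c: "c > 0" by (simp add: c_def)
  have v: "?v \<noteq> 0" "?v \<noteq> \<infinity>"
    using emeasure_lborel_ball_finite[of "0::'a" 1] content_ball_pos[of 1 "0::'a"] by (auto simp: measure_def)
  have le: "ennreal c * ?v * ennreal (decay X) \<le> (\<integral>\<^sup>+Y. ennreal (decay Y * gauss 1 (X - Y)) \<partial>lborel)" for X :: 'a
  proof -
    have "ennreal (c * decay X) * indicator (ball X 1) Y \<le> ennreal (decay Y * gauss 1 (X - Y))" for Y
    proof (cases "Y \<in> ball X 1")
      case True
      then have n: "norm (X - Y) \<le> 1" by (simp add: dist_norm)
      then have "norm (Y - X) \<le> 1" by (simp add: norm_minus_commute)
      then have "decay X / 2 ^ (2 * DIM('a)) \<le> decay Y"
        using decay_shift[of Y X] by (simp add: field_simps)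
      moreover have "exp (-1/2) \<le> gauss 1 (X - Y)"
        using n power_le_one[of "norm (X - Y)" 2] by (simp add: gauss_def)
      ultimately have "exp (-1/2) * (decay X / 2 ^ (2 * DIM('a))) \<le> gauss 1 (X - Y) * decay Y"
        by (intro mult_mono) auto
      then show ?thesis using True by (simp add: c_def mult_ac ennreal_leI)
    qed simp
    then have "(\<integral>\<^sup>+Y. ennreal (c * decay X) * indicator (ball X 1) Y \<partial>lborel) \<le> (\<integral>\<^sup>+Y. ennreal (decay Y * gauss 1 (X - Y)) \<partial>lborel)"
      by (intro nn_integral_mono)
    moreover have "emeasure lborel (ball X 1) = ?v" by (simp add: emeasure_ball)
    then have "(\<integral>\<^sup>+Y. ennreal (c * decay X) * indicator (ball X 1) Y \<partial>lborel) = ennreal (c * decay X) * ?v"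
      by (subst nn_integral_cmult_indicator) auto
    ultimately show ?thesis using c by (simp add: ennreal_mult mult_ac)
  qed
  have "ennreal (decay X) = (1 / (ennreal c * ?v)) * (ennreal c * ?v * ennreal (decay X))" for X :: 'a
  proof -
    have "ennreal c * ?v \<noteq> 0" "ennreal c * ?v \<noteq> \<infinity>" using c v by (auto simp: ennreal_mult_eq_top_iff)
    then have "1 / (ennreal c * ?v) * (ennreal c * ?v) = 1" by (simp add: ennreal_divide_times ennreal_divide_self less_top)
    then show ?thesis by (metis mult.assoc mult_1)
  qed
  then have "ennreal (decay X) \<le> (1 / (ennreal c * ?v)) * (\<integral>\<^sup>+Y. ennreal (decay Y * gauss 1 (X - Y)) \<partial>lborel)" for X :: 'a
    by (rule ord_eq_le_trans[OF _ mult_left_mono[OF le, of "1 / (ennreal c * ?v)" X]]) simp_all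
  moreover have "1 / (ennreal c * ?v) < \<infinity>"
    using c v by (simp add: ennreal_divide_eq_top_iff less_top[symmetric])
  ultimately show ?thesis by blast
qed

text \<open>\<open>f\<close> is, up to a constant, the inverse transform of \<open>g\<close>, which need not be integrable: it is obtained
  by exhausting the space with the sets \<open>A K\<close>, and \<open>F\<close> dominates the approximations.\<close>

definition fourier_approx :: "('a::euclidean_space \<Rightarrow> complex) \<Rightarrow> (nat \<Rightarrow> 'a set) \<Rightarrow> ('a \<Rightarrow> complex) \<Rightarrow> ('a \<Rightarrow> real) \<Rightarrow> bool" where
  "fourier_approx g A f F \<longleftrightarrow> (\<forall>K. A K \<in> sets borel \<and> integrable lborel (\<lambda>p. indicator (A K) p *\<^sub>R g p)) \<and>
     (\<forall>p. eventually (\<lambda>K. p \<in> A K) sequentially) \<and>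
     f \<in> borel_measurable borel \<and> F \<in> borel_measurable borel \<and> (\<forall>X. 0 \<le> F X) \<and>
     (AE X in lborel. (\<lambda>K. ft 1 (\<lambda>p. indicator (A K) p *\<^sub>R g p) X) \<longlonglongrightarrow> f X) \<and>
     (AE X in lborel. \<forall>K. cmod (ft 1 (\<lambda>p. indicator (A K) p *\<^sub>R g p) X) \<le> F X) \<and>
     (\<integral>\<^sup>+X. ennreal ((F X)\<^sup>2 * decay X) \<partial>lborel) < \<infinity>"

text \<open>\<open>W_schur\<close> asks that the inverse square of the weight be uniformly locally
  integrable, measured by a Gaussian window. Under it, \<open>W g\<close> in L^2 controls
  \<open>g\<close> in L^1 on balls as well as the inverse transform locally in L^2.\<close>

locale fourier_weight =
  fixes W :: "'a::euclidean_space \<Rightarrow> real"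
  assumes W_measurable [measurable]: "W \<in> borel_measurable borel"
    and W_pos: "0 < W p"
    and W_schur: "\<exists>M<\<infinity>. \<forall>p. (\<integral>\<^sup>+q. ennreal (1 / (W q)\<^sup>2 * gauss 1 (p - q)) \<partial>lborel) \<le> M"
begin

text \<open>Schur's test with the weight crossed over: u(p) u(q) is the product of W(p) u(p) / W(q)
  and W(q) u(q) / W(p), and each of the two squares is integrated first in the variable of its
  denominator.\<close>

lemma schur_gauss:
  assumes M: "\<And>p. (\<integral>\<^sup>+q. ennreal (1 / (W q)\<^sup>2 * gauss 1 (p - q)) \<partial>lborel) \<le> M"
    and [measurable]: "u \<in> borel_measurable borel" and u: "\<And>p. 0 \<le> u p"
  shows "(\<integral>\<^sup>+p. \<integral>\<^sup>+q. ennreal (u p * u q * gauss 1 (p - q)) \<partial>lborel \<partial>lborel) \<le> 2 * M * (\<integral>\<^sup>+p. ennreal ((W p * u p)\<^sup>2) \<partial>lborel)"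
proof -
  let ?T = "\<lambda>p q. ennreal ((W p * u p)\<^sup>2) * ennreal (1 / (W q)\<^sup>2 * gauss 1 (p - q))"
  let ?N = "\<integral>\<^sup>+p. ennreal ((W p * u p)\<^sup>2) \<partial>lborel"
  have pt: "ennreal (u p * u q * gauss 1 (p - q)) \<le> ?T p q + ?T q p" for p q
  proof -
    define a b where "a = W p * u p / W q" and "b = W q * u q / W p"
    have ab: "0 \<le> a" "0 \<le> b" "u p * u q = a * b" using W_pos[of p] W_pos[of q] u by (auto simp: a_def b_def)
    have "a * b \<le> a\<^sup>2 + b\<^sup>2"
      using sum_squares_bound[of a b] ab mult_nonneg_nonneg[of a b] by linarith
    then have "u p * u q * gauss 1 (p - q) \<le> (a\<^sup>2 + b\<^sup>2) * gauss 1 (p - q)" unfolding ab(3) by (intro mult_right_mono) auto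
    also have "\<dots> = (W p * u p)\<^sup>2 * (1 / (W q)\<^sup>2 * gauss 1 (p - q)) + (W q * u q)\<^sup>2 * (1 / (W p)\<^sup>2 * gauss 1 (q - p))"
      by (simp add: a_def b_def power_divide gauss_minus[of 1 q p] algebra_simps)
    finally show ?thesis
      by (simp add: ennreal_mult[symmetric] ennreal_plus[symmetric] ennreal_leI del: ennreal_plus)
  qed
  have TM: "(\<integral>\<^sup>+p. \<integral>\<^sup>+q. ?T p q \<partial>lborel \<partial>lborel) \<le> ?N * M"
  proof -
    have "(\<integral>\<^sup>+q. ?T p q \<partial>lborel) \<le> ennreal ((W p * u p)\<^sup>2) * M" for p
    proof -
      have "(\<integral>\<^sup>+q. ?T p q \<partial>lborel) = ennreal ((W p * u p)\<^sup>2) * (\<integral>\<^sup>+q. ennreal (1 / (W q)\<^sup>2 * gauss 1 (p - q)) \<partial>lborel)"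
        by (rule nn_integral_cmult) measurable
      also have "\<dots> \<le> ennreal ((W p * u p)\<^sup>2) * M" by (intro mult_left_mono M) simp
      finally show ?thesis .
    qed
    then have "(\<integral>\<^sup>+p. \<integral>\<^sup>+q. ?T p q \<partial>lborel \<partial>lborel) \<le> (\<integral>\<^sup>+p. ennreal ((W p * u p)\<^sup>2) * M \<partial>lborel)"
      by (intro nn_integral_mono)
    also have "\<dots> = ?N * M" by (rule nn_integral_multc) measurable
    finally show ?thesis .
  qed
  have "(\<integral>\<^sup>+p. \<integral>\<^sup>+q. ennreal (u p * u q * gauss 1 (p - q)) \<partial>lborel \<partial>lborel) \<le> (\<integral>\<^sup>+p. \<integral>\<^sup>+q. ?T p q + ?T q p \<partial>lborel \<partial>lborel)"
    by (intro nn_integral_mono pt)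
  also have "\<dots> = (\<integral>\<^sup>+p. \<integral>\<^sup>+q. ?T p q \<partial>lborel \<partial>lborel) + (\<integral>\<^sup>+p. \<integral>\<^sup>+q. ?T q p \<partial>lborel \<partial>lborel)"
    by (simp add: nn_integral_add)
  also have "(\<integral>\<^sup>+p. \<integral>\<^sup>+q. ?T q p \<partial>lborel \<partial>lborel) = (\<integral>\<^sup>+q. \<integral>\<^sup>+p. ?T q p \<partial>lborel \<partial>lborel)"
    by (rule lborel_pair.Fubini') measurable
  also have "(\<integral>\<^sup>+p. \<integral>\<^sup>+q. ?T p q \<partial>lborel \<partial>lborel) + (\<integral>\<^sup>+q. \<integral>\<^sup>+p. ?T q p \<partial>lborel \<partial>lborel) \<le> ?N * M + ?N * M"
    by (intro add_mono TM)
  finally show ?thesis by (simp add: mult_2 distrib_right mult.commute[of M])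
qed

text \<open>The weight \<open>decay\<close> is replaced by an average of Gaussian windows. For each
  window \<open>ft_sq_gauss\<close> and \<open>schur_gauss\<close> give the same bound, and the
  averaging function is integrable.\<close>

lemma ft_weighted_bound:
  "\<exists>C<\<infinity>. \<forall>g. integrable lborel g \<longrightarrow>
    (\<integral>\<^sup>+X. ennreal ((cmod (ft 1 g X))\<^sup>2 * decay X) \<partial>lborel) \<le> C * (\<integral>\<^sup>+p. ennreal ((W p * cmod (g p))\<^sup>2) \<partial>lborel)"
proof -
  obtain M where M: "M < \<infinity>" "\<And>p. (\<integral>\<^sup>+q. ennreal (1 / (W q)\<^sup>2 * gauss 1 (p - q)) \<partial>lborel) \<le> M"
    using W_schur by blast
  obtain C where C: "C < \<infinity>" "\<And>X::'a. ennreal (decay X) \<le> C * (\<integral>\<^sup>+Y. ennreal (decay Y * gauss 1 (X - Y)) \<partial>lborel)"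
    using decay_le_smoothed[where 'a='a] by blast
  let ?c = "ennreal (sqrt (2 * pi) ^ DIM('a))" and ?I = "\<integral>\<^sup>+Y. ennreal (decay (Y::'a)) \<partial>lborel"
  let ?C = "C * (?I * (?c * (2 * M)))"
  have "(\<integral>\<^sup>+X. ennreal ((cmod (ft 1 g X))\<^sup>2 * decay X) \<partial>lborel) \<le> ?C * (\<integral>\<^sup>+p. ennreal ((W p * cmod (g p))\<^sup>2) \<partial>lborel)"
    if g: "integrable lborel g" for g
  proof -
    let ?N = "\<integral>\<^sup>+p. ennreal ((W p * cmod (g p))\<^sup>2) \<partial>lborel"
    have [measurable]: "g \<in> borel_measurable borel" using borel_measurable_integrable[OF g] by simp
    have A: "(\<integral>\<^sup>+X. ennreal ((cmod (ft 1 g X))\<^sup>2 * gauss 1 (X - Y)) \<partial>lborel) \<le> ?c * (2 * M * ?N)" for Y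
      by (rule order_trans[OF ft_sq_gauss[OF g] mult_left_mono[OF schur_gauss[OF M(2)]]]) auto
    have "(\<integral>\<^sup>+X. ennreal ((cmod (ft 1 g X))\<^sup>2 * decay X) \<partial>lborel)
       \<le> (\<integral>\<^sup>+X. C * (\<integral>\<^sup>+Y. ennreal (decay Y) * ennreal ((cmod (ft 1 g X))\<^sup>2 * gauss 1 (X - Y)) \<partial>lborel) \<partial>lborel)"
    proof (rule nn_integral_mono)
      fix X :: 'a
      have "ennreal ((cmod (ft 1 g X))\<^sup>2 * decay X) = ennreal ((cmod (ft 1 g X))\<^sup>2) * ennreal (decay X)"
        by (simp add: ennreal_mult)
      also have "\<dots> \<le> ennreal ((cmod (ft 1 g X))\<^sup>2) * (C * (\<integral>\<^sup>+Y. ennreal (decay Y * gauss 1 (X - Y)) \<partial>lborel))"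
        by (intro mult_left_mono C) auto
      also have "\<dots> = C * (\<integral>\<^sup>+Y. ennreal ((cmod (ft 1 g X))\<^sup>2) * ennreal (decay Y * gauss 1 (X - Y)) \<partial>lborel)"
        by (subst nn_integral_cmult) (auto simp: mult_ac)
      also have "\<dots> = C * (\<integral>\<^sup>+Y. ennreal (decay Y) * ennreal ((cmod (ft 1 g X))\<^sup>2 * gauss 1 (X - Y)) \<partial>lborel)"
        by (simp add: ennreal_mult[symmetric] mult_ac)
      finally show "ennreal ((cmod (ft 1 g X))\<^sup>2 * decay X) \<le> C * (\<integral>\<^sup>+Y. ennreal (decay Y) * ennreal ((cmod (ft 1 g X))\<^sup>2 * gauss 1 (X - Y)) \<partial>lborel)" .
    qed
    also have "\<dots> = C * (\<integral>\<^sup>+X. \<integral>\<^sup>+Y. ennreal (decay Y) * ennreal ((cmod (ft 1 g X))\<^sup>2 * gauss 1 (X - Y)) \<partial>lborel \<partial>lborel)"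
      by (rule nn_integral_cmult) measurable
    also have "(\<integral>\<^sup>+X. \<integral>\<^sup>+Y. ennreal (decay Y) * ennreal ((cmod (ft 1 g X))\<^sup>2 * gauss 1 (X - Y)) \<partial>lborel \<partial>lborel)
      = (\<integral>\<^sup>+Y. \<integral>\<^sup>+X. ennreal (decay Y) * ennreal ((cmod (ft 1 g X))\<^sup>2 * gauss 1 (X - Y)) \<partial>lborel \<partial>lborel)"
      by (rule lborel_pair.Fubini') measurable
    finally have 1: "(\<integral>\<^sup>+X. ennreal ((cmod (ft 1 g X))\<^sup>2 * decay X) \<partial>lborel)
      \<le> C * (\<integral>\<^sup>+Y. \<integral>\<^sup>+X. ennreal (decay Y) * ennreal ((cmod (ft 1 g X))\<^sup>2 * gauss 1 (X - Y)) \<partial>lborel \<partial>lborel)" .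
    have "(\<integral>\<^sup>+X. ennreal (decay Y) * ennreal ((cmod (ft 1 g X))\<^sup>2 * gauss 1 (X - Y)) \<partial>lborel) \<le> ennreal (decay Y) * (?c * (2 * M * ?N))" for Y
    proof -
      have "(\<integral>\<^sup>+X. ennreal (decay Y) * ennreal ((cmod (ft 1 g X))\<^sup>2 * gauss 1 (X - Y)) \<partial>lborel)
        = ennreal (decay Y) * (\<integral>\<^sup>+X. ennreal ((cmod (ft 1 g X))\<^sup>2 * gauss 1 (X - Y)) \<partial>lborel)"
        by (rule nn_integral_cmult) measurable
      also have "\<dots> \<le> ennreal (decay Y) * (?c * (2 * M * ?N))" by (intro mult_left_mono A) simp
      finally show ?thesis .
    qed
    then have "(\<integral>\<^sup>+Y. \<integral>\<^sup>+X. ennreal (decay Y) * ennreal ((cmod (ft 1 g X))\<^sup>2 * gauss 1 (X - Y)) \<partial>lborel \<partial>lborel)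
      \<le> (\<integral>\<^sup>+Y. ennreal (decay (Y::'a)) * (?c * (2 * M * ?N)) \<partial>lborel)"
      by (intro nn_integral_mono)
    also have "\<dots> = ?I * (?c * (2 * M * ?N))" by (rule nn_integral_multc) measurable
    finally have "C * (\<integral>\<^sup>+Y. \<integral>\<^sup>+X. ennreal (decay Y) * ennreal ((cmod (ft 1 g X))\<^sup>2 * gauss 1 (X - Y)) \<partial>lborel \<partial>lborel)
      \<le> C * (?I * (?c * (2 * M * ?N)))" by (rule mult_left_mono) simp
    with 1 show ?thesis by (simp only: mult.assoc order_trans)
  qed
  moreover have "?C < \<infinity>" using M C nn_integral_decay[where 'a='a] by (simp add: ennreal_mult_less_top)
  ultimately show ?thesis by blast
qed

text \<open>|g| is at most (W |g|)^2 + 1 / W^2, and on the ball the Gaussian window centred at 0 is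
  at least exp(- R^2 / 2), so \<open>W_schur\<close> covers the second term.\<close>

lemma weighted_L2_integrable_on_ball:
  assumes [measurable]: "g \<in> borel_measurable borel" and N: "(\<integral>\<^sup>+p. ennreal ((W p * cmod (g p))\<^sup>2) \<partial>lborel) < \<infinity>"
  shows "integrable lborel (\<lambda>p. indicator (cball 0 R) p *\<^sub>R g p)"
proof (rule integrableI_bounded)
  obtain M where M: "M < \<infinity>" "\<And>p. (\<integral>\<^sup>+q. ennreal (1 / (W q)\<^sup>2 * gauss 1 (p - q)) \<partial>lborel) \<le> M"
    using W_schur by blast
  have "ennreal (norm (indicator (cball 0 R) p *\<^sub>R g p)) \<le> ennreal ((W p * cmod (g p))\<^sup>2) + ennreal (exp (R\<^sup>2 / 2)) * ennreal (1 / (W p)\<^sup>2 * gauss 1 (0 - p))" for p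
  proof (cases "p \<in> cball 0 R")
    case True
    then have "(norm p)\<^sup>2 \<le> R\<^sup>2" by (intro power_mono) auto
    then have "1 \<le> exp (R\<^sup>2 / 2) * gauss 1 (0 - p)" by (simp add: gauss_def mult_exp_exp)
    then have 1: "1 / (W p)\<^sup>2 \<le> exp (R\<^sup>2 / 2) * (1 / (W p)\<^sup>2 * gauss 1 (0 - p))"
      using mult_left_mono[of 1 "exp (R\<^sup>2 / 2) * gauss 1 (0 - p)" "1 / (W p)\<^sup>2"] by (simp add: mult_ac)
    have "cmod (g p) = (W p * cmod (g p)) * (1 / W p)" using W_pos[of p] by simp
    also have "\<dots> \<le> (W p * cmod (g p))\<^sup>2 + (1 / W p)\<^sup>2"
    proof -
      have "0 \<le> (W p * cmod (g p)) * (1 / W p)" using W_pos[of p] by simp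
      then show ?thesis using sum_squares_bound[of "W p * cmod (g p)" "1 / W p"] by linarith
    qed
    also have "\<dots> \<le> (W p * cmod (g p))\<^sup>2 + exp (R\<^sup>2 / 2) * (1 / (W p)\<^sup>2 * gauss 1 (0 - p))"
      using 1 by (simp add: power_divide)
    finally show ?thesis using True
      by (simp add: ennreal_mult[symmetric] ennreal_plus[symmetric] ennreal_leI del: ennreal_plus)
  qed simp
  then have "(\<integral>\<^sup>+p. ennreal (norm (indicator (cball 0 R) p *\<^sub>R g p)) \<partial>lborel)
    \<le> (\<integral>\<^sup>+p. ennreal ((W p * cmod (g p))\<^sup>2) + ennreal (exp (R\<^sup>2 / 2)) * ennreal (1 / (W p)\<^sup>2 * gauss 1 (0 - p)) \<partial>lborel)"
    by (intro nn_integral_mono)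
  also have "\<dots> = (\<integral>\<^sup>+p. ennreal ((W p * cmod (g p))\<^sup>2) \<partial>lborel) + ennreal (exp (R\<^sup>2 / 2)) * (\<integral>\<^sup>+p. ennreal (1 / (W p)\<^sup>2 * gauss 1 (0 - p)) \<partial>lborel)"
    by (subst nn_integral_add) (measurable, subst nn_integral_cmult, auto)
  also have "\<dots> < \<infinity>"
    using N M(1) le_less_trans[OF M(2)[of 0] M(1)] by (simp add: ennreal_mult_less_top)
  finally show "(\<integral>\<^sup>+p. ennreal (norm (indicator (cball 0 R) p *\<^sub>R g p)) \<partial>lborel) < \<infinity>" .
  have [measurable]: "cball (0::'a) R \<in> sets borel" by simp
  show "(\<lambda>p. indicator (cball 0 R) p *\<^sub>R g p) \<in> borel_measurable lborel" by measurable
qed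

text \<open>The pieces of \<open>g\<close> are cut out so that their norms decay geometrically; the transforms
  then converge absolutely almost everywhere, and no completeness of \<open>L\<^sup>2\<close> is needed.\<close>

lemma fourier_approx_exists:
  assumes [measurable]: "g \<in> borel_measurable borel" and N: "(\<integral>\<^sup>+p. ennreal ((W p * cmod (g p))\<^sup>2) \<partial>lborel) < \<infinity>"
  shows "\<exists>A f F. fourier_approx g A f F"
proof -
  let ?N = "\<lambda>g. \<integral>\<^sup>+p. ennreal ((W p * cmod (g p))\<^sup>2) \<partial>lborel"
  define tail where "tail R = (\<integral>\<^sup>+p. ennreal ((W p * cmod (g p))\<^sup>2) * indicator (- cball 0 R) p \<partial>lborel)" for R :: real
  have tail0: "(\<lambda>k::nat. tail (real k)) \<longlonglongrightarrow> (\<integral>\<^sup>+p. 0 \<partial>(lborel::'a measure))"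
    unfolding tail_def
  proof (rule nn_integral_dominated_convergence[where w = "\<lambda>p. ennreal ((W p * cmod (g p))\<^sup>2)"])
    show "AE p in lborel. (\<lambda>k. ennreal ((W p * cmod (g p))\<^sup>2) * indicator (- cball 0 (real k)) p) \<longlonglongrightarrow> 0"
    proof (intro AE_I2 tendsto_eventually)
      fix p :: 'a
      obtain n where "norm p \<le> real n" using real_arch_simple by blast
      then show "\<forall>\<^sub>F k in sequentially. ennreal ((W p * cmod (g p))\<^sup>2) * indicator (- cball 0 (real k)) p = 0"
        by (intro eventually_sequentiallyI[of n]) (auto simp: indicator_def)
    qed
    show "AE p in lborel. ennreal ((W p * cmod (g p))\<^sup>2) * indicator (- cball 0 (real k)) p \<le> ennreal ((W p * cmod (g p))\<^sup>2)" for k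
      by (intro AE_I2) (auto simp: indicator_def)
  qed (use N in auto)
  have tmono: "tail R' \<le> tail R" if "R \<le> R'" for R R'
    unfolding tail_def using that by (intro nn_integral_mono) (auto simp: indicator_def)
  \<comment> \<open>The rate 8^(-j) for the squared norms leaves room for a factor 4^j: the weighted
    sum still converges like 2^(-j), and each transform is at most 2^(-j) times a common
    function.\<close>
  have "\<exists>r::nat. tail (real r) \<le> ennreal ((1 / 8) ^ j)" for j
  proof -
    have "eventually (\<lambda>k::nat. tail (real k) < ennreal ((1 / 8) ^ j)) sequentially"
      using tail0 by (intro order_tendstoD) auto
    then obtain k :: nat where "tail (real k) < ennreal ((1 / 8) ^ j)"
      unfolding eventually_sequentially by blast
    then show ?thesis by (intro exI[of _ k] less_imp_le)
  qed
  then obtain r :: "nat \<Rightarrow> nat" where r: "\<And>j. tail (real (r j)) \<le> ennreal ((1 / 8) ^ j)" by metis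
  \<comment> \<open>Partial sums make the radii increasing and at least \<open>r K\<close>; adding
    \<open>K\<close> forces them to infinity.\<close>
  define \<rho> where "\<rho> K = real (\<Sum>j\<le>K. r j) + real K" for K
  have \<rho>: "\<rho> K \<le> \<rho> (Suc K)" "real K \<le> \<rho> K" "real (r K) \<le> \<rho> K" for K
  proof -
    have "r K \<le> (\<Sum>j\<le>K. r j)" using member_le_sum[of K "{..K}" r] by simp
    then have "real (r K) \<le> real (\<Sum>j\<le>K. r j)" by (rule of_nat_mono)
    then show "real (r K) \<le> \<rho> K" unfolding \<rho>_def by linarith
    show "\<rho> K \<le> \<rho> (Suc K)" "real K \<le> \<rho> K" unfolding \<rho>_def by (simp_all del: of_nat_sum)
  qed
  define A where "A K = cball (0::'a) (\<rho> K)" for K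
  have Amono: "A K \<subseteq> A (Suc K)" for K unfolding A_def using \<rho>(1) by (rule subset_cball)
  have [measurable]: "A K \<in> sets borel" for K by (simp add: A_def)
  have Aint: "integrable lborel (\<lambda>p. indicator (A K) p *\<^sub>R g p)" for K
    unfolding A_def by (rule weighted_L2_integrable_on_ball[OF assms])
  have Aev: "eventually (\<lambda>K. p \<in> A K) sequentially" for p
  proof -
    obtain n where "norm p \<le> real n" using real_arch_simple by blast
    then have "norm p \<le> \<rho> k" if "k \<ge> n" for k using \<rho>(2)[of k] that by linarith
    then show ?thesis by (intro eventually_sequentiallyI[of n]) (simp add: A_def)
  qed
  define B where "B j = (case j of 0 \<Rightarrow> A 0 | Suc i \<Rightarrow> A (Suc i) - A i)" for j
  have [measurable]: "B j \<in> sets borel" for j by (cases j) (auto simp: B_def)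
  have BA: "B j \<subseteq> A j" for j by (cases j) (auto simp: B_def)
  define gj where "gj j p = indicator (B j) p *\<^sub>R g p" for j p
  have gjm [measurable]: "gj j \<in> borel_measurable borel" for j unfolding gj_def[abs_def] by measurable
  have gji: "integrable lborel (gj j)" for j
    by (rule Bochner_Integration.integrable_bound[OF Aint[of j]])
      (use BA[of j] in \<open>auto simp: gj_def indicator_def\<close>)
  define fj where "fj j = ft 1 (gj j)" for j
  have [measurable]: "fj j \<in> borel_measurable borel" for j unfolding fj_def by measurable
  have fsum: "ft 1 (\<lambda>p. indicator (A K) p *\<^sub>R g p) X = (\<Sum>j\<le>K. fj j X)" for K X
  proof (induction K)
    case 0
    then show ?case by (simp add: fj_def gj_def[abs_def] B_def)
  next
    case (Suc K)
    have "(\<lambda>p. indicator (A (Suc K)) p *\<^sub>R g p) = (\<lambda>p. 1 * (indicator (A K) p *\<^sub>R g p) + 1 * gj (Suc K) p)"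
    proof
      fix p
      show "indicator (A (Suc K)) p *\<^sub>R g p = 1 * (indicator (A K) p *\<^sub>R g p) + 1 * gj (Suc K) p"
        using Amono[of K] by (cases "p \<in> A K") (auto simp: gj_def B_def indicator_def)
    qed
    then show ?case using ft_lincomb[OF Aint[of K] gji[of "Suc K"], where c = 1 and d = 1 and p = X and \<sigma> = 1] by (simp only: Suc fj_def) simp
  qed
  obtain C where C: "C < \<infinity>" "\<And>g. integrable lborel g \<Longrightarrow> (\<integral>\<^sup>+X. ennreal ((cmod (ft 1 g X))\<^sup>2 * decay X) \<partial>lborel) \<le> C * ?N g"
    using ft_weighted_bound by blast
  \<comment> \<open>The term 8 absorbs the index shift, since piece \<open>Suc i\<close> is bounded
    by the tail at \<open>r i\<close>; the norm of \<open>g\<close> covers the first piece.\<close>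
  have Nj: "?N (gj j) \<le> (?N g + 8) * ennreal ((1 / 8) ^ j)" for j
  proof (cases j)
    case 0
    have "?N (gj 0) \<le> ?N g" by (intro nn_integral_mono) (auto simp: gj_def indicator_def)
    also have "\<dots> \<le> ?N g + 8" by simp
    finally show ?thesis using 0 by simp
  next
    case (Suc i)
    have "?N (gj (Suc i)) \<le> tail (\<rho> i)"
      unfolding tail_def by (intro nn_integral_mono) (auto simp: gj_def B_def A_def indicator_def)
    also have "\<dots> \<le> tail (real (r i))" by (rule tmono[OF \<rho>(3)])
    also have "\<dots> \<le> ennreal ((1 / 8) ^ i)" by (rule r)
    also have "\<dots> = 8 * ennreal ((1 / 8) ^ Suc i)"
      by (simp add: ennreal_mult[symmetric] flip: ennreal_numeral)
    also have "\<dots> \<le> (?N g + 8) * ennreal ((1 / 8) ^ Suc i)" by (intro mult_right_mono) auto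
    finally show ?thesis using Suc by simp
  qed
  \<comment> \<open>A square function with growing weights: where it is finite, the series of
    transforms is dominated by a geometric one.\<close>
  define S where "S X = (\<Sum>j. ennreal (4 ^ j * (cmod (fj j X))\<^sup>2))" for X
  have [measurable]: "S \<in> borel_measurable borel" unfolding S_def[abs_def] by measurable
  have Sfin: "(\<integral>\<^sup>+X. S X * ennreal (decay X) \<partial>lborel) < \<infinity>"
  proof -
    have "(\<integral>\<^sup>+X. S X * ennreal (decay X) \<partial>lborel) = (\<integral>\<^sup>+X. (\<Sum>j. ennreal (4 ^ j * (cmod (fj j X))\<^sup>2) * ennreal (decay X)) \<partial>lborel)"
      unfolding S_def by simp
    also have "\<dots> = (\<Sum>j. \<integral>\<^sup>+X. ennreal (4 ^ j * (cmod (fj j X))\<^sup>2) * ennreal (decay X) \<partial>lborel)"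
      by (rule nn_integral_suminf) measurable
    also have "\<dots> \<le> (\<Sum>j. (C * (?N g + 8)) * ennreal ((1 / 2) ^ j))"
    proof (rule suminf_le)
      fix j
      have "(\<integral>\<^sup>+X. ennreal (4 ^ j * (cmod (fj j X))\<^sup>2) * ennreal (decay X) \<partial>lborel) = (\<integral>\<^sup>+X. ennreal (4 ^ j) * ennreal ((cmod (fj j X))\<^sup>2 * decay X) \<partial>lborel)"
        by (intro nn_integral_cong) (simp add: ennreal_mult[symmetric] mult_ac)
      also have "\<dots> = ennreal (4 ^ j) * (\<integral>\<^sup>+X. ennreal ((cmod (fj j X))\<^sup>2 * decay X) \<partial>lborel)"
        by (rule nn_integral_cmult) measurable
      also have "\<dots> \<le> ennreal (4 ^ j) * (C * ((?N g + 8) * ennreal ((1 / 8) ^ j)))"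
        unfolding fj_def by (intro mult_left_mono order_trans[OF C(2)[OF gji]] Nj) auto
      also have "\<dots> = (C * (?N g + 8)) * (ennreal (4 ^ j) * ennreal ((1 / 8) ^ j))" by (simp add: mult_ac)
      also have "ennreal (4 ^ j) * ennreal ((1 / 8) ^ j) = ennreal ((1 / 2) ^ j)"
        by (simp add: ennreal_mult[symmetric] power_mult_distrib[symmetric])
      finally show "(\<integral>\<^sup>+X. ennreal (4 ^ j * (cmod (fj j X))\<^sup>2) * ennreal (decay X) \<partial>lborel) \<le> (C * (?N g + 8)) * ennreal ((1 / 2) ^ j)" .
    qed auto
    also have "\<dots> = (C * (?N g + 8)) * (\<Sum>j. ennreal ((1 / 2) ^ j))" by simp
    also have "(\<Sum>j. ennreal ((1 / 2) ^ j)) = ennreal (\<Sum>j. (1 / 2) ^ j)"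
      by (rule suminf_ennreal2) auto
    also have "(C * (?N g + 8)) * ennreal (\<Sum>j. (1 / 2) ^ j) < \<infinity>"
      using C(1) N by (simp add: ennreal_mult_less_top)
    finally show ?thesis .
  qed
  have Sae: "AE X in lborel. S X \<noteq> \<infinity>"
  proof -
    have "AE X in lborel. S X * ennreal (decay X) \<noteq> \<infinity>"
      by (rule nn_integral_PInf_AE) (use Sfin in auto)
    then show ?thesis
    proof eventually_elim
      case (elim X)
      then show ?case using decay_pos[of X] by (auto simp: ennreal_mult_eq_top_iff)
    qed
  qed
  define F where "F X = 2 * sqrt (enn2real (S X))" for X
  define f where "f X = lim (\<lambda>K. \<Sum>j\<le>K. fj j X)" for X
  have fjb: "cmod (fj j X) \<le> sqrt (enn2real (S X)) * (1 / 2) ^ j" if "S X \<noteq> \<infinity>" for j X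
  proof -
    have "ennreal (4 ^ j * (cmod (fj j X))\<^sup>2) \<le> S X"
      unfolding S_def by (rule sum_le_suminf[of _ "{j}", simplified]) auto
    also have "\<dots> = ennreal (enn2real (S X))" using that by (simp add: less_top)
    finally have "4 ^ j * (cmod (fj j X))\<^sup>2 \<le> enn2real (S X)" by (simp add: ennreal_le_iff)
    moreover have "4 ^ j * (cmod (fj j X))\<^sup>2 = (2 ^ j * cmod (fj j X))\<^sup>2"
      by (simp add: power_mult_distrib power_mult[symmetric] mult.commute[of j 2]) (simp add: power_mult)
    ultimately have "2 ^ j * cmod (fj j X) \<le> sqrt (enn2real (S X))" by (intro real_le_rsqrt) simp
    then show ?thesis by (simp add: field_simps power_divide)
  qed
  have geo: "(\<lambda>j. sqrt (enn2real (S X)) * (1 / 2) ^ j) sums F X" for X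
    using sums_mult[OF geometric_sums[of "1 / 2 :: real"], of "sqrt (enn2real (S X))"] by (simp add: F_def mult.commute)
  have "fourier_approx g A f F"
    unfolding fourier_approx_def
  proof (intro conjI allI)
    show "f \<in> borel_measurable borel" unfolding f_def[abs_def] by measurable
    show "F \<in> borel_measurable borel" unfolding F_def[abs_def] by measurable
    show "0 \<le> F X" for X by (simp add: F_def)
    show "AE X in lborel. (\<lambda>K. ft 1 (\<lambda>p. indicator (A K) p *\<^sub>R g p) X) \<longlonglongrightarrow> f X"
      using Sae
    proof eventually_elim
      case (elim X)
      have "summable (\<lambda>j. cmod (fj j X))"
        by (rule summable_comparison_test'[OF sums_summable[OF geo[of X]], of 0]) (use fjb[OF elim] in simp)
      then have "summable (\<lambda>j. fj j X)" by (rule summable_norm_cancel)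
      then have "convergent (\<lambda>K. \<Sum>j\<le>K. fj j X)" using summable_LIMSEQ' convergentI by blast
      then show ?case unfolding fsum f_def by (rule convergent_LIMSEQ_iff[THEN iffD1])
    qed
    show "AE X in lborel. \<forall>K. cmod (ft 1 (\<lambda>p. indicator (A K) p *\<^sub>R g p) X) \<le> F X"
      using Sae
    proof eventually_elim
      case (elim X)
      have "cmod (\<Sum>j\<le>K. fj j X) \<le> F X" for K
      proof -
        have "cmod (\<Sum>j\<le>K. fj j X) \<le> (\<Sum>j\<le>K. sqrt (enn2real (S X)) * (1 / 2) ^ j)"
          by (rule order_trans[OF norm_sum sum_mono[OF fjb[OF elim]]])
        also have "\<dots> \<le> (\<Sum>j. sqrt (enn2real (S X)) * (1 / 2) ^ j)"
          by (rule sum_le_suminf[OF sums_summable[OF geo[of X]]]) auto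
        also have "\<dots> = F X" using sums_unique[OF geo[of X]] by simp
        finally show ?thesis .
      qed
      then show ?case unfolding fsum by blast
    qed
    have "(\<integral>\<^sup>+X. ennreal ((F X)\<^sup>2 * decay X) \<partial>lborel) \<le> (\<integral>\<^sup>+X. 4 * (S X * ennreal (decay X)) \<partial>lborel)"
    proof (rule nn_integral_mono)
      fix X :: 'a
      have "(F X)\<^sup>2 = 4 * enn2real (S X)" by (simp add: F_def power_mult_distrib)
      then have "ennreal ((F X)\<^sup>2 * decay X) = 4 * (ennreal (enn2real (S X)) * ennreal (decay X))"
        by (simp add: ennreal_mult mult.assoc)
      also have "\<dots> \<le> 4 * (S X * ennreal (decay X))"
        by (intro mult_left_mono mult_right_mono) (auto simp: enn2real_le_iff ennreal_enn2real_if)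
      finally show "ennreal ((F X)\<^sup>2 * decay X) \<le> 4 * (S X * ennreal (decay X))" .
    qed
    also have "\<dots> = 4 * (\<integral>\<^sup>+X. S X * ennreal (decay X) \<partial>lborel)" by (rule nn_integral_cmult) measurable
    also have "\<dots> < \<infinity>" using Sfin by (simp add: ennreal_mult_less_top)
    finally show "(\<integral>\<^sup>+X. ennreal ((F X)\<^sup>2 * decay X) \<partial>lborel) < \<infinity>" .
  qed (use Aint Aev in auto)
  then show ?thesis by blast
qed

end

section \<open>Products and sharp time cutoffs on the Fourier side\<close>

lemma ft_multiplication:
  fixes f g :: "'a::euclidean_space \<Rightarrow> complex"
  assumes f: "integrable lborel f" and g: "integrable lborel g"
  shows "(LINT p|lborel. f p * ft \<sigma> g p) = (LINT x|lborel. ft \<sigma> f x * g x)"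
proof -
  let ?\<Phi> = "\<lambda>p x. cis (\<sigma> * (x \<bullet> p)) * (f p * g x)"
  have [measurable]: "f \<in> borel_measurable borel" "g \<in> borel_measurable borel"
    using borel_measurable_integrable[OF f] borel_measurable_integrable[OF g] by simp_all
  have int: "integrable (lborel \<Otimes>\<^sub>M lborel) (\<lambda>(p, x). ?\<Phi> p x)"
  proof -
    have "integrable (lborel \<Otimes>\<^sub>M lborel) (\<lambda>z. cis (\<sigma> * (snd z \<bullet> fst z)) * (case z of (p, x) \<Rightarrow> f p * g x))"
      by (rule integrable_cis_mult[OF integrable_prod_mult[OF f g]]) measurable
    then show ?thesis by (simp add: case_prod_beta')
  qed
  have "(LINT p|lborel. f p * ft \<sigma> g p) = (LINT p|lborel. LINT x|lborel. ?\<Phi> p x)"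
    unfolding ft_def by (subst integral_mult_right_zero[symmetric]) (simp add: mult_ac)
  also have "\<dots> = (LINT x|lborel. LINT p|lborel. ?\<Phi> p x)"
    by (rule lborel_pair.Fubini_integral[symmetric, OF int])
  also have "\<dots> = (LINT x|lborel. ft \<sigma> f x * g x)"
    unfolding ft_def by (subst integral_mult_left_zero[symmetric]) (simp add: mult_ac inner_commute)
  finally show ?thesis .
qed

lemma integrable_convolution:
  fixes f g :: "'a::euclidean_space \<Rightarrow> complex"
  assumes f: "integrable lborel f" and g: "integrable lborel g"
  shows "integrable (lborel \<Otimes>\<^sub>M lborel) (\<lambda>(p, P). f p * g (P - p))"
proof (rule lborel_pair.Fubini_integrable)
  have [measurable]: "f \<in> borel_measurable borel" "g \<in> borel_measurable borel"
    using borel_measurable_integrable[OF f] borel_measurable_integrable[OF g] by simp_all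
  show "(\<lambda>(p, P). f p * g (P - p)) \<in> borel_measurable (lborel \<Otimes>\<^sub>M lborel)" by measurable
  have gi: "integrable lborel (\<lambda>P. g (P - p))" for p
    using lborel_integrable_translate[OF g, of "- p"] by (simp add: add.commute)
  then show "AE p in lborel. integrable lborel (\<lambda>P. case (p, P) of (p, P) \<Rightarrow> f p * g (P - p))"
    by simp
  have "(LINT P|lborel. norm (g (P - p))) = (LINT P|lborel. norm (g P))" for p
    using lborel_integral_translate[of "\<lambda>P. norm (g P)" "- p"] by (simp add: add.commute)
  then show "integrable lborel (\<lambda>p. LINT P|lborel. norm (case (p, P) of (p, P) \<Rightarrow> f p * g (P - p)))"
    using f by (simp add: norm_mult)
qed

lemma ft_convolution:
  fixes f g :: "'a::euclidean_space \<Rightarrow> complex"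
  assumes f: "integrable lborel f" and g: "integrable lborel g"
  shows "integrable lborel (\<lambda>P. LINT p|lborel. f p * g (P - p))"
    and "ft \<sigma> (\<lambda>P. LINT p|lborel. f p * g (P - p)) X = ft \<sigma> f X * ft \<sigma> g X"
proof -
  note int = integrable_convolution[OF f g]
  show "integrable lborel (\<lambda>P. LINT p|lborel. f p * g (P - p))"
    by (rule lborel_pair.integrable_snd[OF int])
  have [measurable]: "f \<in> borel_measurable borel" "g \<in> borel_measurable borel"
    using borel_measurable_integrable[OF f] borel_measurable_integrable[OF g] by simp_all
  let ?\<Phi> = "\<lambda>p P. cis (\<sigma> * (P \<bullet> X)) * (f p * g (P - p))"
  have int': "integrable (lborel \<Otimes>\<^sub>M lborel) (\<lambda>(p, P). ?\<Phi> p P)"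
  proof -
    have "integrable (lborel \<Otimes>\<^sub>M lborel) (\<lambda>z. cis (\<sigma> * (snd z \<bullet> X)) * (case z of (p, P) \<Rightarrow> f p * g (P - p)))"
      by (rule integrable_cis_mult[OF int]) measurable
    then show ?thesis by (simp add: case_prod_beta')
  qed
  have "ft \<sigma> (\<lambda>P. LINT p|lborel. f p * g (P - p)) X = (LINT P|lborel. LINT p|lborel. ?\<Phi> p P)"
    unfolding ft_def by (simp only: integral_mult_right_zero)
  also have "\<dots> = (LINT p|lborel. LINT P|lborel. ?\<Phi> p P)"
    by (rule lborel_pair.Fubini_integral[OF int'])
  also have "\<dots> = (LINT p|lborel. (cis (\<sigma> * (p \<bullet> X)) * f p) * ft \<sigma> g X)"
  proof (rule Bochner_Integration.integral_cong[OF refl])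
    fix p :: 'a
    have "(LINT P|lborel. ?\<Phi> p P) = (LINT P|lborel. ?\<Phi> p (p + P))"
      by (rule lborel_integral_translate[symmetric]) measurable
    also have "\<dots> = (LINT P|lborel. (cis (\<sigma> * (p \<bullet> X)) * f p) * (cis (\<sigma> * (P \<bullet> X)) * g P))"
    proof (rule Bochner_Integration.integral_cong[OF refl])
      fix P
      have "cis (\<sigma> * ((p + P) \<bullet> X)) = cis (\<sigma> * (p \<bullet> X)) * cis (\<sigma> * (P \<bullet> X))"
        by (simp add: cis_mult inner_left_distrib distrib_left)
      then show "?\<Phi> p (p + P) = (cis (\<sigma> * (p \<bullet> X)) * f p) * (cis (\<sigma> * (P \<bullet> X)) * g P)"
        by (simp only: add_diff_cancel_left' mult_ac)
    qed
    also have "\<dots> = (cis (\<sigma> * (p \<bullet> X)) * f p) * ft \<sigma> g X"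
      unfolding ft_def by (rule integral_mult_right_zero)
    finally show "(LINT P|lborel. ?\<Phi> p P) = (cis (\<sigma> * (p \<bullet> X)) * f p) * ft \<sigma> g X" .
  qed
  also have "\<dots> = ft \<sigma> f X * ft \<sigma> g X"
    unfolding ft_def by (rule integral_mult_left_zero)
  finally show "ft \<sigma> (\<lambda>P. LINT p|lborel. f p * g (P - p)) X = ft \<sigma> f X * ft \<sigma> g X" .
qed

lemma integrable_decay_mult:
  assumes [measurable]: "F \<in> borel_measurable borel" "G \<in> borel_measurable borel"
    and F: "(\<integral>\<^sup>+X. ennreal ((F X)\<^sup>2 * decay X) \<partial>lborel) < \<infinity>" and G: "(\<integral>\<^sup>+X. ennreal ((G X)\<^sup>2 * decay X) \<partial>lborel) < \<infinity>"
  shows "integrable lborel (\<lambda>X. F X * G X * decay (X :: 'a::euclidean_space))"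
proof -
  have F': "integrable lborel (\<lambda>X. (F X)\<^sup>2 * decay X)" and G': "integrable lborel (\<lambda>X. (G X)\<^sup>2 * decay X)"
    using F G by (auto intro!: integrableI_bounded simp: abs_mult)
  show ?thesis
  proof (rule Bochner_Integration.integrable_bound[OF Bochner_Integration.integrable_add[OF F' G']])
    show "AE X in lborel. norm (F X * G X * decay X) \<le> norm ((F X)\<^sup>2 * decay X + (G X)\<^sup>2 * decay X)"
    proof (rule AE_I2)
      fix X :: 'a
      have "\<bar>F X * G X\<bar> \<le> (F X)\<^sup>2 + (G X)\<^sup>2"
        using sum_squares_bound[of "\<bar>F X\<bar>" "\<bar>G X\<bar>"] abs_ge_zero[of "F X * G X"] unfolding abs_mult power2_abs by linarith
      from mult_right_mono[OF this, of "decay X"]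
      show "norm (F X * G X * decay X) \<le> norm ((F X)\<^sup>2 * decay X + (G X)\<^sup>2 * decay X)"
        by (simp add: abs_mult distrib_right)
    qed
  qed measurable
qed

lemma fourier_approxD:
  fixes g :: "'a::euclidean_space \<Rightarrow> complex"
  assumes "fourier_approx g A f F"
  shows "A K \<in> sets borel" "integrable lborel (\<lambda>p. indicator (A K) p *\<^sub>R g p)"
    "eventually (\<lambda>K. p \<in> A K) sequentially" "f \<in> borel_measurable borel" "F \<in> borel_measurable borel" "0 \<le> F X"
    "AE X in lborel. (\<lambda>K. ft 1 (\<lambda>p. indicator (A K) p *\<^sub>R g p) X) \<longlonglongrightarrow> f X"
    "AE X in lborel. \<forall>K. cmod (ft 1 (\<lambda>p. indicator (A K) p *\<^sub>R g p) X) \<le> F X"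
    "(\<integral>\<^sup>+X. ennreal ((F X)\<^sup>2 * decay X) \<partial>lborel) < \<infinity>"
  using assms unfolding fourier_approx_def by auto

lemma fourier_approx_bound:
  assumes "fourier_approx g A f F"
  shows "AE X in lborel. cmod (f X) \<le> F X"
  using fourier_approxD(7)[OF assms] fourier_approxD(8)[OF assms]
proof eventually_elim
  case (elim X)
  then show ?case by (intro LIMSEQ_le_const2[OF tendsto_norm[OF elim(1)]]) auto
qed

text \<open>For the truncations this is the multiplication formula \<open>ft_multiplication\<close>.
  Dominated convergence passes to the limit on both sides, with a multiple of F times
  \<open>decay\<close> as majorant in space and |g ft 1 \<theta>| in frequency.\<close>

lemma fourier_approx_pairing:
  fixes g :: "'a::euclidean_space \<Rightarrow> complex"
  assumes ap: "fourier_approx g A f F" and \<theta>: "\<theta> \<in> schwartz"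
    and [measurable]: "g \<in> borel_measurable borel" and int: "integrable lborel (\<lambda>p. g p * ft 1 \<theta> p)"
  shows "integrable lborel (\<lambda>X. f X * \<theta> X)" and "(LINT X|lborel. f X * \<theta> X) = (LINT p|lborel. g p * ft 1 \<theta> p)"
proof -
  note ap' = fourier_approxD[OF ap]
  have [measurable]: "f \<in> borel_measurable borel" "F \<in> borel_measurable borel" "\<And>K. A K \<in> sets borel" "\<theta> \<in> borel_measurable borel"
    using ap' schwartz_measurable[OF \<theta>] by auto
  let ?gK = "\<lambda>K p. indicator (A K) p *\<^sub>R g p"
  let ?s = "schwartz_seminorm (2 * DIM('a)) \<theta>"
  have s0: "0 \<le> ?s" by (rule schwartz_seminorm_nonneg[OF \<theta>])
  \<comment> \<open>The constant function 1 belongs to the same weighted L^2 space, because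
    \<open>decay\<close> is integrable.\<close>
  have "integrable lborel (\<lambda>X. F X * 1 * decay X)"
    by (rule integrable_decay_mult) (use ap'(9) nn_integral_decay in auto)
  then have Fi: "integrable lborel (\<lambda>X. ?s * (F X * decay X))" by simp
  have bnd: "cmod (z * \<theta> X) \<le> ?s * (F X * decay X)" if "cmod z \<le> F X" for z X
  proof -
    have "cmod (z * \<theta> X) \<le> F X * (?s * decay X)"
      unfolding norm_mult using that ap'(6)[of X] by (intro mult_mono schwartz_le_decay0 \<theta>) auto
    then show ?thesis by (simp add: mult_ac)
  qed
  show "integrable lborel (\<lambda>X. f X * \<theta> X)"
  proof (rule Bochner_Integration.integrable_bound[OF Fi])
    show "AE X in lborel. cmod (f X * \<theta> X) \<le> norm (?s * (F X * decay X))"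
      using fourier_approx_bound[OF ap] by eventually_elim (use bnd in force)
  qed measurable
  have 1: "(\<lambda>K. LINT p|lborel. ?gK K p * ft 1 \<theta> p) \<longlonglongrightarrow> (LINT p|lborel. g p * ft 1 \<theta> p)"
  proof (rule integral_dominated_convergence)
    show "integrable lborel (\<lambda>p. cmod (g p * ft 1 \<theta> p))" using int by simp
    show "AE p in lborel. (\<lambda>K. ?gK K p * ft 1 \<theta> p) \<longlonglongrightarrow> g p * ft 1 \<theta> p"
    proof (intro AE_I2 tendsto_eventually)
      fix p
      show "\<forall>\<^sub>F K in sequentially. ?gK K p * ft 1 \<theta> p = g p * ft 1 \<theta> p"
        using ap'(3)[of p] by eventually_elim simp
    qed
    show "AE p in lborel. cmod (?gK K p * ft 1 \<theta> p) \<le> cmod (g p * ft 1 \<theta> p)" for K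
      by (intro AE_I2) (simp add: indicator_def)
  qed measurable
  have 2: "(\<lambda>K. LINT X|lborel. ft 1 (?gK K) X * \<theta> X) \<longlonglongrightarrow> (LINT X|lborel. f X * \<theta> X)"
  proof (rule integral_dominated_convergence[OF _ _ Fi])
    show "AE X in lborel. (\<lambda>K. ft 1 (?gK K) X * \<theta> X) \<longlonglongrightarrow> f X * \<theta> X"
      using ap'(7) by eventually_elim (intro tendsto_mult tendsto_const)
    show "AE X in lborel. cmod (ft 1 (?gK K) X * \<theta> X) \<le> ?s * (F X * decay X)" for K
      using ap'(8) by eventually_elim (use bnd in blast)
  qed measurable
  have "(LINT p|lborel. ?gK K p * ft 1 \<theta> p) = (LINT X|lborel. ft 1 (?gK K) X * \<theta> X)" for K
    by (rule ft_multiplication[OF ap'(2) schwartz_integrable[OF \<theta>]])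
  then show "(LINT X|lborel. f X * \<theta> X) = (LINT p|lborel. g p * ft 1 \<theta> p)"
    using 1 2 by (simp add: LIMSEQ_unique)
qed

section \<open>The transform of a sharp cutoff in time\<close>

definition cutoff_kernel :: "real \<Rightarrow> real \<Rightarrow> complex" where
  "cutoff_kernel T \<sigma> = (LINT t|lborel. indicator {0<..<T} t *\<^sub>R cis (- (t * \<sigma>)))"

lemma cutoff_kernel_measurable [measurable]: "cutoff_kernel T \<in> borel_measurable borel"
  unfolding cutoff_kernel_def[abs_def] by measurable

text \<open>The trivial bound T and the bound 2 / |\<sigma>| from the explicit antiderivative are
  combined; 3 T is T + 2 T.\<close>

lemma cutoff_kernel_bound:
  assumes T: "0 < T"
  shows "cmod (cutoff_kernel T \<sigma>) \<le> 3 * T / (1 + T * \<bar>\<sigma>\<bar>)"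
proof -
  have i: "integrable lborel (\<lambda>t. indicator {0<..<T} t :: real)" by (rule integrable_real_indicator) (use T in auto)
  have "cmod (cutoff_kernel T \<sigma>) \<le> (LINT t|lborel. indicator {0<..<T} t)"
    unfolding cutoff_kernel_def
  proof (rule bochner_norm_bound[OF _ i])
    show "integrable lborel (\<lambda>t. indicator {0<..<T} t *\<^sub>R cis (- (t * \<sigma>)))"
      by (rule Bochner_Integration.integrable_bound[OF i]) auto
  qed simp
  then have b1: "cmod (cutoff_kernel T \<sigma>) \<le> T" using T by simp
  have b2: "cmod (cutoff_kernel T \<sigma>) * \<bar>\<sigma>\<bar> \<le> 2"
  proof (cases "\<sigma> = 0")
    case False
    let ?F = "\<lambda>t. cis (- (t * \<sigma>)) / (- \<i> * complex_of_real \<sigma>)"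
    have "cutoff_kernel T \<sigma> = (LINT t|lborel. indicator {0..T} t *\<^sub>R cis (- (t * \<sigma>)))"
      unfolding cutoff_kernel_def
    proof (rule integral_cong_AE)
      show "AE t in lborel. indicator {0<..<T} t *\<^sub>R cis (- (t * \<sigma>)) = indicator {0..T} t *\<^sub>R cis (- (t * \<sigma>))"
        using AE_lborel_singleton[of 0] AE_lborel_singleton[of T] by eventually_elim (auto simp: indicator_def)
    qed measurable
    also have "\<dots> = ?F T - ?F 0"
    proof (rule integral_FTC_Icc)
      show "0 \<le> T" using T by simp
      show "continuous_on {0..T} (\<lambda>t. cis (- (t * \<sigma>)))" by (intro continuous_intros)
      fix t assume "0 \<le> t" "t \<le> T"
      have "((\<lambda>t. exp (- \<i> * complex_of_real \<sigma> * complex_of_real t) / (- \<i> * complex_of_real \<sigma>)) has_vector_derivative exp (- \<i> * complex_of_real \<sigma> * complex_of_real t)) (at t within {0..T})"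
        using False by (auto intro!: derivative_eq_intros has_vector_derivative_real_field)
      then show "(?F has_vector_derivative cis (- (t * \<sigma>))) (at t within {0..T})"
        by (simp add: cis_conv_exp mult_ac)
    qed
    finally have "cmod (cutoff_kernel T \<sigma>) \<le> cmod (?F T) + cmod (?F 0)" using norm_triangle_ineq4 by metis
    then show ?thesis using False by (simp add: norm_divide norm_mult field_simps)
  qed simp
  have "cmod (cutoff_kernel T \<sigma>) * (1 + T * \<bar>\<sigma>\<bar>) = cmod (cutoff_kernel T \<sigma>) + T * (cmod (cutoff_kernel T \<sigma>) * \<bar>\<sigma>\<bar>)"
    by (simp add: algebra_simps)
  also have "\<dots> \<le> T + T * 2" by (intro add_mono b1 mult_left_mono b2) (use T in auto)
  finally have "cmod (cutoff_kernel T \<sigma>) * (1 + T * \<bar>\<sigma>\<bar>) \<le> 3 * T" by simp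
  moreover have "0 < 1 + T * \<bar>\<sigma>\<bar>" using T by (simp add: add_pos_nonneg)
  ultimately show ?thesis by (simp add: pos_le_divide_eq)
qed

lemma decay_Pair_le:
  "decay ((x :: 'a::euclidean_space), (t :: real)) \<le> decay x * decay t"
proof -
  have "1 + norm x \<le> 1 + norm (x, t)" "1 + norm t \<le> 1 + norm (x, t)"
    by (simp_all add: norm_Pair real_le_rsqrt)
  then have "(1 + norm x) ^ (2 * DIM('a)) * (1 + norm t) ^ 2 \<le> (1 + norm (x, t)) ^ (2 * DIM('a)) * (1 + norm (x, t)) ^ 2"
    by (intro mult_mono power_mono) (auto intro: add_nonneg_nonneg)
  then have "(1 + norm x) ^ (2 * DIM('a)) * (1 + norm t) ^ 2 \<le> (1 + norm (x, t)) ^ (2 * DIM('a \<times> real))"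
    by (simp add: power_add[symmetric])
  moreover have "0 < (1 + norm x) ^ (2 * DIM('a)) * (1 + norm t) ^ 2"
    by (intro mult_pos_pos zero_less_power) (auto intro: add_pos_nonneg)
  ultimately show ?thesis unfolding decay_def by (simp add: divide_left_mono frac_le)
qed

text \<open>Only the inversion in the space variable is needed.\<close>

lemma ft_cutoff:
  fixes \<psi> :: "'a::euclidean_space \<times> real \<Rightarrow> complex"
  assumes \<psi>: "\<psi> \<in> schwartz" and T: "0 < T"
  shows "ft 1 (\<lambda>X. indicator (UNIV \<times> {0<..<T}) X *\<^sub>R ft (-1) \<psi> X) (\<xi>, \<tau>')
    = complex_of_real ((2 * pi) ^ DIM('a)) * (LINT \<tau>|lborel. cutoff_kernel T (\<tau> - \<tau>') * \<psi> (\<xi>, \<tau>))"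
proof -
  let ?F = "ft (-1) \<psi>"
  have F: "?F \<in> schwartz" by (rule ft_schwartz[OF \<psi>]) simp
  note [measurable] = schwartz_measurable[OF \<psi>] schwartz_measurable[OF F]
  \<comment> \<open>The transform in the time variable alone. The full transform at (x, t) is the
    spatial transform of \<open>\<Psi> t\<close>, so the integral over x is undone by inversion,
    while the one over (0, T) stays and becomes the kernel.\<close>
  define \<Psi> where "\<Psi> t \<eta> = (LINT \<tau>|lborel. cis (- (t * \<tau>)) * \<psi> (\<eta>, \<tau>))" for t \<eta>
  obtain C where C: "0 \<le> C" "\<And>x t. cmod (\<psi> (x, t)) \<le> C * (decay x * decay t)" "\<And>x t. cmod (?F (x, t)) \<le> C * (decay x * decay t)"
  proof
    let ?C = "schwartz_seminorm (2 * DIM('a \<times> real)) \<psi> + schwartz_seminorm (2 * DIM('a \<times> real)) ?F"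
    have n: "0 \<le> schwartz_seminorm (2 * DIM('a \<times> real)) \<psi>" "0 \<le> schwartz_seminorm (2 * DIM('a \<times> real)) ?F"
      using \<psi> F by (simp_all only: schwartz_seminorm_nonneg)
    show "0 \<le> ?C" using n by simp
    fix x :: 'a and t :: real
    show "cmod (\<psi> (x, t)) \<le> ?C * (decay x * decay t)"
      by (rule order_trans[OF schwartz_le_decay0[OF \<psi>] mult_mono[OF _ decay_Pair_le]]) (use n in auto)
    show "cmod (?F (x, t)) \<le> ?C * (decay x * decay t)"
      by (rule order_trans[OF schwartz_le_decay0[OF F] mult_mono[OF _ decay_Pair_le]]) (use n in auto)
  qed
  have \<psi>i: "integrable lborel (\<lambda>\<tau>. \<psi> (\<eta>, \<tau>))" for \<eta>
  proof (rule Bochner_Integration.integrable_bound)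
    show "integrable lborel (\<lambda>t::real. C * (decay \<eta> * decay t))" by (intro integrable_mult_right integrable_decay)
    show "AE t in lborel. cmod (\<psi> (\<eta>, t)) \<le> norm (C * (decay \<eta> * decay t))"
      using C by (intro AE_I2) (simp add: abs_mult)
  qed measurable
  have Fi: "integrable lborel (\<lambda>x. ?F (x, t))" for t
  proof (rule Bochner_Integration.integrable_bound)
    show "integrable lborel (\<lambda>x::'a. C * (decay x * decay t))" by (intro integrable_mult_right integrable_mult_left integrable_decay)
    show "AE x in lborel. cmod (?F (x, t)) \<le> norm (C * (decay x * decay t))"
      using C by (intro AE_I2) (simp add: abs_mult)
  qed measurable
  have \<psi>pair: "integrable (lborel \<Otimes>\<^sub>M lborel) \<psi>" unfolding lborel_prod by (rule schwartz_integrable[OF \<psi>])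
  have ci: "integrable lborel (\<lambda>\<tau>. cis (- (t * \<tau>)) * \<psi> (\<eta>, \<tau>))" for t \<eta>
    by (rule integrable_cis_mult[OF \<psi>i]) measurable
  have \<Psi>b: "cmod (\<Psi> t \<eta>) \<le> (LINT \<tau>|lborel. C * (decay \<eta> * decay (\<tau>::real)))" for t \<eta>
    unfolding \<Psi>_def
    by (rule bochner_norm_bound[OF ci]) (use C in \<open>auto simp: norm_mult intro!: integrable_mult_right integrable_decay\<close>)
  have \<Psi>m [measurable]: "\<Psi> t \<in> borel_measurable borel" for t
    unfolding \<Psi>_def[abs_def] by measurable
  have \<Psi>b': "cmod (\<Psi> t \<eta>) \<le> C * (LINT \<tau>|lborel. decay (\<tau>::real)) * decay \<eta>" for t \<eta>
    using \<Psi>b[of t \<eta>] by (simp add: mult_ac)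
  have C': "0 \<le> C * (LINT \<tau>|lborel. decay (\<tau>::real))" using C(1) by simp
  have \<Psi>i: "integrable lborel (\<Psi> t)" for t
  proof (rule Bochner_Integration.integrable_bound)
    show "integrable lborel (\<lambda>\<eta>::'a. C * (LINT \<tau>|lborel. decay (\<tau>::real)) * decay \<eta>)" by (intro integrable_mult_right integrable_decay)
    show "AE \<eta> in lborel. cmod (\<Psi> t \<eta>) \<le> norm (C * (LINT \<tau>|lborel. decay (\<tau>::real)) * decay \<eta>)"
      unfolding real_norm_def by (intro AE_I2 order_trans[OF \<Psi>b' abs_ge_self])
  qed measurable
  \<comment> \<open>Continuity enters because inversion is applied at the single point
    \<xi>.\<close>
  have \<Psi>c: "continuous_on UNIV (\<Psi> t)" for t
    unfolding continuous_on_sequentially comp_def \<Psi>_def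
  proof (intro allI ballI impI, elim conjE)
    fix e :: "nat \<Rightarrow> 'a" and \<eta> assume e: "e \<longlonglongrightarrow> \<eta>"
    show "(\<lambda>k. LINT \<tau>|lborel. cis (- (t * \<tau>)) * \<psi> (e k, \<tau>)) \<longlonglongrightarrow> (LINT \<tau>|lborel. cis (- (t * \<tau>)) * \<psi> (\<eta>, \<tau>))"
    proof (rule integral_dominated_convergence)
      show "integrable lborel (\<lambda>\<tau>::real. C * decay \<tau>)" by (intro integrable_mult_right integrable_decay)
      show "AE \<tau> in lborel. (\<lambda>k. cis (- (t * \<tau>)) * \<psi> (e k, \<tau>)) \<longlonglongrightarrow> cis (- (t * \<tau>)) * \<psi> (\<eta>, \<tau>)"
      proof (intro AE_I2 tendsto_mult tendsto_const)
        fix \<tau>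
        have "isCont \<psi> (\<eta>, \<tau>)" using schwartz_continuous[OF \<psi>] by (simp add: continuous_on_eq_continuous_at)
        then show "(\<lambda>k. \<psi> (e k, \<tau>)) \<longlonglongrightarrow> \<psi> (\<eta>, \<tau>)"
          by (rule isCont_tendsto_compose) (intro tendsto_Pair e tendsto_const)
      qed
      have "cmod (\<psi> (x, \<tau>)) \<le> C * decay \<tau>" for x \<tau>
      proof -
        have "decay x * decay \<tau> \<le> 1 * decay \<tau>" by (intro mult_right_mono decay_le_1) auto
        then show ?thesis using C(2)[of x \<tau>] mult_left_mono[OF _ C(1)] by (metis mult_1 order_trans)
      qed
      then show "AE \<tau> in lborel. cmod (cis (- (t * \<tau>)) * \<psi> (e k, \<tau>)) \<le> C * decay \<tau>" for k
        by (simp add: norm_mult)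
    qed measurable
  qed
  have F\<Psi>: "?F (x, t) = ft (-1) (\<Psi> t) x" for x t
  proof -
    have int: "integrable (lborel \<Otimes>\<^sub>M lborel) (\<lambda>(\<eta>, \<tau>). cis (- (x \<bullet> \<eta> + t * \<tau>)) * \<psi> (\<eta>, \<tau>))"
    proof -
      have "integrable (lborel \<Otimes>\<^sub>M lborel) (\<lambda>z. cis (- (x \<bullet> fst z + t * snd z)) * \<psi> z)"
        by (rule integrable_cis_mult[OF \<psi>pair]) measurable
      then show ?thesis by (simp add: case_prod_beta')
    qed
    have "?F (x, t) = (LINT z|(lborel \<Otimes>\<^sub>M lborel). (case z of (\<eta>, \<tau>) \<Rightarrow> cis (- (x \<bullet> \<eta> + t * \<tau>)) * \<psi> (\<eta>, \<tau>)))"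
      unfolding ft_def lborel_prod by (simp add: case_prod_beta' inner_prod_def inner_commute mult.commute[of t])
    also have "\<dots> = (LINT \<eta>|lborel. LINT \<tau>|lborel. cis (- (x \<bullet> \<eta> + t * \<tau>)) * \<psi> (\<eta>, \<tau>))"
      using lborel_pair.integral_fst[OF int] by simp
    also have "\<dots> = (LINT \<eta>|lborel. cis (- 1 * (\<eta> \<bullet> x)) * \<Psi> t \<eta>)"
    proof (rule Bochner_Integration.integral_cong[OF refl])
      fix \<eta> :: 'a
      have "cis (- (x \<bullet> \<eta> + t * \<tau>)) = cis (- 1 * (\<eta> \<bullet> x)) * cis (- (t * \<tau>))" for \<tau>
        by (simp add: cis_mult inner_commute)
      then show "(LINT \<tau>|lborel. cis (- (x \<bullet> \<eta> + t * \<tau>)) * \<psi> (\<eta>, \<tau>)) = cis (- 1 * (\<eta> \<bullet> x)) * \<Psi> t \<eta>"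
        unfolding \<Psi>_def by (simp only: mult.assoc integral_mult_right_zero)
    qed
    finally show ?thesis by (simp add: ft_def)
  qed
  have inv: "(LINT x|lborel. cis (x \<bullet> \<xi>) * ?F (x, t)) = complex_of_real ((2 * pi) ^ DIM('a)) * \<Psi> t \<xi>" for t
  proof -
    have "ft 1 (ft (- 1) (\<Psi> t)) \<xi> = complex_of_real ((2 * pi) ^ DIM('a)) * \<Psi> t \<xi>"
    proof (rule ft_inversion[OF _ \<Psi>i \<Psi>c])
      show "cmod (\<Psi> t x) \<le> C * (LINT \<tau>|lborel. decay (\<tau>::real))" for x
        using \<Psi>b'[of t x] mult_left_mono[OF decay_le_1[of x] C'] by simp
      show "integrable lborel (ft (- 1) (\<Psi> t))" using Fi[of t] unfolding F\<Psi> by simp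
    qed simp
    then show ?thesis by (simp add: ft_def[of 1] F\<Psi>)
  qed
  let ?G = "\<lambda>x t. cis (x \<bullet> \<xi> + t * \<tau>') * (indicator {0<..<T} t *\<^sub>R ?F (x, t))"
  have intG: "integrable (lborel \<Otimes>\<^sub>M lborel) (\<lambda>(x, t). ?G x t)"
  proof -
    have "integrable (lborel \<Otimes>\<^sub>M lborel) (\<lambda>z. cis (fst z \<bullet> \<xi> + snd z * \<tau>') * (indicator {0<..<T} (snd z) *\<^sub>R ?F z))"
    proof (rule integrable_cis_mult)
      show "integrable (lborel \<Otimes>\<^sub>M lborel) (\<lambda>z. indicator {0<..<T} (snd z) *\<^sub>R ?F z)"
      proof (rule Bochner_Integration.integrable_bound)
        show *: "integrable (lborel \<Otimes>\<^sub>M lborel) ?F" unfolding lborel_prod by (rule schwartz_integrable[OF F])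
        note [measurable] = borel_measurable_integrable[OF *]
        show "(\<lambda>z. indicator {0<..<T} (snd z) *\<^sub>R ?F z) \<in> borel_measurable (lborel \<Otimes>\<^sub>M lborel)" by measurable
      qed (auto simp: indicator_def)
    qed measurable
    then show ?thesis by (simp add: case_prod_beta')
  qed
  have "ft 1 (\<lambda>X. indicator (UNIV \<times> {0<..<T}) X *\<^sub>R ?F X) (\<xi>, \<tau>') = (LINT z|(lborel \<Otimes>\<^sub>M lborel). (case z of (x, t) \<Rightarrow> ?G x t))"
    unfolding ft_def lborel_prod by (simp add: case_prod_beta' inner_prod_def indicator_times)
  also have "\<dots> = (LINT t|lborel. LINT x|lborel. ?G x t)"
    using lborel_pair.integral_snd[OF intG] by simp
  also have "\<dots> = (LINT t|lborel. complex_of_real ((2 * pi) ^ DIM('a)) * (LINT \<tau>|lborel. (indicator {0<..<T} t *\<^sub>R cis (- (t * (\<tau> - \<tau>')))) * \<psi> (\<xi>, \<tau>)))"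
  proof (rule Bochner_Integration.integral_cong[OF refl])
    fix t
    have "cis (x \<bullet> \<xi> + t * \<tau>') = cis (t * \<tau>') * cis (x \<bullet> \<xi>)" for x by (simp add: cis_mult add.commute)
    then have "(LINT x|lborel. ?G x t) = (LINT x|lborel. (indicator {0<..<T} t *\<^sub>R cis (t * \<tau>')) * (cis (x \<bullet> \<xi>) * ?F (x, t)))"
      by (simp add: mult_ac)
    also have "\<dots> = (indicator {0<..<T} t *\<^sub>R cis (t * \<tau>')) * (LINT x|lborel. cis (x \<bullet> \<xi>) * ?F (x, t))"
      by (rule integral_mult_right_zero)
    also have "\<dots> = complex_of_real ((2 * pi) ^ DIM('a)) * ((indicator {0<..<T} t *\<^sub>R cis (t * \<tau>')) * \<Psi> t \<xi>)"
      unfolding inv by (simp only: mult_ac)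
    also have "(indicator {0<..<T} t *\<^sub>R cis (t * \<tau>')) * \<Psi> t \<xi> = (LINT \<tau>|lborel. (indicator {0<..<T} t *\<^sub>R cis (- (t * (\<tau> - \<tau>')))) * \<psi> (\<xi>, \<tau>))"
    proof -
      have "cis (- (t * (\<tau> - \<tau>'))) = cis (t * \<tau>') * cis (- (t * \<tau>))" for \<tau>
        by (simp add: cis_mult algebra_simps)
      then show ?thesis
        unfolding \<Psi>_def integral_mult_right_zero[symmetric] by (simp add: mult_ac)
    qed
    finally show "(LINT x|lborel. ?G x t) = complex_of_real ((2 * pi) ^ DIM('a)) * (LINT \<tau>|lborel. (indicator {0<..<T} t *\<^sub>R cis (- (t * (\<tau> - \<tau>')))) * \<psi> (\<xi>, \<tau>))" .
  qed
  also have "\<dots> = complex_of_real ((2 * pi) ^ DIM('a)) * (LINT t|lborel. LINT \<tau>|lborel. (indicator {0<..<T} t *\<^sub>R cis (- (t * (\<tau> - \<tau>')))) * \<psi> (\<xi>, \<tau>))"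
    by (rule integral_mult_right_zero)
  also have "(LINT t|lborel. LINT \<tau>|lborel. (indicator {0<..<T} t *\<^sub>R cis (- (t * (\<tau> - \<tau>')))) * \<psi> (\<xi>, \<tau>))
    = (LINT \<tau>|lborel. LINT t|lborel. (indicator {0<..<T} t *\<^sub>R cis (- (t * (\<tau> - \<tau>')))) * \<psi> (\<xi>, \<tau>))"
  proof (rule lborel_pair.Fubini_integral[symmetric])
    have "integrable lborel (\<lambda>t. complex_of_real (indicator {0<..<T} t))" by (intro integrable_of_real integrable_real_indicator) (use T in auto)
    from integrable_prod_mult[OF this \<psi>i[of \<xi>]]
    have "integrable (lborel \<Otimes>\<^sub>M lborel) (\<lambda>z. cis (- (fst z * (snd z - \<tau>'))) * (case z of (t, \<tau>) \<Rightarrow> complex_of_real (indicator {0<..<T} t) * \<psi> (\<xi>, \<tau>)))"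
      by (rule integrable_cis_mult) measurable
    then show "integrable (lborel \<Otimes>\<^sub>M lborel) (\<lambda>(t, \<tau>). (indicator {0<..<T} t *\<^sub>R cis (- (t * (\<tau> - \<tau>')))) * \<psi> (\<xi>, \<tau>))"
      by (simp add: case_prod_beta' scaleR_conv_of_real mult_ac)
  qed
  also have "\<dots> = (LINT \<tau>|lborel. cutoff_kernel T (\<tau> - \<tau>') * \<psi> (\<xi>, \<tau>))"
    unfolding cutoff_kernel_def by (simp only: integral_mult_left_zero)
  finally show ?thesis .
qed

text \<open>A function that is not integrable has Bochner integral 0 by convention. The bound can
  therefore be used for convolutions before their convergence is known.\<close>

lemma norm_integral_le_nn_integral:
  fixes f :: "'a \<Rightarrow> 'b::{banach,second_countable_topology}"
  shows "ennreal (norm (LINT x|M. f x)) \<le> (\<integral>\<^sup>+x. ennreal (norm (f x)) \<partial>M)"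
  by (cases "integrable M f") (auto simp: integral_norm_bound_ennreal not_integrable_integral_eq)

text \<open>For the truncated transforms the convolution theorem holds exactly. On the space side
  the limit is dominated by a multiple of F1 F2 \<open>decay\<close>; on the frequency side by
  \<open>Kp\<close> times |J|, whose integrability is the hypothesis \<open>H\<close> read after
  Fubini. Finally the kernel, which acts on \<psi> inside \<open>J\<close>, is transposed onto the
  convolution \<open>K\<close>.\<close>

lemma product_cutoff:
  fixes g1 g2 :: "'a::euclidean_space \<times> real \<Rightarrow> complex"
  assumes ap1: "fourier_approx g1 A1 f1 F1" and ap2: "fourier_approx g2 A2 f2 F2"
    and [measurable]: "g1 \<in> borel_measurable borel" "g2 \<in> borel_measurable borel"
    and \<psi>: "\<psi> \<in> schwartz" and T: "0 < T"
    and K_def: "\<And>P. K P = (LINT p|lborel. g1 p * g2 (P - p))"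
    and Kp_def: "\<And>P. Kp P = (\<integral>\<^sup>+p. ennreal (cmod (g1 p) * cmod (g2 (P - p))) \<partial>lborel)"
    and w_def: "\<And>\<xi> \<tau>. w (\<xi>, \<tau>) = (LINT \<tau>'|lborel. cutoff_kernel T (\<tau> - \<tau>') * K (\<xi>, \<tau>'))"
    and fin: "AE P in lborel. Kp P < \<infinity>"
    and H: "(\<integral>\<^sup>+\<xi>. \<integral>\<^sup>+\<tau>. ennreal (cmod (\<psi> (\<xi>, \<tau>))) * (\<integral>\<^sup>+\<tau>'. ennreal (cmod (cutoff_kernel T (\<tau> - \<tau>'))) * Kp (\<xi>, \<tau>') \<partial>lborel) \<partial>lborel \<partial>lborel) < \<infinity>"
  shows "integrable lborel (\<lambda>z. w z * \<psi> z)"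
    and "(LINT X|lborel. indicator (UNIV \<times> {0<..<T}) X *\<^sub>R (f1 X * f2 X * ft (-1) \<psi> X))
      = complex_of_real ((2 * pi) ^ DIM('a)) * (LINT z|lborel. w z * \<psi> z)"
proof -
  note a1 = fourier_approxD[OF ap1] and a2 = fourier_approxD[OF ap2]
  let ?D = "cutoff_kernel T" and ?c = "complex_of_real ((2 * pi) ^ DIM('a))"
  let ?g1 = "\<lambda>k p. indicator (A1 k) p *\<^sub>R g1 p" and ?g2 = "\<lambda>k p. indicator (A2 k) p *\<^sub>R g2 p"
  let ?F = "ft (-1) \<psi>"
  let ?S = "UNIV \<times> {0<..<T} :: ('a \<times> real) set"
  let ?FS = "\<lambda>X. indicator ?S X *\<^sub>R ?F X"
  define J where "J = ft 1 ?FS"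
  define kk where "kk k P = (LINT p|lborel. ?g1 k p * ?g2 k (P - p))" for k P
  have F: "?F \<in> schwartz" by (rule ft_schwartz[OF \<psi>]) simp
  have "open ?S" by (intro open_Times) auto
  then have [measurable]: "?S \<in> sets borel" by simp
  have [measurable]: "f1 \<in> borel_measurable borel" "f2 \<in> borel_measurable borel" "F1 \<in> borel_measurable borel" "F2 \<in> borel_measurable borel"
    "\<And>k. A1 k \<in> sets borel" "\<And>k. A2 k \<in> sets borel"
    using a1 a2 by auto
  note [measurable] = schwartz_measurable[OF \<psi>] schwartz_measurable[OF F]
  have Km [measurable]: "K \<in> borel_measurable borel" unfolding K_def[abs_def] by measurable
  have Kpm [measurable]: "Kp \<in> borel_measurable borel" unfolding Kp_def[abs_def] by measurable
  have Jm [measurable]: "J \<in> borel_measurable borel" unfolding J_def by measurable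
  have w_eq: "w = (\<lambda>z. LINT \<tau>'|lborel. ?D (snd z - \<tau>') * K (fst z, \<tau>'))"
    using w_def by (auto simp: fun_eq_iff)
  have wm': "(\<lambda>z. LINT \<tau>'|lborel. ?D (snd z - \<tau>') * K (fst z, \<tau>')) \<in> borel_measurable (lborel \<Otimes>\<^sub>M lborel)"
    by measurable
  then have wm [measurable]: "w \<in> borel_measurable borel" unfolding w_eq lborel_prod by simp
  have KKp: "ennreal (cmod (K P)) \<le> Kp P" for P
    unfolding K_def Kp_def norm_mult[symmetric] by (rule norm_integral_le_nn_integral)
  have J_eq: "J (\<xi>, \<tau>') = ?c * (LINT \<tau>|lborel. ?D (\<tau> - \<tau>') * \<psi> (\<xi>, \<tau>))" for \<xi> \<tau>'
    unfolding J_def by (rule ft_cutoff[OF \<psi> T])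
  have FSi: "integrable lborel ?FS"
    by (rule Bochner_Integration.integrable_bound[OF schwartz_integrable[OF F]]) (auto simp: indicator_def)

  \<comment> \<open>The absolute integrand of the triple integral in \<xi>, \<tau>' and \<tau>,
    whose finiteness justifies the domination and the exchanges of integrals below.\<close>
  let ?I = "\<lambda>\<xi> \<tau>' \<tau>. Kp (\<xi>, \<tau>') * (ennreal (cmod (?D (\<tau> - \<tau>'))) * ennreal (cmod (\<psi> (\<xi>, \<tau>))))"
  have H': "(\<integral>\<^sup>+\<xi>. \<integral>\<^sup>+\<tau>'. \<integral>\<^sup>+\<tau>. ?I \<xi> \<tau>' \<tau> \<partial>lborel \<partial>lborel \<partial>lborel) < \<infinity>"
  proof -
    have "(\<integral>\<^sup>+\<tau>'. \<integral>\<^sup>+\<tau>. ?I \<xi> \<tau>' \<tau> \<partial>lborel \<partial>lborel) = (\<integral>\<^sup>+\<tau>. ennreal (cmod (\<psi> (\<xi>, \<tau>))) * (\<integral>\<^sup>+\<tau>'. ennreal (cmod (?D (\<tau> - \<tau>'))) * Kp (\<xi>, \<tau>') \<partial>lborel) \<partial>lborel)" for \<xi>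
    proof -
      have "(\<integral>\<^sup>+\<tau>'. \<integral>\<^sup>+\<tau>. ?I \<xi> \<tau>' \<tau> \<partial>lborel \<partial>lborel) = (\<integral>\<^sup>+\<tau>. \<integral>\<^sup>+\<tau>'. ?I \<xi> \<tau>' \<tau> \<partial>lborel \<partial>lborel)"
        by (rule lborel_pair.Fubini'[symmetric]) measurable
      also have "\<dots> = (\<integral>\<^sup>+\<tau>. ennreal (cmod (\<psi> (\<xi>, \<tau>))) * (\<integral>\<^sup>+\<tau>'. ennreal (cmod (?D (\<tau> - \<tau>'))) * Kp (\<xi>, \<tau>') \<partial>lborel) \<partial>lborel)"
        by (subst nn_integral_cmult[symmetric]) (auto simp: mult_ac)
      finally show ?thesis .
    qed
    then show ?thesis using H by simp
  qed

  have KJ: "(\<integral>\<^sup>+P. Kp P * ennreal (cmod (J P)) \<partial>lborel) < \<infinity>"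
  proof -
    have "Kp (\<xi>, \<tau>') * ennreal (cmod (J (\<xi>, \<tau>'))) \<le> ennreal ((2 * pi) ^ DIM('a)) * (\<integral>\<^sup>+\<tau>. ?I \<xi> \<tau>' \<tau> \<partial>lborel)" for \<xi> \<tau>'
    proof -
      have "ennreal (cmod (J (\<xi>, \<tau>'))) = ennreal ((2 * pi) ^ DIM('a)) * ennreal (cmod (LINT \<tau>|lborel. ?D (\<tau> - \<tau>') * \<psi> (\<xi>, \<tau>)))"
      proof -
        have "cmod ?c = (2 * pi) ^ DIM('a)" unfolding norm_of_real by simp
        then show ?thesis unfolding J_eq norm_mult by (simp only: ennreal_mult[OF _ norm_ge_zero] zero_le_power pi_ge_zero zero_le_mult_iff zero_le_numeral simp_thms)
      qed
      also have "\<dots> \<le> ennreal ((2 * pi) ^ DIM('a)) * (\<integral>\<^sup>+\<tau>. ennreal (cmod (?D (\<tau> - \<tau>'))) * ennreal (cmod (\<psi> (\<xi>, \<tau>))) \<partial>lborel)"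
        by (intro mult_left_mono order_trans[OF norm_integral_le_nn_integral]) (auto simp: norm_mult ennreal_mult)
      finally have "Kp (\<xi>, \<tau>') * ennreal (cmod (J (\<xi>, \<tau>'))) \<le> Kp (\<xi>, \<tau>') * (ennreal ((2 * pi) ^ DIM('a)) * (\<integral>\<^sup>+\<tau>. ennreal (cmod (?D (\<tau> - \<tau>'))) * ennreal (cmod (\<psi> (\<xi>, \<tau>))) \<partial>lborel))"
        by (rule mult_left_mono) simp
      also have "\<dots> = ennreal ((2 * pi) ^ DIM('a)) * (\<integral>\<^sup>+\<tau>. ?I \<xi> \<tau>' \<tau> \<partial>lborel)"
        by (subst nn_integral_cmult) (auto simp: mult_ac)
      finally show ?thesis .
    qed
    then have "(\<integral>\<^sup>+P. Kp P * ennreal (cmod (J P)) \<partial>lborel) \<le> (\<integral>\<^sup>+\<xi>. \<integral>\<^sup>+\<tau>'. ennreal ((2 * pi) ^ DIM('a)) * (\<integral>\<^sup>+\<tau>. ?I \<xi> \<tau>' \<tau> \<partial>lborel) \<partial>lborel \<partial>lborel)"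
      by (subst nn_integral_lborel_fst) (simp_all add: lborel_prod nn_integral_mono)
    also have "\<dots> = ennreal ((2 * pi) ^ DIM('a)) * (\<integral>\<^sup>+\<xi>. \<integral>\<^sup>+\<tau>'. \<integral>\<^sup>+\<tau>. ?I \<xi> \<tau>' \<tau> \<partial>lborel \<partial>lborel \<partial>lborel)"
      by (simp add: nn_integral_cmult)
    also have "\<dots> < \<infinity>" using H' by (simp add: ennreal_mult_less_top)
    finally show ?thesis .
  qed
  have dom: "integrable lborel (\<lambda>P. enn2real (Kp P) * cmod (J P))"
  proof (rule integrableI_bounded)
    have "(\<integral>\<^sup>+P. ennreal (norm (enn2real (Kp P) * cmod (J P))) \<partial>lborel) \<le> (\<integral>\<^sup>+P. Kp P * ennreal (cmod (J P)) \<partial>lborel)"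
    proof (rule nn_integral_mono)
      fix P
      have "ennreal (enn2real (Kp P)) \<le> Kp P" by (simp add: ennreal_enn2real_if)
      then show "ennreal (norm (enn2real (Kp P) * cmod (J P))) \<le> Kp P * ennreal (cmod (J P))"
        by (simp add: ennreal_mult mult_right_mono)
    qed
    then show "(\<integral>\<^sup>+P. ennreal (norm (enn2real (Kp P) * cmod (J P))) \<partial>lborel) < \<infinity>" using KJ by (rule le_less_trans)
  qed measurable

  have L1: "(\<lambda>k. LINT P|lborel. kk k P * J P) \<longlonglongrightarrow> (LINT P|lborel. K P * J P)"
  proof (rule integral_dominated_convergence[OF _ _ dom])
    \<comment> \<open>Where the convolution of the moduli is finite, it dominates the truncated
      convolutions, and these converge.\<close>
    have kb: "(\<lambda>k. kk k P) \<longlonglongrightarrow> K P \<and> (\<forall>k. cmod (kk k P) \<le> enn2real (Kp P))" if P: "Kp P < \<infinity>" for P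
    proof -
      have i: "integrable lborel (\<lambda>p. cmod (g1 p) * cmod (g2 (P - p)))"
        using P unfolding Kp_def by (intro integrableI_bounded) auto
      have Kpr: "enn2real (Kp P) = (LINT p|lborel. cmod (g1 p) * cmod (g2 (P - p)))"
        unfolding Kp_def by (subst nn_integral_eq_integral[OF i]) (auto intro!: Bochner_Integration.integral_nonneg)
      have b: "cmod (?g1 k p * ?g2 k (P - p)) \<le> cmod (g1 p) * cmod (g2 (P - p))" for k p
        by (auto simp: norm_mult indicator_def)
      have "(\<lambda>k. kk k P) \<longlonglongrightarrow> K P"
        unfolding kk_def K_def
      proof (rule integral_dominated_convergence[OF _ _ i])
        show "AE p in lborel. (\<lambda>k. ?g1 k p * ?g2 k (P - p)) \<longlonglongrightarrow> g1 p * g2 (P - p)"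
        proof (intro AE_I2 tendsto_eventually)
          fix p
          show "\<forall>\<^sub>F k in sequentially. ?g1 k p * ?g2 k (P - p) = g1 p * g2 (P - p)"
            using a1(3)[of p] a2(3)[of "P - p"] by eventually_elim simp
        qed
        show "AE p in lborel. cmod (?g1 k p * ?g2 k (P - p)) \<le> cmod (g1 p) * cmod (g2 (P - p))" for k
          using b by simp
      qed measurable
      moreover have "cmod (kk k P) \<le> enn2real (Kp P)" for k
        unfolding kk_def Kpr
      proof (rule bochner_norm_bound[OF _ i b])
        show "integrable lborel (\<lambda>p. ?g1 k p * ?g2 k (P - p))"
          by (rule Bochner_Integration.integrable_bound[OF i]) (use b in auto)
      qed
      ultimately show ?thesis by blast
    qed
    show "AE P in lborel. (\<lambda>k. kk k P * J P) \<longlonglongrightarrow> K P * J P"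
      using fin by eventually_elim (use kb in \<open>auto intro!: tendsto_mult\<close>)
    show "AE P in lborel. cmod (kk k P * J P) \<le> enn2real (Kp P) * cmod (J P)" for k
      using fin by eventually_elim (use kb in \<open>auto simp: norm_mult intro!: mult_right_mono\<close>)
    show "(\<lambda>P. kk k P * J P) \<in> borel_measurable lborel" for k unfolding kk_def by measurable
  qed measurable

  have L2: "(\<lambda>k. LINT X|lborel. ft 1 (?g1 k) X * ft 1 (?g2 k) X * ?FS X) \<longlonglongrightarrow> (LINT X|lborel. f1 X * f2 X * ?FS X)"
  proof (rule integral_dominated_convergence)
    let ?s = "schwartz_seminorm (2 * DIM('a \<times> real)) ?F"
    show "integrable lborel (\<lambda>X. ?s * (F1 X * F2 X * decay X))"
      by (intro integrable_mult_right integrable_decay_mult) (use a1 a2 in auto)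
    show "AE X in lborel. (\<lambda>k. ft 1 (?g1 k) X * ft 1 (?g2 k) X * ?FS X) \<longlonglongrightarrow> f1 X * f2 X * ?FS X"
      using a1(7) a2(7) by eventually_elim (intro tendsto_mult tendsto_const)
    have FSb: "cmod (?FS X) \<le> ?s * decay X" for X
    proof -
      have "cmod (?FS X) \<le> cmod (?F X)" by (auto simp: indicator_def)
      also have "\<dots> \<le> ?s * decay X" by (rule schwartz_le_decay0[OF F])
      finally show ?thesis .
    qed
    show "AE X in lborel. cmod (ft 1 (?g1 k) X * ft 1 (?g2 k) X * ?FS X) \<le> ?s * (F1 X * F2 X * decay X)" for k
      using a1(8) a2(8)
    proof eventually_elim
      case (elim X)
      have "cmod (ft 1 (?g1 k) X * ft 1 (?g2 k) X * ?FS X) \<le> F1 X * F2 X * (?s * decay X)"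
        unfolding norm_mult by (intro mult_mono FSb) (use elim a1(6) a2(6) in auto)
      then show ?case by (simp add: mult_ac)
    qed
  qed measurable
  have eqk: "(LINT P|lborel. kk k P * J P) = (LINT X|lborel. ft 1 (?g1 k) X * ft 1 (?g2 k) X * ?FS X)" for k
  proof -
    have kk': "kk k = (\<lambda>P. LINT p|lborel. ?g1 k p * ?g2 k (P - p))" by (simp add: kk_def fun_eq_iff)
    have ki: "integrable lborel (kk k)" unfolding kk' by (rule ft_convolution(1)[OF a1(2) a2(2)])
    show ?thesis
      unfolding J_def ft_multiplication[OF ki FSi] unfolding kk' ft_convolution(2)[OF a1(2) a2(2)] ..
  qed
  have LK: "(LINT X|lborel. f1 X * f2 X * ?FS X) = (LINT P|lborel. K P * J P)"
    using LIMSEQ_unique[OF L2 L1[unfolded eqk]] .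

  have wi: "(\<integral>\<^sup>+z. ennreal (cmod (w z * \<psi> z)) \<partial>lborel) < \<infinity>"
  proof -
    have "ennreal (cmod (w (\<xi>, \<tau>) * \<psi> (\<xi>, \<tau>))) \<le> ennreal (cmod (\<psi> (\<xi>, \<tau>))) * (\<integral>\<^sup>+\<tau>'. ennreal (cmod (?D (\<tau> - \<tau>'))) * Kp (\<xi>, \<tau>') \<partial>lborel)" for \<xi> \<tau>
    proof -
      have "ennreal (cmod (w (\<xi>, \<tau>))) \<le> (\<integral>\<^sup>+\<tau>'. ennreal (cmod (?D (\<tau> - \<tau>'))) * Kp (\<xi>, \<tau>') \<partial>lborel)"
        unfolding w_def
        by (rule order_trans[OF norm_integral_le_nn_integral nn_integral_mono])
          (auto simp: norm_mult ennreal_mult intro!: mult_left_mono KKp)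
      then show ?thesis by (simp add: norm_mult ennreal_mult mult.commute mult_left_mono)
    qed
    then have "(\<integral>\<^sup>+z. ennreal (cmod (w z * \<psi> z)) \<partial>lborel) \<le> (\<integral>\<^sup>+\<xi>. \<integral>\<^sup>+\<tau>. ennreal (cmod (\<psi> (\<xi>, \<tau>))) * (\<integral>\<^sup>+\<tau>'. ennreal (cmod (?D (\<tau> - \<tau>'))) * Kp (\<xi>, \<tau>') \<partial>lborel) \<partial>lborel \<partial>lborel)"
      by (subst nn_integral_lborel_fst) (simp_all add: lborel_prod nn_integral_mono)
    then show ?thesis using H by (rule le_less_trans)
  qed
  show wint: "integrable lborel (\<lambda>z. w z * \<psi> z)"
    by (rule integrableI_bounded) (use wi in auto)
  then have wint': "integrable (lborel \<Otimes>\<^sub>M lborel) (\<lambda>(\<xi>, \<tau>). w (\<xi>, \<tau>) * \<psi> (\<xi>, \<tau>))"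
    unfolding lborel_prod by (simp add: case_prod_beta')
  have KJi: "integrable lborel (\<lambda>P. K P * J P)"
  proof (rule Bochner_Integration.integrable_bound[OF dom])
    show "AE P in lborel. cmod (K P * J P) \<le> norm (enn2real (Kp P) * cmod (J P))"
      using fin
    proof eventually_elim
      case (elim P)
      have "cmod (K P) \<le> enn2real (Kp P)"
        using enn2real_mono[OF KKp[of P]] elim by simp
      then show ?case by (simp add: norm_mult mult_right_mono)
    qed
  qed measurable
  then have KJi': "integrable (lborel \<Otimes>\<^sub>M lborel) (\<lambda>(\<xi>, \<tau>'). K (\<xi>, \<tau>') * J (\<xi>, \<tau>'))"
    unfolding lborel_prod by (simp add: case_prod_beta')
  have "(LINT P|lborel. K P * J P) = (LINT \<xi>|lborel. LINT \<tau>'|lborel. K (\<xi>, \<tau>') * J (\<xi>, \<tau>'))"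
    unfolding lborel_pair.integral_fst[OF KJi'] lborel_prod by (simp add: case_prod_beta')
  also have "\<dots> = (LINT \<xi>|lborel. ?c * (LINT \<tau>|lborel. w (\<xi>, \<tau>) * \<psi> (\<xi>, \<tau>)))"
  proof (rule integral_cong_AE)
    \<comment> \<open>For almost every \<xi> the double integral in \<tau>' and \<tau> converges
      absolutely, so that the kernel can be moved from \<psi> to \<open>K\<close>.\<close>
    have "AE \<xi> in lborel. (\<integral>\<^sup>+\<tau>'. \<integral>\<^sup>+\<tau>. ?I \<xi> \<tau>' \<tau> \<partial>lborel \<partial>lborel) \<noteq> \<infinity>"
      by (rule nn_integral_PInf_AE) (use H' in auto)
    then show "AE \<xi> in lborel. (LINT \<tau>'|lborel. K (\<xi>, \<tau>') * J (\<xi>, \<tau>')) = ?c * (LINT \<tau>|lborel. w (\<xi>, \<tau>) * \<psi> (\<xi>, \<tau>))"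
    proof eventually_elim
      case (elim \<xi>)
      let ?\<Theta> = "\<lambda>\<tau>' \<tau>. K (\<xi>, \<tau>') * (?D (\<tau> - \<tau>') * \<psi> (\<xi>, \<tau>))"
      have int: "integrable (lborel \<Otimes>\<^sub>M lborel) (\<lambda>(\<tau>', \<tau>). ?\<Theta> \<tau>' \<tau>)"
      proof (rule integrableI_bounded)
        have "(\<integral>\<^sup>+x. ennreal (norm (case x of (\<tau>', \<tau>) \<Rightarrow> ?\<Theta> \<tau>' \<tau>)) \<partial>(lborel \<Otimes>\<^sub>M lborel)) = (\<integral>\<^sup>+\<tau>'. \<integral>\<^sup>+\<tau>. ennreal (cmod (?\<Theta> \<tau>' \<tau>)) \<partial>lborel \<partial>lborel)"
          by (subst lborel.nn_integral_fst[symmetric]) simp_all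
        also have "\<dots> \<le> (\<integral>\<^sup>+\<tau>'. \<integral>\<^sup>+\<tau>. ?I \<xi> \<tau>' \<tau> \<partial>lborel \<partial>lborel)"
          by (intro nn_integral_mono) (simp add: norm_mult ennreal_mult mult_right_mono[OF KKp])
        finally show "(\<integral>\<^sup>+x. ennreal (norm (case x of (\<tau>', \<tau>) \<Rightarrow> ?\<Theta> \<tau>' \<tau>)) \<partial>(lborel \<Otimes>\<^sub>M lborel)) < \<infinity>"
          using elim by (simp add: less_top[symmetric] top_unique) (use top_unique in fastforce)
      qed measurable
      have "(LINT \<tau>'|lborel. K (\<xi>, \<tau>') * J (\<xi>, \<tau>')) = (LINT \<tau>'|lborel. ?c * (LINT \<tau>|lborel. ?\<Theta> \<tau>' \<tau>))"
        unfolding J_eq by (simp add: mult_ac)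
      also have "\<dots> = ?c * (LINT \<tau>'|lborel. LINT \<tau>|lborel. ?\<Theta> \<tau>' \<tau>)" by (rule integral_mult_right_zero)
      also have "(LINT \<tau>'|lborel. LINT \<tau>|lborel. ?\<Theta> \<tau>' \<tau>) = (LINT \<tau>|lborel. LINT \<tau>'|lborel. ?\<Theta> \<tau>' \<tau>)"
        by (rule lborel_pair.Fubini_integral[symmetric, OF int])
      also have "\<dots> = (LINT \<tau>|lborel. w (\<xi>, \<tau>) * \<psi> (\<xi>, \<tau>))"
      proof (rule Bochner_Integration.integral_cong[OF refl])
        fix \<tau>
        have "(LINT \<tau>'|lborel. ?\<Theta> \<tau>' \<tau>) = (LINT \<tau>'|lborel. (?D (\<tau> - \<tau>') * K (\<xi>, \<tau>')) * \<psi> (\<xi>, \<tau>))"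
          by (simp only: mult_ac)
        then show "(LINT \<tau>'|lborel. ?\<Theta> \<tau>' \<tau>) = w (\<xi>, \<tau>) * \<psi> (\<xi>, \<tau>)"
          unfolding w_def by (simp only: integral_mult_left_zero)
      qed
      finally show ?case .
    qed
  qed measurable
  also have "\<dots> = ?c * (LINT \<xi>|lborel. LINT \<tau>|lborel. w (\<xi>, \<tau>) * \<psi> (\<xi>, \<tau>))" by (rule integral_mult_right_zero)
  also have "(LINT \<xi>|lborel. LINT \<tau>|lborel. w (\<xi>, \<tau>) * \<psi> (\<xi>, \<tau>)) = (LINT z|lborel. w z * \<psi> z)"
    unfolding lborel_pair.integral_fst[OF wint'] lborel_prod by (simp add: case_prod_beta')
  finally show "(LINT X|lborel. indicator ?S X *\<^sub>R (f1 X * f2 X * ?F X)) = ?c * (LINT z|lborel. w z * \<psi> z)"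
    using LK by (simp add: mult_ac)
qed

section \<open>One-dimensional estimates\<close>

lemma japanese_ge_1: "1 \<le> japanese x"
  by (simp add: japanese_def)

lemma japanese_pos [simp]: "0 < japanese x" and japanese_nonneg [simp]: "0 \<le> japanese x" and japanese_neq_0 [simp]: "japanese x \<noteq> 0"
  using japanese_ge_1[of x] by linarith+

lemma norm_le_japanese: "norm x \<le> japanese x"
  unfolding japanese_def by (rule real_le_rsqrt) simp

lemma japanese_measurable [measurable]: "japanese \<in> borel_measurable borel"
  unfolding japanese_def[abs_def] by measurable

lemma japanese_mono: "norm x \<le> norm y \<Longrightarrow> japanese x \<le> japanese y"
  unfolding japanese_def by (simp add: power_mono)

lemma japanese_minus: "japanese (- x) = japanese x"
  by (simp add: japanese_def)

lemma japanese_add_le: "japanese (x + y) \<le> japanese x + japanese y"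
proof -
  have "(norm (x + y))\<^sup>2 \<le> (norm x + norm y)\<^sup>2" by (intro power_mono norm_triangle_ineq) auto
  also have "\<dots> = (norm x)\<^sup>2 + (norm y)\<^sup>2 + 2 * (norm x * norm y)" by (simp add: power2_sum)
  also have "norm x * norm y \<le> japanese x * japanese y" by (intro mult_mono norm_le_japanese) auto
  finally have "1 + (norm (x + y))\<^sup>2 \<le> (japanese x + japanese y)\<^sup>2"
    unfolding power2_sum by (simp add: japanese_def)
  then show ?thesis unfolding japanese_def[of "x + y"] by (intro real_le_lsqrt) auto
qed

lemma japanese_add_le_mult: "japanese (x + y) \<le> 2 * japanese x * japanese y"
proof -
  have "japanese x \<le> japanese x * japanese y" "japanese y \<le> japanese x * japanese y"
    using japanese_ge_1[of x] japanese_ge_1[of y] by auto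
  then show ?thesis using japanese_add_le[of x y] unfolding mult.assoc by linarith
qed

lemma japanese_powr_le_1: "p \<ge> 0 \<Longrightarrow> japanese x powr (- p) \<le> 1"
  using japanese_ge_1[of x] by (simp add: powr_le_one_le powr_minus inverse_le_1_iff ge_one_powr_ge_zero)

text \<open>Squaring turns the integral into a double integral, to which a b \<le> a^2 + b^2 is
  applied with a = f(x) g(y) and b = g(x) f(y). There is no normalisation by the norms, hence no
  case distinction for infinite values, at the price of a factor 2.\<close>

lemma nn_Cauchy_Schwarz:
  fixes f g :: "'a::euclidean_space \<Rightarrow> ennreal"
  assumes [measurable]: "f \<in> borel_measurable borel" "g \<in> borel_measurable borel"
  shows "(\<integral>\<^sup>+x. f x * g x \<partial>lborel)\<^sup>2 \<le> 2 * (\<integral>\<^sup>+x. (f x)\<^sup>2 \<partial>lborel) * (\<integral>\<^sup>+x. (g x)\<^sup>2 \<partial>lborel)"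
proof -
  have ab: "a * b \<le> a\<^sup>2 + b\<^sup>2" for a b :: ennreal
  proof (cases "a \<le> b")
    case True
    then have "a * b \<le> b * b" by (intro mult_right_mono) auto
    then show ?thesis unfolding power2_eq_square by (rule order_trans) simp
  next
    case False
    then have "a * b \<le> a * a" by (intro mult_left_mono) auto
    then show ?thesis unfolding power2_eq_square by (rule order_trans) simp
  qed
  let ?A = "\<integral>\<^sup>+x. (f x)\<^sup>2 \<partial>lborel" and ?B = "\<integral>\<^sup>+x. (g x)\<^sup>2 \<partial>lborel"
  have "(\<integral>\<^sup>+x. f x * g x \<partial>lborel)\<^sup>2 = (\<integral>\<^sup>+x. \<integral>\<^sup>+y. (f x * g x) * (f y * g y) \<partial>lborel \<partial>lborel)"
    unfolding power2_eq_square by (subst nn_integral_cmult, measurable, subst nn_integral_multc, measurable)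
  also have "\<dots> \<le> (\<integral>\<^sup>+x. \<integral>\<^sup>+y. (f x)\<^sup>2 * (g y)\<^sup>2 + (g x)\<^sup>2 * (f y)\<^sup>2 \<partial>lborel \<partial>lborel)"
  proof (intro nn_integral_mono)
    fix x y
    show "(f x * g x) * (f y * g y) \<le> (f x)\<^sup>2 * (g y)\<^sup>2 + (g x)\<^sup>2 * (f y)\<^sup>2"
      using ab[of "f x * g y" "g x * f y"] by (simp add: power_mult_distrib mult_ac)
  qed
  also have "\<dots> = (\<integral>\<^sup>+x. (f x)\<^sup>2 * ?B + (g x)\<^sup>2 * ?A \<partial>lborel)"
    by (intro nn_integral_cong) (simp add: nn_integral_add nn_integral_cmult)
  also have "\<dots> = ?A * ?B + ?B * ?A"
    by (simp add: nn_integral_add nn_integral_multc)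
  finally show ?thesis by (simp add: mult_2 mult.commute distrib_left mult.assoc distrib_right)
qed

section \<open>Integrals of powers and of modulation weights\<close>

lemma nn_integral_powr_0_1:
  assumes "a < 1"
  shows "(\<integral>\<^sup>+x. ennreal (indicator {0..1} x * x powr (- a)) \<partial>lborel) = ennreal (1 / (1 - a))"
proof -
  have e1: "(\<lambda>x. indicator {0..1} x * x powr (- a)) = (\<lambda>x::real. if x \<in> {0..1} then x powr (- a) else 0)"
    by (auto simp: indicator_def)
  have "((\<lambda>x. x powr (- a)) has_integral (1 powr (- a + 1) / (- a + 1))) {0..1}"
    by (rule has_integral_powr_from_0) (use assms in auto)
  then have "((\<lambda>x. indicator {0..1} x * x powr (- a)) has_integral (1 powr (- a + 1) / (- a + 1))) UNIV"
    unfolding e1 has_integral_restrict_UNIV .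
  then have "(\<integral>\<^sup>+x. indicator {0..1} x * x powr (- a) \<partial>lborel) = 1 powr (- a + 1) / (- a + 1)"
    by (intro nn_integral_has_integral_lborel) auto
  then show ?thesis by (simp add: ennreal_mult' ennreal_indicator)
qed

lemma nn_integral_powr_1_inf:
  assumes "1 < p"
  shows "(\<integral>\<^sup>+x. ennreal (indicator {1..} x * x powr (- p)) \<partial>lborel) = ennreal (1 / (p - 1))"
proof -
  have e1: "(\<lambda>x. indicator {1..} x * x powr (- p)) = (\<lambda>x::real. if x \<in> {1..} then x powr (- p) else 0)"
    by (auto simp: indicator_def)
  have "((\<lambda>x. x powr (- p)) has_integral (- (1 powr (- p + 1)) / (- p + 1))) {1..}"
    by (rule has_integral_powr_to_inf) (use assms in auto)
  then have "((\<lambda>x. indicator {1..} x * x powr (- p)) has_integral (- (1 powr (- p + 1)) / (- p + 1))) UNIV"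
    unfolding e1 has_integral_restrict_UNIV .
  then have "(\<integral>\<^sup>+x. indicator {1..} x * x powr (- p) \<partial>lborel) = - (1 powr (- p + 1)) / (- p + 1)"
    by (intro nn_integral_has_integral_lborel) auto
  moreover have "- (1 powr (- p + 1)) / (- p + 1) = 1 / (p - 1)" using assms by (simp add: field_simps)
  ultimately show ?thesis by (simp add: ennreal_mult' ennreal_indicator)
qed

definition two_powers :: "real \<Rightarrow> real \<Rightarrow> real \<Rightarrow> real" where
  "two_powers a p x = (if \<bar>x\<bar> \<le> 1 then \<bar>x\<bar> powr (- a) else \<bar>x\<bar> powr (- p))"

lemma two_powers_measurable [measurable]: "two_powers a p \<in> borel_measurable borel"
  unfolding two_powers_def[abs_def] by measurable

lemma two_powers_nonneg [simp]: "0 \<le> two_powers a p x"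
  by (simp add: two_powers_def)

lemma nn_integral_two_powers:
  assumes "a < 1" "1 < p"
  shows "(\<integral>\<^sup>+x. ennreal (two_powers a p x) \<partial>lborel) < \<infinity>"
proof -
  let ?f = "\<lambda>x. ennreal (indicator {0..1} x * x powr (- a)) + ennreal (indicator {1..} x * x powr (- p))"
  have f: "(\<integral>\<^sup>+x. ?f x \<partial>lborel) < \<infinity>"
    by (subst nn_integral_add) (auto simp: nn_integral_powr_0_1[OF assms(1)] nn_integral_powr_1_inf[OF assms(2)])
  have "(\<integral>\<^sup>+x. ennreal (two_powers a p x) \<partial>lborel) \<le> (\<integral>\<^sup>+x. ?f x + ?f (0 - x) \<partial>lborel)"
  proof (rule nn_integral_mono)
    fix x :: real
    show "ennreal (two_powers a p x) \<le> ?f x + ?f (0 - x)"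
      by (cases "0 \<le> x"; cases "\<bar>x\<bar> \<le> 1")
        (auto simp: two_powers_def indicator_def add_increasing add_increasing2 split: if_splits)
  qed
  also have "\<dots> = (\<integral>\<^sup>+x. ?f x \<partial>lborel) + (\<integral>\<^sup>+x. ?f (0 - x) \<partial>lborel)"
    by (rule nn_integral_add) measurable
  also have "(\<integral>\<^sup>+x. ?f (0 - x) \<partial>lborel) = (\<integral>\<^sup>+x. ?f x \<partial>lborel)"
    by (rule lborel_nn_integral_reflect) measurable
  finally show ?thesis using f by (auto simp: less_top[symmetric] top_unique)
qed

text \<open>Layer-cake estimate: the singular weight only sees the measure of the sets where \<open>\<phi>\<close> is close to \<open>K\<close>.\<close>

lemma nn_integral_japanese_level:
  fixes \<phi> :: "'a::euclidean_space \<Rightarrow> real"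
  assumes [measurable]: "\<phi> \<in> borel_measurable borel" and e: "0 \<le> e" "e < p"
    and C: "0 \<le> C" and lev: "\<And>\<rho>. 0 < \<rho> \<Longrightarrow> emeasure lborel {x. \<bar>\<phi> x - K\<bar> < \<rho>} \<le> ennreal (C * \<rho> powr e)"
  shows "(\<integral>\<^sup>+x. ennreal (japanese (\<phi> x - K) powr (- p)) \<partial>lborel) \<le> ennreal (C * (1 / (1 - e / p)))"
proof -
  have p: "0 < p" using e by simp
  let ?J = "\<lambda>x. japanese (\<phi> x - K) powr (- p)"
  have "(\<integral>\<^sup>+x. ennreal (?J x) \<partial>lborel) = (\<integral>\<^sup>+x. \<integral>\<^sup>+s. (if 0 < s \<and> s < ?J x then 1 else 0) \<partial>lborel \<partial>lborel)"
  proof (rule nn_integral_cong)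
    fix x
    have "(\<integral>\<^sup>+s. (if 0 < s \<and> s < ?J x then 1 else 0) \<partial>lborel) = (\<integral>\<^sup>+s. indicator {0<..<?J x} s \<partial>lborel)"
      by (intro nn_integral_cong) (auto simp: indicator_def)
    then show "ennreal (?J x) = (\<integral>\<^sup>+s. (if 0 < s \<and> s < ?J x then 1 else 0) \<partial>lborel)" by simp
  qed
  also have "\<dots> = (\<integral>\<^sup>+s. \<integral>\<^sup>+x. (if 0 < s \<and> s < ?J x then 1 else 0) \<partial>lborel \<partial>lborel)"
    by (rule lborel_pair.Fubini'[symmetric]) measurable
  also have "\<dots> \<le> (\<integral>\<^sup>+s. ennreal C * ennreal (indicator {0..1} s * s powr (- (e / p))) \<partial>lborel)"
  proof (rule nn_integral_mono)
    fix s :: real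
    show "(\<integral>\<^sup>+x. (if 0 < s \<and> s < ?J x then 1 else 0) \<partial>lborel) \<le> ennreal C * ennreal (indicator {0..1} s * s powr (- (e / p)))"
    proof (cases "0 < s \<and> s < 1")
      case True
      \<comment> \<open>If s lies below the weight, then |\<phi> - K| < s^(-1/p), a set of measure
        at most C s^(-e/p); this power is integrable on (0, 1) since e < p.\<close>
      let ?\<rho> = "s powr (- (1 / p))"
      have "(if 0 < s \<and> s < ?J x then 1 else 0) \<le> (indicator {x. \<bar>\<phi> x - K\<bar> < ?\<rho>} x :: ennreal)" for x
      proof (cases "s < ?J x")
        case sJ: True
        have "?J x powr (- (1 / p)) < s powr (- (1 / p))"
          using True sJ p by (intro powr_less_mono2_neg) auto
        then have "japanese (\<phi> x - K) < ?\<rho>" using p by (simp add: powr_powr)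
        then have "\<bar>\<phi> x - K\<bar> < ?\<rho>" using norm_le_japanese[of "\<phi> x - K"] by simp
        then show ?thesis by simp
      qed simp
      then have "(\<integral>\<^sup>+x. (if 0 < s \<and> s < ?J x then 1 else 0) \<partial>lborel) \<le> (\<integral>\<^sup>+x. indicator {x. \<bar>\<phi> x - K\<bar> < ?\<rho>} x \<partial>lborel)"
        by (intro nn_integral_mono)
      also have "\<dots> = emeasure lborel {x. \<bar>\<phi> x - K\<bar> < ?\<rho>}"
        by (rule nn_integral_indicator) simp
      also have "\<dots> \<le> ennreal (C * ?\<rho> powr e)" using True by (intro lev) simp
      also have "\<dots> = ennreal C * ennreal (indicator {0..1} s * s powr (- (e / p)))"
        using True C by (simp add: powr_powr ennreal_mult)
      finally show ?thesis .
    next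
      case False
      have "?J x \<le> 1" for x using p by (intro japanese_powr_le_1) simp
      then have "(if 0 < s \<and> s < ?J x then 1 else 0) = (0::ennreal)" for x
        using False by (smt (verit))
      then show ?thesis by simp
    qed
  qed
  also have "\<dots> = ennreal C * (\<integral>\<^sup>+s. ennreal (indicator {0..1} s * s powr (- (e / p))) \<partial>lborel)"
    by (rule nn_integral_cmult) measurable
  also have "\<dots> = ennreal C * ennreal (1 / (1 - e / p))"
    using e p by (subst nn_integral_powr_0_1) auto
  finally show ?thesis using C e p by (simp add: ennreal_mult[symmetric])
qed

lemma nn_integral_japanese_real:
  assumes "1 < p"
  shows "(\<integral>\<^sup>+x. ennreal (japanese (x - (K::real)) powr (- p)) \<partial>lborel) \<le> ennreal (2 * (1 / (1 - 1 / p)))"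
proof (rule nn_integral_japanese_level[where \<phi> = "\<lambda>x. x" and e = 1])
  fix \<rho> :: real assume "0 < \<rho>"
  have "{x. \<bar>x - K\<bar> < \<rho>} = {K - \<rho><..<K + \<rho>}" by auto
  then show "emeasure lborel {x. \<bar>x - K\<bar> < \<rho>} \<le> ennreal (2 * \<rho> powr 1)" using \<open>0 < \<rho>\<close> by simp
qed (use assms in auto)

text \<open>By the triangle inequality the larger of the two brackets is at least half of the
  bracket of A - B. It is pulled out with a loss of 2^p, and the other one is integrable since p >
  1.\<close>

lemma japanese_product_integral:
  assumes p: "1 < p"
  shows "\<exists>C\<ge>0. \<forall>A B :: real. (\<integral>\<^sup>+t. ennreal (japanese (A - t) powr (- p) * japanese (t - B) powr (- p)) \<partial>lborel) \<le> ennreal (C * japanese (A - B) powr (- p))"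
proof -
  let ?I = "2 * (1 / (1 - 1 / p))"
  have I: "0 \<le> ?I" using p by simp
  have "(\<integral>\<^sup>+t. ennreal (japanese (A - t) powr (- p) * japanese (t - B) powr (- p)) \<partial>lborel) \<le> ennreal ((2 powr p * (?I + ?I)) * japanese (A - B) powr (- p))" for A B :: real
  proof -
    let ?x = "\<lambda>t. japanese (t - A)" and ?y = "\<lambda>t. japanese (t - B)" and ?z = "japanese (A - B)"
    have xA: "japanese (A - t) = ?x t" for t using japanese_minus[of "t - A"] by simp
    have pt: "?x t powr (- p) * ?y t powr (- p) \<le> 2 powr p * ?z powr (- p) * (?x t powr (- p) + ?y t powr (- p))" for t
    proof -
      have z: "?z \<le> ?x t + ?y t" using japanese_add_le[of "A - t" "t - B"] unfolding xA[of t] by simp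
      let ?m = "max (?x t) (?y t)"
      have "?z \<le> 2 * ?m" using z by linarith
      then have "(2 * ?m) powr (- p) \<le> ?z powr (- p)" using p by (intro powr_mono2') auto
      then have "2 powr (- p) * ?m powr (- p) \<le> ?z powr (- p)" by (subst (asm) powr_mult) auto
      then have "2 powr p * (2 powr (- p) * ?m powr (- p)) \<le> 2 powr p * ?z powr (- p)" by (rule mult_left_mono) simp
      then have m: "?m powr (- p) \<le> 2 powr p * ?z powr (- p)" by (simp add: mult.assoc[symmetric] powr_add[symmetric])
      show ?thesis
      proof (cases "?x t \<le> ?y t")
        case True
        then have "?y t powr (- p) \<le> 2 powr p * ?z powr (- p)" using m by (simp add: max_def)
        then have "?x t powr (- p) * ?y t powr (- p) \<le> ?x t powr (- p) * (2 powr p * ?z powr (- p))" by (intro mult_left_mono) auto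
        also have "\<dots> \<le> (?x t powr (- p) + ?y t powr (- p)) * (2 powr p * ?z powr (- p))" by (intro mult_right_mono) auto
        finally show ?thesis by (simp add: mult_ac)
      next
        case False
        then have "?x t powr (- p) \<le> 2 powr p * ?z powr (- p)" using m by (simp add: max_def)
        then have "?x t powr (- p) * ?y t powr (- p) \<le> (2 powr p * ?z powr (- p)) * ?y t powr (- p)" by (intro mult_right_mono) auto
        also have "\<dots> \<le> (2 powr p * ?z powr (- p)) * (?x t powr (- p) + ?y t powr (- p))" by (intro mult_left_mono) auto
        finally show ?thesis by (simp add: mult_ac)
      qed
    qed
    have "(\<integral>\<^sup>+t. ennreal (japanese (A - t) powr (- p) * japanese (t - B) powr (- p)) \<partial>lborel)
       \<le> (\<integral>\<^sup>+t. ennreal (2 powr p * ?z powr (- p)) * (ennreal (?x t powr (- p)) + ennreal (?y t powr (- p))) \<partial>lborel)"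
    proof (rule nn_integral_mono)
      fix t
      have "ennreal (?x t powr (- p) * ?y t powr (- p)) \<le> ennreal (2 powr p * ?z powr (- p) * (?x t powr (- p) + ?y t powr (- p)))"
        by (rule ennreal_leI[OF pt])
      then show "ennreal (japanese (A - t) powr (- p) * japanese (t - B) powr (- p)) \<le> ennreal (2 powr p * ?z powr (- p)) * (ennreal (?x t powr (- p)) + ennreal (?y t powr (- p)))"
        unfolding xA by (simp add: ennreal_mult)
    qed
    also have "\<dots> = ennreal (2 powr p * ?z powr (- p)) * ((\<integral>\<^sup>+t. ennreal (?x t powr (- p)) \<partial>lborel) + (\<integral>\<^sup>+t. ennreal (?y t powr (- p)) \<partial>lborel))"
      by (simp add: nn_integral_cmult nn_integral_add)
    also have "\<dots> \<le> ennreal (2 powr p * ?z powr (- p)) * (ennreal ?I + ennreal ?I)"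
      by (intro mult_left_mono add_mono nn_integral_japanese_real p) auto
    also have "\<dots> = ennreal (2 powr p * ?z powr (- p) * (?I + ?I))"
      using I by (subst ennreal_mult) (auto simp del: ennreal_plus simp flip: ennreal_plus)
    finally show ?thesis by (simp add: mult_ac)
  qed
  note main = this
  have "0 \<le> 2 powr p * (?I + ?I)" using I by simp
  then show ?thesis by (intro exI[of _ "2 powr p * (?I + ?I)"] conjI allI main)
qed

lemma ennreal_mult3: "0 \<le> a \<Longrightarrow> 0 \<le> b \<Longrightarrow> 0 \<le> c \<Longrightarrow> ennreal a * (ennreal b * ennreal c) = ennreal (a * (b * c))"
  by (simp add: ennreal_mult)

section \<open>The cutoff kernel against the modulation weight\<close>

lemma nn_integral_affine_abs:
  assumes "T > 0" and [measurable]: "f \<in> borel_measurable borel"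
  shows "(\<integral>\<^sup>+x. f x \<partial>lborel) = ennreal (1 / T) * (\<integral>\<^sup>+x. f (c + x / T) \<partial>lborel)"
  using nn_integral_real_affine[of f "1 / T" c] assms by simp

text \<open>The substitution x = T (\<tau>' - \<tau>) takes T^(1 + \<beta>) out of the power of the
  kernel and 1 / T out of the measure.\<close>

lemma time_kernel_integral:
  assumes \<beta>: "0 < \<beta>" 
  shows "\<exists>C\<ge>0. \<forall>T \<tau>. 0 < T \<longrightarrow> (\<integral>\<^sup>+\<tau>'. ennreal ((3 * T / (1 + T * \<bar>\<tau> - \<tau>'\<bar>)) powr (1 + \<beta>)) \<partial>lborel) \<le> ennreal (C * T powr \<beta>)"
proof -
  let ?I = "\<integral>\<^sup>+x. ennreal (two_powers 0 (1 + \<beta>) x) \<partial>lborel"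
  have I: "?I < \<infinity>" using \<beta> by (intro nn_integral_two_powers) auto
  have "(\<integral>\<^sup>+\<tau>'. ennreal ((3 * T / (1 + T * \<bar>\<tau> - \<tau>'\<bar>)) powr (1 + \<beta>)) \<partial>lborel) \<le> ennreal (3 powr (1 + \<beta>) * enn2real ?I * T powr \<beta>)"
    if T: "0 < T" for T \<tau> :: real
  proof -
    have "(\<integral>\<^sup>+\<tau>'. ennreal ((3 * T / (1 + T * \<bar>\<tau> - \<tau>'\<bar>)) powr (1 + \<beta>)) \<partial>lborel)
      = ennreal (1 / T) * (\<integral>\<^sup>+x. ennreal ((3 * T / (1 + T * \<bar>\<tau> - (\<tau> + x / T)\<bar>)) powr (1 + \<beta>)) \<partial>lborel)"
      using T by (intro nn_integral_affine_abs) auto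
    also have "\<dots> \<le> ennreal (1 / T) * (\<integral>\<^sup>+x. ennreal ((3 * T) powr (1 + \<beta>)) * ennreal (two_powers 0 (1 + \<beta>) x) \<partial>lborel)"
    proof (intro mult_left_mono nn_integral_mono_AE)
      \<comment> \<open>The origin is left out because there \<open>two_powers 0\<close> is 0, as
        \<open>0 powr 0 = 0\<close>.\<close>
      show "AE x in lborel. ennreal ((3 * T / (1 + T * \<bar>\<tau> - (\<tau> + x / T)\<bar>)) powr (1 + \<beta>)) \<le> ennreal ((3 * T) powr (1 + \<beta>)) * ennreal (two_powers 0 (1 + \<beta>) x)"
        using AE_lborel_singleton[of 0]
      proof eventually_elim
        case (elim x)
        have x: "T * \<bar>\<tau> - (\<tau> + x / T)\<bar> = \<bar>x\<bar>" using T by (simp add: abs_divide)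
        have "(3 * T / (1 + \<bar>x\<bar>)) powr (1 + \<beta>) = (3 * T) powr (1 + \<beta>) * (1 + \<bar>x\<bar>) powr (- (1 + \<beta>))"
        proof -
          have "(3 * T / (1 + \<bar>x\<bar>)) powr (1 + \<beta>) = (3 * T) powr (1 + \<beta>) / (1 + \<bar>x\<bar>) powr (1 + \<beta>)"
            by (rule powr_divide)
          then show ?thesis unfolding powr_minus divide_inverse .
        qed
        also have "(1 + \<bar>x\<bar>) powr (- (1 + \<beta>)) \<le> two_powers 0 (1 + \<beta>) x"
        proof (cases "\<bar>x\<bar> \<le> 1")
          case True
          have "(1 + \<bar>x\<bar>) powr (- (1 + \<beta>)) \<le> 1 powr (- (1 + \<beta>))" using \<beta> by (intro powr_mono2') auto
          then show ?thesis using True elim by (simp add: two_powers_def)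
        next
          case False
          then show ?thesis using \<beta> by (auto simp: two_powers_def intro!: powr_mono2')
        qed
        finally show ?case unfolding x by (simp add: ennreal_mult[symmetric] ennreal_leI mult_left_mono)
      qed
    qed simp
    also have "\<dots> = ennreal (1 / T) * (ennreal ((3 * T) powr (1 + \<beta>)) * ennreal (enn2real ?I))"
      using I by (subst nn_integral_cmult) auto
    also have "\<dots> = ennreal (1 / T * ((3 * T) powr (1 + \<beta>) * enn2real ?I))"
      using T by (intro ennreal_mult3) auto
    also have "1 / T * ((3 * T) powr (1 + \<beta>) * enn2real ?I) = 3 powr (1 + \<beta>) * enn2real ?I * T powr \<beta>"
      using T by (simp add: powr_mult powr_add)
    finally show ?thesis .
  qed
  then show ?thesis by (intro exI[of _ "3 powr (1 + \<beta>) * enn2real ?I"]) auto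
qed

text \<open>After scaling around \<open>c\<close>, the smaller of |x| and |x - y| decides: replacing
  the other one by it bounds the integrand by a function with exponent 2 \<beta> < 1 at its
  singularity and 1 + \<beta> > 1 at infinity, uniformly in the position \<open>y\<close> of the
  kernel. The powers of T combine to 2 \<beta> + (1 - \<beta>) - 1 = \<beta>.\<close>

lemma time_kernel_weighted_integral:
  assumes \<beta>: "0 < \<beta>" "\<beta> < 1 / 2"
  shows "\<exists>C\<ge>0. \<forall>T c \<tau>'. 0 < T \<longrightarrow> (\<integral>\<^sup>+\<tau>. ennreal (\<bar>\<tau> - c\<bar> powr (- (2 * \<beta>)) * (3 * T / (1 + T * \<bar>\<tau> - \<tau>'\<bar>)) powr (1 - \<beta>)) \<partial>lborel) \<le> ennreal (C * T powr \<beta>)"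
proof -
  let ?q = "two_powers (2 * \<beta>) (1 + \<beta>)"
  let ?I = "\<integral>\<^sup>+x. ennreal (?q x) \<partial>lborel"
  define i where "i = enn2real ?I"
  have "?I < \<infinity>" using \<beta> by (intro nn_integral_two_powers) auto
  then have I: "?I = ennreal i" "0 \<le> i" by (simp_all add: i_def)
  have q: "\<bar>x\<bar> powr (- (2 * \<beta>)) * (1 + \<bar>x\<bar>) powr (- (1 - \<beta>)) \<le> ?q x" for x
  proof (cases "\<bar>x\<bar> \<le> 1")
    case True
    have "(1 + \<bar>x\<bar>) powr (- (1 - \<beta>)) \<le> 1 powr (- (1 - \<beta>))" using \<beta> by (intro powr_mono2') auto
    then have "\<bar>x\<bar> powr (- (2 * \<beta>)) * (1 + \<bar>x\<bar>) powr (- (1 - \<beta>)) \<le> \<bar>x\<bar> powr (- (2 * \<beta>)) * 1" by (intro mult_left_mono) auto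
    then show ?thesis using True by (simp add: two_powers_def)
  next
    case False
    have "(1 + \<bar>x\<bar>) powr (- (1 - \<beta>)) \<le> \<bar>x\<bar> powr (- (1 - \<beta>))" using \<beta> False by (intro powr_mono2') auto
    then have "\<bar>x\<bar> powr (- (2 * \<beta>)) * (1 + \<bar>x\<bar>) powr (- (1 - \<beta>)) \<le> \<bar>x\<bar> powr (- (2 * \<beta>)) * \<bar>x\<bar> powr (- (1 - \<beta>))" by (intro mult_left_mono) auto
    also have "\<dots> = \<bar>x\<bar> powr (- (2 * \<beta>) + - (1 - \<beta>))" by (rule powr_add[symmetric])
    also have "- (2 * \<beta>) + - (1 - \<beta>) = - (1 + \<beta>)" by simp
    finally show ?thesis using False by (simp add: two_powers_def)
  qed
  have "(\<integral>\<^sup>+\<tau>. ennreal (\<bar>\<tau> - c\<bar> powr (- (2 * \<beta>)) * (3 * T / (1 + T * \<bar>\<tau> - \<tau>'\<bar>)) powr (1 - \<beta>)) \<partial>lborel) \<le> ennreal (3 powr (1 - \<beta>) * (2 * i) * T powr \<beta>)"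
    if T: "0 < T" for T c \<tau>' :: real
  proof -
    define y where "y = T * (\<tau>' - c)"
    let ?k = "T powr (2 * \<beta>) * (3 * T) powr (1 - \<beta>)"
    have "(\<integral>\<^sup>+\<tau>. ennreal (\<bar>\<tau> - c\<bar> powr (- (2 * \<beta>)) * (3 * T / (1 + T * \<bar>\<tau> - \<tau>'\<bar>)) powr (1 - \<beta>)) \<partial>lborel)
      = ennreal (1 / T) * (\<integral>\<^sup>+x. ennreal (\<bar>(c + x / T) - c\<bar> powr (- (2 * \<beta>)) * (3 * T / (1 + T * \<bar>(c + x / T) - \<tau>'\<bar>)) powr (1 - \<beta>)) \<partial>lborel)"
      using T by (intro nn_integral_affine_abs) auto
    also have "\<dots> \<le> ennreal (1 / T) * (\<integral>\<^sup>+x. ennreal ?k * (ennreal (?q x) + ennreal (?q (- y + x))) \<partial>lborel)"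
    proof (intro mult_left_mono nn_integral_mono_AE)
      \<comment> \<open>At x = y the power of |x - y| would be 0 by convention instead of infinite,
        so this point is left out.\<close>
      show "AE x in lborel. ennreal (\<bar>(c + x / T) - c\<bar> powr (- (2 * \<beta>)) * (3 * T / (1 + T * \<bar>(c + x / T) - \<tau>'\<bar>)) powr (1 - \<beta>)) \<le> ennreal ?k * (ennreal (?q x) + ennreal (?q (- y + x)))"
        using AE_lborel_singleton[of y]
      proof eventually_elim
        case (elim x)
        have x: "T * \<bar>(c + x / T) - \<tau>'\<bar> = \<bar>x - y\<bar>"
        proof -
          have "T * \<bar>(c + x / T) - \<tau>'\<bar> = \<bar>T * ((c + x / T) - \<tau>')\<bar>" using T by (simp add: abs_mult)
          also have "T * ((c + x / T) - \<tau>') = x - y" using T by (simp add: y_def algebra_simps)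
          finally show ?thesis .
        qed
        have "\<bar>(c + x / T) - c\<bar> powr (- (2 * \<beta>)) = T powr (2 * \<beta>) * \<bar>x\<bar> powr (- (2 * \<beta>))"
        proof -
          have 1: "\<bar>(c + x / T) - c\<bar> = \<bar>x\<bar> / T" using T by (simp add: abs_divide)
          have "(\<bar>x\<bar> / T) powr (- (2 * \<beta>)) = \<bar>x\<bar> powr (- (2 * \<beta>)) / T powr (- (2 * \<beta>))"
            by (rule powr_divide)
          then show ?thesis unfolding 1 powr_minus_divide[of T "2 * \<beta>"] by simp
        qed
        moreover have "(3 * T / (1 + \<bar>x - y\<bar>)) powr (1 - \<beta>) = (3 * T) powr (1 - \<beta>) * (1 + \<bar>x - y\<bar>) powr (- (1 - \<beta>))"
        proof -
          have "(3 * T / (1 + \<bar>x - y\<bar>)) powr (1 - \<beta>) = (3 * T) powr (1 - \<beta>) / (1 + \<bar>x - y\<bar>) powr (1 - \<beta>)"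
            by (rule powr_divide)
          then show ?thesis unfolding powr_minus divide_inverse .
        qed
        ultimately have e: "\<bar>(c + x / T) - c\<bar> powr (- (2 * \<beta>)) * (3 * T / (1 + T * \<bar>(c + x / T) - \<tau>'\<bar>)) powr (1 - \<beta>)
           = ?k * (\<bar>x\<bar> powr (- (2 * \<beta>)) * (1 + \<bar>x - y\<bar>) powr (- (1 - \<beta>)))"
          unfolding x by (simp add: mult_ac)
        have "\<bar>x\<bar> powr (- (2 * \<beta>)) * (1 + \<bar>x - y\<bar>) powr (- (1 - \<beta>)) \<le> ?q x + ?q (- y + x)"
        proof (cases "\<bar>x\<bar> \<le> \<bar>x - y\<bar>")
          case True
          then have "(1 + \<bar>x - y\<bar>) powr (- (1 - \<beta>)) \<le> (1 + \<bar>x\<bar>) powr (- (1 - \<beta>))" using \<beta> by (intro powr_mono2') auto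
          then have "\<bar>x\<bar> powr (- (2 * \<beta>)) * (1 + \<bar>x - y\<bar>) powr (- (1 - \<beta>)) \<le> \<bar>x\<bar> powr (- (2 * \<beta>)) * (1 + \<bar>x\<bar>) powr (- (1 - \<beta>))" by (intro mult_left_mono) auto
          then show ?thesis using q[of x] two_powers_nonneg[of "2 * \<beta>" "1 + \<beta>" "- y + x"] by linarith
        next
          case False
          then have "\<bar>x\<bar> powr (- (2 * \<beta>)) \<le> \<bar>x - y\<bar> powr (- (2 * \<beta>))" using \<beta> elim by (intro powr_mono2') auto
          then have "\<bar>x\<bar> powr (- (2 * \<beta>)) * (1 + \<bar>x - y\<bar>) powr (- (1 - \<beta>)) \<le> \<bar>x - y\<bar> powr (- (2 * \<beta>)) * (1 + \<bar>x - y\<bar>) powr (- (1 - \<beta>))" by (intro mult_right_mono) auto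
          also have "\<dots> \<le> ?q (- y + x)" using q[of "x - y"] by (simp add: add.commute)
          finally show ?thesis using two_powers_nonneg[of "2 * \<beta>" "1 + \<beta>" x] by linarith
        qed
        then have "?k * (\<bar>x\<bar> powr (- (2 * \<beta>)) * (1 + \<bar>x - y\<bar>) powr (- (1 - \<beta>))) \<le> ?k * (?q x + ?q (- y + x))"
          by (intro mult_left_mono) auto
        then show ?case unfolding e
          by (subst ennreal_plus[symmetric], simp, simp, subst ennreal_mult[symmetric]) (auto intro: ennreal_leI)
      qed
    qed simp
    also have "(\<integral>\<^sup>+x. ennreal ?k * (ennreal (?q x) + ennreal (?q (- y + x))) \<partial>lborel) = ennreal ?k * (?I + (\<integral>\<^sup>+x. ennreal (?q (- y + x)) \<partial>lborel))"
      by (simp add: nn_integral_cmult nn_integral_add)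
    also have "(\<integral>\<^sup>+x. ennreal (?q (- y + x)) \<partial>lborel) = ?I" by (rule lborel_nn_integral_translate) measurable
    also have "?I + ?I = ennreal (2 * i)" unfolding I(1) using I(2) by (simp flip: ennreal_plus)
    also have "ennreal (1 / T) * (ennreal ?k * ennreal (2 * i)) = ennreal (1 / T * (?k * (2 * i)))"
      using T I(2) by (intro ennreal_mult3) auto
    also have "1 / T * (?k * (2 * i)) = 3 powr (1 - \<beta>) * (2 * i) * T powr \<beta>"
    proof -
      have "?k = 3 powr (1 - \<beta>) * (T powr (2 * \<beta>) * T powr (1 - \<beta>))" using T by (simp add: powr_mult)
      also have "T powr (2 * \<beta>) * T powr (1 - \<beta>) = T powr (2 * \<beta> + (1 - \<beta>))" by (rule powr_add[symmetric])
      also have "2 * \<beta> + (1 - \<beta>) = 1 + \<beta>" by simp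
      also have "T powr (1 + \<beta>) = T * T powr \<beta>" using T by (simp add: powr_add)
      finally show ?thesis using T by simp
    qed
    finally show ?thesis .
  qed
  then show ?thesis by (intro exI[of _ "3 powr (1 - \<beta>) * (2 * i)"]) (use I(2) in auto)
qed

text \<open>The power of \<open>T\<close> is gained here: the kernel is split as \<open>d = d\<^sup>(\<^sup>1\<^sup>+\<^sup>\<beta>\<^sup>)\<^sup>/\<^sup>2 d\<^sup>(\<^sup>1\<^sup>-\<^sup>\<beta>\<^sup>)\<^sup>/\<^sup>2\<close>.\<close>

lemma time_cutoff_estimate:
  assumes \<beta>: "0 < \<beta>" "\<beta> < 1 / 2"
  shows "\<exists>C\<ge>0. \<forall>T \<phi> k. 0 < T \<longrightarrow> k \<in> borel_measurable borel \<longrightarrow>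
    (\<integral>\<^sup>+\<tau>. ennreal (japanese (\<bar>\<tau>\<bar> - \<phi>) powr (- (2 * \<beta>))) * (\<integral>\<^sup>+\<tau>'. ennreal (3 * T / (1 + T * \<bar>\<tau> - \<tau>'\<bar>)) * k \<tau>' \<partial>lborel)\<^sup>2 \<partial>lborel)
    \<le> ennreal (C * T powr (2 * \<beta>)) * (\<integral>\<^sup>+\<tau>'. (k \<tau>')\<^sup>2 \<partial>lborel)"
proof -
  obtain C1 where C1: "C1 \<ge> 0" "\<And>T \<tau>. 0 < T \<Longrightarrow> (\<integral>\<^sup>+\<tau>'. ennreal ((3 * T / (1 + T * \<bar>\<tau> - \<tau>'\<bar>)) powr (1 + \<beta>)) \<partial>lborel) \<le> ennreal (C1 * T powr \<beta>)"
    using time_kernel_integral[OF \<beta>(1)] by blast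
  obtain C2 where C2: "C2 \<ge> 0" "\<And>T c \<tau>'. 0 < T \<Longrightarrow> (\<integral>\<^sup>+\<tau>. ennreal (\<bar>\<tau> - c\<bar> powr (- (2 * \<beta>)) * (3 * T / (1 + T * \<bar>\<tau> - \<tau>'\<bar>)) powr (1 - \<beta>)) \<partial>lborel) \<le> ennreal (C2 * T powr \<beta>)"
    using time_kernel_weighted_integral[OF \<beta>] by blast
  have "(\<integral>\<^sup>+\<tau>. ennreal (japanese (\<bar>\<tau>\<bar> - \<phi>) powr (- (2 * \<beta>))) * (\<integral>\<^sup>+\<tau>'. ennreal (3 * T / (1 + T * \<bar>\<tau> - \<tau>'\<bar>)) * k \<tau>' \<partial>lborel)\<^sup>2 \<partial>lborel)
    \<le> ennreal (4 * C1 * C2 * T powr (2 * \<beta>)) * (\<integral>\<^sup>+\<tau>'. (k \<tau>')\<^sup>2 \<partial>lborel)"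
    if T: "0 < T" and [measurable]: "k \<in> borel_measurable borel" for T \<phi> and k :: "real \<Rightarrow> ennreal"
  proof -
    let ?d = "\<lambda>\<tau> \<tau>'. 3 * T / (1 + T * \<bar>\<tau> - \<tau>'\<bar>)"
    let ?B = "\<lambda>\<tau>. japanese (\<bar>\<tau>\<bar> - \<phi>) powr (- (2 * \<beta>))"
    have dpos: "0 < ?d \<tau> \<tau>'" for \<tau> \<tau>' using T by (intro divide_pos_pos add_pos_nonneg) auto
    \<comment> \<open>The half of the kernel with exponent (1 + \<beta>) / 2 is squared and
      integrated at once; the other half stays with \<open>k\<close> until the integration in
      \<tau>.\<close>
    have cs: "(\<integral>\<^sup>+\<tau>'. ennreal (?d \<tau> \<tau>') * k \<tau>' \<partial>lborel)\<^sup>2 \<le> ennreal (2 * C1 * T powr \<beta>) * (\<integral>\<^sup>+\<tau>'. ennreal (?d \<tau> \<tau>' powr (1 - \<beta>)) * (k \<tau>')\<^sup>2 \<partial>lborel)" for \<tau>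
    proof -
      have "ennreal (?d \<tau> \<tau>') * k \<tau>' = ennreal (?d \<tau> \<tau>' powr ((1 + \<beta>) / 2)) * (ennreal (?d \<tau> \<tau>' powr ((1 - \<beta>) / 2)) * k \<tau>')" for \<tau>'
      proof -
        have "?d \<tau> \<tau>' powr ((1 + \<beta>) / 2) * ?d \<tau> \<tau>' powr ((1 - \<beta>) / 2) = ?d \<tau> \<tau>' powr 1"
          unfolding powr_add[symmetric] by (simp add: field_simps)
        also have "\<dots> = ?d \<tau> \<tau>'" using dpos[of \<tau> \<tau>'] by (intro powr_one) simp
        finally show ?thesis by (simp add: mult.assoc[symmetric] ennreal_mult[symmetric])
      qed
      then have "(\<integral>\<^sup>+\<tau>'. ennreal (?d \<tau> \<tau>') * k \<tau>' \<partial>lborel)\<^sup>2 = (\<integral>\<^sup>+\<tau>'. ennreal (?d \<tau> \<tau>' powr ((1 + \<beta>) / 2)) * (ennreal (?d \<tau> \<tau>' powr ((1 - \<beta>) / 2)) * k \<tau>') \<partial>lborel)\<^sup>2"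
        by simp
      also have "\<dots> \<le> 2 * (\<integral>\<^sup>+\<tau>'. (ennreal (?d \<tau> \<tau>' powr ((1 + \<beta>) / 2)))\<^sup>2 \<partial>lborel) * (\<integral>\<^sup>+\<tau>'. (ennreal (?d \<tau> \<tau>' powr ((1 - \<beta>) / 2)) * k \<tau>')\<^sup>2 \<partial>lborel)"
        by (rule nn_Cauchy_Schwarz) measurable
      also have "(\<integral>\<^sup>+\<tau>'. (ennreal (?d \<tau> \<tau>' powr ((1 + \<beta>) / 2)))\<^sup>2 \<partial>lborel) = (\<integral>\<^sup>+\<tau>'. ennreal (?d \<tau> \<tau>' powr (1 + \<beta>)) \<partial>lborel)"
        by (intro nn_integral_cong) (simp add: ennreal_power[symmetric] power2_eq_square ennreal_mult[symmetric] powr_add[symmetric])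
      also have "(\<integral>\<^sup>+\<tau>'. (ennreal (?d \<tau> \<tau>' powr ((1 - \<beta>) / 2)) * k \<tau>')\<^sup>2 \<partial>lborel) = (\<integral>\<^sup>+\<tau>'. ennreal (?d \<tau> \<tau>' powr (1 - \<beta>)) * (k \<tau>')\<^sup>2 \<partial>lborel)"
      proof (intro nn_integral_cong)
        fix \<tau>'
        have "(ennreal (?d \<tau> \<tau>' powr ((1 - \<beta>) / 2)))\<^sup>2 = ennreal (?d \<tau> \<tau>' powr (1 - \<beta>))"
          unfolding power2_eq_square by (simp add: ennreal_mult[symmetric] powr_add[symmetric])
        then show "(ennreal (?d \<tau> \<tau>' powr ((1 - \<beta>) / 2)) * k \<tau>')\<^sup>2 = ennreal (?d \<tau> \<tau>' powr (1 - \<beta>)) * (k \<tau>')\<^sup>2"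
          by (simp only: power_mult_distrib)
      qed
      also have "2 * (\<integral>\<^sup>+\<tau>'. ennreal (?d \<tau> \<tau>' powr (1 + \<beta>)) \<partial>lborel) * (\<integral>\<^sup>+\<tau>'. ennreal (?d \<tau> \<tau>' powr (1 - \<beta>)) * (k \<tau>')\<^sup>2 \<partial>lborel)
         \<le> 2 * ennreal (C1 * T powr \<beta>) * (\<integral>\<^sup>+\<tau>'. ennreal (?d \<tau> \<tau>' powr (1 - \<beta>)) * (k \<tau>')\<^sup>2 \<partial>lborel)"
        by (intro mult_right_mono mult_left_mono C1 T) auto
      also have "2 * ennreal (C1 * T powr \<beta>) = ennreal (2 * C1 * T powr \<beta>)"
        using C1 by (simp add: ennreal_mult mult.assoc)
      finally show ?thesis .
    qed
    have Bd: "(\<integral>\<^sup>+\<tau>. ennreal (?B \<tau>) * ennreal (?d \<tau> \<tau>' powr (1 - \<beta>)) \<partial>lborel) \<le> ennreal (2 * C2 * T powr \<beta>)" for \<tau>'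
    proof -
      have "(\<integral>\<^sup>+\<tau>. ennreal (?B \<tau>) * ennreal (?d \<tau> \<tau>' powr (1 - \<beta>)) \<partial>lborel)
        \<le> (\<integral>\<^sup>+\<tau>. ennreal (\<bar>\<tau> - \<phi>\<bar> powr (- (2 * \<beta>)) * ?d \<tau> \<tau>' powr (1 - \<beta>)) + ennreal (\<bar>\<tau> - (- \<phi>)\<bar> powr (- (2 * \<beta>)) * ?d \<tau> \<tau>' powr (1 - \<beta>)) \<partial>lborel)"
      proof (rule nn_integral_mono_AE)
        show "AE \<tau> in lborel. ennreal (?B \<tau>) * ennreal (?d \<tau> \<tau>' powr (1 - \<beta>)) \<le> ennreal (\<bar>\<tau> - \<phi>\<bar> powr (- (2 * \<beta>)) * ?d \<tau> \<tau>' powr (1 - \<beta>)) + ennreal (\<bar>\<tau> - (- \<phi>)\<bar> powr (- (2 * \<beta>)) * ?d \<tau> \<tau>' powr (1 - \<beta>))"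
          using AE_lborel_singleton[of \<phi>] AE_lborel_singleton[of "- \<phi>"]
        proof eventually_elim
          case (elim \<tau>)
          \<comment> \<open>Without the bracket the weight is singular at \<phi> for \<tau> \<ge> 0
            and at - \<phi> for \<tau> < 0; the sum covers both signs.\<close>
          have "?B \<tau> \<le> \<bar>\<tau> - \<phi>\<bar> powr (- (2 * \<beta>)) + \<bar>\<tau> - (- \<phi>)\<bar> powr (- (2 * \<beta>))"
          proof (cases "0 \<le> \<tau>")
            case True
            then have "?B \<tau> \<le> \<bar>\<tau> - \<phi>\<bar> powr (- (2 * \<beta>))"
              using norm_le_japanese[of "\<bar>\<tau>\<bar> - \<phi>"] \<beta> elim by (intro powr_mono2') auto
            then show ?thesis by (simp add: add_increasing2)
          next
            case False
            then have "\<bar>\<bar>\<tau>\<bar> - \<phi>\<bar> = \<bar>\<tau> - (- \<phi>)\<bar>" by simp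
            then have "?B \<tau> \<le> \<bar>\<tau> - (- \<phi>)\<bar> powr (- (2 * \<beta>))"
              using norm_le_japanese[of "\<bar>\<tau>\<bar> - \<phi>"] \<beta> elim by (intro powr_mono2') auto
            then show ?thesis by (simp add: add_increasing)
          qed
          from mult_right_mono[OF this, of "?d \<tau> \<tau>' powr (1 - \<beta>)"]
          have "?B \<tau> * ?d \<tau> \<tau>' powr (1 - \<beta>) \<le> \<bar>\<tau> - \<phi>\<bar> powr (- (2 * \<beta>)) * ?d \<tau> \<tau>' powr (1 - \<beta>) + \<bar>\<tau> - (- \<phi>)\<bar> powr (- (2 * \<beta>)) * ?d \<tau> \<tau>' powr (1 - \<beta>)"
            by (simp add: distrib_right)
          then have "ennreal (?B \<tau> * ?d \<tau> \<tau>' powr (1 - \<beta>)) \<le> ennreal (\<bar>\<tau> - \<phi>\<bar> powr (- (2 * \<beta>)) * ?d \<tau> \<tau>' powr (1 - \<beta>) + \<bar>\<tau> - (- \<phi>)\<bar> powr (- (2 * \<beta>)) * ?d \<tau> \<tau>' powr (1 - \<beta>))"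
            by (rule ennreal_leI)
          then show ?case by (simp only: ennreal_mult[OF powr_ge_zero powr_ge_zero] ennreal_plus mult_nonneg_nonneg powr_ge_zero)
        qed
      qed
      also have "\<dots> = (\<integral>\<^sup>+\<tau>. ennreal (\<bar>\<tau> - \<phi>\<bar> powr (- (2 * \<beta>)) * ?d \<tau> \<tau>' powr (1 - \<beta>)) \<partial>lborel) + (\<integral>\<^sup>+\<tau>. ennreal (\<bar>\<tau> - (- \<phi>)\<bar> powr (- (2 * \<beta>)) * ?d \<tau> \<tau>' powr (1 - \<beta>)) \<partial>lborel)"
        by (rule nn_integral_add) measurable
      also have "\<dots> \<le> ennreal (C2 * T powr \<beta>) + ennreal (C2 * T powr \<beta>)" by (intro add_mono C2 T)
      also have "\<dots> = ennreal (2 * C2 * T powr \<beta>)" using C2(1) by (simp flip: ennreal_plus)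
      finally show ?thesis .
    qed
    have "(\<integral>\<^sup>+\<tau>. ennreal (?B \<tau>) * (\<integral>\<^sup>+\<tau>'. ennreal (?d \<tau> \<tau>') * k \<tau>' \<partial>lborel)\<^sup>2 \<partial>lborel)
      \<le> (\<integral>\<^sup>+\<tau>. ennreal (?B \<tau>) * (ennreal (2 * C1 * T powr \<beta>) * (\<integral>\<^sup>+\<tau>'. ennreal (?d \<tau> \<tau>' powr (1 - \<beta>)) * (k \<tau>')\<^sup>2 \<partial>lborel)) \<partial>lborel)"
      by (intro nn_integral_mono mult_left_mono cs) auto
    also have "\<dots> = (\<integral>\<^sup>+\<tau>. ennreal (2 * C1 * T powr \<beta>) * (\<integral>\<^sup>+\<tau>'. (k \<tau>')\<^sup>2 * (ennreal (?B \<tau>) * ennreal (?d \<tau> \<tau>' powr (1 - \<beta>))) \<partial>lborel) \<partial>lborel)"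
      by (intro nn_integral_cong) (simp add: nn_integral_cmult[symmetric] mult_ac)
    also have "\<dots> = ennreal (2 * C1 * T powr \<beta>) * (\<integral>\<^sup>+\<tau>. \<integral>\<^sup>+\<tau>'. (k \<tau>')\<^sup>2 * (ennreal (?B \<tau>) * ennreal (?d \<tau> \<tau>' powr (1 - \<beta>))) \<partial>lborel \<partial>lborel)"
      by (rule nn_integral_cmult) measurable
    also have "(\<integral>\<^sup>+\<tau>. \<integral>\<^sup>+\<tau>'. (k \<tau>')\<^sup>2 * (ennreal (?B \<tau>) * ennreal (?d \<tau> \<tau>' powr (1 - \<beta>))) \<partial>lborel \<partial>lborel)
      = (\<integral>\<^sup>+\<tau>'. \<integral>\<^sup>+\<tau>. (k \<tau>')\<^sup>2 * (ennreal (?B \<tau>) * ennreal (?d \<tau> \<tau>' powr (1 - \<beta>))) \<partial>lborel \<partial>lborel)"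
      by (rule lborel_pair.Fubini') measurable
    also have "\<dots> = (\<integral>\<^sup>+\<tau>'. (k \<tau>')\<^sup>2 * (\<integral>\<^sup>+\<tau>. ennreal (?B \<tau>) * ennreal (?d \<tau> \<tau>' powr (1 - \<beta>)) \<partial>lborel) \<partial>lborel)"
      by (intro nn_integral_cong nn_integral_cmult) measurable
    finally have 1: "(\<integral>\<^sup>+\<tau>. ennreal (?B \<tau>) * (\<integral>\<^sup>+\<tau>'. ennreal (?d \<tau> \<tau>') * k \<tau>' \<partial>lborel)\<^sup>2 \<partial>lborel) \<le>
      ennreal (2 * C1 * T powr \<beta>) * (\<integral>\<^sup>+\<tau>'. (k \<tau>')\<^sup>2 * (\<integral>\<^sup>+\<tau>. ennreal (?B \<tau>) * ennreal (?d \<tau> \<tau>' powr (1 - \<beta>)) \<partial>lborel) \<partial>lborel)" .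
    also have "\<dots> \<le> ennreal (2 * C1 * T powr \<beta>) * (\<integral>\<^sup>+\<tau>'. (k \<tau>')\<^sup>2 * ennreal (2 * C2 * T powr \<beta>) \<partial>lborel)"
      by (intro mult_left_mono nn_integral_mono Bd) auto
    also have "(\<integral>\<^sup>+\<tau>'. (k \<tau>')\<^sup>2 * ennreal (2 * C2 * T powr \<beta>) \<partial>lborel) = (\<integral>\<^sup>+\<tau>'. (k \<tau>')\<^sup>2 \<partial>lborel) * ennreal (2 * C2 * T powr \<beta>)"
      by (rule nn_integral_multc) measurable
    also have "ennreal (2 * C1 * T powr \<beta>) * ((\<integral>\<^sup>+\<tau>'. (k \<tau>')\<^sup>2 \<partial>lborel) * ennreal (2 * C2 * T powr \<beta>))
      = ennreal (2 * C1 * T powr \<beta> * (2 * C2 * T powr \<beta>)) * (\<integral>\<^sup>+\<tau>'. (k \<tau>')\<^sup>2 \<partial>lborel)"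
      using C1(1) C2(1) by (simp only: ennreal_mult mult_nonneg_nonneg powr_ge_zero zero_le_numeral mult_ac)
    also have "2 * C1 * T powr \<beta> * (2 * C2 * T powr \<beta>) = 4 * C1 * C2 * T powr (2 * \<beta>)"
      by (simp add: powr_add[symmetric])
    finally show ?thesis .
  qed
  moreover have "0 \<le> 4 * C1 * C2" using C1 C2 by simp
  ultimately show ?thesis by (intro exI[of _ "4 * C1 * C2"]) blast
qed

section \<open>Integrals over thickened spheres\<close>

text \<open>The area of a planar annulus depends only on the difference of the squared radii, here
  at most \<rho> whatever the level \<open>K\<close>. The maximum in \<open>r1\<close> covers the
  case in which the annulus is a disc.\<close>

lemma annulus_measure_2d:
  fixes c :: "real \<times> real"
  assumes \<rho>: "0 < \<rho>"
  shows "emeasure lborel {v. \<bar>2 * (norm (v - c))\<^sup>2 - K\<bar> < \<rho>} \<le> ennreal (pi * \<rho> powr 1)"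
proof (cases "K + \<rho> \<le> 0")
  case True
  have "\<not> \<bar>2 * (norm (v - c))\<^sup>2 - K\<bar> < \<rho>" for v using True zero_le_power2[of "norm (v - c)"] by linarith
  then have e: "{v. \<bar>2 * (norm (v - c))\<^sup>2 - K\<bar> < \<rho>} = {}" by blast
  show ?thesis unfolding e by simp
next
  case False
  define r2 where "r2 = sqrt ((K + \<rho>) / 2)"
  define r1 where "r1 = sqrt (max 0 ((K - \<rho>) / 2))"
  have r: "0 \<le> r1" "0 \<le> r2" "r1\<^sup>2 = max 0 ((K - \<rho>) / 2)" "r2\<^sup>2 = (K + \<rho>) / 2"
    using False by (auto simp: r1_def r2_def)
  have r12: "r1 \<le> r2" using \<rho> False unfolding r1_def r2_def by (intro real_sqrt_le_mono) (auto simp: max_def)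
  have sub: "{v. \<bar>2 * (norm (v - c))\<^sup>2 - K\<bar> < \<rho>} \<subseteq> ball c r2 - ball c r1"
  proof
    fix v assume "v \<in> {v. \<bar>2 * (norm (v - c))\<^sup>2 - K\<bar> < \<rho>}"
    then have v: "(norm (v - c))\<^sup>2 < r2\<^sup>2" "r1\<^sup>2 \<le> (norm (v - c))\<^sup>2"
      unfolding r(3,4) by (auto simp: abs_if split: if_splits)
    then have "norm (v - c) < r2" "r1 \<le> norm (v - c)"
      using r by (auto intro: power2_less_imp_less power2_le_imp_le)
    then show "v \<in> ball c r2 - ball c r1" by (auto simp: dist_norm norm_minus_commute)
  qed
  have "emeasure lborel {v. \<bar>2 * (norm (v - c))\<^sup>2 - K\<bar> < \<rho>} \<le> emeasure lborel (ball c r2 - ball c r1)"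
    using sub by (intro emeasure_mono) auto
  also have "\<dots> = emeasure lborel (ball c r2) - emeasure lborel (ball c r1)"
    using r12 emeasure_lborel_ball_finite[of c r1] by (intro emeasure_Diff) auto
  also have "\<dots> = ennreal (pi * r2\<^sup>2) - ennreal (pi * r1\<^sup>2)"
    using r(1,2) by (simp add: emeasure_ball unit_ball_vol_2 power2_eq_square)
  also have "\<dots> = ennreal (pi * r2\<^sup>2 - pi * r1\<^sup>2)" by (rule ennreal_minus) auto
  also have "pi * r2\<^sup>2 - pi * r1\<^sup>2 = pi * (r2\<^sup>2 - r1\<^sup>2)" by (simp add: right_diff_distrib)
  also have "ennreal \<dots> \<le> ennreal (pi * \<rho> powr 1)"
  proof (intro ennreal_leI mult_left_mono)
    show "r2\<^sup>2 - r1\<^sup>2 \<le> \<rho> powr 1" unfolding r(3,4) using \<rho> by (auto simp: max_def field_simps)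
  qed simp
  finally show ?thesis .
qed

text \<open>The set lies in two intervals of length r2 - r1, and (r2 - r1)^2 \<le> r2^2 - r1^2 \<le>
  \<rho>. The exponent is 1/2 instead of 1 because of levels close to 0, where both intervals reach
  the vertex of the parabola.\<close>

lemma annulus_measure_1d:
  fixes c :: real
  assumes \<rho>: "0 < \<rho>"
  shows "emeasure lborel {x. \<bar>2 * (x - c)\<^sup>2 - K\<bar> < \<rho>} \<le> ennreal (2 * \<rho> powr (1 / 2))"
proof (cases "K + \<rho> \<le> 0")
  case True
  have "\<not> \<bar>2 * (x - c)\<^sup>2 - K\<bar> < \<rho>" for x using True zero_le_power2[of "x - c"] by linarith
  then have e: "{x. \<bar>2 * (x - c)\<^sup>2 - K\<bar> < \<rho>} = {}" by blast
  show ?thesis unfolding e by simp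
next
  case False
  define r2 where "r2 = sqrt ((K + \<rho>) / 2)"
  define r1 where "r1 = sqrt (max 0 ((K - \<rho>) / 2))"
  have r: "0 \<le> r1" "0 \<le> r2" "r1\<^sup>2 = max 0 ((K - \<rho>) / 2)" "r2\<^sup>2 = (K + \<rho>) / 2"
    using False by (auto simp: r1_def r2_def)
  have r12: "r1 \<le> r2" using \<rho> False unfolding r1_def r2_def by (intro real_sqrt_le_mono) (auto simp: max_def)
  have sub: "{x. \<bar>2 * (x - c)\<^sup>2 - K\<bar> < \<rho>} \<subseteq> {c - r2..c - r1} \<union> {c + r1..c + r2}"
  proof
    fix x assume "x \<in> {x. \<bar>2 * (x - c)\<^sup>2 - K\<bar> < \<rho>}"
    then have v: "\<bar>x - c\<bar>\<^sup>2 < r2\<^sup>2" "r1\<^sup>2 \<le> \<bar>x - c\<bar>\<^sup>2"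
      unfolding r(3,4) power2_abs by (auto simp: abs_if split: if_splits)
    then have "\<bar>x - c\<bar> < r2" "r1 \<le> \<bar>x - c\<bar>"
      using r by (auto intro: power2_less_imp_less power2_le_imp_le)
    then show "x \<in> {c - r2..c - r1} \<union> {c + r1..c + r2}" by (auto simp: abs_if split: if_splits)
  qed
  have "emeasure lborel {x. \<bar>2 * (x - c)\<^sup>2 - K\<bar> < \<rho>} \<le> emeasure lborel ({c - r2..c - r1} \<union> {c + r1..c + r2})"
    using sub by (intro emeasure_mono) auto
  also have "\<dots> \<le> emeasure lborel {c - r2..c - r1} + emeasure lborel {c + r1..c + r2}"
    by (rule emeasure_subadditive) auto
  also have "\<dots> = ennreal (2 * (r2 - r1))" using r12 by (simp flip: ennreal_plus)
  also have "\<dots> \<le> ennreal (2 * \<rho> powr (1 / 2))"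
  proof (intro ennreal_leI mult_left_mono)
    have "(r2 - r1)\<^sup>2 \<le> r2\<^sup>2 - r1\<^sup>2"
      using r12 r(1) mult_left_mono[OF r12 r(1)] by (simp add: power2_diff power2_eq_square algebra_simps)
    also have "\<dots> \<le> \<rho>" unfolding r(3,4) using \<rho> by (auto simp: max_def field_simps)
    finally have "r2 - r1 \<le> sqrt \<rho>" by (rule real_le_rsqrt)
    then show "r2 - r1 \<le> \<rho> powr (1 / 2)" using \<rho> by (simp add: powr_half_sqrt)
  qed simp
  finally show ?thesis .
qed

text \<open>It behaves like r^a near the origin and like r^s at infinity. The quotient by the
  bracket makes both bases increasing in r, so that the weight is monotone for nonnegative
  exponents.\<close>

definition radial_weight :: "real \<Rightarrow> real \<Rightarrow> real \<Rightarrow> real" where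
  "radial_weight a s r = (r / japanese r) powr a * japanese r powr s"

lemma radial_weight_measurable [measurable]: "radial_weight a s \<in> borel_measurable borel"
  unfolding radial_weight_def[abs_def] by measurable

lemma radial_weight_nonneg [simp]: "0 \<le> radial_weight a s r"
  by (simp add: radial_weight_def)

lemma radial_weight_pos: "0 < r \<Longrightarrow> 0 < radial_weight a s r"
  by (simp add: radial_weight_def)

lemma radial_weight_0 [simp]: "radial_weight a s 0 = 0"
  by (simp add: radial_weight_def)

lemma ratio_japanese_mono:
  assumes "0 \<le> r" "r \<le> (t::real)"
  shows "r / japanese r \<le> t / japanese t"
proof -
  have "(r * japanese t)\<^sup>2 \<le> (t * japanese r)\<^sup>2"
    using assms power_mono[OF assms(2,1), of 2] by (simp add: power_mult_distrib japanese_def algebra_simps)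
  then have "r * japanese t \<le> t * japanese r" by (rule power2_le_imp_le) (use assms in simp)
  then have "r * japanese t / japanese t \<le> t * japanese r / japanese t" by (rule divide_right_mono) simp
  then have "r \<le> t / japanese t * japanese r" by simp
  then show ?thesis by (simp add: pos_divide_le_eq)
qed

lemma radial_weight_mono:
  assumes "0 \<le> a" "0 \<le> s" "0 \<le> r" "r \<le> t"
  shows "radial_weight a s r \<le> radial_weight a s t"
proof -
  have "japanese r \<le> japanese t" using assms by (intro japanese_mono) auto
  then show ?thesis unfolding radial_weight_def
    using assms ratio_japanese_mono[OF assms(3,4)] by (intro mult_mono powr_mono2) auto
qed

lemma radial_weight_double:
  assumes "0 \<le> a" "0 \<le> s" "0 \<le> r"
  shows "radial_weight a s (2 * r) \<le> 2 powr (a + s) * radial_weight a s r"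
proof -
  have j: "japanese r \<le> japanese (2 * r)" using assms by (intro japanese_mono) auto
  have j2: "japanese (2 * r) \<le> 2 * japanese r"
    using japanese_add_le[of r r] by simp
  have "2 * r / japanese (2 * r) \<le> 2 * (r / japanese r)"
    using j assms by (simp add: frac_le)
  then have "(2 * r / japanese (2 * r)) powr a * japanese (2 * r) powr s \<le> (2 * (r / japanese r)) powr a * (2 * japanese r) powr s"
    using assms j2 by (intro mult_mono powr_mono2) auto
  also have "\<dots> = 2 powr (a + s) * radial_weight a s r"
    unfolding radial_weight_def powr_add powr_mult[of 2] by (simp only: mult_ac)
  finally show ?thesis by (simp add: radial_weight_def)
qed

lemma radial_weight_subadditive:
  fixes x y :: "'a::real_normed_vector"
  assumes "0 \<le> a" "0 \<le> s"
  shows "radial_weight a s (norm (x + y)) \<le> 2 powr (a + s) * (radial_weight a s (norm x) + radial_weight a s (norm y))"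
proof -
  let ?m = "max (norm x) (norm y)"
  have "radial_weight a s (norm (x + y)) \<le> radial_weight a s (2 * ?m)"
    using assms norm_triangle_ineq[of x y] by (intro radial_weight_mono) auto
  also have "\<dots> \<le> 2 powr (a + s) * radial_weight a s ?m"
    using assms by (intro radial_weight_double) (auto simp: le_max_iff_disj)
  also have "\<dots> \<le> 2 powr (a + s) * (radial_weight a s (norm x) + radial_weight a s (norm y))"
    by (intro mult_left_mono) (auto simp: max_def)
  finally show ?thesis .
qed

text \<open>The value at the origin is changed from \<open>0\<close> to \<open>1\<close>, so that the weight is positive everywhere.\<close>

definition pos_weight :: "real \<Rightarrow> real \<Rightarrow> 'a::real_normed_vector \<Rightarrow> real" where
  "pos_weight a s x = (if x = 0 then 1 else radial_weight a s (norm x))"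

lemma pos_weight_measurable [measurable]: "pos_weight a s \<in> borel_measurable (borel :: 'a::euclidean_space measure)"
  unfolding pos_weight_def[abs_def] by measurable

lemma pos_weight_pos [simp]: "0 < pos_weight a s x"
  by (simp add: pos_weight_def radial_weight_pos)

text \<open>The bracket is at most 2 for r \<le> 1 and at most 2 r for r > 1, which compares the
  weight with a pure power in each regime at the cost of 2^(a e).\<close>

lemma radial_weight_inverse_bound:
  assumes "0 \<le> a" "0 \<le> s" "0 \<le> e" "0 < r"
  shows "radial_weight a s r powr (- e) \<le> 2 powr (a * e) * two_powers (a * e) (s * e) r"
proof -
  have jr: "1 \<le> japanese r" "r \<le> japanese r" using japanese_ge_1 norm_le_japanese[of r] assms by auto
  have eq: "radial_weight a s r powr (- e) = (r / japanese r) powr (- (a * e)) * japanese r powr (- (s * e))"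
    using assms by (simp add: radial_weight_def powr_mult powr_powr)
  show ?thesis
  proof (cases "r \<le> 1")
    case True
    have "japanese r \<le> 2"
      using True assms power_le_one[of r 2] unfolding japanese_def by (intro real_le_lsqrt) auto
    then have "r / 2 \<le> r / japanese r" using assms by (intro divide_left_mono) auto
    then have "(r / japanese r) powr (- (a * e)) \<le> (r / 2) powr (- (a * e))" using assms by (intro powr_mono2') auto
    also have "\<dots> = 2 powr (a * e) * r powr (- (a * e))" unfolding powr_divide powr_minus_divide[of 2] by simp
    finally have 1: "(r / japanese r) powr (- (a * e)) \<le> 2 powr (a * e) * r powr (- (a * e))" .
    have "japanese r powr (- (s * e)) \<le> 1" using assms by (intro japanese_powr_le_1) auto
    with 1 have "(r / japanese r) powr (- (a * e)) * japanese r powr (- (s * e)) \<le> (2 powr (a * e) * r powr (- (a * e))) * 1"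
      by (intro mult_mono) auto
    then show ?thesis using True assms unfolding eq by (simp add: two_powers_def)
  next
    case False
    have "japanese r \<le> 2 * r"
    proof -
      have "1 + r\<^sup>2 \<le> (2 * r)\<^sup>2" 
      proof -
        have "1 \<le> r\<^sup>2" using False by (intro one_le_power) simp
        then show ?thesis unfolding power_mult_distrib by simp
      qed
      then show ?thesis using False unfolding japanese_def by (intro real_le_lsqrt) auto
    qed
    then have "1 / 2 \<le> r / japanese r" by (simp add: field_simps)
    then have "(r / japanese r) powr (- (a * e)) \<le> (1 / 2) powr (- (a * e))" using assms by (intro powr_mono2') auto
    also have "\<dots> = 2 powr (a * e)" unfolding powr_divide powr_minus_divide[of 2] by simp
    finally have 1: "(r / japanese r) powr (- (a * e)) \<le> 2 powr (a * e)" .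
    have "japanese r powr (- (s * e)) \<le> r powr (- (s * e))" using assms jr by (intro powr_mono2') auto
    with 1 have "(r / japanese r) powr (- (a * e)) * japanese r powr (- (s * e)) \<le> 2 powr (a * e) * r powr (- (s * e))"
      by (intro mult_mono) auto
    then show ?thesis using False assms unfolding eq by (simp add: two_powers_def)
  qed
qed

section \<open>Inverse square weights on thickened spheres\<close>

text \<open>\<open>R\<close> stands for the contribution of the remaining coordinates to the squared
  distance. It only shifts the level, and the planar bound is uniform in the level.\<close>

lemma nn_integral_annulus_2d:
  assumes "1 < p"
  shows "(\<integral>\<^sup>+y. \<integral>\<^sup>+z. ennreal (japanese (2 * ((y - c)\<^sup>2 + (z - (d::real))\<^sup>2 + R) - K) powr (- p)) \<partial>lborel \<partial>lborel) \<le> ennreal (pi * (1 / (1 - 1 / p)))"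
proof -
  let ?\<phi> = "\<lambda>v :: real \<times> real. 2 * (norm (v - (c, d)))\<^sup>2"
  have \<phi>m: "?\<phi> \<in> borel_measurable borel" by (intro borel_measurable_continuous_onI continuous_intros)
  have "(\<integral>\<^sup>+v. ennreal (japanese (?\<phi> v - (K - 2 * R)) powr (- p)) \<partial>lborel) \<le> ennreal (pi * (1 / (1 - 1 / p)))"
  proof (rule nn_integral_japanese_level[where e = 1])
    show "?\<phi> \<in> borel_measurable borel" by (rule \<phi>m)
  qed (use assms annulus_measure_2d in auto)
  also have "(\<integral>\<^sup>+v. ennreal (japanese (?\<phi> v - (K - 2 * R)) powr (- p)) \<partial>lborel)
     = (\<integral>\<^sup>+y. \<integral>\<^sup>+z. ennreal (japanese (?\<phi> (y, z) - (K - 2 * R)) powr (- p)) \<partial>lborel \<partial>lborel)"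
  proof (rule nn_integral_lborel_fst)
    show "(\<lambda>v. ennreal (japanese (?\<phi> v - (K - 2 * R)) powr (- p))) \<in> borel_measurable (lborel \<Otimes>\<^sub>M lborel)"
      unfolding lborel_prod using \<phi>m by simp
  qed
  also have "\<dots> = (\<integral>\<^sup>+y. \<integral>\<^sup>+z. ennreal (japanese (2 * ((y - c)\<^sup>2 + (z - d)\<^sup>2 + R) - K) powr (- p)) \<partial>lborel \<partial>lborel)"
  proof -
    have "?\<phi> (y, z) - (K - 2 * R) = 2 * ((y - c)\<^sup>2 + (z - d)\<^sup>2 + R) - K" for y z
      by (simp add: norm_Pair distrib_left)
    then show ?thesis by (simp only:)
  qed
  finally show ?thesis .
qed

text \<open>In dimension \<open>n \<ge> 2\<close> two coordinates are used for the sphere, and the weight is distributed over the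
  remaining \<open>n - 2\<close> ones; this is where \<open>2 a < n - 2 < 2 s\<close> enters.\<close>

lemma sphere_weight_bound_ge2:
  assumes dim: "2 \<le> DIM('a::euclidean_space)" and p: "1 < p"
    and a: "0 \<le> a" "a = 0 \<or> 2 * a < real DIM('a) - 2" and s: "0 < s" "real DIM('a) - 2 < 2 * s"
  shows "\<exists>C\<ge>0. \<forall>(c::'a) K. (\<integral>\<^sup>+x. ennreal (1 / (pos_weight a s x)\<^sup>2 * japanese (2 * (norm (x - c))\<^sup>2 - K) powr (- p)) \<partial>lborel) \<le> ennreal C"
proof -
  obtain i :: 'a where i: "i \<in> Basis" using nonempty_Basis by blast
  have "card (Basis - {i}) \<ge> 1" using dim i by simp
  then have "Basis - {i} \<noteq> {}" by (metis card.empty not_one_le_zero)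
  then obtain j :: 'a where j: "j \<in> Basis" "j \<noteq> i" by blast
  define R where "R = Basis - {i, j}"
  have R: "finite R" "i \<notin> R" "j \<notin> R" "Basis = insert i (insert j R)" "i \<notin> insert j R"
    using i j by (auto simp: R_def)
  define m where "m = card R"
  have "DIM('a) = card (insert i (insert j R))" using R(4) by simp
  also have "\<dots> = Suc (Suc m)" using R(1,2,3,5) by (simp add: m_def)
  finally have m: "real m = real DIM('a) - 2" by simp
  \<comment> \<open>The value infinity at 0 makes the bound \<open>pt\<close> hold on the coordinate
    hyperplanes too, and a single point does not affect the integral.\<close>
  define J where "J x = (if x = 0 then \<infinity> else ennreal (radial_weight a s \<bar>x\<bar> powr (- (2 / m))))" for x :: real
  have Jm [measurable]: "J \<in> borel_measurable borel" unfolding J_def[abs_def] by measurable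
  have JI: "(\<integral>\<^sup>+x. J x \<partial>lborel) < \<infinity>" if "m > 0"
  proof -
    have am: "a * (2 / m) < 1" using a m that by (auto simp: field_simps)
    have sm: "1 < s * (2 / m)" using s m that by (auto simp: field_simps)
    have "(\<integral>\<^sup>+x. J x \<partial>lborel) \<le> (\<integral>\<^sup>+x. ennreal (2 powr (a * (2 / m))) * ennreal (two_powers (a * (2 / m)) (s * (2 / m)) x) \<partial>lborel)"
    proof (rule nn_integral_mono_AE)
      show "AE x in lborel. J x \<le> ennreal (2 powr (a * (2 / m))) * ennreal (two_powers (a * (2 / m)) (s * (2 / m)) x)"
        using AE_lborel_singleton[of 0]
      proof eventually_elim
        case (elim x)
        have "radial_weight a s \<bar>x\<bar> powr (- (2 / m)) \<le> 2 powr (a * (2 / m)) * two_powers (a * (2 / m)) (s * (2 / m)) \<bar>x\<bar>"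
          using a s elim by (intro radial_weight_inverse_bound) auto
        also have "two_powers (a * (2 / m)) (s * (2 / m)) \<bar>x\<bar> = two_powers (a * (2 / m)) (s * (2 / m)) x" by (simp add: two_powers_def)
        finally show ?case using elim by (simp add: J_def ennreal_mult[symmetric] ennreal_leI)
      qed
    qed
    also have "\<dots> = ennreal (2 powr (a * (2 / m))) * (\<integral>\<^sup>+x. ennreal (two_powers (a * (2 / m)) (s * (2 / m)) x) \<partial>lborel)"
      by (rule nn_integral_cmult) measurable
    also have "\<dots> < \<infinity>" using nn_integral_two_powers[OF am sm] by (simp add: ennreal_mult_less_top)
    finally show ?thesis .
  qed
  have pt: "ennreal (1 / (pos_weight a s x)\<^sup>2) \<le> (\<Prod>k\<in>R. J (x \<bullet> k))" for x :: 'a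
  proof (cases "R = {}")
    \<comment> \<open>No coordinate is left over: the dimension is 2, where the assumption forces a
      = 0 and the weight is at least 1.\<close>
    case True
    then have "real DIM('a) - 2 = 0" using m by (simp add: m_def)
    then have a0: "a = 0" using a by auto
    have "1 \<le> pos_weight a s x"
      using a0 s(1) japanese_ge_1[of "norm x"] by (simp add: pos_weight_def radial_weight_def ge_one_powr_ge_zero)
    then have "1 / (pos_weight a s x)\<^sup>2 \<le> 1" by (simp add: one_le_power)
    then show ?thesis using True by (simp add: ennreal_le_1)
  next
    case ne: False
    then have m0: "m > 0" using R by (simp add: m_def card_gt_0_iff)
    show ?thesis
    proof (cases "\<exists>k\<in>R. x \<bullet> k = 0")
      case True
      then obtain k where k: "k \<in> R" "x \<bullet> k = 0" by blast
      \<comment> \<open>No factor vanishes, so one infinite factor makes the product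
        infinite.\<close>
      have "J t \<noteq> 0" for t using radial_weight_pos[of "\<bar>t\<bar>" a s] by (auto simp: J_def)
      then have "(\<Prod>k\<in>R. J (x \<bullet> k)) = \<infinity>"
        using k R(1) by (simp add: ennreal_prod_eq_top) (auto simp: J_def intro!: bexI[of _ k])
      then show ?thesis by simp
    next
      case False
      then have nz: "\<And>k. k \<in> R \<Longrightarrow> x \<bullet> k \<noteq> 0" by blast
      then have x0: "x \<noteq> 0" using ne by auto
      let ?w = "radial_weight a s (norm x)"
      have w: "0 < ?w" using x0 by (intro radial_weight_pos) simp
      \<comment> \<open>The inverse square is split into \<open>m\<close> equal factors, one for
        each remaining coordinate; by monotonicity |x| may then be replaced by |x . k| in the factor
        of \<open>k\<close>.\<close>
      have "1 / (pos_weight a s x)\<^sup>2 = (\<Prod>k\<in>R. ?w powr (- (2 / m)))"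
      proof -
        have "(\<Prod>k\<in>R. ?w powr (- (2 / m))) = (?w powr (- (2 / m))) powr real m"
          using w by (simp add: m_def powr_realpow)
        also have "\<dots> = ?w powr (- 2)" using m0 by (simp add: powr_powr)
        also have "\<dots> = 1 / ?w\<^sup>2" using w by (simp add: powr_minus_divide powr_numeral)
        finally show ?thesis using x0 by (simp add: pos_weight_def)
      qed
      also have "\<dots> \<le> (\<Prod>k\<in>R. radial_weight a s \<bar>x \<bullet> k\<bar> powr (- (2 / m)))"
      proof (rule prod_mono)
        fix k assume k: "k \<in> R"
        have "radial_weight a s \<bar>x \<bullet> k\<bar> \<le> ?w"
          using a s k by (intro radial_weight_mono Basis_le_norm) (auto simp: R_def)
        moreover have "0 < radial_weight a s \<bar>x \<bullet> k\<bar>" using nz[OF k] by (intro radial_weight_pos) simp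
        ultimately show "0 \<le> ?w powr (- (2 / m)) \<and> ?w powr (- (2 / m)) \<le> radial_weight a s \<bar>x \<bullet> k\<bar> powr (- (2 / m))"
          using m0 by (intro conjI powr_mono2') auto
      qed
      finally have "ennreal (1 / (pos_weight a s x)\<^sup>2) \<le> (\<Prod>k\<in>R. ennreal (radial_weight a s \<bar>x \<bullet> k\<bar> powr (- (2 / m))))"
        by (subst prod_ennreal) (auto intro: ennreal_leI)
      also have "\<dots> = (\<Prod>k\<in>R. J (x \<bullet> k))" using nz by (intro prod.cong) (auto simp: J_def)
      finally show ?thesis .
    qed
  qed
  let ?M = "ennreal (pi * (1 / (1 - 1 / p)))" and ?P = "\<Prod>k\<in>R. (\<integral>\<^sup>+x. J x \<partial>lborel)"
  have bound: "(\<integral>\<^sup>+x. ennreal (1 / (pos_weight a s x)\<^sup>2 * japanese (2 * (norm (x - c))\<^sup>2 - K) powr (- p)) \<partial>lborel) \<le> ?P * ?M" for c :: 'a and K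
  proof -
    interpret product_sigma_finite "\<lambda>b::'a. lborel :: real measure" ..
    define G where "G f = (\<Prod>k\<in>R. J (f k)) * ennreal (japanese (2 * ((f i - c \<bullet> i)\<^sup>2 + (f j - c \<bullet> j)\<^sup>2 + (\<Sum>k\<in>R. (f k - c \<bullet> k)\<^sup>2)) - K) powr (- p))" for f :: "'a \<Rightarrow> real"
    have Gm [measurable]: "G \<in> borel_measurable (Pi\<^sub>M (insert i (insert j R)) (\<lambda>_. lborel))"
      unfolding G_def[abs_def] by (measurable; auto)
    have nrm: "(norm (x - c))\<^sup>2 = (x \<bullet> i - c \<bullet> i)\<^sup>2 + (x \<bullet> j - c \<bullet> j)\<^sup>2 + (\<Sum>k\<in>R. (x \<bullet> k - c \<bullet> k)\<^sup>2)" for x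
    proof -
      have "(\<Sum>b\<in>Basis. g b) = g i + g j + (\<Sum>k\<in>R. g k)" for g :: "'a \<Rightarrow> real"
        unfolding R(4) using R(1,2,3,5) by (simp add: add.assoc)
      then show ?thesis unfolding norm_sq_Basis by (simp only: inner_diff_left)
    qed
    have "(\<integral>\<^sup>+x. ennreal (1 / (pos_weight a s x)\<^sup>2 * japanese (2 * (norm (x - c))\<^sup>2 - K) powr (- p)) \<partial>lborel) \<le> (\<integral>\<^sup>+x. G (\<lambda>k. x \<bullet> k) \<partial>lborel)"
    proof (rule nn_integral_mono)
      fix x
      show "ennreal (1 / (pos_weight a s x)\<^sup>2 * japanese (2 * (norm (x - c))\<^sup>2 - K) powr (- p)) \<le> G (\<lambda>k. x \<bullet> k)"
        unfolding G_def nrm[symmetric] by (subst ennreal_mult) (auto intro: mult_right_mono pt)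
    qed
    also have "\<dots> = (\<integral>\<^sup>+x. G (\<lambda>k. x \<bullet> k) \<partial>distr (\<Pi>\<^sub>M b\<in>Basis. lborel) borel (\<lambda>f. \<Sum>b\<in>Basis. f b *\<^sub>R b))"
      by (subst lborel_eq) simp
    also have "\<dots> = (\<integral>\<^sup>+f. G (\<lambda>k. (\<Sum>b\<in>Basis. f b *\<^sub>R b) \<bullet> k) \<partial>(\<Pi>\<^sub>M b\<in>Basis. lborel))"
    proof -
      have "(\<lambda>x::'a. G (\<lambda>k. x \<bullet> k)) \<in> borel_measurable borel" unfolding G_def by measurable
      then show ?thesis by (intro nn_integral_distr) (simp_all add: borel_measurable_sum)
    qed
    also have "\<dots> = (\<integral>\<^sup>+f. G f \<partial>(\<Pi>\<^sub>M b\<in>Basis. lborel))"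
    proof (rule nn_integral_cong)
      fix f :: "'a \<Rightarrow> real"
      have "(\<Sum>b\<in>Basis. f b *\<^sub>R b) \<bullet> k = f k" if "k \<in> Basis" for k using that by (simp add: inner_sum_left_Basis)
      then show "G (\<lambda>k. (\<Sum>b\<in>Basis. f b *\<^sub>R b) \<bullet> k) = G f" unfolding G_def using i j R_def by simp
    qed
    \<comment> \<open>The coordinates \<open>i\<close> and \<open>j\<close> are integrated
      innermost, with all others fixed.\<close>
    also have "\<dots> = (\<integral>\<^sup>+f. \<integral>\<^sup>+y. G (f(i := y)) \<partial>lborel \<partial>Pi\<^sub>M (insert j R) (\<lambda>_. lborel))"
      unfolding R(4) by (rule product_nn_integral_insert[OF _ _ Gm]) (use R(1,2,3,5) in auto)
    also have "\<dots> = (\<integral>\<^sup>+f. \<integral>\<^sup>+z. \<integral>\<^sup>+y. G (f(j := z, i := y)) \<partial>lborel \<partial>lborel \<partial>Pi\<^sub>M R (\<lambda>_. lborel))"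
    proof (rule product_nn_integral_insert)
      have "(\<lambda>(f, y). G (f(i := y))) \<in> borel_measurable (Pi\<^sub>M (insert j R) (\<lambda>_. lborel) \<Otimes>\<^sub>M lborel)"
        using measurable_compose[OF measurable_add_dim Gm] by (simp add: case_prod_beta')
      then show "(\<lambda>f. \<integral>\<^sup>+y. G (f(i := y)) \<partial>lborel) \<in> borel_measurable (Pi\<^sub>M (insert j R) (\<lambda>_. lborel))"
        by (rule lborel.borel_measurable_nn_integral)
    qed (use R(1,2,3,5) in auto)
    also have "\<dots> \<le> (\<integral>\<^sup>+f. (\<Prod>k\<in>R. J (f k)) * ?M \<partial>Pi\<^sub>M R (\<lambda>_. lborel))"
    proof (rule nn_integral_mono)
      fix f :: "'a \<Rightarrow> real"
      let ?S = "\<Sum>k\<in>R. (f k - c \<bullet> k)\<^sup>2"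
      let ?\<Phi> = "\<lambda>z y. ennreal (japanese (2 * ((z - c \<bullet> j)\<^sup>2 + (y - c \<bullet> i)\<^sup>2 + ?S) - K) powr (- p))"
      have G: "G (f(j := z, i := y)) = (\<Prod>k\<in>R. J (f k)) * ?\<Phi> z y" for z y
      proof -
        have "(\<Prod>k\<in>R. J ((f(j := z, i := y)) k)) = (\<Prod>k\<in>R. J (f k))" "(\<Sum>k\<in>R. ((f(j := z, i := y)) k - c \<bullet> k)\<^sup>2) = ?S"
          using R by (auto intro!: prod.cong sum.cong)
        then show ?thesis unfolding G_def using j by (simp add: add_ac)
      qed
      have "(\<integral>\<^sup>+z. \<integral>\<^sup>+y. G (f(j := z, i := y)) \<partial>lborel \<partial>lborel) = (\<Prod>k\<in>R. J (f k)) * (\<integral>\<^sup>+z. \<integral>\<^sup>+y. ?\<Phi> z y \<partial>lborel \<partial>lborel)"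
        unfolding G by (simp add: nn_integral_cmult)
      also have "\<dots> \<le> (\<Prod>k\<in>R. J (f k)) * ?M" by (intro mult_left_mono nn_integral_annulus_2d p) simp
      finally show "(\<integral>\<^sup>+z. \<integral>\<^sup>+y. G (f(j := z, i := y)) \<partial>lborel \<partial>lborel) \<le> (\<Prod>k\<in>R. J (f k)) * ?M" .
    qed
    also have "\<dots> = (\<integral>\<^sup>+f. (\<Prod>k\<in>R. J (f k)) \<partial>Pi\<^sub>M R (\<lambda>_. lborel)) * ?M"
      by (rule nn_integral_multc) (measurable; auto)
    also have "(\<integral>\<^sup>+f. (\<Prod>k\<in>R. J (f k)) \<partial>Pi\<^sub>M R (\<lambda>_. lborel)) = ?P"
      using R by (subst product_nn_integral_prod) auto
    finally show ?thesis .
  qed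
  have fin: "?P * ?M < \<infinity>"
  proof (cases "R = {}")
    case False
    then have "m > 0" using R by (simp add: m_def card_gt_0_iff)
    then show ?thesis using JI by (simp add: ennreal_mult_less_top power_less_top_ennreal)
  qed simp
  show ?thesis
    using bound fin by (intro exI[of _ "enn2real (?P * ?M)"]) auto
qed

text \<open>The only coordinate has to serve both the weight and the sphere, so two regions are
  separated. For |x| \<le> 1 the inverse square weight is integrable by 2 a < 1 and the bracket
  factor is at most 1; for |x| > 1 the weight is bounded below and \<open>annulus_measure_1d\<close>
  applies.\<close>

lemma sphere_weight_bound_1:
  assumes dim: "DIM('a::euclidean_space) = 1" and p: "1 < p"
    and a: "0 \<le> a" "2 * a < 1" and s: "0 < s"
  shows "\<exists>C\<ge>0. \<forall>(c::'a) K. (\<integral>\<^sup>+x. ennreal (1 / (pos_weight a s x)\<^sup>2 * japanese (2 * (norm (x - c))\<^sup>2 - K) powr (- p)) \<partial>lborel) \<le> ennreal C"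
proof -
  obtain i :: 'a where i: "Basis = {i}" using dim card_1_singletonE by blast
  \<comment> \<open>The exponent 2 at infinity could be any number above 1: the bound by
    \<open>?q\<close> serves the region |x| \<le> 1.\<close>
  let ?q = "two_powers (2 * a) 2"
  let ?I = "\<integral>\<^sup>+x. ennreal (?q x) \<partial>lborel" and ?M = "ennreal (2 * (1 / (1 - (1 / 2) / p)))"
  have I: "?I < \<infinity>" using a by (intro nn_integral_two_powers) auto
  let ?C = "ennreal (2 powr (a * 2)) * (?I + ?M)"
  have bound: "(\<integral>\<^sup>+x. ennreal (1 / (pos_weight a s x)\<^sup>2 * japanese (2 * (norm (x - c))\<^sup>2 - K) powr (- p)) \<partial>lborel) \<le> ?C" for c :: 'a and K
  proof -
    let ?\<Phi> = "\<lambda>t. japanese (2 * (t - c \<bullet> i)\<^sup>2 - K) powr (- p)"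
    let ?F = "\<lambda>t. ennreal (2 powr (a * 2)) * (ennreal (?q t) + ennreal (?\<Phi> t))"
    have nrm: "norm x = \<bar>x \<bullet> i\<bar>" for x :: 'a
    proof -
      have "(norm x)\<^sup>2 = \<bar>x \<bullet> i\<bar>\<^sup>2" unfolding norm_sq_Basis i by simp
      then show ?thesis by (rule power2_eq_imp_eq) simp_all
    qed
    have "(\<integral>\<^sup>+x. ennreal (1 / (pos_weight a s x)\<^sup>2 * japanese (2 * (norm (x - c))\<^sup>2 - K) powr (- p)) \<partial>lborel) \<le> (\<integral>\<^sup>+x. ?F (x \<bullet> i) \<partial>lborel)"
    proof (rule nn_integral_mono_AE)
      show "AE x in lborel. ennreal (1 / (pos_weight a s x)\<^sup>2 * japanese (2 * (norm (x - c))\<^sup>2 - K) powr (- p)) \<le> ?F (x \<bullet> i)"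
        using AE_lborel_singleton[of 0]
      proof eventually_elim
        case (elim x)
        let ?w = "radial_weight a s (norm x)" and ?t = "x \<bullet> i"
        have w: "0 < ?w" using elim by (intro radial_weight_pos) simp
        have t0: "?t \<noteq> 0" using elim nrm[of x] by auto
        have 1: "1 / (pos_weight a s x)\<^sup>2 = ?w powr (- 2)"
          using w elim by (simp add: pos_weight_def powr_minus_divide powr_numeral)
        also have "\<dots> \<le> 2 powr (a * 2) * two_powers (a * 2) (s * 2) (norm x)"
          using a s elim by (intro radial_weight_inverse_bound) auto
        also have "two_powers (a * 2) (s * 2) (norm x) \<le> (if \<bar>?t\<bar> \<le> 1 then ?q ?t else 1)"
          using s t0 powr_mono2'[of "- (s * 2)" 1 "\<bar>?t\<bar>"] by (auto simp: two_powers_def nrm mult.commute)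
        finally have 2: "1 / (pos_weight a s x)\<^sup>2 \<le> 2 powr (a * 2) * (if \<bar>?t\<bar> \<le> 1 then ?q ?t else 1)" by simp
        have \<Phi>1: "?\<Phi> ?t \<le> 1" using p by (intro japanese_powr_le_1) simp
        have "1 / (pos_weight a s x)\<^sup>2 * ?\<Phi> ?t \<le> 2 powr (a * 2) * ((if \<bar>?t\<bar> \<le> 1 then ?q ?t else 1) * ?\<Phi> ?t)"
          using mult_right_mono[OF 2, of "?\<Phi> ?t"] by (simp add: mult.assoc)
        also have "\<dots> \<le> 2 powr (a * 2) * (?q ?t + ?\<Phi> ?t)"
        proof (intro mult_left_mono)
          show "(if \<bar>?t\<bar> \<le> 1 then ?q ?t else 1) * ?\<Phi> ?t \<le> ?q ?t + ?\<Phi> ?t"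
          proof (cases "\<bar>?t\<bar> \<le> 1")
            case True
            have "?q ?t * ?\<Phi> ?t \<le> ?q ?t * 1" by (intro mult_left_mono \<Phi>1) simp
            then show ?thesis using True by (simp add: add_increasing2)
          qed simp
        qed simp
        finally have "ennreal (1 / (pos_weight a s x)\<^sup>2 * ?\<Phi> ?t) \<le> ennreal (2 powr (a * 2) * (?q ?t + ?\<Phi> ?t))" by (rule ennreal_leI)
        moreover have "(norm (x - c))\<^sup>2 = (?t - c \<bullet> i)\<^sup>2" by (simp add: nrm inner_diff_left)
        ultimately show ?case by (simp add: ennreal_mult)
      qed
    qed
    also have "\<dots> = (\<integral>\<^sup>+x. (\<Prod>b\<in>(Basis::'a set). ?F (x \<bullet> b)) \<partial>lborel)" by (simp add: i)
    also have "\<dots> = (\<Prod>b\<in>(Basis::'a set). \<integral>\<^sup>+t. ?F t \<partial>lborel)" by (rule nn_integral_lborel_prod) auto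
    also have "\<dots> = ennreal (2 powr (a * 2)) * (?I + (\<integral>\<^sup>+t. ennreal (?\<Phi> t) \<partial>lborel))"
      by (simp add: i nn_integral_cmult nn_integral_add)
    also have "\<dots> \<le> ?C"
    proof (intro mult_left_mono add_mono order_refl)
      show "(\<integral>\<^sup>+t. ennreal (?\<Phi> t) \<partial>lborel) \<le> ?M"
        by (rule nn_integral_japanese_level[where \<phi> = "\<lambda>t. 2 * (t - c \<bullet> i)\<^sup>2" and e = "1 / 2"])
          (use p annulus_measure_1d in auto)
    qed simp
    finally show ?thesis .
  qed
  have fin: "?C < \<infinity>" using I by (simp add: ennreal_mult_less_top)
  show ?thesis using bound fin by (intro exI[of _ "enn2real ?C"]) auto
qed

section \<open>The bilinear estimate\<close>

definition nn_conv :: "('a::euclidean_space \<Rightarrow> ennreal) \<Rightarrow> ('a \<Rightarrow> ennreal) \<Rightarrow> 'a \<Rightarrow> ennreal" where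
  "nn_conv u v P = (\<integral>\<^sup>+p. u p * v (P - p) \<partial>lborel)"

lemma nn_conv_measurable [measurable]:
  assumes [measurable]: "u \<in> borel_measurable borel" "v \<in> borel_measurable borel"
  shows "nn_conv u v \<in> borel_measurable borel"
  unfolding nn_conv_def[abs_def] by measurable

lemma nn_conv_commute:
  assumes [measurable]: "u \<in> borel_measurable borel" "v \<in> borel_measurable borel"
  shows "nn_conv u v = nn_conv v u"
proof
  fix P
  have "(\<integral>\<^sup>+p. v (P - p) * u (P - (P - p)) \<partial>lborel) = (\<integral>\<^sup>+p. v p * u (P - p) \<partial>lborel)"
    by (rule lborel_nn_integral_reflect) measurable
  then show "nn_conv u v P = nn_conv v u P" unfolding nn_conv_def by (simp add: mult.commute)
qed

lemma nn_conv_add_left: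
  assumes [measurable]: "u \<in> borel_measurable borel" "u' \<in> borel_measurable borel" "v \<in> borel_measurable borel"
  shows "nn_conv (\<lambda>p. u p + u' p) v P = nn_conv u v P + nn_conv u' v P"
  unfolding nn_conv_def by (simp add: distrib_right nn_integral_add)

lemma ennreal_power2_add_le: "(a + b)\<^sup>2 \<le> 2 * a\<^sup>2 + 2 * (b::ennreal)\<^sup>2"
proof (cases a; cases b)
  fix x y :: real assume "a = ennreal x" "b = ennreal y" "0 \<le> x" "0 \<le> y"
  moreover have "(x + y)\<^sup>2 \<le> 2 * x\<^sup>2 + 2 * y\<^sup>2" using zero_le_power2[of "x - y"] by (simp add: power2_eq_square algebra_simps)
  ultimately show ?thesis by (simp add: ennreal_power ennreal_plus[symmetric] ennreal_mult'[symmetric] ennreal_numeral[symmetric] del: ennreal_plus ennreal_numeral)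
qed (auto simp: power2_eq_square ennreal_mult_top)

text \<open>The right-hand side does not change if \<open>u\<close> alone is reflected. Hence the parts \<open>\<tau> \<ge> 0\<close> and
  \<open>\<tau> < 0\<close> of the two factors need not be distinguished.\<close>

lemma nn_integral_nn_conv_square:
  fixes u v :: "'a::euclidean_space \<Rightarrow> ennreal"
  assumes [measurable]: "u \<in> borel_measurable borel" "v \<in> borel_measurable borel"
  shows "(\<integral>\<^sup>+P. (nn_conv u v P)\<^sup>2 \<partial>lborel) = (\<integral>\<^sup>+z. (\<integral>\<^sup>+p. u p * u (p + z) \<partial>lborel) * (\<integral>\<^sup>+p. v p * v (p + z) \<partial>lborel) \<partial>lborel)"
proof -
  let ?I = "\<lambda>P p z. u p * u (p + z) * (v (P - p) * v (P - p - z))"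
  have sq: "(nn_conv u v P)\<^sup>2 = (\<integral>\<^sup>+p. \<integral>\<^sup>+z. ?I P p z \<partial>lborel \<partial>lborel)" for P
  proof -
    \<comment> \<open>The second copy of the convolution is translated by the variable of the first,
      so that \<open>z\<close> becomes the difference of the two variables.\<close>
    have t: "nn_conv u v P = (\<integral>\<^sup>+z. u (p + z) * v (P - (p + z)) \<partial>lborel)" for p
      unfolding nn_conv_def by (rule lborel_nn_integral_translate[symmetric]) measurable
    have "(nn_conv u v P)\<^sup>2 = (\<integral>\<^sup>+p. u p * v (P - p) * nn_conv u v P \<partial>lborel)"
      unfolding power2_eq_square by (subst (1) nn_conv_def) (simp add: nn_integral_multc)
    also have "\<dots> = (\<integral>\<^sup>+p. \<integral>\<^sup>+z. u p * v (P - p) * (u (p + z) * v (P - (p + z))) \<partial>lborel \<partial>lborel)"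
      by (rule nn_integral_cong) (subst t, simp add: nn_integral_cmult)
    finally show ?thesis by (simp add: mult_ac diff_diff_add)
  qed
  have vv: "(\<integral>\<^sup>+P. v (P - p) * v (P - p - z) \<partial>lborel) = (\<integral>\<^sup>+q. v q * v (q + z) \<partial>lborel)" for p z
  proof -
    have "(\<integral>\<^sup>+P. v (- (p + z) + P + z) * v (- (p + z) + P) \<partial>lborel) = (\<integral>\<^sup>+q. v (q + z) * v q \<partial>lborel)"
      by (rule lborel_nn_integral_translate) measurable
    moreover have "- (p + z) + P + z = P - p" "- (p + z) + P = P - p - z" for P by (simp_all add: algebra_simps)
    ultimately show ?thesis by (simp only: mult.commute)
  qed
  have "(\<integral>\<^sup>+P. (nn_conv u v P)\<^sup>2 \<partial>lborel) = (\<integral>\<^sup>+p. \<integral>\<^sup>+P. \<integral>\<^sup>+z. ?I P p z \<partial>lborel \<partial>lborel \<partial>lborel)"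
    unfolding sq by (rule lborel_pair.Fubini') measurable
  also have "\<dots> = (\<integral>\<^sup>+p. \<integral>\<^sup>+z. \<integral>\<^sup>+P. ?I P p z \<partial>lborel \<partial>lborel \<partial>lborel)"
  proof (rule nn_integral_cong)
    fix p
    show "(\<integral>\<^sup>+P. \<integral>\<^sup>+z. ?I P p z \<partial>lborel \<partial>lborel) = (\<integral>\<^sup>+z. \<integral>\<^sup>+P. ?I P p z \<partial>lborel \<partial>lborel)"
      by (rule lborel_pair.Fubini') measurable
  qed
  also have "\<dots> = (\<integral>\<^sup>+p. \<integral>\<^sup>+z. u p * u (p + z) * (\<integral>\<^sup>+q. v q * v (q + z) \<partial>lborel) \<partial>lborel \<partial>lborel)"
    by (simp add: nn_integral_cmult vv)
  also have "\<dots> = (\<integral>\<^sup>+z. \<integral>\<^sup>+p. u p * u (p + z) * (\<integral>\<^sup>+q. v q * v (q + z) \<partial>lborel) \<partial>lborel \<partial>lborel)"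
    by (rule lborel_pair.Fubini') measurable
  finally show ?thesis by (simp add: nn_integral_multc)
qed

lemma nn_integral_nn_conv_reflect:
  fixes u v :: "'a::euclidean_space \<Rightarrow> ennreal"
  assumes [measurable]: "u \<in> borel_measurable borel" "v \<in> borel_measurable borel"
  shows "(\<integral>\<^sup>+P. (nn_conv (\<lambda>p. u (- p)) v P)\<^sup>2 \<partial>lborel) = (\<integral>\<^sup>+P. (nn_conv u v P)\<^sup>2 \<partial>lborel)"
proof -
  have "(\<integral>\<^sup>+p. u (- p) * u (- (p + z)) \<partial>lborel) = (\<integral>\<^sup>+p. u p * u (p + z) \<partial>lborel)" for z
  proof -
    have "(\<integral>\<^sup>+p. u (- z - p + z) * u (- z - p) \<partial>lborel) = (\<integral>\<^sup>+p. u (p + z) * u p \<partial>lborel)"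
      by (rule lborel_nn_integral_reflect) measurable
    moreover have "- z - p + z = - p" "- z - p = - (p + z)" for p by (simp_all add: algebra_simps)
    ultimately show ?thesis by (simp only: mult.commute)
  qed
  then show ?thesis by (simp add: nn_integral_nn_conv_square)
qed

section \<open>The estimate without spatial weight on the product\<close>

lemma powr_square: "0 < x \<Longrightarrow> (x powr b)\<^sup>2 = (x::real) powr (2 * b)"
  by (simp add: power2_eq_square powr_add[symmetric])

lemma parallelogram_half: "(norm (x - y))\<^sup>2 + (norm y)\<^sup>2 = 2 * (norm (y - (1/2) *\<^sub>R x))\<^sup>2 + (norm (x::'a::real_inner))\<^sup>2 / 2"
  by (simp add: power2_norm_eq_inner inner_diff inner_commute algebra_simps)

text \<open>\<open>h\<close> weights the factors and \<open>r\<close> the product; \<open>h\<close> only differs from \<open>r\<close> at the origin, to be positive.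
  \<open>E\<close> and \<open>B\<close> below are the modulation weights of the paraboloid and of the given phase.\<close>

locale bilinear_weight =
  fixes h r \<phi> :: "'a::euclidean_space \<Rightarrow> real" and b H D S :: real
  assumes h_measurable [measurable]: "h \<in> borel_measurable borel"
    and r_measurable [measurable]: "r \<in> borel_measurable borel"
    and \<phi>_measurable [measurable]: "\<phi> \<in> borel_measurable borel"
    and h_pos [simp]: "0 < h x" and r_nonneg [simp]: "0 \<le> r x" and h_eq_r: "x \<noteq> 0 \<Longrightarrow> h x = r x"
    and h_even [simp]: "h (- x) = h x" and \<phi>_even [simp]: "\<phi> (- x) = \<phi> x"
    and H: "0 \<le> H" "r (x + y) \<le> H * (h x + h y)"
    and \<phi>_close: "\<bar>\<phi> x - (norm x)\<^sup>2\<bar> \<le> D"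
    and S: "0 \<le> S" "(\<integral>\<^sup>+x. ennreal (1 / (h x)\<^sup>2 * japanese (2 * (norm (x - c))\<^sup>2 - K) powr (- (2 * b))) \<partial>lborel) \<le> ennreal S"
    and b: "1 / 2 < b" "b < 1"
begin

definition E :: "'a \<times> real \<Rightarrow> real" where "E p = japanese (snd p - (norm (fst p))\<^sup>2) powr b"

definition B :: "'a \<times> real \<Rightarrow> real" where "B p = japanese (\<bar>snd p\<bar> - \<phi> (fst p)) powr b"

lemma E_measurable [measurable]: "E \<in> borel_measurable borel"
  unfolding E_def[abs_def] by (subst borel_prod[symmetric]) measurable

lemma B_measurable [measurable]: "B \<in> borel_measurable borel"
  unfolding B_def[abs_def] by (subst borel_prod[symmetric]) measurable

lemma hfst_measurable [measurable]: "(\<lambda>p :: 'a \<times> real. h (fst p)) \<in> borel_measurable borel"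
  by (subst borel_prod[symmetric]) measurable

lemma rfst_measurable [measurable]: "(\<lambda>p :: 'a \<times> real. r (fst p)) \<in> borel_measurable borel"
  by (subst borel_prod[symmetric]) measurable

lemma E_pos [simp]: "0 < E p" and B_pos [simp]: "0 < B p"
  by (simp_all add: E_def B_def)

lemma E_nonneg [simp]: "0 \<le> E p" and B_nonneg [simp]: "0 \<le> B p" and h_nonneg [simp]: "0 \<le> h x"
  using E_pos[of p] B_pos[of p] h_pos[of x] by linarith+

lemma B_even [simp]: "B (- p) = B p"
  by (simp add: B_def)

text \<open>This is what Cauchy-Schwarz leaves to be bounded uniformly in \<open>P\<close>. The
  integral over \<sigma> merges the two brackets into one by
  \<open>japanese_product_integral\<close>; the remaining integral over \<eta> is the sphere bound
  of the locale.\<close>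

lemma resolvent_bound:
  "\<exists>C\<ge>0. \<forall>P. (\<integral>\<^sup>+q. ennreal (1 / ((E (P - q))\<^sup>2 * (h (fst q) * E q)\<^sup>2)) \<partial>lborel) \<le> ennreal C"
proof -
  have p: "1 < 2 * b" using b by simp
  obtain C where C: "0 \<le> C" "\<And>A B :: real. (\<integral>\<^sup>+t. ennreal (japanese (A - t) powr (- (2 * b)) * japanese (t - B) powr (- (2 * b))) \<partial>lborel) \<le> ennreal (C * japanese (A - B) powr (- (2 * b)))"
    using japanese_product_integral[OF p] by auto
  have "(\<integral>\<^sup>+q. ennreal (1 / ((E (P - q))\<^sup>2 * (h (fst q) * E q)\<^sup>2)) \<partial>lborel) \<le> ennreal (C * S)" for P
  proof -
    obtain \<xi> \<tau> where P: "P = (\<xi>, \<tau>)" by (cases P)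
    have Em [measurable]: "(\<lambda>q. ennreal (1 / ((E (P - q))\<^sup>2 * (h (fst q) * E q)\<^sup>2))) \<in> borel_measurable borel" by measurable
    have pt: "ennreal (1 / ((E (P - (\<eta>, \<sigma>)))\<^sup>2 * (h (fst (\<eta>, \<sigma>)) * E (\<eta>, \<sigma>))\<^sup>2))
       = ennreal (1 / (h \<eta>)\<^sup>2) * ennreal (japanese (\<tau> - (norm (\<xi> - \<eta>))\<^sup>2 - \<sigma>) powr (- (2 * b)) * japanese (\<sigma> - (norm \<eta>)\<^sup>2) powr (- (2 * b)))" for \<eta> \<sigma>
      unfolding E_def P power_mult_distrib
      by (simp add: powr_square ennreal_mult[symmetric] powr_minus_divide algebra_simps)
    have "(\<integral>\<^sup>+q. ennreal (1 / ((E (P - q))\<^sup>2 * (h (fst q) * E q)\<^sup>2)) \<partial>lborel)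
      = (\<integral>\<^sup>+\<eta>. \<integral>\<^sup>+\<sigma>. ennreal (1 / ((E (P - (\<eta>, \<sigma>)))\<^sup>2 * (h (fst (\<eta>, \<sigma>)) * E (\<eta>, \<sigma>))\<^sup>2)) \<partial>lborel \<partial>lborel)"
      by (rule nn_integral_lborel_fst) (simp add: lborel_prod)
    also have "\<dots> = (\<integral>\<^sup>+\<eta>. ennreal (1 / (h \<eta>)\<^sup>2) * (\<integral>\<^sup>+\<sigma>. ennreal (japanese (\<tau> - (norm (\<xi> - \<eta>))\<^sup>2 - \<sigma>) powr (- (2 * b)) * japanese (\<sigma> - (norm \<eta>)\<^sup>2) powr (- (2 * b))) \<partial>lborel) \<partial>lborel)"
      unfolding pt by (simp add: nn_integral_cmult)
    also have "\<dots> \<le> (\<integral>\<^sup>+\<eta>. ennreal C * ennreal (1 / (h \<eta>)\<^sup>2 * japanese (2 * (norm (\<eta> - (1/2) *\<^sub>R \<xi>))\<^sup>2 - (\<tau> - (norm \<xi>)\<^sup>2 / 2)) powr (- (2 * b))) \<partial>lborel)"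
    proof (rule nn_integral_mono)
      fix \<eta>
      \<comment> \<open>The sphere has centre \<xi>/2 and level \<tau> - |\<xi>|^2 / 2; the sign
        disappears because the bracket is even.\<close>
      have "\<tau> - (norm (\<xi> - \<eta>))\<^sup>2 - (norm \<eta>)\<^sup>2 = - (2 * (norm (\<eta> - (1/2) *\<^sub>R \<xi>))\<^sup>2 - (\<tau> - (norm \<xi>)\<^sup>2 / 2))"
        using parallelogram_half[of \<xi> \<eta>] by linarith
      then have "japanese (\<tau> - (norm (\<xi> - \<eta>))\<^sup>2 - (norm \<eta>)\<^sup>2) = japanese (2 * (norm (\<eta> - (1/2) *\<^sub>R \<xi>))\<^sup>2 - (\<tau> - (norm \<xi>)\<^sup>2 / 2))"
        by (simp only: japanese_minus)
      then have "ennreal (1 / (h \<eta>)\<^sup>2) * (\<integral>\<^sup>+\<sigma>. ennreal (japanese (\<tau> - (norm (\<xi> - \<eta>))\<^sup>2 - \<sigma>) powr (- (2 * b)) * japanese (\<sigma> - (norm \<eta>)\<^sup>2) powr (- (2 * b))) \<partial>lborel)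
        \<le> ennreal (1 / (h \<eta>)\<^sup>2) * ennreal (C * japanese (2 * (norm (\<eta> - (1/2) *\<^sub>R \<xi>))\<^sup>2 - (\<tau> - (norm \<xi>)\<^sup>2 / 2)) powr (- (2 * b)))"
        by (intro mult_left_mono order_trans[OF C(2)]) auto
      also have "\<dots> = ennreal C * ennreal (1 / (h \<eta>)\<^sup>2 * japanese (2 * (norm (\<eta> - (1/2) *\<^sub>R \<xi>))\<^sup>2 - (\<tau> - (norm \<xi>)\<^sup>2 / 2)) powr (- (2 * b)))"
        using C(1) by (simp add: ennreal_mult[symmetric] mult_ac)
      finally show "ennreal (1 / (h \<eta>)\<^sup>2) * (\<integral>\<^sup>+\<sigma>. ennreal (japanese (\<tau> - (norm (\<xi> - \<eta>))\<^sup>2 - \<sigma>) powr (- (2 * b)) * japanese (\<sigma> - (norm \<eta>)\<^sup>2) powr (- (2 * b))) \<partial>lborel) \<le> \<dots>" .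
    qed
    also have "\<dots> = ennreal C * (\<integral>\<^sup>+\<eta>. ennreal (1 / (h \<eta>)\<^sup>2 * japanese (2 * (norm (\<eta> - (1/2) *\<^sub>R \<xi>))\<^sup>2 - (\<tau> - (norm \<xi>)\<^sup>2 / 2)) powr (- (2 * b))) \<partial>lborel)"
      by (rule nn_integral_cmult) measurable
    also have "\<dots> \<le> ennreal C * ennreal S" by (intro mult_left_mono S(2)) simp
    finally show ?thesis using C(1) S(1) by (simp add: ennreal_mult)
  qed
  then show ?thesis using C(1) S(1) by (intro exI[of _ "C * S"]) auto
qed

text \<open>Cauchy-Schwarz for each \<open>P\<close>, with the weights of both factors inserted and
  divided out. Only the second factor carries \<open>h\<close>, matching the single h^(-2) in
  \<open>resolvent_bound\<close>. The squares that remain form a convolution, whose integral is the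
  product of the two squared norms.\<close>

lemma parabolic_bilinear:
  "\<exists>C\<ge>0. \<forall>u\<in>borel_measurable borel. \<forall>v\<in>borel_measurable borel. (\<integral>\<^sup>+P. (nn_conv u v P)\<^sup>2 \<partial>lborel)
     \<le> ennreal C * (\<integral>\<^sup>+p. (ennreal (E p) * u p)\<^sup>2 \<partial>lborel) * (\<integral>\<^sup>+p. (ennreal (h (fst p) * E p) * v p)\<^sup>2 \<partial>lborel)"
proof -
  obtain C where C: "0 \<le> C" "\<And>P. (\<integral>\<^sup>+q. ennreal (1 / ((E (P - q))\<^sup>2 * (h (fst q) * E q)\<^sup>2)) \<partial>lborel) \<le> ennreal C"
    using resolvent_bound by blast
  have "(\<integral>\<^sup>+P. (nn_conv u v P)\<^sup>2 \<partial>lborel)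
     \<le> ennreal (2 * C) * (\<integral>\<^sup>+p. (ennreal (E p) * u p)\<^sup>2 \<partial>lborel) * (\<integral>\<^sup>+p. (ennreal (h (fst p) * E p) * v p)\<^sup>2 \<partial>lborel)"
    if [measurable]: "u \<in> borel_measurable borel" "v \<in> borel_measurable borel" for u v
  proof -
    define U where "U p = (ennreal (E p) * u p)\<^sup>2" for p
    define V where "V p = (ennreal (h (fst p) * E p) * v p)\<^sup>2" for p
    have [measurable]: "U \<in> borel_measurable borel" "V \<in> borel_measurable borel"
      unfolding U_def[abs_def] V_def[abs_def] by measurable
    have pw: "(nn_conv u v P)\<^sup>2 \<le> ennreal (2 * C) * nn_conv U V P" for P
    proof -
      let ?f = "\<lambda>p. (ennreal (E p) * u p) * (ennreal (h (fst (P - p)) * E (P - p)) * v (P - p))"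
      let ?g = "\<lambda>p. ennreal (1 / (E p * (h (fst (P - p)) * E (P - p))))"
      have "u p * v (P - p) = ?f p * ?g p" for p
      proof -
        have "ennreal (E p) * ennreal (h (fst (P - p)) * E (P - p)) * ?g p = ennreal (E p * (h (fst (P - p)) * E (P - p)) * (1 / (E p * (h (fst (P - p)) * E (P - p)))))"
          by (simp only: ennreal_mult E_nonneg h_nonneg mult_nonneg_nonneg divide_nonneg_nonneg zero_le_one)
        also have "E p * (h (fst (P - p)) * E (P - p)) * (1 / (E p * (h (fst (P - p)) * E (P - p)))) = 1"
          using mult_pos_pos[OF E_pos[of p] mult_pos_pos[OF h_pos[of "fst (P - p)"] E_pos[of "P - p"]]]
          by (simp only: times_divide_eq_right mult.right_neutral divide_self less_imp_neq[symmetric] not_False_eq_True)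
        finally have 1: "ennreal (E p) * ennreal (h (fst (P - p)) * E (P - p)) * ?g p = 1" by simp
        have "?f p * ?g p = (ennreal (E p) * ennreal (h (fst (P - p)) * E (P - p)) * ?g p) * (u p * v (P - p))"
          by (simp only: mult_ac)
        then show ?thesis unfolding 1 by simp
      qed
      then have "(nn_conv u v P)\<^sup>2 = (\<integral>\<^sup>+p. ?f p * ?g p \<partial>lborel)\<^sup>2" unfolding nn_conv_def by simp
      also have "\<dots> \<le> 2 * (\<integral>\<^sup>+p. (?f p)\<^sup>2 \<partial>lborel) * (\<integral>\<^sup>+p. (?g p)\<^sup>2 \<partial>lborel)"
        by (rule nn_Cauchy_Schwarz) measurable
      also have "(\<integral>\<^sup>+p. (?f p)\<^sup>2 \<partial>lborel) = nn_conv U V P"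
        unfolding nn_conv_def U_def V_def by (simp only: power_mult_distrib)
      also have "(\<integral>\<^sup>+p. (?g p)\<^sup>2 \<partial>lborel) \<le> ennreal C"
      proof -
        let ?G = "\<lambda>q. ennreal (1 / ((E (P - q))\<^sup>2 * (h (fst q) * E q)\<^sup>2))"
        have "(\<integral>\<^sup>+p. (?g p)\<^sup>2 \<partial>lborel) = (\<integral>\<^sup>+p. ?G (P - p) \<partial>lborel)"
          by (intro nn_integral_cong) (simp add: ennreal_power power_divide power_mult_distrib)
        also have "\<dots> = (\<integral>\<^sup>+p. ?G p \<partial>lborel)" by (rule lborel_nn_integral_reflect) measurable
        finally show ?thesis using C(2)[of P] by simp
      qed
      finally have "(nn_conv u v P)\<^sup>2 \<le> 2 * nn_conv U V P * ennreal C" by (simp add: mult_left_mono)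
      then show ?thesis using C(1) by (simp add: ennreal_mult mult_ac)
    qed
    have "(\<integral>\<^sup>+P. (nn_conv u v P)\<^sup>2 \<partial>lborel) \<le> (\<integral>\<^sup>+P. ennreal (2 * C) * nn_conv U V P \<partial>lborel)"
      by (rule nn_integral_mono) (rule pw)
    also have "\<dots> = ennreal (2 * C) * (\<integral>\<^sup>+P. \<integral>\<^sup>+p. U p * V (P - p) \<partial>lborel \<partial>lborel)"
      by (subst nn_integral_cmult) (simp_all add: nn_conv_def[abs_def])
    also have "(\<integral>\<^sup>+P. \<integral>\<^sup>+p. U p * V (P - p) \<partial>lborel \<partial>lborel) = (\<integral>\<^sup>+p. \<integral>\<^sup>+P. U p * V (P - p) \<partial>lborel \<partial>lborel)"
      by (rule lborel_pair.Fubini') measurable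
    also have "\<dots> = (\<integral>\<^sup>+p. U p \<partial>lborel) * (\<integral>\<^sup>+p. V p \<partial>lborel)"
    proof -
      have "(\<integral>\<^sup>+P. V (P - p) \<partial>lborel) = (\<integral>\<^sup>+P. V P \<partial>lborel)" for p
        using lborel_nn_integral_translate[of V "- p"] by simp
      then show ?thesis by (simp add: nn_integral_cmult nn_integral_multc)
    qed
    finally show ?thesis unfolding U_def V_def by (simp add: mult.assoc)
  qed
  then show ?thesis using C(1) by (intro exI[of _ "2 * C"]) auto
qed

text \<open>For \<tau> \<ge> 0 the two modulations differ by \<phi> - |\<xi>|^2, which is bounded by
  \<open>D\<close>, and a bounded shift changes the bracket by a bounded factor.\<close>

lemma E_le_B: "0 \<le> snd p \<Longrightarrow> E p \<le> (2 * japanese D) powr b * B p"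
proof -
  assume "0 \<le> snd p"
  then have "japanese (snd p - (norm (fst p))\<^sup>2) = japanese ((\<bar>snd p\<bar> - \<phi> (fst p)) + (\<phi> (fst p) - (norm (fst p))\<^sup>2))" by simp
  also have "\<dots> \<le> 2 * japanese (\<bar>snd p\<bar> - \<phi> (fst p)) * japanese (\<phi> (fst p) - (norm (fst p))\<^sup>2)" by (rule japanese_add_le_mult)
  also have "\<dots> \<le> 2 * japanese (\<bar>snd p\<bar> - \<phi> (fst p)) * japanese D"
    using \<phi>_close[of "fst p"] by (intro mult_left_mono japanese_mono) auto
  finally have "japanese (snd p - (norm (fst p))\<^sup>2) powr b \<le> (2 * japanese D * japanese (\<bar>snd p\<bar> - \<phi> (fst p))) powr b"
    using b by (intro powr_mono2) (auto simp: mult_ac)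
  then show ?thesis unfolding E_def B_def by (simp add: powr_mult)
qed

text \<open>The part of \<open>u\<close> at negative \<tau> is the reflection of a function living
  at positive \<tau>, and undoing the reflection preserves the norm of the convolution by
  \<open>nn_integral_nn_conv_reflect\<close>.\<close>

lemma sign_split:
  fixes u v :: "'a \<times> real \<Rightarrow> ennreal"
  assumes [measurable]: "u \<in> borel_measurable borel" "v \<in> borel_measurable borel"
  shows "(\<integral>\<^sup>+P. (nn_conv u v P)\<^sup>2 \<partial>lborel) \<le> 2 * (\<integral>\<^sup>+P. (nn_conv (\<lambda>p. u p * indicator (UNIV \<times> {0..}) p) v P)\<^sup>2 \<partial>lborel)
     + 2 * (\<integral>\<^sup>+P. (nn_conv (\<lambda>p. u (- p) * indicator (UNIV \<times> {0<..}) p) v P)\<^sup>2 \<partial>lborel)"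
proof -
  \<comment> \<open>A closed half line in one term and an open one in the other, so that \<tau> = 0
    is counted once.\<close>
  let ?u = "\<lambda>p. u p * indicator (UNIV \<times> {0..}) p" and ?v = "\<lambda>p. u (- p) * indicator (UNIV \<times> {0<..}) p"
  have s [measurable]: "(UNIV \<times> {0..} :: ('a \<times> real) set) \<in> sets borel" "(UNIV \<times> {0<..} :: ('a \<times> real) set) \<in> sets borel"
    by (auto simp: borel_prod[symmetric] intro!: pair_measureI)
  have [measurable]: "?u \<in> borel_measurable borel" "?v \<in> borel_measurable borel" by measurable
  have uv: "u p = ?u p + ?v (- p)" for p by (cases p) (auto simp: indicator_def)
  have "(nn_conv u v P)\<^sup>2 \<le> 2 * (nn_conv ?u v P)\<^sup>2 + 2 * (nn_conv (\<lambda>p. ?v (- p)) v P)\<^sup>2" for P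
  proof -
    have "nn_conv u v P = nn_conv (\<lambda>p. ?u p + ?v (- p)) v P" using uv by presburger
    also have "\<dots> = nn_conv ?u v P + nn_conv (\<lambda>p. ?v (- p)) v P" by (rule nn_conv_add_left) measurable
    finally show ?thesis using ennreal_power2_add_le by simp
  qed
  then have "(\<integral>\<^sup>+P. (nn_conv u v P)\<^sup>2 \<partial>lborel) \<le> (\<integral>\<^sup>+P. 2 * (nn_conv ?u v P)\<^sup>2 + 2 * (nn_conv (\<lambda>p. ?v (- p)) v P)\<^sup>2 \<partial>lborel)"
    by (intro nn_integral_mono)
  also have "\<dots> = 2 * (\<integral>\<^sup>+P. (nn_conv ?u v P)\<^sup>2 \<partial>lborel) + 2 * (\<integral>\<^sup>+P. (nn_conv (\<lambda>p. ?v (- p)) v P)\<^sup>2 \<partial>lborel)"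
    by (subst nn_integral_add) (simp_all add: nn_integral_cmult)
  also have "(\<integral>\<^sup>+P. (nn_conv (\<lambda>p. ?v (- p)) v P)\<^sup>2 \<partial>lborel) = (\<integral>\<^sup>+P. (nn_conv ?v v P)\<^sup>2 \<partial>lborel)"
    by (rule nn_integral_nn_conv_reflect) measurable
  finally show ?thesis .
qed

lemma weighted_half_le:
  fixes u :: "'a \<times> real \<Rightarrow> ennreal"
  assumes [measurable]: "u \<in> borel_measurable borel" "W \<in> borel_measurable borel" and W: "\<And>p. W (- p) = W p"
  shows "(\<integral>\<^sup>+p. (ennreal (W p) * (u p * indicator (UNIV \<times> {0..}) p))\<^sup>2 \<partial>lborel) \<le> (\<integral>\<^sup>+p. (ennreal (W p) * u p)\<^sup>2 \<partial>lborel)"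
    and "(\<integral>\<^sup>+p. (ennreal (W p) * (u (- p) * indicator (UNIV \<times> {0<..}) p))\<^sup>2 \<partial>lborel) \<le> (\<integral>\<^sup>+p. (ennreal (W p) * u p)\<^sup>2 \<partial>lborel)"
proof -
  show "(\<integral>\<^sup>+p. (ennreal (W p) * (u p * indicator (UNIV \<times> {0..}) p))\<^sup>2 \<partial>lborel) \<le> (\<integral>\<^sup>+p. (ennreal (W p) * u p)\<^sup>2 \<partial>lborel)"
    by (intro nn_integral_mono power_mono mult_left_mono) (auto simp: indicator_def)
  have "(\<integral>\<^sup>+p. (ennreal (W p) * (u (- p) * indicator (UNIV \<times> {0<..}) p))\<^sup>2 \<partial>lborel) \<le> (\<integral>\<^sup>+p. (ennreal (W (0 - p)) * u (0 - p))\<^sup>2 \<partial>lborel)"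
    using W by (intro nn_integral_mono power_mono) (auto simp: indicator_def intro!: mult_left_mono)
  also have "\<dots> = (\<integral>\<^sup>+p. (ennreal (W p) * u p)\<^sup>2 \<partial>lborel)"
    by (rule lborel_nn_integral_reflect) measurable
  finally show "(\<integral>\<^sup>+p. (ennreal (W p) * (u (- p) * indicator (UNIV \<times> {0<..}) p))\<^sup>2 \<partial>lborel) \<le> (\<integral>\<^sup>+p. (ennreal (W p) * u p)\<^sup>2 \<partial>lborel)" .
qed

text \<open>Three stages: both factors supported in \<tau> \<ge> 0, where \<open>E_le_B\<close>
  applies; then the first factor arbitrary; then also the second, by commutativity. Each splitting
  multiplies the constant by 4, and the reflected halves have no larger norm since \<open>B\<close>
  and \<open>h\<close> are even.\<close>

lemma hyperbolic_bilinear: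
  "\<exists>C\<ge>0. \<forall>u\<in>borel_measurable borel. \<forall>v\<in>borel_measurable borel. (\<integral>\<^sup>+P. (nn_conv u v P)\<^sup>2 \<partial>lborel)
     \<le> ennreal C * ((\<integral>\<^sup>+p. (ennreal (B p) * u p)\<^sup>2 \<partial>lborel) * (\<integral>\<^sup>+p. (ennreal (h (fst p) * B p) * v p)\<^sup>2 \<partial>lborel))"
proof -
  obtain C where C: "0 \<le> C" "\<And>u v. u \<in> borel_measurable borel \<Longrightarrow> v \<in> borel_measurable borel \<Longrightarrow> (\<integral>\<^sup>+P. (nn_conv u v P)\<^sup>2 \<partial>lborel)
     \<le> ennreal C * (\<integral>\<^sup>+p. (ennreal (E p) * u p)\<^sup>2 \<partial>lborel) * (\<integral>\<^sup>+p. (ennreal (h (fst p) * E p) * v p)\<^sup>2 \<partial>lborel)"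
    using parabolic_bilinear by blast
  define L where "L = (2 * japanese D) powr b"
  have L: "0 \<le> L" by (simp add: L_def)
  let ?N = "\<lambda>u v. \<integral>\<^sup>+P. (nn_conv u v P)\<^sup>2 \<partial>lborel"
  let ?I = "\<lambda>u. \<integral>\<^sup>+p. (ennreal (B p) * u p)\<^sup>2 \<partial>lborel" and ?J = "\<lambda>v. \<integral>\<^sup>+p. (ennreal (h (fst p) * B p) * v p)\<^sup>2 \<partial>lborel"
  let ?C = "ennreal (C * L\<^sup>2 * L\<^sup>2)"
  have s [measurable]: "(UNIV \<times> {0..} :: ('a \<times> real) set) \<in> sets borel" "(UNIV \<times> {0<..} :: ('a \<times> real) set) \<in> sets borel"
    by (auto simp: borel_prod[symmetric] intro!: pair_measureI)
  have hB [measurable]: "(\<lambda>p. h (fst p) * B p) \<in> borel_measurable borel" by measurable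
  have hBe: "h (fst (- p)) * B (- p) = h (fst p) * B p" for p by simp
  have half: "(\<integral>\<^sup>+p. (ennreal (k p * E p) * u p)\<^sup>2 \<partial>lborel) \<le> ennreal (L\<^sup>2) * (\<integral>\<^sup>+p. (ennreal (k p * B p) * u p)\<^sup>2 \<partial>lborel)"
    if [measurable]: "u \<in> borel_measurable borel" "k \<in> borel_measurable borel" and k: "\<And>p. 0 \<le> k p" and u: "\<And>p. snd p < 0 \<Longrightarrow> u p = 0" for u k
  proof -
    have "(\<integral>\<^sup>+p. (ennreal (k p * E p) * u p)\<^sup>2 \<partial>lborel) \<le> (\<integral>\<^sup>+p. ennreal (L\<^sup>2) * (ennreal (k p * B p) * u p)\<^sup>2 \<partial>lborel)"
    proof (rule nn_integral_mono)
      fix p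
      show "(ennreal (k p * E p) * u p)\<^sup>2 \<le> ennreal (L\<^sup>2) * (ennreal (k p * B p) * u p)\<^sup>2"
      proof (cases "snd p < 0")
        case False
        have "k p * E p \<le> k p * (L * B p)" using E_le_B[of p] False k unfolding L_def by (intro mult_left_mono) auto
        then have "ennreal (k p * E p) \<le> ennreal (L * (k p * B p))" by (intro ennreal_leI) (simp add: mult_ac)
        also have "\<dots> = ennreal L * ennreal (k p * B p)" using L k by (intro ennreal_mult) auto
        finally have "(ennreal (k p * E p) * u p)\<^sup>2 \<le> (ennreal L * (ennreal (k p * B p) * u p))\<^sup>2"
          by (intro power_mono) (simp_all add: mult.assoc[symmetric] mult_right_mono)
        then show ?thesis using L by (simp only: power_mult_distrib ennreal_power)
      qed (use u in simp)
    qed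
    then show ?thesis by (subst (asm) nn_integral_cmult) measurable
  qed
  have both: "?N u v \<le> ?C * (?I u * ?J v)"
    if [measurable]: "u \<in> borel_measurable borel" "v \<in> borel_measurable borel" and s: "\<And>p. snd p < 0 \<Longrightarrow> u p = 0" "\<And>p. snd p < 0 \<Longrightarrow> v p = 0" for u v
  proof -
    have "?N u v \<le> ennreal C * (\<integral>\<^sup>+p. (ennreal (E p) * u p)\<^sup>2 \<partial>lborel) * (\<integral>\<^sup>+p. (ennreal (h (fst p) * E p) * v p)\<^sup>2 \<partial>lborel)"
      by (rule C(2)) measurable
    also have "\<dots> \<le> ennreal C * (ennreal (L\<^sup>2) * ?I u) * (ennreal (L\<^sup>2) * ?J v)"
      using half[of u "\<lambda>_. 1"] half[of v "\<lambda>p. h (fst p)"] s by (intro mult_mono) auto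
    also have "\<dots> = ennreal C * ennreal (L\<^sup>2) * ennreal (L\<^sup>2) * (?I u * ?J v)" by (simp only: mult_ac)
    also have "ennreal C * ennreal (L\<^sup>2) * ennreal (L\<^sup>2) = ?C" using C(1) by (simp add: ennreal_mult)
    finally show ?thesis .
  qed
  have four: "2 * (?C * X) + 2 * (?C * X) = ennreal (4 * (C * L\<^sup>2 * L\<^sup>2)) * X" for X
  proof -
    have "2 * (?C * X) + 2 * (?C * X) = (4 * ?C) * X" by (simp only: mult.assoc distrib_right[symmetric]) simp
    also have "4 * ?C = ennreal (4 * (C * L\<^sup>2 * L\<^sup>2))" using C(1) by (subst ennreal_mult) auto
    finally show ?thesis .
  qed
  have one: "?N u v \<le> ennreal (4 * (C * L\<^sup>2 * L\<^sup>2)) * (?I u * ?J v)"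
    if [measurable]: "u \<in> borel_measurable borel" "v \<in> borel_measurable borel" and s: "\<And>p. snd p < 0 \<Longrightarrow> v p = 0" for u v
  proof -
    let ?u = "\<lambda>p. u p * indicator (UNIV \<times> {0..}) p" and ?v = "\<lambda>p. u (- p) * indicator (UNIV \<times> {0<..}) p"
    have "?N u v \<le> 2 * ?N ?u v + 2 * ?N ?v v" by (rule sign_split) measurable
    also have "\<dots> \<le> 2 * (?C * (?I u * ?J v)) + 2 * (?C * (?I u * ?J v))"
    proof (intro add_mono mult_left_mono)
      have "?N ?u v \<le> ?C * (?I ?u * ?J v)" by (rule both) (measurable, auto simp: indicator_def s)
      also have "\<dots> \<le> ?C * (?I u * ?J v)" by (intro mult_left_mono mult_right_mono weighted_half_le(1)) auto
      finally show "?N ?u v \<le> ?C * (?I u * ?J v)" .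
      have "?N ?v v \<le> ?C * (?I ?v * ?J v)" by (rule both) (measurable, auto simp: indicator_def s)
      also have "\<dots> \<le> ?C * (?I u * ?J v)" by (intro mult_left_mono mult_right_mono weighted_half_le(2)) auto
      finally show "?N ?v v \<le> ?C * (?I u * ?J v)" .
    qed simp_all
    finally show ?thesis unfolding four .
  qed
  have "?N u v \<le> ennreal (4 * (4 * (C * L\<^sup>2 * L\<^sup>2))) * (?I u * ?J v)"
    if [measurable]: "u \<in> borel_measurable borel" "v \<in> borel_measurable borel" for u v
  proof -
    let ?C' = "ennreal (4 * (C * L\<^sup>2 * L\<^sup>2))"
    let ?u = "\<lambda>p. v p * indicator (UNIV \<times> {0..}) p" and ?v = "\<lambda>p. v (- p) * indicator (UNIV \<times> {0<..}) p"
    have m [measurable]: "?u \<in> borel_measurable borel" "?v \<in> borel_measurable borel" by measurable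
    have "?N v u \<le> 2 * ?N ?u u + 2 * ?N ?v u" by (rule sign_split) measurable
    then have "?N u v \<le> 2 * ?N u ?u + 2 * ?N u ?v"
      unfolding nn_conv_commute[OF that(2,1)] nn_conv_commute[OF m(1) that(1)] nn_conv_commute[OF m(2) that(1)] .
    also have "\<dots> \<le> 2 * (?C' * (?I u * ?J v)) + 2 * (?C' * (?I u * ?J v))"
    proof (intro add_mono mult_left_mono)
      have "?N u ?u \<le> ?C' * (?I u * ?J ?u)" by (rule one) (measurable, auto simp: indicator_def)
      also have "\<dots> \<le> ?C' * (?I u * ?J v)" using hBe by (intro mult_left_mono weighted_half_le(1)) auto
      finally show "?N u ?u \<le> ?C' * (?I u * ?J v)" .
      have "?N u ?v \<le> ?C' * (?I u * ?J ?v)" by (rule one) (measurable, auto simp: indicator_def)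
      also have "\<dots> \<le> ?C' * (?I u * ?J v)" using hBe by (intro mult_left_mono weighted_half_le(2)) auto
      finally show "?N u ?v \<le> ?C' * (?I u * ?J v)" .
    qed simp_all
    also have "2 * (?C' * X) + 2 * (?C' * X) = ennreal (4 * (4 * (C * L\<^sup>2 * L\<^sup>2))) * X" for X
    proof -
      have "2 * (?C' * X) + 2 * (?C' * X) = (4 * ?C') * X" by (simp only: mult.assoc distrib_right[symmetric]) simp
      also have "4 * ?C' = ennreal (4 * (4 * (C * L\<^sup>2 * L\<^sup>2)))" using C(1) by (subst (2) ennreal_mult) auto
      finally show ?thesis .
    qed
    finally show ?thesis .
  qed
  then show ?thesis using C(1) by (intro exI[of _ "4 * (4 * (C * L\<^sup>2 * L\<^sup>2))"]) auto
qed

end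

section \<open>The weighted estimate and the time cutoff\<close>

lemma nn_integral_lborel_prod_mult:
  fixes f :: "'a::euclidean_space \<Rightarrow> ennreal" and g :: "'b::euclidean_space \<Rightarrow> ennreal"
  assumes [measurable]: "f \<in> borel_measurable borel" "g \<in> borel_measurable borel"
  shows "(\<integral>\<^sup>+p. f (fst p) * g (snd p) \<partial>lborel) = (\<integral>\<^sup>+x. f x \<partial>lborel) * (\<integral>\<^sup>+y. g y \<partial>lborel)"
proof -
  have "(\<integral>\<^sup>+p. f (fst p) * g (snd p) \<partial>lborel) = (\<integral>\<^sup>+x. \<integral>\<^sup>+y. f (fst (x, y)) * g (snd (x, y)) \<partial>lborel \<partial>lborel)"
    by (rule nn_integral_lborel_fst) measurable
  then show ?thesis by (simp add: nn_integral_cmult nn_integral_multc)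
qed

text \<open>Off this null set the weights \<open>h\<close> and \<open>r\<close> of the locale
  \<open>bilinear_weight\<close> agree.\<close>

lemma AE_lborel_fst_nonzero: "AE p in lborel. fst (p :: 'a::euclidean_space \<times> 'b::euclidean_space) \<noteq> 0"
proof (rule AE_I)
  have "emeasure (lborel \<Otimes>\<^sub>M lborel) ({0::'a} \<times> (UNIV :: 'b set)) = emeasure lborel {0::'a} * emeasure lborel (UNIV :: 'b set)"
    by (rule lborel.emeasure_pair_measure_Times) auto
  then show "emeasure lborel ({0::'a} \<times> (UNIV :: 'b set)) = 0" unfolding lborel_prod by simp
  show "({0::'a} \<times> (UNIV :: 'b set)) \<in> sets lborel" by (auto simp: borel_prod[symmetric] intro!: pair_measureI)
qed auto

text \<open>Convolution in \<tau> with the majorant of \<open>cutoff_kernel\<close>, so that the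
  time cutoff can be estimated on nonnegative functions.\<close>

definition nn_cutoff :: "real \<Rightarrow> ('a::euclidean_space \<times> real \<Rightarrow> ennreal) \<Rightarrow> 'a \<times> real \<Rightarrow> ennreal" where
  "nn_cutoff T k P = (\<integral>\<^sup>+\<tau>'. ennreal (3 * T / (1 + T * \<bar>snd P - \<tau>'\<bar>)) * k (fst P, \<tau>') \<partial>lborel)"

lemma nn_cutoff_measurable [measurable]:
  assumes "k \<in> borel_measurable borel"
  shows "nn_cutoff T k \<in> borel_measurable borel"
proof -
  have [measurable]: "k \<in> borel_measurable (borel \<Otimes>\<^sub>M borel)" using assms by (simp add: borel_prod)
  have "nn_cutoff T k \<in> borel_measurable (borel \<Otimes>\<^sub>M borel)"
    unfolding nn_cutoff_def[abs_def] by measurable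
  then show ?thesis by (simp add: borel_prod)
qed

context bilinear_weight begin

abbreviation weighted_sq :: "('a \<times> real \<Rightarrow> ennreal) \<Rightarrow> ennreal" where
  "weighted_sq u \<equiv> (\<integral>\<^sup>+p. (ennreal (h (fst p) * B p) * u p)\<^sup>2 \<partial>lborel)"

text \<open>In each of the two terms, the factor that has received \<open>h\<close> takes the first
  place in \<open>hyperbolic_bilinear\<close> and the other one the second, where the estimate
  charges \<open>h\<close> anyway. Thus both factors end up with the same weight.\<close>

lemma weighted_bilinear:
  "\<exists>C\<ge>0. \<forall>u\<in>borel_measurable borel. \<forall>v\<in>borel_measurable borel.
     (\<integral>\<^sup>+P. (ennreal (r (fst P)) * nn_conv u v P)\<^sup>2 \<partial>lborel) \<le> ennreal C * (weighted_sq u * weighted_sq v)"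
proof -
  obtain C where C: "0 \<le> C" "\<And>u v. u \<in> borel_measurable borel \<Longrightarrow> v \<in> borel_measurable borel \<Longrightarrow> (\<integral>\<^sup>+P. (nn_conv u v P)\<^sup>2 \<partial>lborel)
     \<le> ennreal C * ((\<integral>\<^sup>+p. (ennreal (B p) * u p)\<^sup>2 \<partial>lborel) * weighted_sq v)"
    using hyperbolic_bilinear by blast
  have "(\<integral>\<^sup>+P. (ennreal (r (fst P)) * nn_conv u v P)\<^sup>2 \<partial>lborel) \<le> ennreal (4 * H\<^sup>2 * C) * (weighted_sq u * weighted_sq v)"
    if [measurable]: "u \<in> borel_measurable borel" "v \<in> borel_measurable borel" for u v
  proof -
    let ?hu = "\<lambda>p. ennreal (h (fst p)) * u p" and ?hv = "\<lambda>p. ennreal (h (fst p)) * v p"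
    have m [measurable]: "?hu \<in> borel_measurable borel" "?hv \<in> borel_measurable borel" by measurable
    have pw: "ennreal (r (fst P)) * nn_conv u v P \<le> ennreal H * (nn_conv ?hu v P + nn_conv ?hv u P)" for P
    proof -
      have "ennreal (r (fst P)) * (u p * v (P - p)) \<le> ennreal H * (?hu p * v (P - p) + u p * ?hv (P - p))" for p
      proof -
        have "ennreal (r (fst P)) \<le> ennreal (H * (h (fst p) + h (fst (P - p))))"
          using H(2)[of "fst p" "fst (P - p)"] by (intro ennreal_leI) simp
        also have "\<dots> = ennreal H * (ennreal (h (fst p)) + ennreal (h (fst (P - p))))"
          using H(1) by (simp add: ennreal_mult)
        finally have "ennreal (r (fst P)) * (u p * v (P - p)) \<le> ennreal H * (ennreal (h (fst p)) + ennreal (h (fst (P - p)))) * (u p * v (P - p))"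
          by (rule mult_right_mono) simp
        then show ?thesis by (simp only: distrib_left distrib_right mult_ac)
      qed
      then have "(\<integral>\<^sup>+p. ennreal (r (fst P)) * (u p * v (P - p)) \<partial>lborel) \<le> (\<integral>\<^sup>+p. ennreal H * (?hu p * v (P - p) + u p * ?hv (P - p)) \<partial>lborel)"
        by (intro nn_integral_mono)
      moreover have "(\<integral>\<^sup>+p. ennreal (r (fst P)) * (u p * v (P - p)) \<partial>lborel) = ennreal (r (fst P)) * nn_conv u v P"
        unfolding nn_conv_def by (rule nn_integral_cmult) measurable
      moreover have "(\<integral>\<^sup>+p. ennreal H * (?hu p * v (P - p) + u p * ?hv (P - p)) \<partial>lborel) = ennreal H * (nn_conv ?hu v P + nn_conv u ?hv P)"
        unfolding nn_conv_def by (subst nn_integral_cmult, measurable, subst nn_integral_add, measurable)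
      ultimately show ?thesis using nn_conv_commute[of u ?hv] that by simp
    qed
    have hh: "(ennreal (B p) * (ennreal (h (fst p)) * u p)) = ennreal (h (fst p) * B p) * u p" for u p
      by (simp add: ennreal_mult mult_ac)
    have "(\<integral>\<^sup>+P. (ennreal (r (fst P)) * nn_conv u v P)\<^sup>2 \<partial>lborel)
      \<le> (\<integral>\<^sup>+P. ennreal (2 * H\<^sup>2) * (nn_conv ?hu v P)\<^sup>2 + ennreal (2 * H\<^sup>2) * (nn_conv ?hv u P)\<^sup>2 \<partial>lborel)"
    proof (rule nn_integral_mono)
      fix P
      have "(ennreal (r (fst P)) * nn_conv u v P)\<^sup>2 \<le> (ennreal H)\<^sup>2 * (nn_conv ?hu v P + nn_conv ?hv u P)\<^sup>2"
        unfolding power_mult_distrib[symmetric] by (intro power_mono pw) simp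
      also have "\<dots> \<le> (ennreal H)\<^sup>2 * (2 * (nn_conv ?hu v P)\<^sup>2 + 2 * (nn_conv ?hv u P)\<^sup>2)"
        by (intro mult_left_mono ennreal_power2_add_le) simp
      also have "\<dots> = ennreal (2 * H\<^sup>2) * (nn_conv ?hu v P)\<^sup>2 + ennreal (2 * H\<^sup>2) * (nn_conv ?hv u P)\<^sup>2"
        using H(1) by (simp add: ennreal_mult ennreal_power distrib_left mult_ac)
      finally show "(ennreal (r (fst P)) * nn_conv u v P)\<^sup>2 \<le> \<dots>" .
    qed
    also have "\<dots> = ennreal (2 * H\<^sup>2) * (\<integral>\<^sup>+P. (nn_conv ?hu v P)\<^sup>2 \<partial>lborel) + ennreal (2 * H\<^sup>2) * (\<integral>\<^sup>+P. (nn_conv ?hv u P)\<^sup>2 \<partial>lborel)"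
      by (subst nn_integral_add) (simp_all add: nn_integral_cmult)
    also have "\<dots> \<le> ennreal (2 * H\<^sup>2) * (ennreal C * (weighted_sq u * weighted_sq v)) + ennreal (2 * H\<^sup>2) * (ennreal C * (weighted_sq v * weighted_sq u))"
      using C(2)[OF m(1) that(2)] C(2)[OF m(2) that(1)] unfolding hh by (intro add_mono mult_left_mono) auto
    also have "\<dots> = (ennreal (2 * H\<^sup>2) * ennreal C + ennreal (2 * H\<^sup>2) * ennreal C) * (weighted_sq u * weighted_sq v)"
      by (simp only: distrib_left distrib_right mult_ac)
    also have "ennreal (2 * H\<^sup>2) * ennreal C + ennreal (2 * H\<^sup>2) * ennreal C = ennreal (4 * H\<^sup>2 * C)"
      using C(1) by (simp add: ennreal_mult[symmetric] ennreal_plus[symmetric] del: ennreal_plus)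
    finally show ?thesis .
  qed
  then show ?thesis using C(1) by (intro exI[of _ "4 * H\<^sup>2 * C"]) auto
qed

text \<open>\<open>time_cutoff_estimate\<close> is applied for each fixed \<xi> with \<beta> = 1 -
  b; the weight \<open>r\<close> passes through because the cutoff acts in \<tau> only.\<close>

lemma cutoff_bilinear:
  "\<exists>C\<ge>0. \<forall>T>0. \<forall>u\<in>borel_measurable borel. \<forall>v\<in>borel_measurable borel.
     (\<integral>\<^sup>+P. (ennreal (r (fst P) * japanese (\<bar>snd P\<bar> - \<phi> (fst P)) powr (b - 1)) * nn_cutoff T (nn_conv u v) P)\<^sup>2 \<partial>lborel)
       \<le> ennreal (C * T powr (2 * (1 - b))) * (weighted_sq u * weighted_sq v)"
proof -
  \<comment> \<open>The range of \<beta> in the time estimate corresponds exactly to that of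
    \<open>b\<close>.\<close>
  have \<beta>: "0 < 1 - b" "1 - b < 1 / 2" using b by auto
  obtain C1 where C1: "0 \<le> C1" "\<And>T \<phi> k. 0 < T \<Longrightarrow> k \<in> borel_measurable borel \<Longrightarrow>
    (\<integral>\<^sup>+\<tau>. ennreal (japanese (\<bar>\<tau>\<bar> - \<phi>) powr (- (2 * (1 - b)))) * (\<integral>\<^sup>+\<tau>'. ennreal (3 * T / (1 + T * \<bar>\<tau> - \<tau>'\<bar>)) * k \<tau>' \<partial>lborel)\<^sup>2 \<partial>lborel)
    \<le> ennreal (C1 * T powr (2 * (1 - b))) * (\<integral>\<^sup>+\<tau>'. (k \<tau>')\<^sup>2 \<partial>lborel)"
    using time_cutoff_estimate[OF \<beta>] by auto
  obtain C2 where C2: "0 \<le> C2" "\<And>u v. u \<in> borel_measurable borel \<Longrightarrow> v \<in> borel_measurable borel \<Longrightarrow>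
     (\<integral>\<^sup>+P. (ennreal (r (fst P)) * nn_conv u v P)\<^sup>2 \<partial>lborel) \<le> ennreal C2 * (weighted_sq u * weighted_sq v)"
    using weighted_bilinear by blast
  have "(\<integral>\<^sup>+P. (ennreal (r (fst P) * japanese (\<bar>snd P\<bar> - \<phi> (fst P)) powr (b - 1)) * nn_cutoff T (nn_conv u v) P)\<^sup>2 \<partial>lborel)
       \<le> ennreal (C1 * C2 * T powr (2 * (1 - b))) * (weighted_sq u * weighted_sq v)"
    if T: "0 < T" and uv [measurable]: "u \<in> borel_measurable borel" "v \<in> borel_measurable borel" for T u v
  proof -
    define k where "k = nn_conv u v"
    have kb: "k \<in> borel_measurable borel" unfolding k_def by measurable
    have [measurable]: "nn_cutoff T k \<in> borel_measurable borel" using kb by measurable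
    have [measurable]: "k \<in> borel_measurable (borel \<Otimes>\<^sub>M borel)" "nn_cutoff T k \<in> borel_measurable (borel \<Otimes>\<^sub>M borel)"
      using kb nn_cutoff_measurable[OF kb, of T] by (simp_all add: borel_prod)
    have pt: "(ennreal (r \<xi> * japanese (\<bar>\<tau>\<bar> - \<phi> \<xi>) powr (b - 1)) * nn_cutoff T k (\<xi>, \<tau>))\<^sup>2
      = ennreal (japanese (\<bar>\<tau>\<bar> - \<phi> \<xi>) powr (- (2 * (1 - b)))) * (\<integral>\<^sup>+\<tau>'. ennreal (3 * T / (1 + T * \<bar>\<tau> - \<tau>'\<bar>)) * (ennreal (r \<xi>) * k (\<xi>, \<tau>')) \<partial>lborel)\<^sup>2" for \<xi> \<tau>
    proof -
      have "(\<integral>\<^sup>+\<tau>'. ennreal (3 * T / (1 + T * \<bar>\<tau> - \<tau>'\<bar>)) * (ennreal (r \<xi>) * k (\<xi>, \<tau>')) \<partial>lborel)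
        = (\<integral>\<^sup>+\<tau>'. ennreal (r \<xi>) * (ennreal (3 * T / (1 + T * \<bar>\<tau> - \<tau>'\<bar>)) * k (\<xi>, \<tau>')) \<partial>lborel)"
        by (simp only: mult_ac)
      also have "\<dots> = ennreal (r \<xi>) * nn_cutoff T k (\<xi>, \<tau>)"
        unfolding nn_cutoff_def fst_conv snd_conv by (rule nn_integral_cmult) measurable
      finally have 1: "(\<integral>\<^sup>+\<tau>'. ennreal (3 * T / (1 + T * \<bar>\<tau> - \<tau>'\<bar>)) * (ennreal (r \<xi>) * k (\<xi>, \<tau>')) \<partial>lborel) = ennreal (r \<xi>) * nn_cutoff T k (\<xi>, \<tau>)" .
      have "2 * (b - 1) = - (2 * (1 - b))" by simp
      then have 2: "(ennreal (japanese (\<bar>\<tau>\<bar> - \<phi> \<xi>) powr (b - 1)))\<^sup>2 = ennreal (japanese (\<bar>\<tau>\<bar> - \<phi> \<xi>) powr (- (2 * (1 - b))))"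
        by (simp only: ennreal_power powr_ge_zero powr_square japanese_pos)
      show ?thesis unfolding 1 2[symmetric] by (simp add: ennreal_mult power_mult_distrib mult_ac)
    qed
    have "(\<integral>\<^sup>+P. (ennreal (r (fst P) * japanese (\<bar>snd P\<bar> - \<phi> (fst P)) powr (b - 1)) * nn_cutoff T k P)\<^sup>2 \<partial>lborel)
      = (\<integral>\<^sup>+\<xi>. \<integral>\<^sup>+\<tau>. (ennreal (r (fst (\<xi>, \<tau>)) * japanese (\<bar>snd (\<xi>, \<tau>)\<bar> - \<phi> (fst (\<xi>, \<tau>))) powr (b - 1)) * nn_cutoff T k (\<xi>, \<tau>))\<^sup>2 \<partial>lborel \<partial>lborel)"
      by (rule nn_integral_lborel_fst) measurable
    also have "\<dots> = (\<integral>\<^sup>+\<xi>. \<integral>\<^sup>+\<tau>. ennreal (japanese (\<bar>\<tau>\<bar> - \<phi> \<xi>) powr (- (2 * (1 - b)))) * (\<integral>\<^sup>+\<tau>'. ennreal (3 * T / (1 + T * \<bar>\<tau> - \<tau>'\<bar>)) * (ennreal (r \<xi>) * k (\<xi>, \<tau>')) \<partial>lborel)\<^sup>2 \<partial>lborel \<partial>lborel)"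
      unfolding fst_conv snd_conv pt ..
    also have "\<dots> \<le> (\<integral>\<^sup>+\<xi>. ennreal (C1 * T powr (2 * (1 - b))) * (\<integral>\<^sup>+\<tau>'. (ennreal (r \<xi>) * k (\<xi>, \<tau>'))\<^sup>2 \<partial>lborel) \<partial>lborel)"
      by (intro nn_integral_mono C1(2) T) measurable
    also have "\<dots> = ennreal (C1 * T powr (2 * (1 - b))) * (\<integral>\<^sup>+\<xi>. \<integral>\<^sup>+\<tau>'. (ennreal (r (fst (\<xi>, \<tau>'))) * k (\<xi>, \<tau>'))\<^sup>2 \<partial>lborel \<partial>lborel)"
      unfolding fst_conv by (rule nn_integral_cmult) measurable
    also have "(\<integral>\<^sup>+\<xi>. \<integral>\<^sup>+\<tau>'. (ennreal (r (fst (\<xi>, \<tau>'))) * k (\<xi>, \<tau>'))\<^sup>2 \<partial>lborel \<partial>lborel) = (\<integral>\<^sup>+P. (ennreal (r (fst P)) * k P)\<^sup>2 \<partial>lborel)"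
      by (rule nn_integral_lborel_fst[symmetric]) measurable
    also have "ennreal (C1 * T powr (2 * (1 - b))) * \<dots> \<le> ennreal (C1 * T powr (2 * (1 - b))) * (ennreal C2 * (weighted_sq u * weighted_sq v))"
      unfolding k_def by (intro mult_left_mono C2(2) uv) simp
    also have "\<dots> = (ennreal (C1 * T powr (2 * (1 - b))) * ennreal C2) * (weighted_sq u * weighted_sq v)"
      by (simp only: mult.assoc)
    also have "ennreal (C1 * T powr (2 * (1 - b))) * ennreal C2 = ennreal (C1 * C2 * T powr (2 * (1 - b)))"
      using C1(1) C2(1) by (simp add: ennreal_mult[symmetric] mult_ac)
    finally show ?thesis unfolding k_def .
  qed
  then show ?thesis using C1(1) C2(1) by (intro exI[of _ "C1 * C2"]) auto
qed

text \<open>The convolution is square integrable against \<open>r\<close>, which is positive almost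
  everywhere.\<close>

lemma nn_conv_finite:
  assumes [measurable]: "u \<in> borel_measurable borel" "v \<in> borel_measurable borel"
    and "weighted_sq u < \<infinity>" "weighted_sq v < \<infinity>"
  shows "AE P in lborel. nn_conv u v P < \<infinity>"
proof -
  obtain C where C: "0 \<le> C" "\<And>u v. u \<in> borel_measurable borel \<Longrightarrow> v \<in> borel_measurable borel \<Longrightarrow>
     (\<integral>\<^sup>+P. (ennreal (r (fst P)) * nn_conv u v P)\<^sup>2 \<partial>lborel) \<le> ennreal C * (weighted_sq u * weighted_sq v)"
    using weighted_bilinear by blast
  have "(\<integral>\<^sup>+P. (ennreal (r (fst P)) * nn_conv u v P)\<^sup>2 \<partial>lborel) < \<infinity>"
    by (rule le_less_trans[OF C(2)]) (use assms in \<open>auto simp: ennreal_mult_less_top\<close>)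
  then have "AE P in lborel. (ennreal (r (fst P)) * nn_conv u v P)\<^sup>2 \<noteq> \<infinity>"
    by (intro nn_integral_PInf_AE) auto
  with AE_lborel_fst_nonzero show ?thesis
  proof eventually_elim
    case (elim P)
    then have "0 < r (fst P)" using h_eq_r[of "fst P"] h_pos[of "fst P"] by simp
    then show ?case using elim(2) by (cases "nn_conv u v P") (auto simp: ennreal_mult_top power2_eq_square less_top)
  qed
qed

text \<open>The polynomial factor in the assumption of the next lemma pays for the modulation weight
  and for the integrability in \<open>\<tau>\<close> and, by the sphere bound with \<open>c = 0\<close>, in \<open>\<xi>\<close>.\<close>

lemma dual_weight_bound:
  "\<exists>C\<ge>0. \<forall>(k :: 'a \<times> real \<Rightarrow> real) s. (\<forall>p. 0 \<le> k p \<and> k p * (1 + norm p) ^ 4 \<le> s) \<longrightarrow>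
     (\<integral>\<^sup>+p. ennreal ((k p * japanese (\<bar>snd p\<bar> - \<phi> (fst p)) powr (1 - b) / h (fst p))\<^sup>2) \<partial>lborel) \<le> ennreal (C * s\<^sup>2)"
proof -
  have D: "0 \<le> D" using \<phi>_close[of 0] by linarith
  let ?I = "2 * (1 / (1 - 1 / 2)) :: real"
  \<comment> \<open>With x = 1 + |p|, the modulation bracket is at most (3 + D) x^2, while 9 x^4 and
    4 x^2 bound the powers of the brackets in \<xi> and \<tau> that are inserted for convergence.
    Together this is x^8, the square of the factor assumed for \<open>k\<close>.\<close>
  let ?M = "36 * (3 + D)"
  have "(\<integral>\<^sup>+p. ennreal ((k p * japanese (\<bar>snd p\<bar> - \<phi> (fst p)) powr (1 - b) / h (fst p))\<^sup>2) \<partial>lborel) \<le> ennreal (?M * S * ?I * s\<^sup>2)"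
    if k: "\<And>p. 0 \<le> k p" "\<And>p. k p * (1 + norm p) ^ 4 \<le> s" for k :: "'a \<times> real \<Rightarrow> real" and s
  proof -
    let ?f = "\<lambda>x::'a. ennreal (1 / (h x)\<^sup>2 * japanese (2 * (norm (x - 0))\<^sup>2 - 0) powr (- (2 * b)))"
    let ?g = "\<lambda>t::real. ennreal (japanese (t - 0) powr (- 2))"
    have [measurable]: "?f \<in> borel_measurable borel" "?g \<in> borel_measurable borel" by measurable
    have pw: "(k p * japanese (\<bar>snd p\<bar> - \<phi> (fst p)) powr (1 - b) / h (fst p))\<^sup>2
       \<le> (?M * s\<^sup>2) * ((1 / (h (fst p))\<^sup>2 * japanese (2 * (norm (fst p))\<^sup>2) powr (- (2 * b))) * japanese (snd p) powr (- 2))" for p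
    proof -
      define x where "x = 1 + norm p"
      have x: "1 \<le> x" "norm (fst p) \<le> x" "\<bar>snd p\<bar> \<le> x"
        using norm_fst_le[of "fst p" "snd p"] norm_snd_le[of "snd p" "fst p"] by (simp_all add: x_def)
      have x2: "x \<le> x\<^sup>2" "1 \<le> x\<^sup>2" using x(1) by (simp_all add: power2_eq_square mult_le_cancel_left1 one_le_mult_iff[symmetric]) (use x(1) mult_mono[of 1 x 1 x] in auto)
      have jap: "japanese y \<le> 1 + \<bar>y\<bar>" for y :: real
        unfolding japanese_def by (rule real_le_lsqrt) (auto simp: power2_eq_square algebra_simps)
      have n2: "(norm (fst p))\<^sup>2 \<le> x\<^sup>2" using x(2) by (intro power_mono) auto
      have a1: "japanese (\<bar>snd p\<bar> - \<phi> (fst p)) \<le> (3 + D) * x\<^sup>2"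
      proof -
        have "\<bar>\<bar>snd p\<bar> - \<phi> (fst p)\<bar> \<le> x + (x\<^sup>2 + D)" using \<phi>_close[of "fst p"] n2 x(3) zero_le_power2[of "norm (fst p)"] x(1) by linarith
        then have "japanese (\<bar>snd p\<bar> - \<phi> (fst p)) \<le> 1 + (x + (x\<^sup>2 + D))" using jap[of "\<bar>snd p\<bar> - \<phi> (fst p)"] by linarith
        also have "\<dots> \<le> x\<^sup>2 + (x\<^sup>2 + (x\<^sup>2 + D * x\<^sup>2))" using x2 D mult_left_mono[OF x2(2) D] by (intro add_mono) auto
        finally show ?thesis by (simp add: algebra_simps)
      qed
      have "(japanese (\<bar>snd p\<bar> - \<phi> (fst p)) powr (1 - b))\<^sup>2 \<le> japanese (\<bar>snd p\<bar> - \<phi> (fst p)) powr 1"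
        unfolding powr_square[OF japanese_pos] using b japanese_ge_1 by (intro powr_mono) auto
      with a1 have A: "(japanese (\<bar>snd p\<bar> - \<phi> (fst p)) powr (1 - b))\<^sup>2 \<le> (3 + D) * x\<^sup>2" by simp
      have "japanese (2 * (norm (fst p))\<^sup>2) \<le> 3 * x\<^sup>2" using jap[of "2 * (norm (fst p))\<^sup>2"] n2 x2(2) by simp
      then have "(japanese (2 * (norm (fst p))\<^sup>2))\<^sup>2 \<le> (3 * x\<^sup>2)\<^sup>2" by (intro power_mono) auto
      moreover have "japanese (2 * (norm (fst p))\<^sup>2) powr (2 * b) \<le> japanese (2 * (norm (fst p))\<^sup>2) powr 2"
        using b japanese_ge_1 by (intro powr_mono) auto
      ultimately have Bd: "japanese (2 * (norm (fst p))\<^sup>2) powr (2 * b) \<le> 9 * x ^ 4" by (simp add: power_mult_distrib power_mult[symmetric])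
      have "japanese (snd p) \<le> 2 * x" using jap[of "snd p"] x(1,3) by simp
      then have "(japanese (snd p))\<^sup>2 \<le> (2 * x)\<^sup>2" by (intro power_mono) auto
      then have Cd: "japanese (snd p) powr 2 \<le> 4 * x\<^sup>2" by (simp add: power_mult_distrib)
      let ?J = "japanese (2 * (norm (fst p))\<^sup>2) powr (2 * b) * japanese (snd p) powr 2"
      have "(k p * japanese (\<bar>snd p\<bar> - \<phi> (fst p)) powr (1 - b))\<^sup>2 * ?J
        = (k p)\<^sup>2 * ((japanese (\<bar>snd p\<bar> - \<phi> (fst p)) powr (1 - b))\<^sup>2 * ?J)" by (simp add: power_mult_distrib mult_ac)
      also have "\<dots> \<le> (k p)\<^sup>2 * ((3 + D) * x\<^sup>2 * (9 * x ^ 4 * (4 * x\<^sup>2)))"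
        using A Bd Cd D x(1) by (intro mult_left_mono mult_mono) auto
      also have "\<dots> = ?M * (k p * x ^ 4)\<^sup>2" by (simp add: power_mult_distrib power_mult[symmetric] power_add[symmetric] mult_ac)
      also have "\<dots> \<le> ?M * s\<^sup>2" using k[of p] D unfolding x_def by (intro mult_left_mono power_mono) auto
      finally have fin: "(k p * japanese (\<bar>snd p\<bar> - \<phi> (fst p)) powr (1 - b))\<^sup>2 * ?J \<le> ?M * s\<^sup>2" .
      have J: "0 < ?J" by simp
      from fin have "(k p * japanese (\<bar>snd p\<bar> - \<phi> (fst p)) powr (1 - b))\<^sup>2 \<le> ?M * s\<^sup>2 / ?J"
        using J by (simp only: pos_le_divide_eq)
      then have "(k p * japanese (\<bar>snd p\<bar> - \<phi> (fst p)) powr (1 - b))\<^sup>2 / (h (fst p))\<^sup>2 \<le> ?M * s\<^sup>2 / ?J / (h (fst p))\<^sup>2"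
        by (rule divide_right_mono) simp
      then show ?thesis by (simp add: power_divide powr_minus_divide field_simps)
    qed
    have "(\<integral>\<^sup>+p. ennreal ((k p * japanese (\<bar>snd p\<bar> - \<phi> (fst p)) powr (1 - b) / h (fst p))\<^sup>2) \<partial>lborel) \<le> (\<integral>\<^sup>+p. ennreal (?M * s\<^sup>2) * (?f (fst p) * ?g (snd p)) \<partial>lborel)"
    proof (rule nn_integral_mono)
      fix p
      show "ennreal ((k p * japanese (\<bar>snd p\<bar> - \<phi> (fst p)) powr (1 - b) / h (fst p))\<^sup>2) \<le> ennreal (?M * s\<^sup>2) * (?f (fst p) * ?g (snd p))"
        using ennreal_leI[OF pw[of p]] D by (simp add: ennreal_mult[symmetric])
    qed
    also have "\<dots> = ennreal (?M * s\<^sup>2) * (\<integral>\<^sup>+p. ?f (fst p) * ?g (snd p) \<partial>lborel)"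
    proof (rule nn_integral_cmult)
      have "(\<lambda>p. ?f (fst p) * ?g (snd p)) \<in> borel_measurable (borel \<Otimes>\<^sub>M borel)" by measurable
      then show "(\<lambda>p. ?f (fst p) * ?g (snd p)) \<in> borel_measurable lborel" by (simp add: borel_prod)
    qed
    also have "(\<integral>\<^sup>+p. ?f (fst p) * ?g (snd p) \<partial>lborel) = (\<integral>\<^sup>+x. ?f x \<partial>lborel) * (\<integral>\<^sup>+t. ?g t \<partial>lborel)"
      by (rule nn_integral_lborel_prod_mult) measurable
    also have "ennreal (?M * s\<^sup>2) * \<dots> \<le> ennreal (?M * s\<^sup>2) * (ennreal S * ennreal ?I)"
      by (intro mult_left_mono mult_mono S(2) nn_integral_japanese_real) auto
    also have "\<dots> = ennreal (?M * S * ?I * s\<^sup>2)" by (subst ennreal_mult3) (use D S(1) in \<open>auto simp: mult_ac\<close>)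
    finally show ?thesis .
  qed
  then show ?thesis using D S(1) by (intro exI[of _ "?M * S * ?I"]) auto
qed

text \<open>A Gaussian is dominated by the product of a bracket in \<tau> and the bracket of the
  sphere bound with level 0, so the constant \<open>S\<close> also yields the local integrability on
  which the construction of the inverse transform rests.\<close>

lemma fourier_weight: "fourier_weight (\<lambda>p :: 'a \<times> real. h (fst p))"
proof
  show "\<exists>M<\<infinity>. \<forall>p::'a \<times> real. (\<integral>\<^sup>+q. ennreal (1 / (h (fst q))\<^sup>2 * gauss 1 (p - q)) \<partial>lborel) \<le> M"
  proof (intro exI conjI allI)
    fix p :: "'a \<times> real"
    let ?f = "\<lambda>x::'a. ennreal (1 / (h x)\<^sup>2 * japanese (2 * (norm (x - fst p))\<^sup>2 - 0) powr (- (2 * b)))"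
    let ?g = "\<lambda>t::real. ennreal (japanese (t - snd p) powr (- 2))"
    have [measurable]: "?f \<in> borel_measurable borel" "?g \<in> borel_measurable borel" by measurable
    \<comment> \<open>864 is 144 times 6, from bounding the powers of the brackets by 144 (1 +
      y/6)^2 and 6 (1 + y/6). The product is a cube, dominated by exp (y/6)^3 = exp (y/2), the
      inverse of the Gaussian.\<close>
    have pw: "1 / (h (fst q))\<^sup>2 * gauss 1 (p - q) \<le> 864 * ((1 / (h (fst q))\<^sup>2 * japanese (2 * (norm (fst q - fst p))\<^sup>2) powr (- (2 * b))) * japanese (snd q - snd p) powr (- 2))" for q
    proof -
      define y where "y = (norm (p - q))\<^sup>2"
      have y: "0 \<le> y" "(norm (fst q - fst p))\<^sup>2 \<le> y" "(snd q - snd p)\<^sup>2 \<le> y"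
        unfolding y_def norm_Pair norm_prod_def by (simp_all add: norm_minus_commute power2_commute)
      have "(japanese (2 * (norm (fst q - fst p))\<^sup>2))\<^sup>2 = 1 + 4 * ((norm (fst q - fst p))\<^sup>2)\<^sup>2"
        by (simp add: japanese_def power_mult_distrib)
      also have "\<dots> \<le> 1 + 4 * y\<^sup>2" using y by (intro add_left_mono mult_left_mono power_mono) auto
      also have "\<dots> \<le> 144 * (1 + y / 6)\<^sup>2" using y by (simp add: power2_eq_square algebra_simps)
      finally have j1: "(japanese (2 * (norm (fst q - fst p))\<^sup>2))\<^sup>2 \<le> 144 * (1 + y / 6)\<^sup>2" .
      have "japanese (2 * (norm (fst q - fst p))\<^sup>2) powr (2 * b) \<le> japanese (2 * (norm (fst q - fst p))\<^sup>2) powr 2"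
        using b japanese_ge_1 by (intro powr_mono) auto
      then have j1': "japanese (2 * (norm (fst q - fst p))\<^sup>2) powr (2 * b) \<le> 144 * (1 + y / 6)\<^sup>2" using j1 by simp
      have j2: "japanese (snd q - snd p) powr 2 \<le> 6 * (1 + y / 6)"
        using y(1,3) by (simp add: japanese_def)
      let ?J = "japanese (2 * (norm (fst q - fst p))\<^sup>2) powr (2 * b) * japanese (snd q - snd p) powr 2"
      have "?J \<le> (144 * (1 + y / 6)\<^sup>2) * (6 * (1 + y / 6))" using y by (intro mult_mono j1' j2) auto
      also have "\<dots> = 864 * (1 + y / 6) ^ 3" by (simp add: power2_eq_square power3_eq_cube)
      also have "\<dots> \<le> 864 * (exp (y / 6)) ^ 3" using y by (intro mult_left_mono power_mono) auto
      also have "(exp (y / 6)) ^ 3 = exp (y / 2)" by (simp add: exp_of_nat_mult[symmetric])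
      finally have "?J \<le> 864 * exp (y / 2)" .
      moreover have "gauss 1 (p - q) = 1 / exp (y / 2)" by (simp add: gauss_def y_def exp_minus field_simps)
      moreover have "0 < ?J" by simp
      moreover have "1 / e \<le> 864 * (1 / J)" if "J \<le> 864 * e" "0 < J" "0 < e" for J e :: real
        using that by (simp add: field_simps)
      ultimately have "gauss 1 (p - q) \<le> 864 * (1 / ?J)" by simp
      then have "1 / (h (fst q))\<^sup>2 * gauss 1 (p - q) \<le> 1 / (h (fst q))\<^sup>2 * (864 * (1 / ?J))" by (rule mult_left_mono) simp
      then show ?thesis by (simp add: powr_minus_divide)
    qed
    have "(\<integral>\<^sup>+q. ennreal (1 / (h (fst q))\<^sup>2 * gauss 1 (p - q)) \<partial>lborel) \<le> (\<integral>\<^sup>+q. ennreal 864 * (?f (fst q) * ?g (snd q)) \<partial>lborel)"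
    proof (rule nn_integral_mono)
      fix q
      show "ennreal (1 / (h (fst q))\<^sup>2 * gauss 1 (p - q)) \<le> ennreal 864 * (?f (fst q) * ?g (snd q))"
        using ennreal_leI[OF pw[of q]] by (simp add: ennreal_mult[symmetric] del: ennreal_numeral)
    qed
    also have "\<dots> = ennreal 864 * (\<integral>\<^sup>+q. ?f (fst q) * ?g (snd q) \<partial>lborel)"
    proof (rule nn_integral_cmult)
      have "(\<lambda>p. ?f (fst p) * ?g (snd p)) \<in> borel_measurable (borel \<Otimes>\<^sub>M borel)" by measurable
      then show "(\<lambda>p. ?f (fst p) * ?g (snd p)) \<in> borel_measurable lborel" by (simp add: borel_prod)
    qed
    also have "(\<integral>\<^sup>+q. ?f (fst q) * ?g (snd q) \<partial>lborel) = (\<integral>\<^sup>+x. ?f x \<partial>lborel) * (\<integral>\<^sup>+t. ?g t \<partial>lborel)"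
      by (rule nn_integral_lborel_prod_mult) measurable
    also have "ennreal 864 * \<dots> \<le> ennreal 864 * (ennreal S * ennreal (2 * (1 / (1 - 1 / 2))))"
      by (intro mult_left_mono mult_mono S(2) nn_integral_japanese_real) auto
    finally show "(\<integral>\<^sup>+q. ennreal (1 / (h (fst q))\<^sup>2 * gauss 1 (p - q)) \<partial>lborel) \<le> ennreal 864 * (ennreal S * ennreal (2 * (1 / (1 - 1 / 2))))" .
  qed (simp add: ennreal_mult_less_top)
qed (auto simp: hfst_measurable)

end

section \<open>Pairing with Schwartz functions and the cut-off product\<close>

lemma schwartz_seminorm_mono:
  assumes "f \<in> schwartz" "M \<le> N"
  shows "schwartz_seminorm M f \<le> schwartz_seminorm N f"
proof -
  have "schwartz_seminorm M f \<le> (\<Sum>vs\<in>{vs. set vs \<subseteq> Basis \<and> length vs \<le> M}. SUP x. (1 + norm x) ^ N * cmod (partials vs f x))"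
    unfolding schwartz_seminorm_def
  proof (rule sum_mono, rule cSUP_mono)
    fix vs assume "vs \<in> {vs::'a list. set vs \<subseteq> Basis \<and> length vs \<le> M}"
    then show "bdd_above (range (\<lambda>x. (1 + norm x) ^ N * cmod (partials vs f x)))"
      using schwartz_sup_bdd[OF assms(1)] by simp
    fix x
    show "\<exists>m\<in>UNIV. (1 + norm x) ^ M * cmod (partials vs f x) \<le> (1 + norm m) ^ N * cmod (partials vs f m)"
      using assms(2) by (intro bexI[of _ x] mult_right_mono power_increasing) auto
  qed simp
  also have "\<dots> \<le> schwartz_seminorm N f"
    unfolding schwartz_seminorm_def
    using assms by (intro sum_mono2 schwartz_sup_nonneg finite_basis_lists) auto
  finally show ?thesis .
qed

text \<open>The exponent 4 is the one with which \<open>pairing_bound\<close> measures the function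
  paired with.\<close>

lemma ft_seminorm_bound_power4:
  assumes "\<bar>\<sigma>\<bar> = 1"
  shows "\<exists>C N. 0 \<le> C \<and> (\<forall>f::'a::euclidean_space \<Rightarrow> complex. f \<in> schwartz \<longrightarrow> (\<forall>p. cmod (ft \<sigma> f p) * (1 + norm p) ^ 4 \<le> C * schwartz_seminorm N f))"
proof -
  obtain C0 N0 where 0: "0 \<le> C0" "\<And>f p. (f :: 'a \<Rightarrow> complex) \<in> schwartz \<Longrightarrow> norm p ^ 0 * cmod (ft \<sigma> f p) \<le> C0 * schwartz_seminorm N0 f"
    using ft_seminorm_bound[OF assms, of 0] by blast
  obtain C4 N4 where 4: "0 \<le> C4" "\<And>f p. (f :: 'a \<Rightarrow> complex) \<in> schwartz \<Longrightarrow> norm p ^ 4 * cmod (ft \<sigma> f p) \<le> C4 * schwartz_seminorm N4 f"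
    using ft_seminorm_bound[OF assms, of 4] by blast
  have "cmod (ft \<sigma> f p) * (1 + norm p) ^ 4 \<le> (8 * (C0 + C4)) * schwartz_seminorm (max N0 N4) f" if f: "f \<in> schwartz" for f :: "'a \<Rightarrow> complex" and p
  proof -
    have sq: "(1 + x)\<^sup>2 \<le> 2 * (1 + x\<^sup>2)" for x :: real using zero_le_power2[of "1 - x"] by (simp add: power2_eq_square algebra_simps)
    have "(1 + norm p) ^ 4 = ((1 + norm p)\<^sup>2)\<^sup>2" by (simp add: power_mult[symmetric])
    also have "\<dots> \<le> (2 * (1 + (norm p)\<^sup>2))\<^sup>2" by (intro power_mono sq) auto
    also have "\<dots> = 4 * (1 + (norm p)\<^sup>2)\<^sup>2" by (simp only: power_mult_distrib) simp
    also have "\<dots> \<le> 4 * (2 * (1 + ((norm p)\<^sup>2)\<^sup>2))" by (intro mult_left_mono sq) auto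
    also have "\<dots> = 8 * (norm p ^ 0 + norm p ^ 4)" by (simp add: power_mult[symmetric])
    finally have "cmod (ft \<sigma> f p) * (1 + norm p) ^ 4 \<le> cmod (ft \<sigma> f p) * (8 * (norm p ^ 0 + norm p ^ 4))" by (rule mult_left_mono) simp
    also have "\<dots> = 8 * (norm p ^ 0 * cmod (ft \<sigma> f p) + norm p ^ 4 * cmod (ft \<sigma> f p))" by (simp add: algebra_simps)
    also have "\<dots> \<le> 8 * (C0 * schwartz_seminorm (max N0 N4) f + C4 * schwartz_seminorm (max N0 N4) f)"
      using order_trans[OF 0(2)[OF f, of p] mult_left_mono[OF schwartz_seminorm_mono[OF f, of N0 "max N0 N4"] 0(1)]]
        order_trans[OF 4(2)[OF f, of p] mult_left_mono[OF schwartz_seminorm_mono[OF f, of N4 "max N0 N4"] 4(1)]]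
      by (intro mult_left_mono add_mono) auto
    finally show ?thesis by (simp add: algebra_simps)
  qed
  then show ?thesis using 0(1) 4(1) by (intro exI[of _ "8 * (C0 + C4)"] exI[of _ "max N0 N4"]) auto
qed

lemma nn_conv_cmod: "nn_conv (\<lambda>p. ennreal (cmod (g1 p))) (\<lambda>p. ennreal (cmod (g2 p))) P = (\<integral>\<^sup>+p. ennreal (cmod (g1 p) * cmod (g2 (P - p))) \<partial>lborel)"
  unfolding nn_conv_def by (simp add: ennreal_mult)

context bilinear_weight begin

text \<open>The squared norm on the output side. Off \<xi> = 0 its weight is the reciprocal of the
  one in \<open>dual_weight_bound\<close>, which makes pairing with Schwartz functions
  possible.\<close>

abbreviation dual_sq :: "('a \<times> real \<Rightarrow> ennreal) \<Rightarrow> ennreal" where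
  "dual_sq g \<equiv> (\<integral>\<^sup>+P. (ennreal (r (fst P) * japanese (\<bar>snd P\<bar> - \<phi> (fst P)) powr (b - 1)) * g P)\<^sup>2 \<partial>lborel)"

lemma mod_measurable [measurable]: "(\<lambda>p::'a \<times> real. japanese (\<bar>snd p\<bar> - \<phi> (fst p)) powr e) \<in> borel_measurable borel"
  by (subst borel_prod[symmetric]) measurable

text \<open>Cauchy-Schwarz with reciprocal weights, which cancel where \<xi> \<noteq> 0. The
  parameter \<open>s\<close> plays the role of a seminorm, so that the bound yields temperedness as
  well as convergence.\<close>

lemma pairing_bound:
  "\<exists>C\<ge>0. \<forall>k s g. k \<in> borel_measurable borel \<longrightarrow> g \<in> borel_measurable borel \<longrightarrow> (\<forall>p. 0 \<le> k p \<and> k p * (1 + norm p) ^ 4 \<le> s) \<longrightarrow>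
     (\<integral>\<^sup>+p. ennreal (k p) * g p \<partial>lborel)\<^sup>2 \<le> ennreal (C * s\<^sup>2) * dual_sq g"
proof -
  obtain C where C: "0 \<le> C" "\<And>k s. (\<And>p. 0 \<le> k p) \<Longrightarrow> (\<And>p. k p * (1 + norm p) ^ 4 \<le> s) \<Longrightarrow>
     (\<integral>\<^sup>+p. ennreal ((k p * japanese (\<bar>snd p\<bar> - \<phi> (fst p)) powr (1 - b) / h (fst p))\<^sup>2) \<partial>lborel) \<le> ennreal (C * s\<^sup>2)"
    using dual_weight_bound by blast
  have "(\<integral>\<^sup>+p. ennreal (k p) * g p \<partial>lborel)\<^sup>2 \<le> ennreal ((2 * C) * s\<^sup>2) * dual_sq g"
    if [measurable]: "k \<in> borel_measurable borel" "g \<in> borel_measurable borel" and k: "\<And>p. 0 \<le> k p" "\<And>p. k p * (1 + norm p) ^ 4 \<le> s" for k s g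
  proof -
    let ?j = "\<lambda>p. japanese (\<bar>snd p\<bar> - \<phi> (fst p))"
    let ?f = "\<lambda>p. ennreal (k p * ?j p powr (1 - b) / h (fst p))" and ?g = "\<lambda>p. ennreal (r (fst p) * ?j p powr (b - 1)) * g p"
    have eq: "(\<integral>\<^sup>+p. ennreal (k p) * g p \<partial>lborel) = (\<integral>\<^sup>+p. ?f p * ?g p \<partial>lborel)"
    proof (rule nn_integral_cong_AE)
      show "AE p in lborel. ennreal (k p) * g p = ?f p * ?g p"
        using AE_lborel_fst_nonzero
      proof eventually_elim
        case (elim p)
        have "?j p powr (1 - b) * ?j p powr (b - 1) = 1" by (simp add: powr_add[symmetric])
        then have "k p * ?j p powr (1 - b) / h (fst p) * (r (fst p) * ?j p powr (b - 1)) = k p"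
          using h_eq_r[OF elim] h_pos[of "fst p"] by (simp add: field_simps)
        then have "?f p * ennreal (r (fst p) * ?j p powr (b - 1)) = ennreal (k p)"
          using k(1)[of p] by (simp add: ennreal_mult[symmetric])
        then show ?case by (simp only: mult.assoc[symmetric])
      qed
    qed
    have "(\<integral>\<^sup>+p. ennreal (k p) * g p \<partial>lborel)\<^sup>2 \<le> 2 * (\<integral>\<^sup>+p. (?f p)\<^sup>2 \<partial>lborel) * (\<integral>\<^sup>+p. (?g p)\<^sup>2 \<partial>lborel)"
      unfolding eq by (rule nn_Cauchy_Schwarz) measurable
    also have "\<dots> \<le> ennreal ((2 * C) * s\<^sup>2) * (\<integral>\<^sup>+p. (?g p)\<^sup>2 \<partial>lborel)"
    proof (rule mult_right_mono)
      have "(\<integral>\<^sup>+p. (?f p)\<^sup>2 \<partial>lborel) \<le> ennreal (C * s\<^sup>2)"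
        using C(2)[of k s, OF k] k(1) by (simp add: ennreal_power)
      then have "2 * (\<integral>\<^sup>+p. (?f p)\<^sup>2 \<partial>lborel) \<le> 2 * ennreal (C * s\<^sup>2)" by (rule mult_left_mono) simp
      also have "\<dots> = ennreal ((2 * C) * s\<^sup>2)" using C(1) by (simp add: ennreal_mult mult.assoc)
      finally show "2 * (\<integral>\<^sup>+p. (?f p)\<^sup>2 \<partial>lborel) \<le> ennreal ((2 * C) * s\<^sup>2)" .
    qed simp
    finally show ?thesis .
  qed
  then show ?thesis using C(1) by (intro exI[of _ "2 * C"]) auto
qed

lemma dual_sq_le: "dual_sq g \<le> weighted_sq g"
proof (rule nn_integral_mono_AE)
  show "AE P in lborel. (ennreal (r (fst P) * japanese (\<bar>snd P\<bar> - \<phi> (fst P)) powr (b - 1)) * g P)\<^sup>2 \<le> (ennreal (h (fst P) * B P) * g P)\<^sup>2"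
    using AE_lborel_fst_nonzero
  proof eventually_elim
    case (elim P)
    have "r (fst P) * japanese (\<bar>snd P\<bar> - \<phi> (fst P)) powr (b - 1) \<le> h (fst P) * B P"
      unfolding B_def using h_eq_r[OF elim] b japanese_ge_1 by (intro mult_mono powr_mono) auto
    then show ?case by (intro power_mono mult_right_mono ennreal_leI) auto
  qed
qed

lemma pairing_integrable:
  fixes g \<psi> :: "'a \<times> real \<Rightarrow> complex"
  assumes [measurable]: "g \<in> borel_measurable borel" and \<psi>: "\<psi> \<in> schwartz" and fin: "dual_sq (\<lambda>p. ennreal (cmod (g p))) < \<infinity>"
  shows "integrable lborel (\<lambda>p. g p * \<psi> p)"
proof (rule integrableI_bounded)
  obtain C where C: "0 \<le> C" "\<And>k s g. k \<in> borel_measurable borel \<Longrightarrow> g \<in> borel_measurable borel \<Longrightarrow> (\<And>p. 0 \<le> k p \<and> k p * (1 + norm p) ^ 4 \<le> s) \<Longrightarrow>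
     (\<integral>\<^sup>+p. ennreal (k p) * g p \<partial>lborel)\<^sup>2 \<le> ennreal (C * s\<^sup>2) * dual_sq g"
    using pairing_bound by blast
  note [measurable] = schwartz_measurable[OF \<psi>]
  have "(\<integral>\<^sup>+p. ennreal (cmod (\<psi> p)) * ennreal (cmod (g p)) \<partial>lborel)\<^sup>2 \<le> ennreal (C * (schwartz_seminorm 4 \<psi>)\<^sup>2) * dual_sq (\<lambda>p. ennreal (cmod (g p)))"
    by (rule C(2)) (use schwartz_seminorm_bound[OF \<psi>, of _ 4] in \<open>auto simp: mult.commute\<close>)
  also have "\<dots> < \<infinity>" using fin by (simp add: ennreal_mult_less_top)
  finally have "(\<integral>\<^sup>+p. ennreal (cmod (\<psi> p)) * ennreal (cmod (g p)) \<partial>lborel) < \<infinity>"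
    by (simp add: power_less_top_ennreal)
  then show "(\<integral>\<^sup>+p. ennreal (norm (g p * \<psi> p)) \<partial>lborel) < \<infinity>"
    by (simp add: norm_mult ennreal_mult mult.commute)
qed (use schwartz_measurable[OF \<psi>] in measurable)

text \<open>The sphere bound gives the functions \<open>f1\<close> and \<open>f2\<close> through
  \<open>fourier_approx_exists\<close>, and the bilinear estimate verifies the hypotheses of
  \<open>product_cutoff\<close>. The size of \<open>w\<close> is recorded by a pointwise majorant,
  whose norm depends on T as required by \<open>cutoff_bilinear\<close>.\<close>

lemma cutoff_product:
  fixes g1 g2 :: "'a \<times> real \<Rightarrow> complex"
  assumes [measurable]: "g1 \<in> borel_measurable borel" "g2 \<in> borel_measurable borel"
    and fin: "weighted_sq (\<lambda>p. ennreal (cmod (g1 p))) < \<infinity>" "weighted_sq (\<lambda>p. ennreal (cmod (g2 p))) < \<infinity>" and T: "0 < T"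
  shows "\<exists>f1 f2 w. f1 \<in> borel_measurable borel \<and> f2 \<in> borel_measurable borel \<and> w \<in> borel_measurable borel
    \<and> (\<forall>\<theta>\<in>schwartz. integrable lborel (\<lambda>X. f1 X * \<theta> X) \<and> (LINT X|lborel. f1 X * \<theta> X) = (LINT p|lborel. g1 p * ft 1 \<theta> p))
    \<and> (\<forall>\<theta>\<in>schwartz. integrable lborel (\<lambda>X. f2 X * \<theta> X) \<and> (LINT X|lborel. f2 X * \<theta> X) = (LINT p|lborel. g2 p * ft 1 \<theta> p))
    \<and> (\<exists>C N. \<forall>\<psi>\<in>schwartz. integrable lborel (\<lambda>X. f1 X * f2 X * \<psi> X) \<and> (LINT X|lborel. cmod (f1 X * f2 X * \<psi> X)) \<le> C * schwartz_seminorm N \<psi>)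
    \<and> (\<forall>P. ennreal (cmod (w P)) \<le> nn_cutoff T (nn_conv (\<lambda>p. ennreal (cmod (g1 p))) (\<lambda>p. ennreal (cmod (g2 p)))) P)
    \<and> (\<forall>\<psi>\<in>schwartz. integrable lborel (\<lambda>P. w P * \<psi> P)
        \<and> (LINT X|lborel. indicator (UNIV \<times> {0<..<T}) X *\<^sub>R (f1 X * f2 X * ft (-1) \<psi> X)) = complex_of_real ((2 * pi) ^ DIM('a)) * (LINT P|lborel. w P * \<psi> P))"
proof -
  interpret W: fourier_weight "\<lambda>p :: 'a \<times> real. h (fst p)" by (rule fourier_weight)
  \<comment> \<open>Since B \<ge> 1, the full norm controls the one with \<open>h\<close> alone,
    which is the weight of the interpreted locale.\<close>
  have N: "(\<integral>\<^sup>+p. ennreal ((h (fst p) * cmod (g p))\<^sup>2) \<partial>lborel) < \<infinity>" if "weighted_sq (\<lambda>p. ennreal (cmod (g p))) < \<infinity>" for g :: "'a \<times> real \<Rightarrow> complex"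
  proof (rule le_less_trans[OF nn_integral_mono that])
    fix p
    have "h (fst p) * 1 \<le> h (fst p) * B p" unfolding B_def using b japanese_ge_1 by (intro mult_left_mono ge_one_powr_ge_zero) auto
    then have "h (fst p) * cmod (g p) \<le> h (fst p) * B p * cmod (g p)" by (intro mult_right_mono) auto
    then have "(h (fst p) * cmod (g p))\<^sup>2 \<le> (h (fst p) * B p * cmod (g p))\<^sup>2" by (intro power_mono) auto
    then show "ennreal ((h (fst p) * cmod (g p))\<^sup>2) \<le> (ennreal (h (fst p) * B p) * ennreal (cmod (g p)))\<^sup>2"
      by (simp add: ennreal_mult[symmetric] ennreal_power)
  qed
  obtain A1 f1 F1 where ap1: "fourier_approx g1 A1 f1 F1" using W.fourier_approx_exists[OF _ N[OF fin(1)]] by auto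
  obtain A2 f2 F2 where ap2: "fourier_approx g2 A2 f2 F2" using W.fourier_approx_exists[OF _ N[OF fin(2)]] by auto
  note a1 = fourier_approxD[OF ap1] and a2 = fourier_approxD[OF ap2]
  note [measurable] = a1(4,5) a2(4,5)
  let ?u = "\<lambda>p. ennreal (cmod (g1 p))" and ?v = "\<lambda>p. ennreal (cmod (g2 p))"
  define K where "K P = (LINT p|lborel. g1 p * g2 (P - p))" for P
  define w where "w P = (LINT \<tau>'|lborel. cutoff_kernel T (snd P - \<tau>') * K (fst P, \<tau>'))" for P
  have Kb: "K \<in> borel_measurable borel" unfolding K_def[abs_def] by measurable
  then have [measurable]: "K \<in> borel_measurable (borel \<Otimes>\<^sub>M borel)" by (simp add: borel_prod)
  have wm: "w \<in> borel_measurable borel"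
  proof -
    have "w \<in> borel_measurable (borel \<Otimes>\<^sub>M borel)" unfolding w_def[abs_def] by measurable
    then show ?thesis by (simp add: borel_prod)
  qed
  have kc: "ennreal (cmod (cutoff_kernel T \<sigma>)) \<le> ennreal (3 * T / (1 + T * \<bar>\<sigma>\<bar>))" for \<sigma>
    by (intro ennreal_leI cutoff_kernel_bound T)
  have Kc: "ennreal (cmod (K P)) \<le> nn_conv ?u ?v P" for P
    unfolding K_def nn_conv_cmod by (rule order_trans[OF norm_integral_le_nn_integral]) (simp add: norm_mult)
  have wb: "ennreal (cmod (w P)) \<le> nn_cutoff T (nn_conv ?u ?v) P" for P
  proof -
    have "ennreal (cmod (w P)) \<le> (\<integral>\<^sup>+\<tau>'. ennreal (cmod (cutoff_kernel T (snd P - \<tau>') * K (fst P, \<tau>'))) \<partial>lborel)"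
      unfolding w_def by (rule norm_integral_le_nn_integral)
    also have "\<dots> \<le> nn_cutoff T (nn_conv ?u ?v) P"
      unfolding nn_cutoff_def norm_mult by (intro nn_integral_mono) (simp add: ennreal_mult mult_mono kc Kc)
    finally show ?thesis .
  qed
  have pair: "\<forall>\<theta>\<in>schwartz. integrable lborel (\<lambda>X. f X * \<theta> X) \<and> (LINT X|lborel. f X * \<theta> X) = (LINT p|lborel. g p * ft 1 \<theta> p)"
    if ap: "fourier_approx g A f F" and g: "g \<in> borel_measurable borel" "weighted_sq (\<lambda>p. ennreal (cmod (g p))) < \<infinity>" for g A f F
  proof
    fix \<theta> :: "'a \<times> real \<Rightarrow> complex" assume \<theta>: "\<theta> \<in> schwartz"
    have "integrable lborel (\<lambda>p. g p * ft 1 \<theta> p)"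
      using le_less_trans[OF dual_sq_le g(2)] by (intro pairing_integrable g(1) ft_schwartz \<theta>) auto
    then show "integrable lborel (\<lambda>X. f X * \<theta> X) \<and> (LINT X|lborel. f X * \<theta> X) = (LINT p|lborel. g p * ft 1 \<theta> p)"
      using fourier_approx_pairing[OF ap \<theta> g(1)] by blast
  qed
  have dec: "\<exists>C N. \<forall>\<psi>\<in>schwartz. integrable lborel (\<lambda>X. f1 X * f2 X * \<psi> X) \<and> (LINT X|lborel. cmod (f1 X * f2 X * \<psi> X)) \<le> C * schwartz_seminorm N \<psi>"
  proof (intro exI ballI)
    fix \<psi> :: "'a \<times> real \<Rightarrow> complex" assume \<psi>: "\<psi> \<in> schwartz"
    note [measurable] = schwartz_measurable[OF \<psi>]
    let ?N = "2 * DIM('a \<times> real) + 0"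
    let ?M = "\<lambda>X. (F1 X)\<^sup>2 * decay X + (F2 X)\<^sup>2 * decay X"
    have i: "integrable lborel ?M"
      using a1(9) a2(9) by (intro Bochner_Integration.integrable_add integrableI_bounded) (auto simp: decay_nonneg)
    then have i': "integrable lborel (\<lambda>X. ?M X * schwartz_seminorm ?N \<psi>)" by simp
    have le: "AE X in lborel. cmod (f1 X * f2 X * \<psi> X) \<le> ?M X * schwartz_seminorm ?N \<psi>"
      using fourier_approx_bound[OF ap1] fourier_approx_bound[OF ap2]
    proof eventually_elim
      case (elim X)
      have ps: "cmod (\<psi> X) \<le> schwartz_seminorm ?N \<psi> * decay X" using schwartz_le_decay[OF \<psi>, of X 0] by simp
      have "cmod (f1 X * f2 X * \<psi> X) \<le> (F1 X * F2 X) * (schwartz_seminorm ?N \<psi> * decay X)"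
        unfolding norm_mult using elim a1(6) a2(6) by (intro mult_mono ps) auto
      also have "\<dots> \<le> ((F1 X)\<^sup>2 + (F2 X)\<^sup>2) * (schwartz_seminorm ?N \<psi> * decay X)"
      proof (intro mult_right_mono)
        have "2 * (F1 X * F2 X) \<le> (F1 X)\<^sup>2 + (F2 X)\<^sup>2" using zero_le_power2[of "F1 X - F2 X"] by (simp add: power2_eq_square algebra_simps)
        moreover have "0 \<le> F1 X * F2 X" using a1(6) a2(6) by simp
        ultimately show "F1 X * F2 X \<le> (F1 X)\<^sup>2 + (F2 X)\<^sup>2" by linarith
        show "0 \<le> schwartz_seminorm ?N \<psi> * decay X" using schwartz_seminorm_nonneg[OF \<psi>] decay_nonneg by simp
      qed
      finally show ?case by (simp add: algebra_simps)
    qed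
    have int: "integrable lborel (\<lambda>X. f1 X * f2 X * \<psi> X)"
      by (rule Bochner_Integration.integrable_bound[OF i']) (use le in \<open>auto elim: eventually_mono\<close>)
    have "(LINT X|lborel. cmod (f1 X * f2 X * \<psi> X)) \<le> (LINT X|lborel. ?M X * schwartz_seminorm ?N \<psi>)"
      by (rule integral_mono_AE[OF integrable_norm[OF int] i' le])
    also have "\<dots> = (LINT X|lborel. ?M X) * schwartz_seminorm ?N \<psi>" by simp
    finally show "integrable lborel (\<lambda>X. f1 X * f2 X * \<psi> X) \<and> (LINT X|lborel. cmod (f1 X * f2 X * \<psi> X)) \<le> (LINT X|lborel. ?M X) * schwartz_seminorm ?N \<psi>"
      using int by blast
  qed
  obtain Cp where Cp: "0 \<le> Cp" "\<And>k s g. k \<in> borel_measurable borel \<Longrightarrow> g \<in> borel_measurable borel \<Longrightarrow> (\<And>p. 0 \<le> k p \<and> k p * (1 + norm p) ^ 4 \<le> s) \<Longrightarrow>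
     (\<integral>\<^sup>+p. ennreal (k p) * g p \<partial>lborel)\<^sup>2 \<le> ennreal (Cp * s\<^sup>2) * dual_sq g"
    using pairing_bound by blast
  obtain Cb where Cb: "dual_sq (nn_cutoff T (nn_conv ?u ?v)) \<le> ennreal (Cb * T powr (2 * (1 - b))) * (weighted_sq ?u * weighted_sq ?v)"
  proof -
    have "?u \<in> borel_measurable borel" "?v \<in> borel_measurable borel" by measurable
    then show ?thesis using cutoff_bilinear T that by blast
  qed
  \<comment> \<open>A finite norm on the output side means a finite pairing with every Schwartz
    function, which is the absolute convergence that \<open>product_cutoff\<close> asks for.\<close>
  have lowfin: "dual_sq (nn_cutoff T (nn_conv ?u ?v)) < \<infinity>"
    by (rule le_less_trans[OF Cb]) (use fin in \<open>auto simp: ennreal_mult_less_top\<close>)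
  have nm [measurable]: "nn_cutoff T (nn_conv ?u ?v) \<in> borel_measurable borel" by measurable
  have prod: "integrable lborel (\<lambda>P. w P * \<psi> P)
        \<and> (LINT X|lborel. indicator (UNIV \<times> {0<..<T}) X *\<^sub>R (f1 X * f2 X * ft (-1) \<psi> X)) = complex_of_real ((2 * pi) ^ DIM('a)) * (LINT P|lborel. w P * \<psi> P)"
    if \<psi>: "\<psi> \<in> schwartz" for \<psi>
  proof -
    note [measurable] = schwartz_measurable[OF \<psi>]
    have "(\<integral>\<^sup>+p. ennreal (cmod (\<psi> p)) * nn_cutoff T (nn_conv ?u ?v) p \<partial>lborel)\<^sup>2 \<le> ennreal (Cp * (schwartz_seminorm 4 \<psi>)\<^sup>2) * dual_sq (nn_cutoff T (nn_conv ?u ?v))"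
      by (rule Cp(2)) (use schwartz_seminorm_bound[OF \<psi>, of _ 4] in \<open>auto simp: mult.commute\<close>)
    also have "\<dots> < \<infinity>" using lowfin by (simp add: ennreal_mult_less_top)
    finally have f: "(\<integral>\<^sup>+p. ennreal (cmod (\<psi> p)) * nn_cutoff T (nn_conv ?u ?v) p \<partial>lborel) < \<infinity>"
      by (simp add: power_less_top_ennreal)
    have e: "(\<integral>\<^sup>+p. ennreal (cmod (\<psi> p)) * nn_cutoff T (nn_conv ?u ?v) p \<partial>lborel)
      = (\<integral>\<^sup>+\<xi>. \<integral>\<^sup>+\<tau>. ennreal (cmod (\<psi> (\<xi>, \<tau>))) * nn_cutoff T (nn_conv ?u ?v) (\<xi>, \<tau>) \<partial>lborel \<partial>lborel)"
      by (rule nn_integral_lborel_fst) (simp add: lborel_prod)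
    have Hf: "(\<integral>\<^sup>+\<xi>. \<integral>\<^sup>+\<tau>. ennreal (cmod (\<psi> (\<xi>, \<tau>))) * (\<integral>\<^sup>+\<tau>'. ennreal (cmod (cutoff_kernel T (\<tau> - \<tau>'))) * nn_conv ?u ?v (\<xi>, \<tau>') \<partial>lborel) \<partial>lborel \<partial>lborel) < \<infinity>"
      by (rule le_less_trans[OF _ f], unfold e, unfold nn_cutoff_def fst_conv snd_conv)
        (intro nn_integral_mono mult_left_mono mult_right_mono kc, simp_all)
    have wd: "w (\<xi>, \<tau>) = (LINT \<tau>'|lborel. cutoff_kernel T (\<tau> - \<tau>') * K (\<xi>, \<tau>'))" for \<xi> \<tau> by (simp add: w_def)
    have "AE P in lborel. nn_conv ?u ?v P < \<infinity>" by (rule nn_conv_finite) (use fin in auto)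
    note pc = product_cutoff[OF ap1 ap2 assms(1,2) \<psi> T K_def nn_conv_cmod wd this Hf]
    show ?thesis by (rule conjI[OF pc])
  qed
  show ?thesis
    using a1(4) a2(4) wm pair[OF ap1 assms(1) fin(1)] pair[OF ap2 assms(2) fin(2)] dec wb prod
    by (intro exI[of _ f1] exI[of _ f2] exI[of _ w] conjI) auto
qed

end

section \<open>Distributions with weighted Fourier transforms\<close>

lemma has_fourier_transform_unique:
  fixes u :: "'a::euclidean_space distribution"
  assumes g: "has_fourier_transform u g" and g': "has_fourier_transform u g'"
  shows "AE p in lborel. g p = g' p"
proof -
  have [measurable]: "g \<in> borel_measurable borel" "g' \<in> borel_measurable borel"
    using assms by (auto simp: has_fourier_transform_def)
  have "AE p in lborel. g p - g' p = 0"
  proof (rule schwartz_annihilator_AE)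
    fix \<psi> :: "'a \<Rightarrow> complex" assume "\<psi> \<in> schwartz"
    then have i: "integrable lborel (\<lambda>p. g p * \<psi> p)" "integrable lborel (\<lambda>p. g' p * \<psi> p)"
      and e: "(LINT p|lborel. g p * \<psi> p) = (LINT p|lborel. g' p * \<psi> p)"
      using g g' by (auto simp: has_fourier_transform_def)
    show "integrable lborel (\<lambda>p. (g p - g' p) * \<psi> p)" "(LINT p|lborel. (g p - g' p) * \<psi> p) = 0"
      using i e by (simp_all add: left_diff_distrib)
  qed measurable
  then show ?thesis by simp
qed

section \<open>The phase function and the norms on the Fourier side\<close>

lemma phase_measurable [measurable]: "phase \<alpha> \<gamma> \<in> borel_measurable borel"
  unfolding phase_def[abs_def] by measurable

lemma X_weight_measurable [measurable]: "X_weight \<alpha> \<gamma> s \<omega> b \<in> borel_measurable borel"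
  unfolding X_weight_def by (subst borel_prod[symmetric]) measurable

lemma phase_minus [simp]: "phase \<alpha> \<gamma> (- x) = phase \<alpha> \<gamma> x"
  by (simp add: phase_def)

text \<open>Completing the square, the phase is sqrt (y^2 + \<delta>) with y = |x|^2 + \<alpha>/2
  and \<delta> = \<gamma> - \<alpha>^2/4 > 0, so it lies between |y| and |y| + sqrt
  \<delta>.\<close>

lemma phase_close:
  assumes "\<gamma> > \<alpha>\<^sup>2 / 4"
  shows "\<bar>phase \<alpha> \<gamma> x - (norm x)\<^sup>2\<bar> \<le> sqrt (\<gamma> - \<alpha>\<^sup>2 / 4) + \<bar>\<alpha>\<bar>"
proof -
  let ?\<delta> = "\<gamma> - \<alpha>\<^sup>2 / 4" and ?y = "(norm x)\<^sup>2 + \<alpha> / 2"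
  have \<delta>: "0 \<le> ?\<delta>" using assms by simp
  have ph: "phase \<alpha> \<gamma> x = sqrt (?y\<^sup>2 + ?\<delta>)"
    by (simp add: phase_def power2_eq_square algebra_simps power4_eq_xxxx)
  have "\<bar>?y\<bar> \<le> phase \<alpha> \<gamma> x" unfolding ph by (rule real_le_rsqrt) (use \<delta> in simp)
  moreover have "phase \<alpha> \<gamma> x \<le> \<bar>?y\<bar> + sqrt ?\<delta>"
    using sqrt_add_le_add_sqrt[of "?y\<^sup>2" ?\<delta>] \<delta> unfolding ph by simp
  moreover have "0 \<le> (norm x)\<^sup>2" by simp
  ultimately show ?thesis by linarith
qed

lemma X_norm_eq:
  assumes "has_fourier_transform u g"
  shows "X_norm \<alpha> \<gamma> s \<omega> b u = sqrt (LINT p|lborel. (X_weight \<alpha> \<gamma> s \<omega> b p * cmod (g p))\<^sup>2)"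
proof -
  let ?g = "SOME g. has_fourier_transform u g"
  have h: "has_fourier_transform u ?g" by (rule someI[of "has_fourier_transform u", OF assms])
  have [measurable]: "g \<in> borel_measurable borel" "?g \<in> borel_measurable borel"
    using assms h by (auto simp: has_fourier_transform_def)
  have "(LINT p|lborel. (X_weight \<alpha> \<gamma> s \<omega> b p * cmod (?g p))\<^sup>2) = (LINT p|lborel. (X_weight \<alpha> \<gamma> s \<omega> b p * cmod (g p))\<^sup>2)"
  proof (rule integral_cong_AE)
    show "AE p in lborel. (X_weight \<alpha> \<gamma> s \<omega> b p * cmod (?g p))\<^sup>2 = (X_weight \<alpha> \<gamma> s \<omega> b p * cmod (g p))\<^sup>2"
      using has_fourier_transform_unique[OF h assms] by eventually_elim simp
  qed measurable
  then show ?thesis by (simp add: X_norm_def)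
qed

lemma X_norm_nonneg [simp]: "0 \<le> X_norm \<alpha> \<gamma> s \<omega> b u"
  by (simp add: X_norm_def Bochner_Integration.integral_nonneg)

lemma X_spaceE:
  assumes "u \<in> X_space \<alpha> \<gamma> s \<omega> b"
  obtains g where "has_fourier_transform u g" "g \<in> borel_measurable borel"
    "(\<integral>\<^sup>+p. ennreal ((X_weight \<alpha> \<gamma> s \<omega> b p * cmod (g p))\<^sup>2) \<partial>lborel) = ennreal ((X_norm \<alpha> \<gamma> s \<omega> b u)\<^sup>2)"
proof -
  obtain g where g: "has_fourier_transform u g" "integrable lborel (\<lambda>p. (X_weight \<alpha> \<gamma> s \<omega> b p * cmod (g p))\<^sup>2)"
    using assms by (auto simp: X_space_def)
  show ?thesis
  proof
    show "g \<in> borel_measurable borel" using g(1) by (simp add: has_fourier_transform_def)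
    show "(\<integral>\<^sup>+p. ennreal ((X_weight \<alpha> \<gamma> s \<omega> b p * cmod (g p))\<^sup>2) \<partial>lborel) = ennreal ((X_norm \<alpha> \<gamma> s \<omega> b u)\<^sup>2)"
      unfolding X_norm_eq[OF g(1)] by (subst nn_integral_eq_integral[OF g(2)]) (simp_all add: Bochner_Integration.integral_nonneg)
  qed (rule g(1))
qed

lemma X_spaceI:
  assumes "tempered_distribution u" "has_fourier_transform u g"
    and le: "(\<integral>\<^sup>+p. ennreal ((X_weight \<alpha> \<gamma> s \<omega> b p * cmod (g p))\<^sup>2) \<partial>lborel) \<le> ennreal (c\<^sup>2)" and c: "0 \<le> c"
  shows "u \<in> X_space \<alpha> \<gamma> s \<omega> b" "X_norm \<alpha> \<gamma> s \<omega> b u \<le> c"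
proof -
  have [measurable]: "g \<in> borel_measurable borel" using assms by (simp add: has_fourier_transform_def)
  have i: "integrable lborel (\<lambda>p. (X_weight \<alpha> \<gamma> s \<omega> b p * cmod (g p))\<^sup>2)"
    using le_less_trans[OF le, of \<infinity>] by (intro integrableI_bounded) auto
  then show "u \<in> X_space \<alpha> \<gamma> s \<omega> b" using assms by (auto simp: X_space_def)
  have "(LINT p|lborel. (X_weight \<alpha> \<gamma> s \<omega> b p * cmod (g p))\<^sup>2) \<le> c\<^sup>2"
    using le by (subst (asm) nn_integral_eq_integral[OF i]) auto
  then show "X_norm \<alpha> \<gamma> s \<omega> b u \<le> c"
    unfolding X_norm_eq[OF assms(2)] by (rule real_le_lsqrt[OF c])
qed

lemma smoothing_multiplier:
  fixes \<psi> :: "'n::finite spacetime \<Rightarrow> complex"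
  assumes "\<psi> \<in> schwartz"
  shows "(\<lambda>\<xi>. (case \<xi> of (\<xi>, \<tau>) \<Rightarrow> complex_of_real ((norm \<xi>)\<^sup>2 * japanese \<xi> powr (- 2))) * \<psi> \<xi>) \<in> schwartz"
proof -
  \<comment> \<open>Only the space directions enter, so the sum of squares in the generator is
    |\<xi>|^2.\<close>
  let ?S = "(\<lambda>b::real^'n. (b, 0::real)) ` Basis"
  have S: "?S \<subseteq> Basis" by (auto simp: Basis_prod_def)
  let ?p = "\<lambda>x. 1 + (- 1) * complex_of_real (1 / (1 + (\<Sum>b\<in>?S. (x \<bullet> b)\<^sup>2)))"
  have p: "?p \<in> mult_class ?S" by (intro mult_class.add mult_class.mult mult_class.const mult_class.recip)
  have pc: "?p x = (case x of (\<xi>, \<tau>) \<Rightarrow> complex_of_real ((norm \<xi>)\<^sup>2 * japanese \<xi> powr (- 2)))" for x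
  proof -
    obtain \<xi> \<tau> where x: "x = (\<xi>, \<tau>)" by (cases x)
    have s: "(\<Sum>b\<in>?S. (x \<bullet> b)\<^sup>2) = (norm \<xi>)\<^sup>2"
      by (subst sum.reindex) (auto simp: inj_on_def x inner_prod_def norm_sq_Basis)
    have j: "japanese \<xi> powr (- 2) = 1 / (1 + (norm \<xi>)\<^sup>2)" by (simp add: powr_minus_divide japanese_def)
    have pos: "1 + (norm \<xi>)\<^sup>2 \<noteq> 0" using zero_le_power2[of "norm \<xi>"] by linarith
    have e: "1 + (- 1) * (1 / (1 + (norm \<xi>)\<^sup>2)) = (norm \<xi>)\<^sup>2 * (1 / (1 + (norm \<xi>)\<^sup>2))" using pos by (simp add: field_simps)
    have "?p x = complex_of_real (1 + (- 1) * (1 / (1 + (norm \<xi>)\<^sup>2)))" unfolding s by (simp only: of_real_add of_real_mult of_real_1 of_real_minus)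
    then show ?thesis unfolding e unfolding x prod.case j .
  qed
  have "(\<lambda>\<xi>. (case \<xi> of (\<xi>, \<tau>) \<Rightarrow> complex_of_real ((norm \<xi>)\<^sup>2 * japanese \<xi> powr (- 2))) * \<psi> \<xi>) = (\<lambda>x. ?p x * \<psi> x)"
    by (rule ext) (simp only: pc)
  then show ?thesis using schwartz_mult_class[OF p assms S] by (simp only:)
qed

text \<open>The two comparisons tie the model weights to the norms: on the factors the weight may be
  lowered to \<open>h\<close>, and on the product the symbol of the multiplier times the weight must
  stay below \<open>r\<close>. At the origin \<open>powr\<close> makes the weight 0, so
  \<open>upper\<close>, where \<open>h\<close> is positive, has to exclude this point.\<close>

locale bilinear_X = bilinear_weight h r "phase \<alpha> \<gamma>" b H D S
  for h r :: "real ^ 'n::finite \<Rightarrow> real" and \<alpha> \<gamma> b H D S +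
  fixes s \<omega> :: real
  assumes upper: "x \<noteq> 0 \<Longrightarrow> h x \<le> japanese x powr (s + \<omega>) * norm x powr (- \<omega>)"
    and lower: "(norm x)\<^sup>2 * japanese x powr (- 2) * (japanese x powr (s + \<omega>) * norm x powr (- \<omega>)) \<le> r x"
begin

abbreviation "Xb \<equiv> X_space \<alpha> \<gamma> s \<omega> b :: 'n spacetime distribution set"
abbreviation "Nb \<equiv> X_norm \<alpha> \<gamma> s \<omega> b :: 'n spacetime distribution \<Rightarrow> real"

lemma weighted_sq_le:
  "weighted_sq (\<lambda>p. ennreal (cmod (g p))) \<le> (\<integral>\<^sup>+p. ennreal ((X_weight \<alpha> \<gamma> s \<omega> b p * cmod (g p))\<^sup>2) \<partial>lborel)"
proof (rule nn_integral_mono_AE)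
  show "AE p in lborel. (ennreal (h (fst p) * B p) * ennreal (cmod (g p)))\<^sup>2 \<le> ennreal ((X_weight \<alpha> \<gamma> s \<omega> b p * cmod (g p))\<^sup>2)"
    using AE_lborel_fst_nonzero
  proof eventually_elim
    case (elim p)
    have "h (fst p) * B p \<le> X_weight \<alpha> \<gamma> s \<omega> b p"
      unfolding X_weight_def B_def case_prod_beta using upper[OF elim] by (intro mult_right_mono) auto
    then have "(h (fst p) * B p * cmod (g p))\<^sup>2 \<le> (X_weight \<alpha> \<gamma> s \<omega> b p * cmod (g p))\<^sup>2"
      by (intro power_mono mult_right_mono) auto
    then show ?case by (simp add: ennreal_mult[symmetric] ennreal_power)
  qed
qed

lemma X_space_fourier:
  assumes "u \<in> Xb"
  obtains g where "has_fourier_transform u g" "g \<in> borel_measurable borel" "weighted_sq (\<lambda>p. ennreal (cmod (g p))) \<le> ennreal ((Nb u)\<^sup>2)"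
proof -
  obtain g where g: "has_fourier_transform u g" "g \<in> borel_measurable borel"
    "(\<integral>\<^sup>+p. ennreal ((X_weight \<alpha> \<gamma> s \<omega> b p * cmod (g p))\<^sup>2) \<partial>lborel) = ennreal ((Nb u)\<^sup>2)"
    using X_spaceE[OF assms] .
  show ?thesis by (rule that[OF g(1,2) weighted_sq_le[of g, unfolded g(3)]])
qed

text \<open>The value at \<theta> is a pairing on the Fourier side with the inverse transform of
  \<theta>, to which \<open>pairing_bound\<close> applies. Elements of small norm are therefore
  small on each fixed function.\<close>

lemma X_space_schwartz_bound:
  assumes \<theta>: "\<theta> \<in> schwartz"
  shows "\<exists>C\<ge>0. \<forall>v\<in>Xb. cmod (v \<theta>) \<le> C * Nb v"
proof -
  obtain C where C: "0 \<le> C" "\<And>k s g. k \<in> borel_measurable borel \<Longrightarrow> g \<in> borel_measurable borel \<Longrightarrow> (\<And>p. 0 \<le> k p \<and> k p * (1 + norm p) ^ 4 \<le> s) \<Longrightarrow>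
     (\<integral>\<^sup>+p. ennreal (k p) * g p \<partial>lborel)\<^sup>2 \<le> ennreal (C * s\<^sup>2) * dual_sq g"
    using pairing_bound by blast
  let ?\<psi> = "inverse_fourier \<theta>"
  have \<psi>: "?\<psi> \<in> schwartz" by (rule inverse_fourier_schwartz[OF \<theta>])
  note [measurable] = schwartz_measurable[OF \<psi>]
  let ?s = "schwartz_seminorm 4 ?\<psi>"
  have "cmod (v \<theta>) \<le> sqrt (C * ?s\<^sup>2) * Nb v" if v: "v \<in> Xb" for v
  proof -
    obtain g where g: "has_fourier_transform v g" "g \<in> borel_measurable borel" "weighted_sq (\<lambda>p. ennreal (cmod (g p))) \<le> ennreal ((Nb v)\<^sup>2)"
      using X_space_fourier[OF v] .
    note [measurable] = g(2)
    have "v \<theta> = (LINT p|lborel. g p * ?\<psi> p)"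
      using bspec[OF conjunct2[OF g(1)[unfolded has_fourier_transform_def]] \<psi>] unfolding fourier_inverse_fourier[OF \<theta>] by (rule conjunct2)
    then have "ennreal (cmod (v \<theta>)) \<le> (\<integral>\<^sup>+p. ennreal (cmod (?\<psi> p)) * ennreal (cmod (g p)) \<partial>lborel)"
      using norm_integral_le_nn_integral[of lborel "\<lambda>p. g p * ?\<psi> p"] by (simp add: norm_mult ennreal_mult mult.commute)
    then have "(ennreal (cmod (v \<theta>)))\<^sup>2 \<le> (\<integral>\<^sup>+p. ennreal (cmod (?\<psi> p)) * ennreal (cmod (g p)) \<partial>lborel)\<^sup>2" by (rule power_mono) simp
    also have "\<dots> \<le> ennreal (C * ?s\<^sup>2) * dual_sq (\<lambda>p. ennreal (cmod (g p)))"
      by (rule C(2)) (use schwartz_seminorm_bound[OF \<psi>, of _ 4] in \<open>auto simp: mult.commute\<close>)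
    also have "\<dots> \<le> ennreal (C * ?s\<^sup>2) * ennreal ((Nb v)\<^sup>2)"
      by (intro mult_left_mono order_trans[OF dual_sq_le g(3)]) simp
    also have "\<dots> = ennreal ((sqrt (C * ?s\<^sup>2) * Nb v)\<^sup>2)"
      using C(1) by (simp add: ennreal_mult[symmetric] power_mult_distrib)
    finally have "(cmod (v \<theta>))\<^sup>2 \<le> (sqrt (C * ?s\<^sup>2) * Nb v)\<^sup>2"
      by (simp add: ennreal_power)
    then show ?thesis by (rule power2_le_imp_le) (use C(1) in simp)
  qed
  then show ?thesis using C(1) by (intro exI[of _ "sqrt (C * ?s\<^sup>2)"] conjI ballI) simp_all
qed

text \<open>If the infimum defining the norm is \<open>0\<close>, it may not be attained a priori; but then \<open>u\<close> vanishes on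
  test functions by the preceding lemma, and \<open>v = 0\<close> will do.\<close>

lemma X_slab_representative:
  assumes u: "u \<in> X_space_slab \<alpha> \<gamma> s \<omega> b T"
  shows "\<exists>v\<in>Xb. equal_on (slab T) v u \<and> Nb v \<le> 2 * X_norm_slab \<alpha> \<gamma> s \<omega> b T u"
proof -
  let ?V = "{v \<in> Xb. equal_on (slab T) v u}"
  let ?N = "X_norm_slab \<alpha> \<gamma> s \<omega> b T u"
  have ne: "?V \<noteq> {}" using u by (auto simp: X_space_slab_def)
  have bdd: "bdd_below (Nb ` ?V)" by (rule bdd_belowI[of _ 0]) auto
  have N: "?N = Inf (Nb ` ?V)" by (simp add: X_norm_slab_def)
  have N0: "0 \<le> ?N" unfolding N by (rule cINF_greatest[OF ne]) simp
  show ?thesis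
  proof (cases "?N = 0")
    case False
    \<comment> \<open>A positive infimum lies strictly below its double, so some extension has norm
      in between.\<close>
    with N0 have "Inf (Nb ` ?V) < 2 * ?N" unfolding N by simp
    then obtain v where "v \<in> ?V" "Nb v < 2 * ?N" unfolding cINF_less_iff[OF ne bdd] by (elim bexE)
    then show ?thesis by auto
  next
    case True
    have z: "u \<theta> = 0" if \<theta>: "\<theta> \<in> test_functions (slab T)" for \<theta>
    proof -
      obtain C where C: "0 \<le> C" "\<And>v. v \<in> Xb \<Longrightarrow> cmod (v \<theta>) \<le> C * Nb v"
        using X_space_schwartz_bound[OF subsetD[OF test_functions_schwartz \<theta>]] by (elim exE conjE) (rule that, assumption, erule (1) bspec)
      have le: "cmod (u \<theta>) \<le> e" if e: "0 < e" for e
      proof -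
        \<comment> \<open>The divisor is \<open>C + 1\<close> because \<open>C\<close> may be
          0.\<close>
        have "Inf (Nb ` ?V) < e / (C + 1)" using True e C(1) unfolding N by simp
        then obtain v where v: "v \<in> ?V" "Nb v < e / (C + 1)" unfolding cINF_less_iff[OF ne bdd] by (elim bexE)
        have "cmod (u \<theta>) = cmod (v \<theta>)" using v(1) \<theta> by (simp add: equal_on_def)
        also have "\<dots> \<le> C * Nb v" using C(2) v(1) by simp
        also have "\<dots> \<le> (C + 1) * Nb v" by (intro mult_right_mono) auto
        also have "\<dots> \<le> e" using v(2) C(1) by (simp add: pos_less_divide_eq mult.commute less_imp_le)
        finally show ?thesis .
      qed
      have "cmod (u \<theta>) \<le> 0" by (rule field_le_epsilon) (simp add: le)
      then show ?thesis by simp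
    qed
    let ?v = "\<lambda>_. 0 :: complex"
    have hf: "has_fourier_transform ?v (\<lambda>_. 0)" by (simp add: has_fourier_transform_def)
    have "tempered_distribution ?v" unfolding tempered_distribution_def by (auto intro!: exI[of _ 0])
    from X_spaceI[OF this hf, of \<alpha> \<gamma> s \<omega> b 0] have "?v \<in> Xb" "Nb ?v \<le> 0" by simp_all
    then show ?thesis using z True by (intro bexI[of _ ?v] conjI) (simp_all add: equal_on_def)
  qed
qed

end

section \<open>Products on the slab\<close>

lemma slab_measurable [measurable]: "slab T \<in> sets borel"
  unfolding slab_def by (auto simp: borel_prod[symmetric] intro!: pair_measureI)

lemma integrable_slab: "integrable lborel f \<Longrightarrow> integrable lborel (\<lambda>X. indicator (slab T) X *\<^sub>R f X)"
  for f :: "'n::finite spacetime \<Rightarrow> complex"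
  by (rule integrable_mult_indicator) auto

text \<open>The function obtained by exhaustion lacks the normalising factor of the inverse
  transform, which is restored here; the exponent is the full space-time dimension.\<close>

lemma represents_on_slab:
  fixes v :: "'n::finite spacetime distribution"
  assumes v: "has_fourier_transform v g" and [measurable]: "f \<in> borel_measurable borel"
    and f: "\<And>\<theta>. \<theta> \<in> schwartz \<Longrightarrow> integrable lborel (\<lambda>X. f X * \<theta> X)"
      "\<And>\<theta>. \<theta> \<in> schwartz \<Longrightarrow> (LINT X|lborel. f X * \<theta> X) = (LINT p|lborel. g p * ft 1 \<theta> p)"
  shows "represents_on (slab T) (\<lambda>X. complex_of_real (1 / (2 * pi) ^ DIM('n spacetime)) * f X) v"
  unfolding represents_on_def
proof (intro conjI ballI)
  let ?k = "complex_of_real (1 / (2 * pi) ^ DIM('n spacetime))"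
  show "set_borel_measurable lborel (slab T) (\<lambda>X. ?k * f X)" unfolding set_borel_measurable_def by measurable
  fix \<theta> :: "'n spacetime \<Rightarrow> complex" assume t: "\<theta> \<in> test_functions (slab T)"
  then have \<theta>: "\<theta> \<in> schwartz" using test_functions_schwartz by (rule rev_subsetD)
  have i: "integrable lborel (\<lambda>X. ?k * f X * \<theta> X)" using f(1)[OF \<theta>] by (simp only: mult.assoc integrable_mult_right)
  then show "set_integrable lborel (slab T) (\<lambda>X. ?k * f X * \<theta> X)"
    unfolding set_integrable_def by (rule integrable_slab)
  have z: "\<theta> X = 0" if "X \<notin> slab T" for X
  proof (rule ccontr)
    assume "\<theta> X \<noteq> 0"
    then have "X \<in> closure {X. \<theta> X \<noteq> 0}" by (intro subsetD[OF closure_subset]) simp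
    then show False using t that by (auto simp: test_functions_def)
  qed
  \<comment> \<open>The transform \<open>g\<close> describes \<open>v\<close> on transforms only, so
    \<theta> is written as one.\<close>
  have "v \<theta> = v (fourier (inverse_fourier \<theta>))" by (simp only: fourier_inverse_fourier[OF \<theta>])
  also have "\<dots> = (LINT p|lborel. g p * inverse_fourier \<theta> p)"
    using v inverse_fourier_schwartz[OF \<theta>] by (simp add: has_fourier_transform_def)
  also have "\<dots> = (LINT p|lborel. ?k * (g p * ft 1 \<theta> p))"
    unfolding inverse_fourier_eq_ft by (simp only: mult.left_commute)
  also have "\<dots> = ?k * (LINT X|lborel. f X * \<theta> X)" by (simp only: integral_mult_right_zero f(2)[OF \<theta>])
  also have "\<dots> = (LINT X|lborel. ?k * f X * \<theta> X)" by (simp only: mult.assoc integral_mult_right_zero)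
  also have "\<dots> = (LINT X:slab T|lborel. ?k * f X * \<theta> X)"
    unfolding set_lebesgue_integral_def by (rule Bochner_Integration.integral_cong) (auto simp: indicator_def z)
  finally show "v \<theta> = (LINT X:slab T|lborel. ?k * f X * \<theta> X)" .
qed

lemma inverse_fourier_lincomb:
  assumes "f \<in> schwartz" "g \<in> schwartz"
  shows "inverse_fourier (\<lambda>x. c * f x + g x) = (\<lambda>x. c * inverse_fourier f x + inverse_fourier g x)"
proof -
  have "ft 1 (\<lambda>x. c * f x + g x) = (\<lambda>p. c * ft 1 f p + ft 1 g p)"
    using ft_lincomb[OF schwartz_integrable[OF assms(1)] schwartz_integrable[OF assms(2)], of 1 c 1] by (simp add: fun_eq_iff)
  then show ?thesis unfolding inverse_fourier_eq_ft by (simp only: distrib_left mult.left_commute)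
qed

lemma fourier_lincomb:
  assumes "f \<in> schwartz" "g \<in> schwartz"
  shows "fourier (\<lambda>x. c * f x + g x) = (\<lambda>x. c * fourier f x + fourier g x)"
  using ft_lincomb[OF schwartz_integrable[OF assms(1)] schwartz_integrable[OF assms(2)], of "-1" c 1]
  unfolding fourier_eq_ft by (simp add: fun_eq_iff)

context bilinear_X begin

abbreviation m0 :: "real ^ 'n \<Rightarrow> real" where "m0 \<equiv> \<lambda>\<xi>. (norm \<xi>)\<^sup>2 * japanese \<xi> powr (- 2)"

abbreviation M0 :: "'n spacetime \<Rightarrow> complex" where "M0 \<equiv> \<lambda>(\<xi>, \<tau>). complex_of_real (m0 \<xi>)"

lemma M0_norm: "cmod (M0 P) = m0 (fst P)" and m0_le_1: "m0 \<xi> \<le> 1"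
proof -
  show "cmod (M0 P) = m0 (fst P)" by (cases P) (simp add: norm_mult norm_power)
  show "m0 \<xi> \<le> 1" by (simp add: powr_minus_divide japanese_def pos_divide_le_eq add_pos_nonneg)
qed

text \<open>The product \<open>W\<close>, extended by zero, has the transform \<open>w\<close> up to
  a factor, and after the multiplier the transform is \<open>G\<close>. By \<open>lower\<close> the
  weight of the norm times the symbol is at most \<open>r\<close>, so \<open>cutoff_bilinear\<close>
  bounds the norm. Global elements are treated here, with no infimum over extensions.\<close>

lemma X_bilinear:
  "\<exists>C\<ge>0. \<forall>T>0. \<forall>v1\<in>Xb. \<forall>v2\<in>Xb. \<exists>w. is_product_on (slab T) v1 v2 w \<and>
     spatial_multiplier m0 w \<in> X_space \<alpha> \<gamma> s \<omega> (b - 1) \<and>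
     X_norm \<alpha> \<gamma> s \<omega> (b - 1) (spatial_multiplier m0 w) \<le> C * T powr (1 - b) * Nb v1 * Nb v2"
proof -
  obtain C where C: "0 \<le> C" "\<And>T u v. 0 < T \<Longrightarrow> u \<in> borel_measurable borel \<Longrightarrow> v \<in> borel_measurable borel \<Longrightarrow>
     dual_sq (nn_cutoff T (nn_conv u v)) \<le> ennreal (C * T powr (2 * (1 - b))) * (weighted_sq u * weighted_sq v)"
    using cutoff_bilinear by blast
  obtain Cp where Cp: "0 \<le> Cp" "\<And>k s g. k \<in> borel_measurable borel \<Longrightarrow> g \<in> borel_measurable borel \<Longrightarrow> (\<And>p. 0 \<le> k p \<and> k p * (1 + norm p) ^ 4 \<le> s) \<Longrightarrow>
     (\<integral>\<^sup>+p. ennreal (k p) * g p \<partial>lborel)\<^sup>2 \<le> ennreal (Cp * s\<^sup>2) * dual_sq g"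
    using pairing_bound by blast
  \<comment> \<open>\<open>\<kappa>\<close> normalises the inverse transform of each factor; in
    \<open>\<kappa>'\<close> both of them meet the power of 2 pi that the spatial inversion produces
    in \<open>product_cutoff\<close>.\<close>
  define \<kappa> where "\<kappa> = 1 / (2 * pi) ^ DIM('n spacetime)"
  define \<kappa>' where "\<kappa>' = \<kappa>\<^sup>2 * (2 * pi) ^ DIM(real ^ 'n)"
  have \<kappa>: "0 \<le> \<kappa>" "0 \<le> \<kappa>'" by (simp_all add: \<kappa>_def \<kappa>'_def)
  have "\<exists>w. is_product_on (slab T) v1 v2 w \<and> spatial_multiplier m0 w \<in> X_space \<alpha> \<gamma> s \<omega> (b - 1) \<and>
     X_norm \<alpha> \<gamma> s \<omega> (b - 1) (spatial_multiplier m0 w) \<le> \<kappa>' * sqrt C * T powr (1 - b) * Nb v1 * Nb v2"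
    if T: "0 < T" and v1: "v1 \<in> Xb" and v2: "v2 \<in> Xb" for T v1 v2
  proof -
    obtain g1 where g1: "has_fourier_transform v1 g1" "g1 \<in> borel_measurable borel" "weighted_sq (\<lambda>p. ennreal (cmod (g1 p))) \<le> ennreal ((Nb v1)\<^sup>2)"
      using X_space_fourier[OF v1] .
    obtain g2 where g2: "has_fourier_transform v2 g2" "g2 \<in> borel_measurable borel" "weighted_sq (\<lambda>p. ennreal (cmod (g2 p))) \<le> ennreal ((Nb v2)\<^sup>2)"
      using X_space_fourier[OF v2] .
    note [measurable] = g1(2) g2(2)
    let ?u = "\<lambda>p. ennreal (cmod (g1 p))" and ?v = "\<lambda>p. ennreal (cmod (g2 p))"
    have fin: "weighted_sq ?u < \<infinity>" "weighted_sq ?v < \<infinity>"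
      using le_less_trans[OF g1(3)] le_less_trans[OF g2(3)] by auto
    obtain f1 f2 w where fm [measurable]: "f1 \<in> borel_measurable borel" "f2 \<in> borel_measurable borel" "w \<in> borel_measurable borel"
      and p1: "\<forall>\<theta>\<in>schwartz. integrable lborel (\<lambda>X. f1 X * \<theta> X) \<and> (LINT X|lborel. f1 X * \<theta> X) = (LINT p|lborel. g1 p * ft 1 \<theta> p)"
      and p2: "\<forall>\<theta>\<in>schwartz. integrable lborel (\<lambda>X. f2 X * \<theta> X) \<and> (LINT X|lborel. f2 X * \<theta> X) = (LINT p|lborel. g2 p * ft 1 \<theta> p)"
      and tb: "\<exists>C N. \<forall>\<psi>\<in>schwartz. integrable lborel (\<lambda>X. f1 X * f2 X * \<psi> X) \<and> (LINT X|lborel. cmod (f1 X * f2 X * \<psi> X)) \<le> C * schwartz_seminorm N \<psi>"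
      and wb: "\<forall>P. ennreal (cmod (w P)) \<le> nn_cutoff T (nn_conv ?u ?v) P"
      and wp: "\<forall>\<psi>\<in>schwartz. integrable lborel (\<lambda>P. w P * \<psi> P)
        \<and> (LINT X|lborel. indicator (UNIV \<times> {0<..<T}) X *\<^sub>R (f1 X * f2 X * ft (-1) \<psi> X)) = complex_of_real ((2 * pi) ^ DIM(real ^ 'n)) * (LINT P|lborel. w P * \<psi> P)"
      using cutoff_product[OF g1(2) g2(2) fin T] by (elim exE, elim conjE) (rule that)
    obtain C2 N2 where tb: "\<And>\<psi>. \<psi> \<in> schwartz \<Longrightarrow> integrable lborel (\<lambda>X. f1 X * f2 X * \<psi> X)"
      "\<And>\<psi>. \<psi> \<in> schwartz \<Longrightarrow> (LINT X|lborel. cmod (f1 X * f2 X * \<psi> X)) \<le> C2 * schwartz_seminorm N2 \<psi>"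
      using tb by blast
    define F1 where "F1 X = complex_of_real \<kappa> * f1 X" for X
    define F2 where "F2 X = complex_of_real \<kappa> * f2 X" for X
    define W where "W \<psi> = (LINT X:slab T|lborel. F1 X * F2 X * \<psi> X)" for \<psi>
    have FF: "F1 X * F2 X * \<psi> X = complex_of_real (\<kappa>\<^sup>2) * (f1 X * f2 X * \<psi> X)" for \<psi> X
      by (simp add: F1_def F2_def power2_eq_square mult_ac)
    have W: "W \<psi> = complex_of_real (\<kappa>\<^sup>2) * (LINT X|lborel. indicator (slab T) X *\<^sub>R (f1 X * f2 X * \<psi> X))" for \<psi>
      unfolding W_def set_lebesgue_integral_def FF mult_scaleR_right[symmetric] by (rule integral_mult_right_zero)
    have Fi: "set_integrable lborel (slab T) (\<lambda>X. F1 X * F2 X * \<psi> X)" if "\<psi> \<in> schwartz" for \<psi>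
      unfolding FF set_integrable_def by (intro integrable_slab integrable_mult_right tb(1) that)
    have Wlin: "W (\<lambda>x. c * \<psi> x + \<theta> x) = c * W \<psi> + W \<theta>" if "\<psi> \<in> schwartz" "\<theta> \<in> schwartz" for c \<psi> \<theta>
    proof -
      have "W (\<lambda>x. c * \<psi> x + \<theta> x) = (LINT X|lborel. c * (indicator (slab T) X *\<^sub>R (F1 X * F2 X * \<psi> X)) + indicator (slab T) X *\<^sub>R (F1 X * F2 X * \<theta> X))"
        unfolding W_def set_lebesgue_integral_def by (rule Bochner_Integration.integral_cong) (auto simp: algebra_simps indicator_def)
      also have "\<dots> = c * W \<psi> + W \<theta>"
        using Bochner_Integration.integral_add[OF integrable_mult_right[OF Fi[OF that(1), unfolded set_integrable_def], of c] Fi[OF that(2), unfolded set_integrable_def]]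
        unfolding W_def set_lebesgue_integral_def by (simp only: integral_mult_right_zero)
      finally show ?thesis .
    qed
    have Wbd: "cmod (W \<psi>) \<le> \<kappa>\<^sup>2 * C2 * schwartz_seminorm N2 \<psi>" if \<psi>: "\<psi> \<in> schwartz" for \<psi>
    proof -
      have "cmod (W \<psi>) = \<kappa>\<^sup>2 * cmod (LINT X|lborel. indicator (slab T) X *\<^sub>R (f1 X * f2 X * \<psi> X))"
        unfolding W by (simp add: norm_mult norm_power)
      also have "\<dots> \<le> \<kappa>\<^sup>2 * (C2 * schwartz_seminorm N2 \<psi>)"
      proof (rule mult_left_mono)
        have "cmod (LINT X|lborel. indicator (slab T) X *\<^sub>R (f1 X * f2 X * \<psi> X)) \<le> (LINT X|lborel. cmod (f1 X * f2 X * \<psi> X))"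
          by (rule bochner_norm_bound[OF integrable_slab[OF tb(1)[OF \<psi>]] integrable_norm[OF tb(1)[OF \<psi>]]]) (simp add: indicator_def)
        then show "cmod (LINT X|lborel. indicator (slab T) X *\<^sub>R (f1 X * f2 X * \<psi> X)) \<le> C2 * schwartz_seminorm N2 \<psi>"
          using tb(2)[OF \<psi>] by (rule order_trans)
      qed simp
      finally show ?thesis by (simp only: mult.assoc)
    qed
    have Wt: "tempered_distribution W"
      unfolding tempered_distribution_def using Wlin Wbd by blast
    have r1: "represents_on (slab T) F1 v1" unfolding F1_def \<kappa>_def
      by (rule represents_on_slab[OF g1(1) fm(1)]) (use p1 in auto)
    have r2: "represents_on (slab T) F2 v2" unfolding F2_def \<kappa>_def
      by (rule represents_on_slab[OF g2(1) fm(2)]) (use p2 in auto)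
    have prod: "is_product_on (slab T) v1 v2 W"
      unfolding is_product_on_def using Wt r1 r2 Fi by (auto simp: W_def)
    have Wf: "W (fourier \<psi>) = complex_of_real \<kappa>' * (LINT P|lborel. w P * \<psi> P)" if "\<psi> \<in> schwartz" for \<psi>
      unfolding W slab_def fourier_eq_ft bspec[OF wp that, THEN conjunct2] \<kappa>'_def of_real_mult by (rule mult.assoc[symmetric])
    let ?V = "spatial_multiplier m0 W"
    have V: "?V \<eta> = W (fourier (\<lambda>P. M0 P * inverse_fourier \<eta> P))" for \<eta>
      by (simp only: spatial_multiplier_def multiplier_def)
    have Ms: "(\<lambda>P. M0 P * \<psi> P) \<in> schwartz" if "\<psi> \<in> schwartz" for \<psi> by (rule smoothing_multiplier[OF that])
    have M0m [measurable]: "M0 \<in> borel_measurable borel" by (subst borel_prod[symmetric]) measurable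
    define G where "G P = complex_of_real \<kappa>' * (w P * M0 P)" for P
    have Gm [measurable]: "G \<in> borel_measurable borel" unfolding G_def[abs_def] by measurable
    have hG: "has_fourier_transform ?V G"
      unfolding has_fourier_transform_def
    proof (intro conjI ballI)
      fix \<psi> :: "'n spacetime \<Rightarrow> complex" assume \<psi>: "\<psi> \<in> schwartz"
      have e: "G P * \<psi> P = complex_of_real \<kappa>' * (w P * (M0 P * \<psi> P))" for P unfolding G_def by (simp only: mult.assoc)
      show "integrable lborel (\<lambda>p. G p * \<psi> p)"
        unfolding e using bspec[OF wp Ms[OF \<psi>]] by (intro integrable_mult_right) (rule conjunct1)
      show "?V (fourier \<psi>) = (LINT p|lborel. G p * \<psi> p)"
        unfolding V inverse_fourier_fourier[OF \<psi>] Wf[OF Ms[OF \<psi>]] e by (rule integral_mult_right_zero[symmetric])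
    qed simp
    have dual: "dual_sq (\<lambda>P. ennreal (cmod (w P))) \<le> ennreal (C * T powr (2 * (1 - b))) * (ennreal ((Nb v1)\<^sup>2) * ennreal ((Nb v2)\<^sup>2))"
    proof -
      have "dual_sq (\<lambda>P. ennreal (cmod (w P))) \<le> dual_sq (nn_cutoff T (nn_conv ?u ?v))"
        by (intro nn_integral_mono power_mono mult_left_mono wb[rule_format]) auto
      also have "\<dots> \<le> ennreal (C * T powr (2 * (1 - b))) * (weighted_sq ?u * weighted_sq ?v)"
        by (rule C(2)[OF T]) measurable
      also have "\<dots> \<le> ennreal (C * T powr (2 * (1 - b))) * (ennreal ((Nb v1)\<^sup>2) * ennreal ((Nb v2)\<^sup>2))"
        by (intro mult_left_mono mult_mono g1(3) g2(3)) auto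
      finally show ?thesis .
    qed
    define D0 where "D0 = C * T powr (2 * (1 - b)) * ((Nb v1)\<^sup>2 * (Nb v2)\<^sup>2)"
    have D0: "0 \<le> D0" "dual_sq (\<lambda>P. ennreal (cmod (w P))) \<le> ennreal D0"
      using dual C(1) by (simp_all add: D0_def ennreal_mult[symmetric])
    \<comment> \<open>Continuity is read off on the Fourier side: the symbol is at most 1, and
      \<open>pairing_bound\<close> bounds the value by a seminorm of the argument, which enters
      through its inverse transform.\<close>
    have Vt: "tempered_distribution ?V"
      unfolding tempered_distribution_def
    proof (intro conjI ballI allI)
      fix \<psi> \<theta> :: "'n spacetime \<Rightarrow> complex" and c assume st: "\<psi> \<in> schwartz" "\<theta> \<in> schwartz"
      note i = inverse_fourier_schwartz[OF st(1)] inverse_fourier_schwartz[OF st(2)]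
      have "(\<lambda>P. M0 P * inverse_fourier (\<lambda>x. c * \<psi> x + \<theta> x) P) = (\<lambda>P. c * (M0 P * inverse_fourier \<psi> P) + M0 P * inverse_fourier \<theta> P)"
        unfolding inverse_fourier_lincomb[OF st] by (simp only: distrib_left mult.left_commute)
      then show "?V (\<lambda>x. c * \<psi> x + \<theta> x) = c * ?V \<psi> + ?V \<theta>"
        unfolding V using fourier_lincomb[OF Ms[OF i(1)] Ms[OF i(2)], of c]
          Wlin[OF fourier_schwartz[OF Ms[OF i(1)]] fourier_schwartz[OF Ms[OF i(2)]], of c] by (simp only:)
    next
      have one: "\<bar>1\<bar> = (1::real)" by simp
      obtain Cf N where Cf: "0 \<le> Cf" "\<And>f p. (f :: 'n spacetime \<Rightarrow> complex) \<in> schwartz \<Longrightarrow> cmod (ft 1 f p) * (1 + norm p) ^ 4 \<le> Cf * schwartz_seminorm N f"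
        using ft_seminorm_bound_power4[OF one] by (elim exE conjE) (rule that, assumption, blast)
      have "cmod (?V \<eta>) \<le> (\<kappa>' * sqrt (Cp * D0) * (\<kappa> * Cf)) * schwartz_seminorm N \<eta>" if \<eta>: "\<eta> \<in> schwartz" for \<eta>
      proof -
        let ?i = "inverse_fourier \<eta>" and ?s = "\<kappa> * Cf * schwartz_seminorm N \<eta>"
        have i: "?i \<in> schwartz" by (rule inverse_fourier_schwartz[OF \<eta>])
        note [measurable] = schwartz_measurable[OF i]
        have ms: "(\<lambda>p. cmod (?i p)) \<in> borel_measurable borel" "(\<lambda>P. ennreal (cmod (w P))) \<in> borel_measurable borel" by measurable
        have s0: "0 \<le> ?s" using \<kappa>(1) Cf(1) schwartz_seminorm_nonneg[OF \<eta>] by simp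
        have ib: "cmod (?i p) * (1 + norm p) ^ 4 \<le> ?s" for p
        proof -
          have "cmod (?i p) = \<kappa> * cmod (ft 1 \<eta> p)" unfolding inverse_fourier_eq_ft \<kappa>_def[symmetric] using \<kappa>(1) by (simp add: norm_mult)
          then show ?thesis using mult_left_mono[OF Cf(2)[OF \<eta>, of p] \<kappa>(1)] by (simp only: mult.assoc)
        qed
        have "?V \<eta> = ?V (fourier ?i)" by (simp only: fourier_inverse_fourier[OF \<eta>])
        also have "\<dots> = (LINT P|lborel. G P * ?i P)" using hG i by (simp add: has_fourier_transform_def)
        finally have "ennreal (cmod (?V \<eta>)) \<le> (\<integral>\<^sup>+P. ennreal (cmod (G P * ?i P)) \<partial>lborel)"
          using norm_integral_le_nn_integral[of lborel "\<lambda>P. G P * ?i P"] by simp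
        also have "\<dots> \<le> (\<integral>\<^sup>+P. ennreal \<kappa>' * (ennreal (cmod (?i P)) * ennreal (cmod (w P))) \<partial>lborel)"
        proof (rule nn_integral_mono)
          fix P
          have "cmod (G P * ?i P) = (\<kappa>' * (cmod (?i P) * cmod (w P))) * m0 (fst P)"
            unfolding G_def norm_mult M0_norm using \<kappa>(2) by simp
          also have "\<dots> \<le> (\<kappa>' * (cmod (?i P) * cmod (w P))) * 1" using \<kappa>(2) by (intro mult_left_mono m0_le_1) simp
          finally have "cmod (G P * ?i P) \<le> \<kappa>' * (cmod (?i P) * cmod (w P))" by simp
          then have "ennreal (cmod (G P * ?i P)) \<le> ennreal (\<kappa>' * (cmod (?i P) * cmod (w P)))" by (rule ennreal_leI)
          then show "ennreal (cmod (G P * ?i P)) \<le> ennreal \<kappa>' * (ennreal (cmod (?i P)) * ennreal (cmod (w P)))"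
            using \<kappa>(2) by (simp add: ennreal_mult)
        qed
        also have "\<dots> = ennreal \<kappa>' * (\<integral>\<^sup>+P. ennreal (cmod (?i P)) * ennreal (cmod (w P)) \<partial>lborel)"
          by (rule nn_integral_cmult) measurable
        finally have "(ennreal (cmod (?V \<eta>)))\<^sup>2 \<le> (ennreal \<kappa>' * (\<integral>\<^sup>+P. ennreal (cmod (?i P)) * ennreal (cmod (w P)) \<partial>lborel))\<^sup>2"
          by (rule power_mono) simp
        also have "\<dots> = (ennreal \<kappa>')\<^sup>2 * (\<integral>\<^sup>+P. ennreal (cmod (?i P)) * ennreal (cmod (w P)) \<partial>lborel)\<^sup>2" by (rule power_mult_distrib)
        also have "\<dots> \<le> (ennreal \<kappa>')\<^sup>2 * (ennreal (Cp * ?s\<^sup>2) * dual_sq (\<lambda>P. ennreal (cmod (w P))))"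
          by (intro mult_left_mono Cp(2) conjI norm_ge_zero ib ms) simp
        also have "\<dots> \<le> (ennreal \<kappa>')\<^sup>2 * (ennreal (Cp * ?s\<^sup>2) * ennreal D0)"
          by (intro mult_left_mono D0(2)) simp_all
        also have "\<dots> = ennreal (\<kappa>'\<^sup>2 * (Cp * ?s\<^sup>2 * D0))" using \<kappa>(2) Cp(1) D0(1) by (simp add: ennreal_power ennreal_mult)
        also have "\<kappa>'\<^sup>2 * (Cp * ?s\<^sup>2 * D0) = (\<kappa>' * sqrt (Cp * D0) * ?s)\<^sup>2" using Cp(1) D0(1) by (simp add: power_mult_distrib)
        finally have "ennreal ((cmod (?V \<eta>))\<^sup>2) \<le> ennreal ((\<kappa>' * sqrt (Cp * D0) * ?s)\<^sup>2)" by (simp only: ennreal_power norm_ge_zero)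
        then have "(cmod (?V \<eta>))\<^sup>2 \<le> (\<kappa>' * sqrt (Cp * D0) * ?s)\<^sup>2" by (simp only: ennreal_le_iff zero_le_power2)
        then have "cmod (?V \<eta>) \<le> \<kappa>' * sqrt (Cp * D0) * ?s"
          by (rule power2_le_imp_le) (intro mult_nonneg_nonneg[OF _ s0] mult_nonneg_nonneg \<kappa>(2) real_sqrt_ge_zero Cp(1) D0(1))
        then show ?thesis by (simp only: mult.assoc)
      qed
      then show "\<exists>N C. \<forall>f\<in>schwartz. cmod (?V f) \<le> C * schwartz_seminorm N f" by (intro exI ballI)
    qed
    let ?c = "\<kappa>' * sqrt C * T powr (1 - b) * Nb v1 * Nb v2"
    \<comment> \<open>The bound is for the squared norm; the root turns T^(2 (1 - b)) into T^(1 -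
      b).\<close>
    have c2: "\<kappa>'\<^sup>2 * D0 = ?c\<^sup>2"
      unfolding D0_def using C(1) T by (simp add: power_mult_distrib powr_square)
    have "(\<integral>\<^sup>+p. ennreal ((X_weight \<alpha> \<gamma> s \<omega> (b - 1) p * cmod (G p))\<^sup>2) \<partial>lborel)
      \<le> (\<integral>\<^sup>+P. ennreal (\<kappa>'\<^sup>2) * (ennreal (r (fst P) * japanese (\<bar>snd P\<bar> - phase \<alpha> \<gamma> (fst P)) powr (b - 1)) * ennreal (cmod (w P)))\<^sup>2 \<partial>lborel)"
    proof (rule nn_integral_mono)
      fix P :: "'n spacetime"
      let ?j = "japanese (\<bar>snd P\<bar> - phase \<alpha> \<gamma> (fst P)) powr (b - 1)"
      let ?x = "japanese (fst P) powr (s + \<omega>) * norm (fst P) powr (- \<omega>)"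
      have "X_weight \<alpha> \<gamma> s \<omega> (b - 1) P * cmod (G P) = (\<kappa>' * ?j * cmod (w P)) * (m0 (fst P) * ?x)"
        unfolding G_def norm_mult M0_norm unfolding X_weight_def case_prod_beta using \<kappa>(2) by simp
      also have "\<dots> \<le> (\<kappa>' * ?j * cmod (w P)) * r (fst P)" using \<kappa>(2) by (intro mult_left_mono lower) simp
      finally have "(X_weight \<alpha> \<gamma> s \<omega> (b - 1) P * cmod (G P))\<^sup>2 \<le> ((\<kappa>' * ?j * cmod (w P)) * r (fst P))\<^sup>2"
        by (rule power_mono) (simp add: X_weight_def case_prod_beta)
      also have "\<dots> = \<kappa>'\<^sup>2 * (r (fst P) * ?j * cmod (w P))\<^sup>2" by (simp add: power_mult_distrib)
      finally have "ennreal ((X_weight \<alpha> \<gamma> s \<omega> (b - 1) P * cmod (G P))\<^sup>2) \<le> ennreal (\<kappa>'\<^sup>2 * (r (fst P) * ?j * cmod (w P))\<^sup>2)" by (rule ennreal_leI)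
      also have "\<dots> = ennreal (\<kappa>'\<^sup>2) * (ennreal (r (fst P) * ?j) * ennreal (cmod (w P)))\<^sup>2"
        by (simp add: ennreal_mult ennreal_power[symmetric] power_mult_distrib)
      finally show "ennreal ((X_weight \<alpha> \<gamma> s \<omega> (b - 1) P * cmod (G P))\<^sup>2) \<le> ennreal (\<kappa>'\<^sup>2) * (ennreal (r (fst P) * ?j) * ennreal (cmod (w P)))\<^sup>2" .
    qed
    also have "\<dots> = ennreal (\<kappa>'\<^sup>2) * dual_sq (\<lambda>P. ennreal (cmod (w P)))" by (rule nn_integral_cmult) measurable
    also have "\<dots> \<le> ennreal (\<kappa>'\<^sup>2) * ennreal D0" by (intro mult_left_mono D0(2)) simp
    also have "\<dots> = ennreal (?c\<^sup>2)" unfolding c2[symmetric] using D0(1) by (simp add: ennreal_mult)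
    finally have fin: "(\<integral>\<^sup>+p. ennreal ((X_weight \<alpha> \<gamma> s \<omega> (b - 1) p * cmod (G p))\<^sup>2) \<partial>lborel) \<le> ennreal (?c\<^sup>2)" .
    have c0: "0 \<le> ?c" using \<kappa>(2) C(1) by simp
    show ?thesis using prod X_spaceI[OF Vt hG fin c0] by (intro exI[of _ W] conjI)
  qed
  then show ?thesis using \<kappa>(2) C(1) by (intro exI[of _ "\<kappa>' * sqrt C"] conjI allI impI ballI) auto
qed

end

lemma japanese_norm [simp]: "japanese (norm x) = japanese x"
  by (simp add: japanese_def)

lemma radial_weight_le_pos_weight: "radial_weight a s (norm x) \<le> pos_weight a s x"
  by (simp add: pos_weight_def)

lemma X_radial_weight:
  assumes "x \<noteq> 0"
  shows "japanese x powr (s + \<omega>) * norm x powr (- \<omega>) = (norm x / japanese x) powr (- \<omega>) * japanese x powr s"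
  using assms by (simp add: powr_divide powr_add powr_minus field_simps)

lemma norm_ratio_le_1: "norm x / japanese x \<le> 1"
  using norm_le_japanese[of x] by simp

context bilinear_X begin

text \<open>Being the product on the slab depends only on the restrictions of the factors, so almost
  optimal extensions can be multiplied instead. The infimum for the product is bounded by its value
  at the product itself.\<close>

lemma X_slab_bilinear:
  "\<exists>C>0. \<forall>T. 0 < T \<and> T < 1 \<longrightarrow>
    (\<forall>u1 \<in> X_space_slab \<alpha> \<gamma> s \<omega> b T. \<forall>u2 \<in> X_space_slab \<alpha> \<gamma> s \<omega> b T.
      \<exists>w :: 'n spacetime distribution. is_product_on (slab T) u1 u2 w \<and>
        spatial_multiplier m0 w \<in> X_space_slab \<alpha> \<gamma> s \<omega> (b - 1) T \<and>
        X_norm_slab \<alpha> \<gamma> s \<omega> (b - 1) T (spatial_multiplier m0 w)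
          \<le> C * T powr (1 - b) * X_norm_slab \<alpha> \<gamma> s \<omega> b T u1 * X_norm_slab \<alpha> \<gamma> s \<omega> b T u2)"
proof -
  obtain C where C: "0 \<le> C" "\<And>T v1 v2. 0 < T \<Longrightarrow> v1 \<in> Xb \<Longrightarrow> v2 \<in> Xb \<Longrightarrow> \<exists>w. is_product_on (slab T) v1 v2 w \<and>
     spatial_multiplier m0 w \<in> X_space \<alpha> \<gamma> s \<omega> (b - 1) \<and>
     X_norm \<alpha> \<gamma> s \<omega> (b - 1) (spatial_multiplier m0 w) \<le> C * T powr (1 - b) * Nb v1 * Nb v2"
    using X_bilinear by (elim exE conjE) (rule that, assumption, blast)
  show ?thesis
  \<comment> \<open>Each factor is replaced by an extension of at most twice its norm, hence the 4;
    adding 1 makes the constant positive.\<close>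
  proof (intro exI[of _ "4 * C + 1"] conjI allI impI ballI)
    show "0 < 4 * C + 1" using C(1) by simp
    fix T and u1 u2 :: "'n spacetime distribution"
    assume T: "0 < T \<and> T < 1" and u1: "u1 \<in> X_space_slab \<alpha> \<gamma> s \<omega> b T" and u2: "u2 \<in> X_space_slab \<alpha> \<gamma> s \<omega> b T"
    let ?N1 = "X_norm_slab \<alpha> \<gamma> s \<omega> b T u1" and ?N2 = "X_norm_slab \<alpha> \<gamma> s \<omega> b T u2"
    obtain v1 where v1: "v1 \<in> Xb" "equal_on (slab T) v1 u1" "Nb v1 \<le> 2 * ?N1" using X_slab_representative[OF u1] by blast
    obtain v2 where v2: "v2 \<in> Xb" "equal_on (slab T) v2 u2" "Nb v2 \<le> 2 * ?N2" using X_slab_representative[OF u2] by blast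
    have n: "0 \<le> ?N1" "0 \<le> ?N2" using X_norm_nonneg[of \<alpha> \<gamma> s \<omega> b v1] X_norm_nonneg[of \<alpha> \<gamma> s \<omega> b v2] v1(3) v2(3) by linarith+
    obtain w where w: "is_product_on (slab T) v1 v2 w" "spatial_multiplier m0 w \<in> X_space \<alpha> \<gamma> s \<omega> (b - 1)"
      "X_norm \<alpha> \<gamma> s \<omega> (b - 1) (spatial_multiplier m0 w) \<le> C * T powr (1 - b) * Nb v1 * Nb v2"
      using C(2)[OF conjunct1[OF T] v1(1) v2(1)] by (elim exE conjE) (rule that)
    let ?V = "spatial_multiplier m0 w"
    have rep: "represents_on (slab T) f u" if "represents_on (slab T) f v" "equal_on (slab T) v u" for f u and v :: "'n spacetime distribution"
      using that by (auto simp: represents_on_def equal_on_def)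
    have prod: "is_product_on (slab T) u1 u2 w"
      using w(1) rep[OF _ v1(2)] rep[OF _ v2(2)] unfolding is_product_on_def by blast
    have mem: "?V \<in> {v \<in> X_space \<alpha> \<gamma> s \<omega> (b - 1). equal_on (slab T) v ?V}" using w(2) by (simp add: equal_on_def)
    then have sp: "?V \<in> X_space_slab \<alpha> \<gamma> s \<omega> (b - 1) T" by (auto simp: X_space_slab_def)
    have "X_norm_slab \<alpha> \<gamma> s \<omega> (b - 1) T ?V \<le> X_norm \<alpha> \<gamma> s \<omega> (b - 1) ?V"
      unfolding X_norm_slab_def by (rule cINF_lower[OF _ mem]) (auto intro!: bdd_belowI[of _ 0])
    also have "\<dots> \<le> C * T powr (1 - b) * Nb v1 * Nb v2" by (rule w(3))
    also have "\<dots> \<le> C * T powr (1 - b) * (2 * ?N1) * (2 * ?N2)"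
      using C(1) n by (intro mult_mono v1(3) v2(3) order_refl) auto
    also have "\<dots> = 4 * C * (T powr (1 - b) * ?N1 * ?N2)" by simp
    also have "\<dots> \<le> (4 * C + 1) * (T powr (1 - b) * ?N1 * ?N2)" using n by (intro mult_right_mono) auto
    finally have "X_norm_slab \<alpha> \<gamma> s \<omega> (b - 1) T ?V \<le> (4 * C + 1) * T powr (1 - b) * ?N1 * ?N2" by (simp only: mult.assoc)
    with prod sp show "\<exists>w :: 'n spacetime distribution. is_product_on (slab T) u1 u2 w \<and>
        spatial_multiplier m0 w \<in> X_space_slab \<alpha> \<gamma> s \<omega> (b - 1) T \<and>
        X_norm_slab \<alpha> \<gamma> s \<omega> (b - 1) T (spatial_multiplier m0 w) \<le> (4 * C + 1) * T powr (1 - b) * ?N1 * ?N2"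
      by (intro exI[of _ w] conjI)
  qed
qed

end

text \<open>The exponent at the origin is a = max (0, - \<omega>). For \<omega> \<ge> 0 the singular
  part of the weight is at least 1 and is dropped on the factors, while on the product the
  multiplier absorbs it, leaving the exponent 2 - \<omega> > 0. For \<omega> < 0 the weight vanishes
  at the origin to the order a, and the lower bound on \<omega> becomes 2 a < n - 2, or 2 a < 1 on
  the line, as in the sphere bounds.\<close>

lemma bilinear_X_weights:
  fixes \<alpha> \<gamma> s \<omega> b :: real
  assumes \<gamma>: "\<gamma> > \<alpha>\<^sup>2 / 4" and b: "1 / 2 < b" "b < 1"
    and one: "CARD('n::finite) = 1 \<Longrightarrow> - 1 / 2 < \<omega> \<and> \<omega> < 2 \<and> s > 0"
    and two: "CARD('n) \<ge> 2 \<Longrightarrow> 1 - real CARD('n) / 2 < \<omega> \<and> \<omega> < 2 \<and> s > real CARD('n) / 2 - 1"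
  shows "\<exists>S. bilinear_X (pos_weight (max 0 (- \<omega>)) s :: real ^ 'n \<Rightarrow> real) (\<lambda>x. radial_weight (max 0 (- \<omega>)) s (norm x))
    \<alpha> \<gamma> b (2 powr (max 0 (- \<omega>) + s)) (sqrt (\<gamma> - \<alpha>\<^sup>2 / 4) + \<bar>\<alpha>\<bar>) S s \<omega>"
proof -
  let ?a = "max 0 (- \<omega>)"
  have p: "1 < 2 * b" using b by simp
  have "CARD('n) = 1 \<or> 2 \<le> CARD('n)" using zero_less_card_finite[where 'a = 'n] by linarith
  then have s: "0 < s" and \<omega>: "\<omega> < 2" using one two by force+
  have "\<exists>C\<ge>0. \<forall>(c::real ^ 'n) K. (\<integral>\<^sup>+x. ennreal (1 / (pos_weight ?a s x)\<^sup>2 * japanese (2 * (norm (x - c))\<^sup>2 - K) powr (- (2 * b))) \<partial>lborel) \<le> ennreal C"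
    using \<open>CARD('n) = 1 \<or> 2 \<le> CARD('n)\<close>
  proof
    assume "CARD('n) = 1"
    with one p s show ?thesis by (intro sphere_weight_bound_1) auto
  next
    assume "2 \<le> CARD('n)"
    with two[OF this] p s show ?thesis by (intro sphere_weight_bound_ge2) auto
  qed
  then obtain S where S: "0 \<le> S" "\<And>(c::real ^ 'n) K. (\<integral>\<^sup>+x. ennreal (1 / (pos_weight ?a s x)\<^sup>2 * japanese (2 * (norm (x - c))\<^sup>2 - K) powr (- (2 * b))) \<partial>lborel) \<le> ennreal S"
    by blast
  have sub: "radial_weight ?a s (norm (x + y)) \<le> 2 powr (?a + s) * (pos_weight ?a s x + pos_weight ?a s y)" for x y :: "real ^ 'n"
  proof -
    have "radial_weight ?a s (norm (x + y)) \<le> 2 powr (?a + s) * (radial_weight ?a s (norm x) + radial_weight ?a s (norm y))"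
      using s by (intro radial_weight_subadditive) auto
    also have "\<dots> \<le> 2 powr (?a + s) * (pos_weight ?a s x + pos_weight ?a s y)"
      by (intro mult_left_mono add_mono radial_weight_le_pos_weight) simp
    finally show ?thesis .
  qed
  have up: "pos_weight ?a s x \<le> japanese x powr (s + \<omega>) * norm x powr (- \<omega>)" if "x \<noteq> 0" for x :: "real ^ 'n"
    unfolding X_radial_weight[OF that] pos_weight_def radial_weight_def using that norm_ratio_le_1[of x]
    by (auto intro!: mult_right_mono powr_mono')
  have low: "(norm x)\<^sup>2 * japanese x powr (- 2) * (japanese x powr (s + \<omega>) * norm x powr (- \<omega>)) \<le> radial_weight ?a s (norm x)" for x :: "real ^ 'n"
  proof (cases "x = 0")
    case False
    let ?q = "norm x / japanese x"
    have q: "0 < ?q" using False by simp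
    have "(norm x)\<^sup>2 * japanese x powr (- 2) = ?q powr 2"
      using False by (simp add: powr_minus_divide power_divide)
    then have "(norm x)\<^sup>2 * japanese x powr (- 2) * (japanese x powr (s + \<omega>) * norm x powr (- \<omega>)) = ?q powr (2 - \<omega>) * japanese x powr s"
      unfolding X_radial_weight[OF False] by (simp add: powr_add[symmetric] mult.assoc[symmetric] del: powr_numeral)
    also have "\<dots> \<le> ?q powr ?a * japanese x powr s"
      using \<omega> q norm_ratio_le_1[of x] by (intro mult_right_mono powr_mono') auto
    finally show ?thesis by (simp add: radial_weight_def)
  qed simp
  have "bilinear_X (pos_weight ?a s :: real ^ 'n \<Rightarrow> real) (\<lambda>x. radial_weight ?a s (norm x)) \<alpha> \<gamma> b (2 powr (?a + s)) (sqrt (\<gamma> - \<alpha>\<^sup>2 / 4) + \<bar>\<alpha>\<bar>) S s \<omega>"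
  proof
    show "\<bar>phase \<alpha> \<gamma> x - (norm x)\<^sup>2\<bar> \<le> sqrt (\<gamma> - \<alpha>\<^sup>2 / 4) + \<bar>\<alpha>\<bar>" for x :: "real ^ 'n" by (rule phase_close[OF \<gamma>])
    show "(\<integral>\<^sup>+x. ennreal (1 / (pos_weight ?a s x)\<^sup>2 * japanese (2 * (norm (x - c))\<^sup>2 - K) powr (- (2 * b))) \<partial>lborel) \<le> ennreal S" for c :: "real ^ 'n" and K
      by (rule S(2))
    show "pos_weight ?a s (- x) = pos_weight ?a s x" "x \<noteq> 0 \<Longrightarrow> pos_weight ?a s x = radial_weight ?a s (norm x)" for x :: "real ^ 'n"
      by (simp_all add: pos_weight_def)
    show "(norm x)\<^sup>2 * japanese x powr (- 2) * (japanese x powr (s + \<omega>) * norm x powr (- \<omega>)) \<le> radial_weight ?a s (norm x)" for x :: "real ^ 'n"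
      by (rule low)
  qed (use S(1) b sub up in auto)
  then show ?thesis ..
qed

theorem lemma3p1:
  fixes \<alpha> \<gamma> s \<omega> b :: real
  assumes "\<gamma> > \<alpha>\<^sup>2 / 4"
    and "1 / 2 < b" and "b < 1"
    and "CARD('n::finite) = 1 \<Longrightarrow> - 1 / 2 < \<omega> \<and> \<omega> < 2 \<and> s > 0"
    and "CARD('n) \<ge> 2 \<Longrightarrow>
           1 - real CARD('n) / 2 < \<omega> \<and> \<omega> < 2 \<and> s > real CARD('n) / 2 - 1"
  shows "\<exists>C>0. \<forall>T. 0 < T \<and> T < 1 \<longrightarrow>
    (\<forall>u\<^sub>1 \<in> X_space_slab \<alpha> \<gamma> s \<omega> b T. \<forall>u\<^sub>2 \<in> X_space_slab \<alpha> \<gamma> s \<omega> b T.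
      \<exists>w :: 'n spacetime distribution. is_product_on (slab T) u\<^sub>1 u\<^sub>2 w \<and>
        spatial_multiplier (\<lambda>\<xi>. (norm \<xi>)\<^sup>2 * japanese \<xi> powr (- 2)) w
          \<in> X_space_slab \<alpha> \<gamma> s \<omega> (b - 1) T \<and>
        X_norm_slab \<alpha> \<gamma> s \<omega> (b - 1) T
            (spatial_multiplier (\<lambda>\<xi>. (norm \<xi>)\<^sup>2 * japanese \<xi> powr (- 2)) w)
          \<le> C * T powr (1 - b) * X_norm_slab \<alpha> \<gamma> s \<omega> b T u\<^sub>1 * X_norm_slab \<alpha> \<gamma> s \<omega> b T u\<^sub>2)"
proof -
  obtain S where "bilinear_X (pos_weight (max 0 (- \<omega>)) s :: real ^ 'n \<Rightarrow> real) (\<lambda>x. radial_weight (max 0 (- \<omega>)) s (norm x))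
    \<alpha> \<gamma> b (2 powr (max 0 (- \<omega>) + s)) (sqrt (\<gamma> - \<alpha>\<^sup>2 / 4) + \<bar>\<alpha>\<bar>) S s \<omega>"
    using bilinear_X_weights[OF assms] ..
  then show ?thesis by (rule bilinear_X.X_slab_bilinear)
qed

end
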